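(* Let $q\in(0,1)$. For the $\mathcal{O}(U(1))$-Hopf–Galois extension $B=\mathcal{O}(\mathbb{C}P^{n-1}_q)\subseteq A=\mathcal{O}(S^{2n-1}_q)$, the group of twists $\mathcal{T}^*$ of the associated Ehresmann–Schauenburg bialgebroid $\mathcal{C}(A,\mathcal{O}(U(1)))$ satisfies $$\mathcal{T}^*\simeq(\mathbb{C}^* )^n,$$ where $\mathbb{C}^*$ is the multiplicative group of non-zero complex numbers.
   Context: All algebras are unital over $\mathbb{C}$, $\otimes=\otimes_{\mathbb{C}}$. Sweedler-type notations and expressions such as $a\otimes\tilde a$ denote sums. **The extension.** $\mathcal{O}(S^{2n-1}_q)$ is the $*$-algebra generated by $z_i,z_i^*$, $i=1,\dots,n$, with relations $z_iz_j=qz_jz_i$ for $i<j$; $z_i^*z_j=qz_jz_i^*$ for $i\ne j$; $[z_1^*,z_1]=0$; $[z_k^*,z_k]=(1-q^2)\sum_{j=1}^{k-1}z_jz_j^*$ for $1<k\le n$; $\sum_{j=1}^nz_jz_j^*=1$ (equivalently $\sum_{j=1}^nq^{2(n-j)}z_j^*z_j=1$). $H=\mathcal{O}(U(1))=\mathbb{C}[u,u^{-1}]$ is the Hopf algebra of Laurent polynomials with $\Delta(u^{\pm1})=u^{\pm1}\otimes u^{\pm1}$, $\epsilon(u^{\pm1})=1$, $S(u^{\pm1})=u^{\mp1}$. The right coaction $\rho:A\to A\otimes H$, $\rho(a)=a_{(0)}\otimes a_{(1)}$, is the algebra morphism with $z_i\mapsto z_i\otimes u$, $z_i^*\mapsto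 z_i^*\otimes u^{-1}$. The subalgebra of coaction invariants $\{a\mid\rho(a)=a\otimes1\}$ is $B=\mathcal{O}(\mathbb{C}P^{n-1}_q)$, the $*$-subalgebra generated by the elements $z_i^*z_j$. The canonical map $\chi:A\otimes_BA\to A\otimes H$, $a\otimes_B\tilde a\mapsto a\tilde a_{(0)}\otimes\tilde a_{(1)}$, is bijective and $A$ is faithfully flat over $B$; the translation map is $\tau(h)=\chi^{-1}(1_A\otimes h)=h^{\langle1\rangle}\otimes_Bh^{\langle2\rangle}$, with $\tau(u)=\sum_jq^{2(n-j)}z_j^*\otimes_Bz_j$ and $\tau(u^{-1})=\sum_jz_j\otimes_Bz_j^*$. **Ehresmann–Schauenburg bialgebroid.** $\mathcal{C}(A,H)=(A\otimes A)^{coH}=\{a\otimes\tilde a\in A\otimes A\mid a_{(0)}\otimes\tilde a_{(0)}\otimes a_{(1)}\tilde a_{(1)}=a\otimes\tilde a\otimes1_H\}$, a subalgebra of $A\otimes A^{op}$: $(a\otimes\tilde a)(c\otimes\tilde c)=ac\otimes\tilde c\tilde a$. It is a left $B$-bialgebroid with source $s(b)=b\otimes1_A$, target $t(b)=1_A\otimes b$, $B$-bimodule structure $b\,h\,b'=s(b)t(b')h$, coproduct $\underline{\Delta}(a\otimes\tilde a)=a_{(0)}\otimes a_{(1)}{}^{\langle1\rangle}\otimes_Ba_{(1)}{}^{\langle2\rangle}\otimes\tilde a\in\mathcal{C}(A,H)\otimes_B\mathcal{C}(A,H)$ and counit $\underline{\epsilon}(a\otimes\tilde a)=a\tilde a$.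 **Twists.** For a left $B$-bialgebroid $\mathcal{H}$ with $\underline{\Delta}(h)=h_{(1)}\otimes_Bh_{(2)}$, the convolution algebra $\mathcal{H}^*$ consists of the right $B$-linear maps $\phi_*:\mathcal{H}\to B$ (i.e. linear with $\phi_*(t(b)h)=\phi_*(h)b$), with product $(\phi_*\psi_* )(h)=\psi_*\big(s(\phi_*(h_{(1)}))h_{(2)}\big)$ and unit $\underline{\epsilon}$. It acts on $\mathcal{H}$ by $h\triangleleft\phi_*:=s(\phi_*(h_{(1)}))h_{(2)}$. A twist is an invertible element $\phi_*$ of $\mathcal{H}^*$ with $1_{\mathcal{H}}\triangleleft\phi_*=1_{\mathcal{H}}$ and $(h\triangleleft\phi_* )(h'\triangleleft\phi_* )=(hh')\triangleleft\phi_*$ for all $h,h'\in\mathcal{H}$. Twists form a group $\mathcal{T}^*$ under the convolution product. *)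

theory Defs
  imports "HOL-Algebra.Product_Groups" "HOL-Algebra.QuotRing" "HOL-Algebra.Module"
    "HOL-Library.Poly_Mapping" Complex_Main
begin

text \<open>
  Complex algebras and complex vector spaces are records of type \<^typ>\<open>(complex, 'a) module\<close>;
  for a mere vector space the fields \<open>mult\<close> and \<open>one\<close> carry no meaning.
  The free vector space on a set consists of finitely supported functions
  \<^typ>\<open>'x \<Rightarrow>\<^sub>0 complex\<close>, where \<^term>\<open>Poly_Mapping.single x 1\<close> is the basis vector of \<open>x\<close>.
\<close>

section \<open>Linear algebra\<close>

definition fscale :: "complex \<Rightarrow> ('x \<Rightarrow>\<^sub>0 complex) \<Rightarrow> ('x \<Rightarrow>\<^sub>0 complex)"
  where "fscale c f = Poly_Mapping.map ((*) c) f"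

lemma lookup_fscale [simp]:
  "Poly_Mapping.lookup (fscale c f) x = c * Poly_Mapping.lookup f x"
  by (simp add: fscale_def map.rep_eq when_def)

global_interpretation fvs: vector_space fscale
  by unfold_locales (auto intro!: poly_mapping_eqI simp: lookup_add algebra_simps)

definition free_space :: "'x set \<Rightarrow> (complex, 'x \<Rightarrow>\<^sub>0 complex) module"
  where "free_space X =
    \<lparr>carrier = {f. Poly_Mapping.keys f \<subseteq> X}, mult = undefined, one = undefined,
     zero = 0, add = (+), smult = fscale\<rparr>"

text \<open>Quotient by a two-sided ideal of an algebra, or by a subspace of a vector space.\<close>

definition quotient :: "(complex, 'a) module \<Rightarrow> 'a set \<Rightarrow> (complex, 'a set) module"
  where "quotient M N = ring.extend (M Quot N)
    (module.fields (\<lambda>c X. \<Union>x\<in>X. N +>\<^bsub>M\<^esub> (c \<odot>\<^bsub>M\<^esub> x)))"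

text \<open>
  The tensor product \<open>V \<otimes>\<^sub>B W\<close> of complex vector spaces over the elements of a set \<open>B\<close>
  acting by \<open>r\<close> from the right on \<open>V\<close> and by \<open>l\<close> from the left on \<open>W\<close>.
\<close>

definition tensor_relations ::
    "'b set \<Rightarrow> ('v \<Rightarrow> 'b \<Rightarrow> 'v) \<Rightarrow> ('b \<Rightarrow> 'w \<Rightarrow> 'w) \<Rightarrow>
     (complex, 'v) module \<Rightarrow> (complex, 'w) module \<Rightarrow> ('v \<times> 'w \<Rightarrow>\<^sub>0 complex) set"
  where "tensor_relations B r l V W =
    (let e = (\<lambda>v w. Poly_Mapping.single (v, w) (1::complex)) in fvs.span
      ({e (v \<oplus>\<^bsub>V\<^esub> v') w - e v w - e v' w | v v' w.
          v \<in> carrier V \<and> v' \<in> carrier V \<and> w \<in> carrier W} \<union>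
       {e v (w \<oplus>\<^bsub>W\<^esub> w') - e v w - e v w' | v w w'.
          v \<in> carrier V \<and> w \<in> carrier W \<and> w' \<in> carrier W} \<union>
       {e (c \<odot>\<^bsub>V\<^esub> v) w - fscale c (e v w) | c v w. v \<in> carrier V \<and> w \<in> carrier W} \<union>
       {e v (c \<odot>\<^bsub>W\<^esub> w) - fscale c (e v w) | c v w. v \<in> carrier V \<and> w \<in> carrier W} \<union>
       {e (r v b) w - e v (l b w) | b v w. b \<in> B \<and> v \<in> carrier V \<and> w \<in> carrier W}))"

definition tensor_over ::
    "'b set \<Rightarrow> ('v \<Rightarrow> 'b \<Rightarrow> 'v) \<Rightarrow> ('b \<Rightarrow> 'w \<Rightarrow> 'w) \<Rightarrow>
     (complex, 'v) module \<Rightarrow> (complex, 'w) module \<Rightarrow>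
     (complex, ('v \<times> 'w \<Rightarrow>\<^sub>0 complex) set) module"
  where "tensor_over B r l V W =
    quotient (free_space (carrier V \<times> carrier W)) (tensor_relations B r l V W)"

definition pure_over ::
    "'b set \<Rightarrow> ('v \<Rightarrow> 'b \<Rightarrow> 'v) \<Rightarrow> ('b \<Rightarrow> 'w \<Rightarrow> 'w) \<Rightarrow>
     (complex, 'v) module \<Rightarrow> (complex, 'w) module \<Rightarrow> 'v \<Rightarrow> 'w \<Rightarrow>
     ('v \<times> 'w \<Rightarrow>\<^sub>0 complex) set"
  where "pure_over B r l V W v w =
    tensor_relations B r l V W
      +>\<^bsub>free_space (carrier V \<times> carrier W)\<^esub> Poly_Mapping.single (v, w) 1"

text \<open>
  The linear map to \<open>T\<close> sending \<open>v \<otimes> w\<close> to \<open>g v w\<close>, for any of the above tensor products.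
  It depends on the chosen representative unless \<open>g\<close> is bilinear and balanced.
  Nested uses render Sweedler notation: for \<open>X = x\<^sub>0 \<otimes> x\<^sub>1\<close>, the term
  \<open>tensor_lift T g X\<close> is the sum written \<open>g x\<^sub>0 x\<^sub>1\<close>.
\<close>

definition tensor_lift ::
    "(complex, 't) module \<Rightarrow> ('v \<Rightarrow> 'w \<Rightarrow> 't) \<Rightarrow> ('v \<times> 'w \<Rightarrow>\<^sub>0 complex) set \<Rightarrow> 't"
  where "tensor_lift T g X =
    (let f = (SOME f. f \<in> X) in
      \<Oplus>\<^bsub>T\<^esub>p\<in>Poly_Mapping.keys f. Poly_Mapping.lookup f p \<odot>\<^bsub>T\<^esub> g (fst p) (snd p))"

text \<open>Tensor products over the complex numbers.\<close>

definition tensor ::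
    "(complex, 'v) module \<Rightarrow> (complex, 'w) module \<Rightarrow>
     (complex, ('v \<times> 'w \<Rightarrow>\<^sub>0 complex) set) module"
  where "tensor V W =
    tensor_over (UNIV :: complex set) (\<lambda>v c. c \<odot>\<^bsub>V\<^esub> v) (\<lambda>c w. c \<odot>\<^bsub>W\<^esub> w) V W"

definition pure ::
    "(complex, 'v) module \<Rightarrow> (complex, 'w) module \<Rightarrow> 'v \<Rightarrow> 'w \<Rightarrow>
     ('v \<times> 'w \<Rightarrow>\<^sub>0 complex) set"
  where "pure V W =
    pure_over (UNIV :: complex set) (\<lambda>v c. c \<odot>\<^bsub>V\<^esub> v) (\<lambda>c w. c \<odot>\<^bsub>W\<^esub> w) V W"

definition tensor_alg ::
    "(complex, 'v) module \<Rightarrow> (complex, 'w) module \<Rightarrow>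
     (complex, ('v \<times> 'w \<Rightarrow>\<^sub>0 complex) set) module"
  where "tensor_alg V W = (tensor V W)
    \<lparr>mult := (\<lambda>X Y.
       tensor_lift (tensor V W) (\<lambda>v w.
         tensor_lift (tensor V W) (\<lambda>v' w'.
           pure V W (v \<otimes>\<^bsub>V\<^esub> v') (w \<otimes>\<^bsub>W\<^esub> w')) Y) X),
     one := pure V W \<one>\<^bsub>V\<^esub> \<one>\<^bsub>W\<^esub>\<rparr>"

definition opposite :: "(complex, 'a) module \<Rightarrow> (complex, 'a) module"
  where "opposite A = A\<lparr>mult := (\<lambda>x y. y \<otimes>\<^bsub>A\<^esub> x)\<rparr>"

section \<open>Algebras given by generators and relations\<close>

text \<open>
  Words form a monoid under concatenation, so that the convolution product of
  \<^typ>\<open>'g list \<Rightarrow>\<^sub>0 complex\<close> is the multiplication of the free algebra on \<^typ>\<open>'g\<close>.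
\<close>

instantiation list :: (type) monoid_add
begin

definition zero_list :: "'a list" where "zero_list = []"
definition plus_list :: "'a list \<Rightarrow> 'a list \<Rightarrow> 'a list" where "plus_list xs ys = xs @ ys"

instance by standard (simp_all add: zero_list_def plus_list_def)

end

definition free_alg :: "'g set \<Rightarrow> (complex, 'g list \<Rightarrow>\<^sub>0 complex) module"
  where "free_alg G =
    \<lparr>carrier = {f. Poly_Mapping.keys f \<subseteq> lists G}, mult = (*), one = 1,
     zero = 0, add = (+), smult = fscale\<rparr>"

text \<open>
  The algebra map to \<open>R\<close>, defined on a quotient of a free algebra, that sends the class of each
  generator \<open>g\<close> to \<open>\<gamma> g\<close>. Well defined only if \<open>\<gamma>\<close> respects the relations.
\<close>

definition alg_lift ::
    "(complex, 'r) module \<Rightarrow> ('g \<Rightarrow> 'r) \<Rightarrow> ('g list \<Rightarrow>\<^sub>0 complex) set \<Rightarrow> 'r"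
  where "alg_lift R \<gamma> X =
    (let f = (SOME f. f \<in> X) in
      \<Oplus>\<^bsub>R\<^esub>w\<in>Poly_Mapping.keys f.
        Poly_Mapping.lookup f w \<odot>\<^bsub>R\<^esub> foldr (\<lambda>g y. \<gamma> g \<otimes>\<^bsub>R\<^esub> y) w \<one>\<^bsub>R\<^esub>)"

section \<open>The quantum sphere and its coaction\<close>

datatype gen = Z nat | Zstar nat

fun gen_star :: "gen \<Rightarrow> gen"
  where "gen_star (Z i) = Zstar i" | "gen_star (Zstar i) = Z i"

definition sphere_gens :: "nat \<Rightarrow> gen set"
  where "sphere_gens n = Z ` {1..n} \<union> Zstar ` {1..n}"

text \<open>The conjugate-linear anti-multiplicative involution of the free algebra.\<close>

definition free_star :: "(gen list \<Rightarrow>\<^sub>0 complex) \<Rightarrow> (gen list \<Rightarrow>\<^sub>0 complex)"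
  where "free_star f =
    (\<Sum>w\<in>Poly_Mapping.keys f.
      Poly_Mapping.single (rev (map gen_star w)) (cnj (Poly_Mapping.lookup f w)))"

definition sphere_relations :: "nat \<Rightarrow> real \<Rightarrow> (gen list \<Rightarrow>\<^sub>0 complex) set"
  where "sphere_relations n q =
    (let z = (\<lambda>i. Poly_Mapping.single [Z i] 1);
         zs = (\<lambda>i. Poly_Mapping.single [Zstar i] 1);
         q' = complex_of_real q
     in {z i * z j - fscale q' (z j * z i) | i j. i \<in> {1..n} \<and> j \<in> {1..n} \<and> i < j} \<union>
        {zs i * z j - fscale q' (z j * zs i) | i j. i \<in> {1..n} \<and> j \<in> {1..n} \<and> i \<noteq> j} \<union>
        {zs 1 * z 1 - z 1 * zs 1} \<union>
        {zs k * z k - z k * zs k - fscale (1 - q'\<^sup>2) (\<Sum>j = 1..k - 1. z j * zs j) | k.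
           1 < k \<and> k \<le> n} \<union>
        {(\<Sum>j = 1..n. z j * zs j) - 1})"

text \<open>
  As the sphere is presented as a *-algebra, the adjoints of the relations are imposed as well;
  they add \<open>z\<^sub>j\<^sup>* z\<^sub>i\<^sup>* = q z\<^sub>i\<^sup>* z\<^sub>j\<^sup>*\<close> for \<open>i < j\<close>.
\<close>

definition sphere_ideal :: "nat \<Rightarrow> real \<Rightarrow> (gen list \<Rightarrow>\<^sub>0 complex) set"
  where "sphere_ideal n q =
    Idl\<^bsub>free_alg (sphere_gens n)\<^esub> (sphere_relations n q \<union> free_star ` sphere_relations n q)"

definition sphere :: "nat \<Rightarrow> real \<Rightarrow> (complex, (gen list \<Rightarrow>\<^sub>0 complex) set) module"
  where "sphere n q = quotient (free_alg (sphere_gens n)) (sphere_ideal n q)"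

text \<open>
  The Laurent polynomials, as the group algebra of the integers: \<open>u\<^sup>k\<close> is the basis vector of \<open>k\<close>.
\<close>

definition laurent :: "(complex, int \<Rightarrow>\<^sub>0 complex) module"
  where "laurent =
    \<lparr>carrier = UNIV, mult = (*), one = 1, zero = 0, add = (+), smult = fscale\<rparr>"

definition sphere_coaction ::
    "nat \<Rightarrow> real \<Rightarrow> (gen list \<Rightarrow>\<^sub>0 complex) set \<Rightarrow>
     ((gen list \<Rightarrow>\<^sub>0 complex) set \<times> (int \<Rightarrow>\<^sub>0 complex) \<Rightarrow>\<^sub>0 complex) set"
  where "sphere_coaction n q =
    (let A = sphere n q;
         cls = (\<lambda>g. sphere_ideal n q +>\<^bsub>free_alg (sphere_gens n)\<^esub> Poly_Mapping.single [g] 1)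
     in alg_lift (tensor_alg A laurent)
          (\<lambda>g. case g of
                 Z i \<Rightarrow> pure A laurent (cls (Z i)) (Poly_Mapping.single 1 1)
               | Zstar i \<Rightarrow> pure A laurent (cls (Zstar i)) (Poly_Mapping.single (-1) 1)))"

section \<open>Hopf--Galois extensions\<close>

text \<open>
  Below, \<open>A\<close> is an algebra with right \<open>H\<close>-coaction \<open>\<rho>\<close>, where \<open>H\<close> is a Hopf algebra of which
  only the algebra structure enters the definitions.
\<close>

definition coinvariants ::
    "(complex, 'a) module \<Rightarrow> (complex, 'h) module \<Rightarrow>
     ('a \<Rightarrow> ('a \<times> 'h \<Rightarrow>\<^sub>0 complex) set) \<Rightarrow> (complex, 'a) module"
  where "coinvariants A H \<rho> = A\<lparr>carrier := {a \<in> carrier A. \<rho> a = pure A H a \<one>\<^bsub>H\<^esub>}\<rparr>"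

definition tensor_B ::
    "(complex, 'a) module \<Rightarrow> (complex, 'h) module \<Rightarrow>
     ('a \<Rightarrow> ('a \<times> 'h \<Rightarrow>\<^sub>0 complex) set) \<Rightarrow> (complex, ('a \<times> 'a \<Rightarrow>\<^sub>0 complex) set) module"
  where "tensor_B A H \<rho> =
    tensor_over (carrier (coinvariants A H \<rho>)) (\<lambda>a b. a \<otimes>\<^bsub>A\<^esub> b) (\<lambda>b a. b \<otimes>\<^bsub>A\<^esub> a) A A"

text \<open>\<open>\<chi> (a \<otimes>\<^sub>B a') = a a'\<^sub>0 \<otimes> a'\<^sub>1\<close>\<close>

definition canonical_map ::
    "(complex, 'a) module \<Rightarrow> (complex, 'h) module \<Rightarrow>
     ('a \<Rightarrow> ('a \<times> 'h \<Rightarrow>\<^sub>0 complex) set) \<Rightarrow>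
     ('a \<times> 'a \<Rightarrow>\<^sub>0 complex) set \<Rightarrow> ('a \<times> 'h \<Rightarrow>\<^sub>0 complex) set"
  where "canonical_map A H \<rho> =
    tensor_lift (tensor A H) (\<lambda>a a'.
      tensor_lift (tensor A H) (\<lambda>a'0 a'1. pure A H (a \<otimes>\<^bsub>A\<^esub> a'0) a'1) (\<rho> a'))"

definition translation_map ::
    "(complex, 'a) module \<Rightarrow> (complex, 'h) module \<Rightarrow>
     ('a \<Rightarrow> ('a \<times> 'h \<Rightarrow>\<^sub>0 complex) set) \<Rightarrow> 'h \<Rightarrow> ('a \<times> 'a \<Rightarrow>\<^sub>0 complex) set"
  where "translation_map A H \<rho> h =
    inv_into (carrier (tensor_B A H \<rho>)) (canonical_map A H \<rho>) (pure A H \<one>\<^bsub>A\<^esub> h)"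

section \<open>Left bialgebroids and twists\<close>

text \<open>The record holds the data of a left bialgebroid; its axioms are not part of it.\<close>

record ('b, 'h) bialgebroid =
  base :: "(complex, 'b) module"
  total :: "(complex, 'h) module"
  src :: "'b \<Rightarrow> 'h"
  tgt :: "'b \<Rightarrow> 'h"
  coprod :: "'h \<Rightarrow> ('h \<times> 'h \<Rightarrow>\<^sub>0 complex) set"
  counit :: "'h \<Rightarrow> 'b"

text \<open>
  With the bimodule structure \<open>b h b' = s b * t b' * h\<close>, the coproduct takes values in
  \<open>tensor_over (carrier B) (\<lambda>h b. t b * h) (\<lambda>b h. s b * h) H H\<close>.
\<close>

definition dual_carrier :: "('b, 'h) bialgebroid \<Rightarrow> ('h \<Rightarrow> 'b) set"
  where "dual_carrier K =
    {\<phi> \<in> carrier (total K) \<rightarrow>\<^sub>E carrier (base K).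
      (\<forall>h\<in>carrier (total K). \<forall>k\<in>carrier (total K).
         \<phi> (h \<oplus>\<^bsub>total K\<^esub> k) = \<phi> h \<oplus>\<^bsub>base K\<^esub> \<phi> k) \<and>
      (\<forall>c. \<forall>h\<in>carrier (total K). \<phi> (c \<odot>\<^bsub>total K\<^esub> h) = c \<odot>\<^bsub>base K\<^esub> \<phi> h) \<and>
      (\<forall>b\<in>carrier (base K). \<forall>h\<in>carrier (total K).
         \<phi> (tgt K b \<otimes>\<^bsub>total K\<^esub> h) = \<phi> h \<otimes>\<^bsub>base K\<^esub> b)}"

definition dual_algebra :: "('b, 'h) bialgebroid \<Rightarrow> ('h \<Rightarrow> 'b) monoid"
  where "dual_algebra K =
    \<lparr>carrier = dual_carrier K,
     mult = (\<lambda>\<phi> \<psi>. \<lambda>h\<in>carrier (total K).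
       tensor_lift (base K) (\<lambda>h1 h2. \<psi> (src K (\<phi> h1) \<otimes>\<^bsub>total K\<^esub> h2)) (coprod K h)),
     one = (\<lambda>h\<in>carrier (total K). counit K h)\<rparr>"

definition dual_action :: "('b, 'h) bialgebroid \<Rightarrow> 'h \<Rightarrow> ('h \<Rightarrow> 'b) \<Rightarrow> 'h"
  where "dual_action K h \<phi> =
    tensor_lift (total K) (\<lambda>h1 h2. src K (\<phi> h1) \<otimes>\<^bsub>total K\<^esub> h2) (coprod K h)"

definition is_twist :: "('b, 'h) bialgebroid \<Rightarrow> ('h \<Rightarrow> 'b) \<Rightarrow> bool"
  where "is_twist K \<phi> \<longleftrightarrow>
    \<phi> \<in> Units (dual_algebra K) \<and>
    dual_action K \<one>\<^bsub>total K\<^esub> \<phi> = \<one>\<^bsub>total K\<^esub> \<and>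
    (\<forall>h\<in>carrier (total K). \<forall>h'\<in>carrier (total K).
       dual_action K h \<phi> \<otimes>\<^bsub>total K\<^esub> dual_action K h' \<phi> =
       dual_action K (h \<otimes>\<^bsub>total K\<^esub> h') \<phi>)"

definition twist_group :: "('b, 'h) bialgebroid \<Rightarrow> ('h \<Rightarrow> 'b) monoid"
  where "twist_group K = (dual_algebra K)\<lparr>carrier := {\<phi>. is_twist K \<phi>}\<rparr>"

section \<open>The Ehresmann--Schauenburg bialgebroid\<close>

text \<open>\<open>a \<otimes> a' \<mapsto> a\<^sub>0 \<otimes> a'\<^sub>0 \<otimes> a\<^sub>1 a'\<^sub>1\<close>, with values in \<open>(A \<otimes> A) \<otimes> H\<close>\<close>

definition diagonal_coaction ::
    "(complex, 'a) module \<Rightarrow> (complex, 'h) module \<Rightarrow>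
     ('a \<Rightarrow> ('a \<times> 'h \<Rightarrow>\<^sub>0 complex) set) \<Rightarrow> ('a \<times> 'a \<Rightarrow>\<^sub>0 complex) set \<Rightarrow>
     (('a \<times> 'a \<Rightarrow>\<^sub>0 complex) set \<times> 'h \<Rightarrow>\<^sub>0 complex) set"
  where "diagonal_coaction A H \<rho> =
    (let AA = tensor A A; T = tensor AA H in
     tensor_lift T (\<lambda>a a'.
       tensor_lift T (\<lambda>a0 a1.
         tensor_lift T (\<lambda>a'0 a'1.
           pure AA H (pure A A a0 a'0) (a1 \<otimes>\<^bsub>H\<^esub> a'1)) (\<rho> a')) (\<rho> a)))"

definition ES_total ::
    "(complex, 'a) module \<Rightarrow> (complex, 'h) module \<Rightarrow>
     ('a \<Rightarrow> ('a \<times> 'h \<Rightarrow>\<^sub>0 complex) set) \<Rightarrow>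
     (complex, ('a \<times> 'a \<Rightarrow>\<^sub>0 complex) set) module"
  where "ES_total A H \<rho> = (tensor_alg A (opposite A))
    \<lparr>carrier := {x \<in> carrier (tensor A A).
       diagonal_coaction A H \<rho> x = pure (tensor A A) H x \<one>\<^bsub>H\<^esub>}\<rparr>"

text \<open>
  The formula \<open>a\<^sub>0 \<otimes> \<tau>(a\<^sub>1) \<otimes> a'\<close> for the coproduct is an element of
  \<open>(A \<otimes> A) \<otimes>\<^sub>B (A \<otimes> A) = A \<otimes> (A \<otimes>\<^sub>B A) \<otimes> A\<close>; the coproduct is the element of
  \<open>\<C> \<otimes>\<^sub>B \<C>\<close>, where \<open>\<C> = (A \<otimes> A)\<^sup>c\<^sup>o\<^sup>H\<close>, that the canonical (injective) map
  \<open>\<C> \<otimes>\<^sub>B \<C> \<rightarrow> (A \<otimes> A) \<otimes>\<^sub>B (A \<otimes> A)\<close> sends to it.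
\<close>

definition ES_coprod ::
    "(complex, 'a) module \<Rightarrow> (complex, 'h) module \<Rightarrow>
     ('a \<Rightarrow> ('a \<times> 'h \<Rightarrow>\<^sub>0 complex) set) \<Rightarrow> ('a \<times> 'a \<Rightarrow>\<^sub>0 complex) set \<Rightarrow>
     (('a \<times> 'a \<Rightarrow>\<^sub>0 complex) set \<times> ('a \<times> 'a \<Rightarrow>\<^sub>0 complex) set \<Rightarrow>\<^sub>0 complex) set"
  where "ES_coprod A H \<rho> x =
    (let B = carrier (coinvariants A H \<rho>);
         AA = tensor_alg A (opposite A);
         C = ES_total A H \<rho>;
         r = (\<lambda>h b. pure A A \<one>\<^bsub>A\<^esub> b \<otimes>\<^bsub>AA\<^esub> h);
         l = (\<lambda>b h. pure A A b \<one>\<^bsub>A\<^esub> \<otimes>\<^bsub>AA\<^esub> h);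
         T = tensor_over B r l AA AA;
         \<iota> = tensor_lift T (\<lambda>h k. pure_over B r l AA AA h k)
     in inv_into (carrier (tensor_over B r l C C)) \<iota>
          (tensor_lift T (\<lambda>a a'.
             tensor_lift T (\<lambda>a0 a1.
               tensor_lift T (\<lambda>y y'.
                 pure_over B r l AA AA (pure A A a0 y) (pure A A y' a'))
               (translation_map A H \<rho> a1)) (\<rho> a)) x))"

definition ES_bialgebroid ::
    "(complex, 'a) module \<Rightarrow> (complex, 'h) module \<Rightarrow>
     ('a \<Rightarrow> ('a \<times> 'h \<Rightarrow>\<^sub>0 complex) set) \<Rightarrow> ('a, ('a \<times> 'a \<Rightarrow>\<^sub>0 complex) set) bialgebroid"
  where "ES_bialgebroid A H \<rho> =
    \<lparr>base = coinvariants A H \<rho>,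
     total = ES_total A H \<rho>,
     src = (\<lambda>b. pure A A b \<one>\<^bsub>A\<^esub>),
     tgt = (\<lambda>b. pure A A \<one>\<^bsub>A\<^esub> b),
     coprod = ES_coprod A H \<rho>,
     counit = tensor_lift A (\<lambda>a a'. a \<otimes>\<^bsub>A\<^esub> a')\<rparr>"

definition complex_units :: "complex monoid"
  where "complex_units = \<lparr>carrier = {c. c \<noteq> 0}, mult = (*), one = 1\<rparr>"

end

theory Submission
  imports Defs
begin

text \<open>
  A right \<open>B\<close>-linear map \<open>\<phi>\<close> on the Ehresmann--Schauenburg bialgebroid of a strongly graded algebra \<open>A\<close>
  has the form \<open>\<phi> (a \<otimes> a') = F a * a'\<close> for a unique graded linear \<open>F\<close>, and \<open>\<phi>\<close> acts as \<open>F \<otimes> id\<close>.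
  Hence twists correspond to graded algebra automorphisms of \<open>A\<close>, and it remains to show that those
  of the quantum sphere are the maps \<open>z\<^sub>j \<mapsto> c\<^sub>j z\<^sub>j\<close>, \<open>z\<^sub>j\<^sup>* \<mapsto> z\<^sub>j\<^sup>* / c\<^sub>j\<close>.

  Let \<open>x\<^sub>k = \<Sum>j\<le>k. z\<^sub>j z\<^sub>j\<^sup>*\<close>. Sending \<open>z\<^sub>j\<^sup>*\<close> to \<open>z\<^sub>j\<^sup>-\<^sup>1 (x\<^sub>j - x\<^sub>j\<^sub>-\<^sub>1)\<close> embeds the sphere into the quantum torus
  on \<open>z\<^sub>1, \<dots>, z\<^sub>n, x\<^sub>1, \<dots>, x\<^sub>n\<^sub>-\<^sub>1\<close>, because the PBW monomials have distinct leading terms. Each \<open>x\<^sub>k\<close> is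
  normal, so its image \<open>y\<close> under an automorphism is normal as well; comparing leading and lowest terms
  in \<open>y s = s' y\<close> shows that \<open>y\<close> is a monomial. Since the image of the sphere preserves the positive
  part of a highest weight module, \<open>y\<close> involves no \<open>z\<^sub>j\<close>, and the inverse automorphism forces
  \<open>y\<close> to be a multiple of some \<open>x\<^sub>l\<close>. The commutation relations with the \<open>x\<^sub>l\<close> and the factorisation of
  \<open>x\<^sub>j - x\<^sub>j\<^sub>-\<^sub>1\<close> as \<open>z\<^sub>j z\<^sub>j\<^sup>*\<close> then determine the images of \<open>z\<^sub>j\<close> and \<open>z\<^sub>j\<^sup>*\<close> by induction on \<open>j\<close>.
\<close>

section \<open>Complex vector spaces and linear maps\<close>

text \<open>Coproduct and translation map are defined through \<open>inv_into\<close>, tensors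
  through representatives picked by \<open>SOME\<close>; so every formula rests on an explicit
  inverse and on a proof of multilinearity. Strong grading supplies the inverses: for each k there
  are x_i of degree -k and y_i of degree k with sum of x_i y_i equal to 1, so the translation map
  sends u^k to the sum of the x_i \<otimes> y_i, and F(a) is the sum of phi(a \<otimes> x_i) y_i for
  a of degree k. The sphere is given by relations, which show neither what is nonzero nor what is a
  zero divisor. In the torus both are visible through a translation invariant order of the
  exponents. There, however, every monomial is invertible and hence normal, so two traces of the
  sphere must be kept: the coordinates 2, ..., n of a weight stay nonnegative, and for n \<ge> 2 a
  negative power of z_1 always comes with x_1. Coordinate 1 is exceptional because z_1^* = z_1^{-1}
  x_1 is a single term and kills no weight vector.\<close>

locale cvec = abelian_group V for V :: "(complex, 'v) module" (structure) +
  assumes smult_closed [simp, intro]: "v \<in> carrier V \<Longrightarrow> c \<odot> v \<in> carrier V"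
    and smult_add_left: "v \<in> carrier V \<Longrightarrow> (c + d) \<odot> v = c \<odot> v \<oplus> d \<odot> v"
    and smult_add_right: "v \<in> carrier V \<Longrightarrow> w \<in> carrier V \<Longrightarrow> c \<odot> (v \<oplus> w) = c \<odot> v \<oplus> c \<odot> w"
    and smult_smult: "v \<in> carrier V \<Longrightarrow> c \<odot> (d \<odot> v) = (c * d) \<odot> v"
    and smult_one [simp]: "v \<in> carrier V \<Longrightarrow> 1 \<odot> v = v"
begin

lemma smult_zero_left [simp]: "v \<in> carrier V \<Longrightarrow> 0 \<odot> v = \<zero>"
  using smult_add_left[of v 0 0] by (simp add: add.r_cancel_one')

lemma smult_zero_right [simp]: "c \<odot> \<zero> = \<zero>"
  using smult_add_right[of \<zero> \<zero> c] by (simp add: add.r_cancel_one')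

lemma smult_minus_one: "v \<in> carrier V \<Longrightarrow> (-1) \<odot> v = \<ominus> v"
  using smult_add_left[of v "-1" 1] by (simp add: minus_equality)

end

definition clinear :: "(complex, 'v) module \<Rightarrow> (complex, 'w) module \<Rightarrow> ('v \<Rightarrow> 'w) \<Rightarrow> bool"
  where "clinear V W f \<longleftrightarrow>
    (\<forall>v\<in>carrier V. f v \<in> carrier W) \<and>
    (\<forall>v\<in>carrier V. \<forall>v'\<in>carrier V. f (v \<oplus>\<^bsub>V\<^esub> v') = f v \<oplus>\<^bsub>W\<^esub> f v') \<and>
    (\<forall>c. \<forall>v\<in>carrier V. f (c \<odot>\<^bsub>V\<^esub> v) = c \<odot>\<^bsub>W\<^esub> f v)"

lemma clinearI:
  assumes "\<And>v. v \<in> carrier V \<Longrightarrow> f v \<in> carrier W"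
    and "\<And>v v'. v \<in> carrier V \<Longrightarrow> v' \<in> carrier V \<Longrightarrow> f (v \<oplus>\<^bsub>V\<^esub> v') = f v \<oplus>\<^bsub>W\<^esub> f v'"
    and "\<And>c v. v \<in> carrier V \<Longrightarrow> f (c \<odot>\<^bsub>V\<^esub> v) = c \<odot>\<^bsub>W\<^esub> f v"
  shows "clinear V W f"
  using assms by (auto simp: clinear_def)

lemma clinear_closed: "clinear V W f \<Longrightarrow> v \<in> carrier V \<Longrightarrow> f v \<in> carrier W"
  and clinear_add: "clinear V W f \<Longrightarrow> v \<in> carrier V \<Longrightarrow> v' \<in> carrier V \<Longrightarrow>
    f (v \<oplus>\<^bsub>V\<^esub> v') = f v \<oplus>\<^bsub>W\<^esub> f v'"
  and clinear_smult: "clinear V W f \<Longrightarrow> v \<in> carrier V \<Longrightarrow> f (c \<odot>\<^bsub>V\<^esub> v) = c \<odot>\<^bsub>W\<^esub> f v"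
  by (auto simp: clinear_def)

lemma clinear_zero:
  assumes "cvec V" "cvec W" "clinear V W f" shows "f \<zero>\<^bsub>V\<^esub> = \<zero>\<^bsub>W\<^esub>"
proof -
  interpret V: cvec V by fact
  interpret W: cvec W by fact
  have "f (0 \<odot>\<^bsub>V\<^esub> \<zero>\<^bsub>V\<^esub>) = 0 \<odot>\<^bsub>W\<^esub> f \<zero>\<^bsub>V\<^esub>" by (rule clinear_smult[OF assms(3)]) simp
  then show ?thesis using clinear_closed[OF assms(3), of "\<zero>\<^bsub>V\<^esub>"] by simp
qed

lemma clinear_finsum:
  assumes "cvec V" "cvec W" "clinear V W f" "finite I" "\<And>i. i \<in> I \<Longrightarrow> h i \<in> carrier V"
  shows "f (finsum V h I) = finsum W (\<lambda>i. f (h i)) I"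
proof -
  interpret V: cvec V by fact
  interpret W: cvec W by fact
  show ?thesis using assms(4,5)
  proof (induction I rule: finite_induct)
    case empty then show ?case using clinear_zero assms by simp
  next
    case (insert i I)
    have h: "h \<in> I \<rightarrow> carrier V" using insert by auto
    moreover have "(\<lambda>i. f (h i)) \<in> I \<rightarrow> carrier W"
      using insert clinear_closed[OF assms(3)] by auto
    ultimately show ?case using insert clinear_closed[OF assms(3)]
      by (simp add: clinear_add[OF assms(3)])
  qed
qed

lemma clinear_compose: "clinear V W f \<Longrightarrow> clinear W U g \<Longrightarrow> clinear V U (\<lambda>v. g (f v))"
  by (auto simp: clinear_def)

lemma clinear_id: "clinear V V (\<lambda>v. v)"
  by (auto simp: clinear_def)

lemma clinear_finsum_maps:
  assumes "cvec V" "cvec W" "finite I" "\<And>i. i \<in> I \<Longrightarrow> clinear V W (f i)"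
  shows "clinear V W (\<lambda>v. finsum W (\<lambda>i. f i v) I)"
proof -
  interpret V: cvec V by fact
  interpret W: cvec W by fact
  have c: "clinear W W (\<lambda>x. c \<odot>\<^bsub>W\<^esub> x)" for c
    by (rule clinearI) (auto simp: W.smult_add_right W.smult_smult mult.commute)
  show ?thesis
  proof (rule clinearI)
    fix v v' assume v: "v \<in> carrier V" "v' \<in> carrier V"
    have "finsum W (\<lambda>i. f i (v \<oplus>\<^bsub>V\<^esub> v')) I = finsum W (\<lambda>i. f i v \<oplus>\<^bsub>W\<^esub> f i v') I"
      by (rule W.finsum_cong') (auto simp: v clinear_add[OF assms(4)] clinear_closed[OF assms(4)])
    then show "finsum W (\<lambda>i. f i (v \<oplus>\<^bsub>V\<^esub> v')) I
        = finsum W (\<lambda>i. f i v) I \<oplus>\<^bsub>W\<^esub> finsum W (\<lambda>i. f i v') I"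
      using v clinear_closed[OF assms(4)] by (simp add: W.finsum_addf Pi_def)
  next
    fix k v assume v: "v \<in> carrier V"
    have "finsum W (\<lambda>i. f i (k \<odot>\<^bsub>V\<^esub> v)) I = finsum W (\<lambda>i. k \<odot>\<^bsub>W\<^esub> f i v) I"
      by (rule W.finsum_cong') (auto simp: v clinear_smult[OF assms(4)] clinear_closed[OF assms(4)])
    then show "finsum W (\<lambda>i. f i (k \<odot>\<^bsub>V\<^esub> v)) I = k \<odot>\<^bsub>W\<^esub> finsum W (\<lambda>i. f i v) I"
      using v clinear_closed[OF assms(4)] assms(2,3) by (simp add: clinear_finsum[OF _ _ c])
  qed (use clinear_closed[OF assms(4)] in \<open>auto intro!: W.finsum_closed\<close>)
qed

lemma (in cvec) clinear_scale: "clinear V V (\<lambda>x. c \<odot> x)"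
  by (rule clinearI) (auto simp: smult_add_right smult_smult mult.commute)

definition cbilinear ::
    "(complex, 'v) module \<Rightarrow> (complex, 'w) module \<Rightarrow> (complex, 'u) module \<Rightarrow> ('v \<Rightarrow> 'w \<Rightarrow> 'u) \<Rightarrow> bool"
  where "cbilinear V W U g \<longleftrightarrow>
    (\<forall>v\<in>carrier V. clinear W U (g v)) \<and> (\<forall>w\<in>carrier W. clinear V U (\<lambda>v. g v w))"

lemma cbilinearI:
  assumes "\<And>v. v \<in> carrier V \<Longrightarrow> clinear W U (g v)"
    and "\<And>w. w \<in> carrier W \<Longrightarrow> clinear V U (\<lambda>v. g v w)"
  shows "cbilinear V W U g"
  using assms by (auto simp: cbilinear_def)

lemma cbilinear_left: "cbilinear V W U g \<Longrightarrow> w \<in> carrier W \<Longrightarrow> clinear V U (\<lambda>v. g v w)"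
  and cbilinear_right: "cbilinear V W U g \<Longrightarrow> v \<in> carrier V \<Longrightarrow> clinear W U (g v)"
  by (auto simp: cbilinear_def)

lemma cbilinear_closed:
  "cbilinear V W U g \<Longrightarrow> v \<in> carrier V \<Longrightarrow> w \<in> carrier W \<Longrightarrow> g v w \<in> carrier U"
  by (auto simp: cbilinear_def clinear_def)

section \<open>Quotients of free vector spaces\<close>

definition lsum :: "(complex, 'u) module \<Rightarrow> ('x \<Rightarrow> 'u) \<Rightarrow> ('x \<Rightarrow>\<^sub>0 complex) \<Rightarrow> 'u"
  where "lsum U g f = (\<Oplus>\<^bsub>U\<^esub>p\<in>Poly_Mapping.keys f. Poly_Mapping.lookup f p \<odot>\<^bsub>U\<^esub> g p)"

context cvec begin

lemma lsum_superset:
  assumes "finite S" "Poly_Mapping.keys f \<subseteq> S" "\<And>x. x \<in> S \<Longrightarrow> g x \<in> carrier V"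
  shows "lsum V g f = (\<Oplus>p\<in>S. Poly_Mapping.lookup f p \<odot> g p)"
  unfolding lsum_def using assms
  by (intro add.finprod_mono_neutral_cong_left) (auto simp: in_keys_iff)

lemma lsum_closed:
  assumes "\<And>x. x \<in> Poly_Mapping.keys f \<Longrightarrow> g x \<in> carrier V"
  shows "lsum V g f \<in> carrier V"
  unfolding lsum_def using assms by (auto intro!: finsum_closed)

lemma lsum_add:
  assumes "\<And>x. x \<in> X \<Longrightarrow> g x \<in> carrier V" "Poly_Mapping.keys f \<subseteq> X" "Poly_Mapping.keys h \<subseteq> X"
  shows "lsum V g (f + h) = lsum V g f \<oplus> lsum V g h"
proof -
  let ?S = "Poly_Mapping.keys f \<union> Poly_Mapping.keys h"
  have S: "finite ?S" "\<And>x. x \<in> ?S \<Longrightarrow> g x \<in> carrier V" using assms by auto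
  have "lsum V g (f + h) = (\<Oplus>p\<in>?S. Poly_Mapping.lookup (f + h) p \<odot> g p)"
    by (rule lsum_superset) (use S Poly_Mapping.keys_add[of f h] in auto)
  also have "\<dots> = (\<Oplus>p\<in>?S. Poly_Mapping.lookup f p \<odot> g p \<oplus> Poly_Mapping.lookup h p \<odot> g p)"
    by (rule finsum_cong') (use S in \<open>auto simp: lookup_add smult_add_left\<close>)
  also have "\<dots> = lsum V g f \<oplus> lsum V g h"
    using S lsum_superset[of ?S f g] lsum_superset[of ?S h g]
    by (subst finsum_addf) auto
  finally show ?thesis .
qed

lemma lsum_fscale:
  assumes "\<And>x. x \<in> Poly_Mapping.keys f \<Longrightarrow> g x \<in> carrier V"
  shows "lsum V g (fscale c f) = c \<odot> lsum V g f"
proof -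
  have "lsum V g (fscale c f) = (\<Oplus>p\<in>Poly_Mapping.keys f. Poly_Mapping.lookup (fscale c f) p \<odot> g p)"
    by (rule lsum_superset) (auto simp: assms in_keys_iff)
  also have "\<dots> = (\<Oplus>p\<in>Poly_Mapping.keys f. c \<odot> (Poly_Mapping.lookup f p \<odot> g p))"
    by (rule finsum_cong') (auto simp: assms smult_smult)
  also have "\<dots> = c \<odot> lsum V g f"
    unfolding lsum_def by (rule clinear_finsum[symmetric, OF _ _ clinear_scale])
      (auto simp: assms cvec_axioms)
  finally show ?thesis .
qed

lemma lsum_zero [simp]: "lsum V g 0 = \<zero>"
  by (simp add: lsum_def)

lemma lsum_single [simp]: "g x \<in> carrier V \<Longrightarrow> lsum V g (Poly_Mapping.single x c) = c \<odot> g x"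
  by (cases "c = 0") (simp_all add: lsum_def)

end

lemma fscale_single: "fscale c (Poly_Mapping.single g a) = Poly_Mapping.single g (c * a)"
  by (rule poly_mapping_eqI) (auto simp: lookup_single when_def)

lemma keys_fscale: "Poly_Mapping.keys (fscale c f) \<subseteq> Poly_Mapping.keys f"
  by (auto simp: in_keys_iff)

lemma subspace_keys: "fvs.subspace {f. Poly_Mapping.keys f \<subseteq> X}"
  unfolding fvs.subspace_def
  by (auto dest!: keys_fscale[THEN subsetD] Poly_Mapping.keys_add[THEN subsetD])

text \<open>Relations are given as a span or as a generated ideal; \<open>fvs.span_minimal\<close>
  and \<open>I_minimal\<close> reduce vanishing on them to the generators once the kernel is known
  to be a subspace.\<close>

lemma (in cvec) subspace_lsum_kernel:
  assumes "\<And>x. x \<in> X \<Longrightarrow> g x \<in> carrier V"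
  shows "fvs.subspace {f. Poly_Mapping.keys f \<subseteq> X \<and> lsum V g f = \<zero>}"
proof -
  have "lsum V g (fscale c f) = \<zero>" if "Poly_Mapping.keys f \<subseteq> X" "lsum V g f = \<zero>" for c f
    using lsum_fscale[of f g c] that assms by auto
  moreover have "lsum V g (f + h) = \<zero>"
    if "Poly_Mapping.keys f \<subseteq> X" "lsum V g f = \<zero>" "Poly_Mapping.keys h \<subseteq> X" "lsum V g h = \<zero>" for f h
    using lsum_add[of X g f h] that assms by simp
  ultimately show ?thesis using subspace_keys[of X] by (auto simp: fvs.subspace_def)
qed

lemma sum_single_lookup:
  "(\<Sum>x\<in>Poly_Mapping.keys f. Poly_Mapping.single x (Poly_Mapping.lookup f x)) = f"
  by (rule poly_mapping_eqI) (auto simp: lookup_sum lookup_single when_def in_keys_iff sum.delta)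

text \<open>Shared by tensor products and by algebras with generators and relations: only the linear
  structure of \<open>M\<close> is fixed, so \<open>M\<close> may be a free vector space or a free
  algebra, and \<open>N\<close> a span or an ideal.\<close>

locale free_quotient =
  fixes M :: "(complex, 'x \<Rightarrow>\<^sub>0 complex) module" and X :: "'x set" and N :: "('x \<Rightarrow>\<^sub>0 complex) set"
  assumes carrier_M: "carrier M = {f. Poly_Mapping.keys f \<subseteq> X}"
    and add_M: "add M = (+)" and zero_M: "zero M = 0" and smult_M: "smult M = fscale"
    and subspace_N: "fvs.subspace N" and N_subset: "N \<subseteq> carrier M"
begin

abbreviation "cls f \<equiv> N +>\<^bsub>M\<^esub> f"

lemma cls_def: "cls f = (\<lambda>h. h + f) ` N"
  by (auto simp: a_r_coset_def r_coset_def add_M)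

lemma carrier_add: "f \<in> carrier M \<Longrightarrow> h \<in> carrier M \<Longrightarrow> f + h \<in> carrier M"
  and carrier_fscale: "f \<in> carrier M \<Longrightarrow> fscale c f \<in> carrier M"
  and carrier_zero: "0 \<in> carrier M"
  and carrier_uminus: "f \<in> carrier M \<Longrightarrow> - f \<in> carrier M"
  using subspace_keys[of X] unfolding carrier_M fvs.subspace_def by auto

lemma carrier_single: "x \<in> X \<Longrightarrow> Poly_Mapping.single x c \<in> carrier M"
  by (auto simp: carrier_M)

lemma carrier_sum: "(\<And>i. i \<in> I \<Longrightarrow> f i \<in> carrier M) \<Longrightarrow> sum f I \<in> carrier M"
  by (induction I rule: infinite_finite_induct) (auto simp: carrier_zero carrier_add)

lemma N_add: "f \<in> N \<Longrightarrow> h \<in> N \<Longrightarrow> f + h \<in> N"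
  and N_diff: "f \<in> N \<Longrightarrow> h \<in> N \<Longrightarrow> f - h \<in> N"
  and N_uminus: "f \<in> N \<Longrightarrow> - f \<in> N"
  and N_fscale: "f \<in> N \<Longrightarrow> fscale c f \<in> N" and N_zero: "0 \<in> N"
  using fvs.subspace_diff[OF subspace_N] fvs.subspace_neg[OF subspace_N] subspace_N
  unfolding fvs.subspace_def by auto

lemma mem_cls: "g \<in> cls f \<longleftrightarrow> g - f \<in> N"
  by (auto simp: cls_def image_iff) (metis add_diff_cancel diff_add_cancel)

lemma self_in_cls: "f \<in> cls f"
  by (simp add: mem_cls N_zero)

lemma cls_eq_iff: "cls f = cls g \<longleftrightarrow> f - g \<in> N"
proof
  assume "cls f = cls g" then show "f - g \<in> N" using mem_cls self_in_cls by blast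
next
  assume *: "f - g \<in> N"
  have "h - f \<in> N \<longleftrightarrow> h - g \<in> N" for h
    using N_add[OF _ *, of "h - f"] N_diff[OF _ *, of "h - g"] by (auto simp: algebra_simps)
  then show "cls f = cls g" by (auto simp: mem_cls)
qed

lemma cls_subset: "f \<in> carrier M \<Longrightarrow> cls f \<subseteq> carrier M"
  using N_subset carrier_add by (auto simp: cls_def)

lemma carrier_quotient: "carrier (quotient M N) = cls ` carrier M"
  by (auto simp: quotient_def ring.defs module.defs FactRing_def A_RCOSETS_defs a_r_coset_def
      simp del: add_M)

lemma cls_closed: "f \<in> carrier M \<Longrightarrow> cls f \<in> carrier (quotient M N)"
  by (simp add: carrier_quotient)

lemma cls_exhaust: assumes "x \<in> carrier (quotient M N)" obtains f where "f \<in> carrier M" "x = cls f"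
  using assms by (auto simp: carrier_quotient)

lemma zero_quotient: "\<zero>\<^bsub>quotient M N\<^esub> = cls 0"
  by (simp add: quotient_def ring.defs module.defs FactRing_def cls_def)

lemma add_cls: "cls f \<oplus>\<^bsub>quotient M N\<^esub> cls g = cls (f + g)"
proof -
  have "cls f \<oplus>\<^bsub>quotient M N\<^esub> cls g = {h + k | h k. h \<in> cls f \<and> k \<in> cls g}"
    by (auto simp: quotient_def ring.defs module.defs FactRing_def set_add_defs add_M)
  also have "{h + k | h k. h \<in> cls f \<and> k \<in> cls g} = cls (f + g)"
  proof (intro Set.set_eqI iffI)
    fix x assume "x \<in> {h + k | h k. h \<in> cls f \<and> k \<in> cls g}"
    then obtain h k where "h - f \<in> N" "k - g \<in> N" "x = h + k" by (auto simp: mem_cls)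
    then show "x \<in> cls (f + g)" using N_add[of "h - f" "k - g"] by (simp add: mem_cls algebra_simps)
  next
    fix x assume "x \<in> cls (f + g)"
    then have "x - g \<in> cls f" by (simp add: mem_cls algebra_simps)
    then show "x \<in> {h + k | h k. h \<in> cls f \<and> k \<in> cls g}" using self_in_cls[of g] by force
  qed
  finally show ?thesis .
qed

lemma smult_cls: "c \<odot>\<^bsub>quotient M N\<^esub> cls f = cls (fscale c f)"
proof -
  have "c \<odot>\<^bsub>quotient M N\<^esub> cls f = (\<Union>x\<in>cls f. cls (fscale c x))"
    by (simp add: quotient_def ring.defs module.defs smult_M)
  moreover have "cls (fscale c x) = cls (fscale c f)" if "x \<in> cls f" for x
    using that by (simp add: mem_cls cls_eq_iff N_fscale flip: fvs.scale_right_diff_distrib)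
  moreover have "cls f \<noteq> {}" using self_in_cls by blast
  ultimately show ?thesis by simp
qed

lemma cvec_quotient: "cvec (quotient M N)"
proof -
  have "abelian_group (quotient M N)"
  proof (rule abelian_groupI)
    fix x assume "x \<in> carrier (quotient M N)"
    then obtain f where f: "f \<in> carrier M" "x = cls f" by (rule cls_exhaust)
    have "cls (-f) \<oplus>\<^bsub>quotient M N\<^esub> x = \<zero>\<^bsub>quotient M N\<^esub>"
      by (simp add: f add_cls zero_quotient)
    then show "\<exists>y\<in>carrier (quotient M N). y \<oplus>\<^bsub>quotient M N\<^esub> x = \<zero>\<^bsub>quotient M N\<^esub>"
      using f carrier_uminus cls_closed by blast
  qed (auto elim!: cls_exhaust simp: add_cls zero_quotient cls_closed carrier_add carrier_zero add_ac)
  then show ?thesis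
    by (intro cvec.intro cvec_axioms.intro)
      (auto elim!: cls_exhaust simp: add_cls smult_cls cls_closed carrier_add carrier_fscale
        fvs.scale_left_distrib fvs.scale_right_distrib)
qed

lemma some_cls:
  assumes "f \<in> carrier M"
  shows "(SOME g. g \<in> cls f) \<in> carrier M" "(SOME g. g \<in> cls f) - f \<in> N"
proof -
  have "(SOME g. g \<in> cls f) \<in> cls f" by (rule someI) (rule self_in_cls)
  then show "(SOME g. g \<in> cls f) \<in> carrier M" "(SOME g. g \<in> cls f) - f \<in> N"
    using cls_subset[OF assms] mem_cls by blast+
qed

text \<open>The chosen representative differs from \<open>f\<close> by an element of
  \<open>N\<close>, where the sum vanishes. The values of \<open>tensor_lift\<close> and
  \<open>alg_lift\<close> on classes are computed through this.\<close>

lemma lsum_some_cls: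
  assumes "cvec U" "\<And>x. x \<in> X \<Longrightarrow> g x \<in> carrier U" "\<And>f. f \<in> N \<Longrightarrow> lsum U g f = \<zero>\<^bsub>U\<^esub>"
    and "f \<in> carrier M"
  shows "lsum U g (SOME h. h \<in> cls f) = lsum U g f"
proof -
  interpret U: cvec U by fact
  let ?h = "SOME h. h \<in> cls f"
  have *: "?h \<in> carrier M" "?h - f \<in> N" using some_cls assms by auto
  have "lsum U g ((?h - f) + f) = lsum U g (?h - f) \<oplus>\<^bsub>U\<^esub> lsum U g f"
    using *(2) N_subset assms(4) by (intro U.lsum_add[of X]) (auto simp: assms carrier_M)
  then show ?thesis
    using assms *(2) by (auto simp: carrier_M intro!: U.l_zero U.lsum_closed)
qed

lemma clinear_lsum_some:
  assumes "cvec U" "\<And>x. x \<in> X \<Longrightarrow> g x \<in> carrier U" "\<And>f. f \<in> N \<Longrightarrow> lsum U g f = \<zero>\<^bsub>U\<^esub>"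
  shows "clinear (quotient M N) U (\<lambda>Y. lsum U g (SOME h. h \<in> Y))"
proof -
  interpret U: cvec U by fact
  have "lsum U g f \<in> carrier U" if "f \<in> carrier M" for f
    using that assms(2) by (auto simp: carrier_M intro!: U.lsum_closed)
  moreover have "lsum U g (f + h) = lsum U g f \<oplus>\<^bsub>U\<^esub> lsum U g h" if "f \<in> carrier M" "h \<in> carrier M" for f h
    using U.lsum_add[of X g f h] that assms by (auto simp: carrier_M)
  moreover have "lsum U g (fscale c f) = c \<odot>\<^bsub>U\<^esub> lsum U g f" if "f \<in> carrier M" for c f
    using U.lsum_fscale[of f g] that assms by (auto simp: carrier_M)
  ultimately show ?thesis
    by (auto simp: clinear_def add_cls smult_cls lsum_some_cls[OF assms] carrier_add carrier_fscale
        elim!: cls_exhaust)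
qed

lemma cls_induct [consumes 1]:
  assumes "Y \<in> carrier (quotient M N)"
    and "\<And>c x. x \<in> X \<Longrightarrow> Q (c \<odot>\<^bsub>quotient M N\<^esub> cls (Poly_Mapping.single x 1))"
    and "Q \<zero>\<^bsub>quotient M N\<^esub>"
    and "\<And>Y Z. Y \<in> carrier (quotient M N) \<Longrightarrow> Z \<in> carrier (quotient M N) \<Longrightarrow> Q Y \<Longrightarrow> Q Z \<Longrightarrow>
      Q (Y \<oplus>\<^bsub>quotient M N\<^esub> Z)"
  shows "Q Y"
proof -
  obtain f where f: "f \<in> carrier M" "Y = cls f" using assms(1) by (rule cls_exhaust)
  have "Q (cls (\<Sum>x\<in>S. Poly_Mapping.single x (Poly_Mapping.lookup f x)))"
    if "finite S" "S \<subseteq> X" for S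
    using that
  proof (induction S rule: finite_induct)
    case empty then show ?case using assms(3) by (simp add: zero_quotient)
  next
    case (insert x S)
    have "fscale (Poly_Mapping.lookup f x) (Poly_Mapping.single x 1) =
        Poly_Mapping.single x (Poly_Mapping.lookup f x)"
      by (auto intro!: poly_mapping_eqI simp: lookup_single when_def)
    then have "Q (cls (Poly_Mapping.single x (Poly_Mapping.lookup f x)))"
      using assms(2)[of x "Poly_Mapping.lookup f x"] insert by (simp add: smult_cls)
    then show ?case using insert
      by (auto simp flip: add_cls intro!: assms(4) cls_closed carrier_single carrier_sum)
  qed
  from this[of "Poly_Mapping.keys f"] show ?thesis using f by (simp add: carrier_M sum_single_lookup)
qed

end

section \<open>Tensor products\<close>

locale tensor_setup = V: cvec V + W: cvec W
  for B :: "'b set" and r :: "'v \<Rightarrow> 'b \<Rightarrow> 'v" and l :: "'b \<Rightarrow> 'w \<Rightarrow> 'w"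
    and V :: "(complex, 'v) module" and W :: "(complex, 'w) module" +
  assumes r_closed: "b \<in> B \<Longrightarrow> v \<in> carrier V \<Longrightarrow> r v b \<in> carrier V"
    and l_closed: "b \<in> B \<Longrightarrow> w \<in> carrier W \<Longrightarrow> l b w \<in> carrier W"
begin

abbreviation "T \<equiv> tensor_over B r l V W"
abbreviation "pr \<equiv> pure_over B r l V W"
abbreviation "balanced g \<equiv> (\<forall>b\<in>B. \<forall>v\<in>carrier V. \<forall>w\<in>carrier W. g (r v b) w = g v (l b w))"

lemma tensor_relations_subset:
  "tensor_relations B r l V W \<subseteq> {f. Poly_Mapping.keys f \<subseteq> carrier V \<times> carrier W}" (is "_ \<subseteq> ?C")
proof -
  have e: "Poly_Mapping.single (v, w) c \<in> ?C" if "v \<in> carrier V" "w \<in> carrier W" for v w and c :: complex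
    using that by auto
  have d: "f - g \<in> ?C" if "f \<in> ?C" "g \<in> ?C" for f g
    using fvs.subspace_diff[OF subspace_keys] that by blast
  have s: "fscale c f \<in> ?C" if "f \<in> ?C" for f c
    using fvs.subspace_scale[OF subspace_keys] that by blast
  show ?thesis
    unfolding tensor_relations_def Let_def
    apply (rule fvs.span_minimal[OF _ subspace_keys])
    apply (intro Un_least subsetI)
        apply (elim CollectE exE conjE, hypsubst, intro d s e; (assumption | rule V.a_closed W.a_closed V.smult_closed W.smult_closed r_closed l_closed)+)+
    done
qed

sublocale FQ: free_quotient "free_space (carrier V \<times> carrier W)" "carrier V \<times> carrier W"
  "tensor_relations B r l V W"
  using tensor_relations_subset
  by unfold_locales (auto simp: free_space_def tensor_relations_def Let_def intro: fvs.subspace_span)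

lemma pr_def: "pr v w = FQ.cls (Poly_Mapping.single (v, w) 1)"
  by (simp add: pure_over_def)

lemma T_def: "T = quotient (free_space (carrier V \<times> carrier W)) (tensor_relations B r l V W)"
  by (simp add: tensor_over_def)

sublocale T: cvec T
  unfolding T_def by (rule FQ.cvec_quotient)

lemma relation_gens:
  shows "v \<in> carrier V \<Longrightarrow> v' \<in> carrier V \<Longrightarrow> w \<in> carrier W \<Longrightarrow>
     Poly_Mapping.single (v \<oplus>\<^bsub>V\<^esub> v', w) 1 - Poly_Mapping.single (v, w) 1 - Poly_Mapping.single (v', w) 1
      \<in> tensor_relations B r l V W"
    and "v \<in> carrier V \<Longrightarrow> w \<in> carrier W \<Longrightarrow> w' \<in> carrier W \<Longrightarrow>
     Poly_Mapping.single (v, w \<oplus>\<^bsub>W\<^esub> w') 1 - Poly_Mapping.single (v, w) 1 - Poly_Mapping.single (v, w') 1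
      \<in> tensor_relations B r l V W"
    and "v \<in> carrier V \<Longrightarrow> w \<in> carrier W \<Longrightarrow>
     Poly_Mapping.single (c \<odot>\<^bsub>V\<^esub> v, w) 1 - fscale c (Poly_Mapping.single (v, w) 1)
      \<in> tensor_relations B r l V W"
    and "v \<in> carrier V \<Longrightarrow> w \<in> carrier W \<Longrightarrow>
     Poly_Mapping.single (v, c \<odot>\<^bsub>W\<^esub> w) 1 - fscale c (Poly_Mapping.single (v, w) 1)
      \<in> tensor_relations B r l V W"
    and "b \<in> B \<Longrightarrow> v \<in> carrier V \<Longrightarrow> w \<in> carrier W \<Longrightarrow>
     Poly_Mapping.single (r v b, w) 1 - Poly_Mapping.single (v, l b w) 1
      \<in> tensor_relations B r l V W"
  unfolding tensor_relations_def Let_def by (rule fvs.span_base; blast)+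

lemma pr_closed [simp]: "v \<in> carrier V \<Longrightarrow> w \<in> carrier W \<Longrightarrow> pr v w \<in> carrier T"
  unfolding T_def pr_def by (intro FQ.cls_closed FQ.carrier_single) simp

lemma pr_bilinear: "cbilinear V W T pr"
proof (intro cbilinearI clinearI)
  fix v w w' assume "v \<in> carrier V" "w \<in> carrier W" "w' \<in> carrier W"
  then show "pr v (w \<oplus>\<^bsub>W\<^esub> w') = pr v w \<oplus>\<^bsub>T\<^esub> pr v w'"
    using relation_gens(2)[of v w w'] by (simp add: pr_def T_def FQ.add_cls FQ.cls_eq_iff diff_diff_eq)
next
  fix v v' w assume "v \<in> carrier V" "w \<in> carrier W" "v' \<in> carrier V"
  then show "pr (v \<oplus>\<^bsub>V\<^esub> v') w = pr v w \<oplus>\<^bsub>T\<^esub> pr v' w"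
    using relation_gens(1)[of v v' w] by (simp add: pr_def T_def FQ.add_cls FQ.cls_eq_iff diff_diff_eq)
next
  fix v w c assume "v \<in> carrier V" "w \<in> carrier W"
  then show "pr (c \<odot>\<^bsub>V\<^esub> v) w = c \<odot>\<^bsub>T\<^esub> pr v w"
    using relation_gens(3) by (simp add: pr_def T_def FQ.smult_cls FQ.cls_eq_iff)
next
  fix v w c assume "v \<in> carrier V" "w \<in> carrier W"
  then show "pr v (c \<odot>\<^bsub>W\<^esub> w) = c \<odot>\<^bsub>T\<^esub> pr v w"
    using relation_gens(4) by (simp add: pr_def T_def FQ.smult_cls FQ.cls_eq_iff)
qed auto

lemma pr_balanced: "b \<in> B \<Longrightarrow> v \<in> carrier V \<Longrightarrow> w \<in> carrier W \<Longrightarrow> pr (r v b) w = pr v (l b w)"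
  using relation_gens(5) by (simp add: pr_def FQ.cls_eq_iff)

text \<open>Scalars and zero need no case of their own: a multiple c (v \<otimes> w) is the pure
  tensor of c v and w, and 0 is the pure tensor of 0 and 0.\<close>

lemma tensor_induct [consumes 1, case_names pure add]:
  assumes "x \<in> carrier T"
    and pure: "\<And>v w. v \<in> carrier V \<Longrightarrow> w \<in> carrier W \<Longrightarrow> Q (pr v w)"
    and add: "\<And>x y. x \<in> carrier T \<Longrightarrow> y \<in> carrier T \<Longrightarrow> Q x \<Longrightarrow> Q y \<Longrightarrow> Q (x \<oplus>\<^bsub>T\<^esub> y)"
  shows "Q x"
  using assms(1)[unfolded T_def]
proof (induction rule: FQ.cls_induct)
  case (1 c p)
  obtain v w where p: "p = (v, w)" "v \<in> carrier V" "w \<in> carrier W" using 1 by auto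
  have "c \<odot>\<^bsub>T\<^esub> pr v w = pr (c \<odot>\<^bsub>V\<^esub> v) w"
    using clinear_smult[OF cbilinear_left[OF pr_bilinear], of w v c] p by simp
  then show ?case using pure[of "c \<odot>\<^bsub>V\<^esub> v" w] p by (simp add: T_def pr_def)
next
  case 2
  have "pr \<zero>\<^bsub>V\<^esub> \<zero>\<^bsub>W\<^esub> = \<zero>\<^bsub>T\<^esub>"
    using clinear_zero[OF _ _ cbilinear_left[OF pr_bilinear], of "\<zero>\<^bsub>W\<^esub>"] V.cvec_axioms T.cvec_axioms
    by simp
  then show ?case using pure[of "\<zero>\<^bsub>V\<^esub>" "\<zero>\<^bsub>W\<^esub>"] by (simp add: T_def)
next
  case (3 Y Z) then show ?case using add by (simp add: T_def)
qed

text \<open>Each of the five families of generating relations goes to an identity that expresses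
  additivity, homogeneity or balancedness of \<open>g\<close>. This is the universal property behind
  \<open>tensor_lift\<close>.\<close>

lemma lsum_relations:
  assumes "cvec U" "cbilinear V W U g" "balanced g" "f \<in> tensor_relations B r l V W"
  shows "lsum U (\<lambda>p. g (fst p) (snd p)) f = \<zero>\<^bsub>U\<^esub>"
proof -
  interpret U: cvec U by fact
  let ?g = "\<lambda>p. g (fst p) (snd p)" and ?X = "carrier V \<times> carrier W"
  let ?K = "{f. Poly_Mapping.keys f \<subseteq> ?X \<and> lsum U ?g f = \<zero>\<^bsub>U\<^esub>}"
  have g: "g v w \<in> carrier U" if "v \<in> carrier V" "w \<in> carrier W" for v w
    using cbilinear_closed[OF assms(2)] that by auto
  have gX: "?g x \<in> carrier U" if "x \<in> ?X" for x using that g by auto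
  have sub: "lsum U ?g (f - h) = lsum U ?g f \<ominus>\<^bsub>U\<^esub> lsum U ?g h"
    if "Poly_Mapping.keys f \<subseteq> ?X" "Poly_Mapping.keys h \<subseteq> ?X" for f h
  proof -
    have "Poly_Mapping.keys (f - h) \<subseteq> ?X" using fvs.subspace_diff[OF subspace_keys] that by blast
    then have "lsum U ?g f = lsum U ?g (f - h) \<oplus>\<^bsub>U\<^esub> lsum U ?g h"
      using U.lsum_add[of ?X ?g "f - h" h] gX that by simp
    moreover have "lsum U ?g (f - h) \<in> carrier U" "lsum U ?g h \<in> carrier U"
      using \<open>Poly_Mapping.keys (f - h) \<subseteq> ?X\<close> that gX by (auto intro!: U.lsum_closed)
    ultimately show ?thesis by (simp add: U.minus_eq U.a_assoc U.r_neg)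
  qed
  have kd: "Poly_Mapping.keys (f - h) \<subseteq> ?X" if "Poly_Mapping.keys f \<subseteq> ?X" "Poly_Mapping.keys h \<subseteq> ?X" for f h :: "_ \<Rightarrow>\<^sub>0 complex"
    using fvs.subspace_diff[OF subspace_keys] that by blast
  have ks: "Poly_Mapping.keys (fscale c f) \<subseteq> ?X" if "Poly_Mapping.keys f \<subseteq> ?X" for f and c
    by (rule subset_trans[OF keys_fscale that])
  have e: "Poly_Mapping.keys (Poly_Mapping.single (v, w) (1::complex)) \<subseteq> ?X" if "v \<in> carrier V" "w \<in> carrier W" for v w
    using that by auto
  have l1: "lsum U ?g (Poly_Mapping.single (v, w) 1) = g v w" if "v \<in> carrier V" "w \<in> carrier W" for v w
    using g[OF that] by simp
  have l2: "lsum U ?g (fscale c (Poly_Mapping.single (v, w) 1)) = c \<odot>\<^bsub>U\<^esub> g v w" if "v \<in> carrier V" "w \<in> carrier W" for v w c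
    using g[OF that] by (subst U.lsum_fscale) auto
  have z2: "x \<ominus>\<^bsub>U\<^esub> y = \<zero>\<^bsub>U\<^esub>" if "x = y" "y \<in> carrier U" for x y
    using that by (simp add: U.minus_eq U.r_neg)
  have z3: "x \<ominus>\<^bsub>U\<^esub> y \<ominus>\<^bsub>U\<^esub> z = \<zero>\<^bsub>U\<^esub>" if "x = y \<oplus>\<^bsub>U\<^esub> z" "y \<in> carrier U" "z \<in> carrier U" for x y z
    using that U.a_comm[of y z] by (simp add: U.minus_eq U.a_assoc U.r_neg1 U.r_neg2 U.r_neg)
  note lin = cbilinear_left[OF assms(2)] cbilinear_right[OF assms(2)]
  let ?s = "\<lambda>v w. Poly_Mapping.single (v, w) (1::complex)"
  have k1: "?s (v \<oplus>\<^bsub>V\<^esub> v') w - ?s v w - ?s v' w \<in> ?K"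
    if "v \<in> carrier V" "v' \<in> carrier V" "w \<in> carrier W" for v v' w
    using that by (simp add: sub kd e l1 g del: keys_single)
      (rule z3, simp_all add: g clinear_add[OF lin(1)])
  have k2: "?s v (w \<oplus>\<^bsub>W\<^esub> w') - ?s v w - ?s v w' \<in> ?K"
    if "v \<in> carrier V" "w \<in> carrier W" "w' \<in> carrier W" for v w w'
    using that by (simp add: sub kd e l1 g del: keys_single)
      (rule z3, simp_all add: g clinear_add[OF lin(2)])
  have k3: "?s (c \<odot>\<^bsub>V\<^esub> v) w - fscale c (?s v w) \<in> ?K"
    if "v \<in> carrier V" "w \<in> carrier W" for v w c
    using that by (simp add: sub kd ks e l1 l2 g del: keys_single)
      (rule z2, simp_all add: g clinear_smult[OF lin(1)])
  have k4: "?s v (c \<odot>\<^bsub>W\<^esub> w) - fscale c (?s v w) \<in> ?K"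
    if "v \<in> carrier V" "w \<in> carrier W" for v w c
    using that by (simp add: sub kd ks e l1 l2 g del: keys_single)
      (rule z2, simp_all add: g clinear_smult[OF lin(2)])
  have k5: "?s (r v b) w - ?s v (l b w) \<in> ?K"
    if "b \<in> B" "v \<in> carrier V" "w \<in> carrier W" for v w b
    using that assms(3) by (simp add: sub kd e l1 g r_closed l_closed del: keys_single)
      (rule z2, simp_all add: g l_closed)
  have "tensor_relations B r l V W \<subseteq> ?K"
    unfolding tensor_relations_def Let_def
  proof (rule fvs.span_minimal[OF _ U.subspace_lsum_kernel[OF gX]], intro Un_least subsetI)
  qed (elim CollectE exE conjE; hypsubst; rule k1 k2 k3 k4 k5; assumption)+
  then show ?thesis using assms(4) by blast
qed

lemma tensor_lift_def': "tensor_lift U g Y = lsum U (\<lambda>p. g (fst p) (snd p)) (SOME f. f \<in> Y)"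
  by (simp add: tensor_lift_def lsum_def Let_def)

lemma lift_linear:
  assumes "cvec U" "cbilinear V W U g" "balanced g"
  shows "clinear T U (tensor_lift U g)"
  unfolding T_def tensor_lift_def'[abs_def]
  by (rule FQ.clinear_lsum_some)
    (use assms lsum_relations in \<open>auto intro: cbilinear_closed[OF assms(2)]\<close>)

lemma lift_pure:
  assumes "cvec U" "cbilinear V W U g" "balanced g" "v \<in> carrier V" "w \<in> carrier W"
  shows "tensor_lift U g (pr v w) = g v w"
proof -
  interpret U: cvec U by fact
  have "tensor_lift U g (pr v w) = lsum U (\<lambda>p. g (fst p) (snd p)) (Poly_Mapping.single (v, w) 1)"
    unfolding tensor_lift_def' pr_def
    by (rule FQ.lsum_some_cls)
      (use assms lsum_relations FQ.carrier_single in \<open>auto intro: cbilinear_closed[OF assms(2)]\<close>)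
  then show ?thesis using cbilinear_closed[OF assms(2,4,5)] by simp
qed

end

text \<open>The base algebra, the bialgebroid and the opposite or tensor algebras arise by record
  update from a known vector space: they differ from it in the carrier or in the multiplicative
  fields only.\<close>

lemma cvec_restrict:
  assumes "cvec V" "carrier V' \<subseteq> carrier V" "zero V' = zero V" "add V' = add V" "smult V' = smult V"
    and "\<zero>\<^bsub>V\<^esub> \<in> carrier V'"
    and "\<And>v w. v \<in> carrier V' \<Longrightarrow> w \<in> carrier V' \<Longrightarrow> v \<oplus>\<^bsub>V\<^esub> w \<in> carrier V'"
    and "\<And>c v. v \<in> carrier V' \<Longrightarrow> c \<odot>\<^bsub>V\<^esub> v \<in> carrier V'"
  shows "cvec V'"
proof -
  interpret V: cvec V by fact
  have sub: "v \<in> carrier V" if "v \<in> carrier V'" for v using that assms(2) by blast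
  have "abelian_group V'"
  proof (rule abelian_groupI)
    fix x assume x: "x \<in> carrier V'"
    then have "(-1) \<odot>\<^bsub>V\<^esub> x \<oplus>\<^bsub>V\<^esub> x = \<zero>\<^bsub>V\<^esub>" using sub V.smult_minus_one V.l_neg by simp
    then show "\<exists>y\<in>carrier V'. y \<oplus>\<^bsub>V'\<^esub> x = \<zero>\<^bsub>V'\<^esub>" using assms(3,4,8) x by metis
  qed (use assms(3-7) sub in \<open>auto simp: V.a_ac\<close>)
  then show ?thesis
    by (intro cvec.intro cvec_axioms.intro)
      (use assms(3-8) sub in \<open>auto simp: V.smult_add_left V.smult_add_right V.smult_smult\<close>)
qed

context tensor_setup begin

text \<open>In a nested lift the inner integrand depends on the outer variables, so the outer lift
  is well defined only if the inner one is linear in them.\<close>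

lemma lift_param:
  assumes "cvec P" "cvec U"
    and bil: "\<And>p. p \<in> carrier P \<Longrightarrow> cbilinear V W U (g p)"
    and bal: "\<And>p. p \<in> carrier P \<Longrightarrow> balanced (g p)"
    and lin: "\<And>v w. v \<in> carrier V \<Longrightarrow> w \<in> carrier W \<Longrightarrow> clinear P U (\<lambda>p. g p v w)"
    and x: "x \<in> carrier T"
  shows "clinear P U (\<lambda>p. tensor_lift U (g p) x)"
proof -
  interpret U: cvec U by fact
  interpret P: cvec P by fact
  note L = lift_linear[OF assms(2) bil bal]
  show ?thesis using x
  proof (induction rule: tensor_induct)
    case (pure v w)
    have "tensor_lift U (g p) (pr v w) = g p v w" if "p \<in> carrier P" for p
      using lift_pure[OF assms(2) bil bal] that pure by simp
    then show ?case using lin[OF pure] by (simp add: clinear_def)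
  next
    case (add x y)
    have *: "tensor_lift U (g p) (x \<oplus>\<^bsub>T\<^esub> y) = tensor_lift U (g p) x \<oplus>\<^bsub>U\<^esub> tensor_lift U (g p) y"
      if "p \<in> carrier P" for p
      using clinear_add[OF L] add that by blast
    note c = clinear_closed[OF add.IH(1)] clinear_closed[OF add.IH(2)]
    show ?case
      by (rule clinearI) (simp_all add: * c clinear_add[OF add.IH(1)] clinear_add[OF add.IH(2)]
          clinear_smult[OF add.IH(1)] clinear_smult[OF add.IH(2)] U.a_ac U.smult_add_right)
  qed
qed

lemma linear_ext:
  assumes "clinear T U f" "clinear T U g"
    and "\<And>v w. v \<in> carrier V \<Longrightarrow> w \<in> carrier W \<Longrightarrow> f (pr v w) = g (pr v w)"
    and "x \<in> carrier T"
  shows "f x = g x"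
  using assms(4) by (induction rule: tensor_induct)
    (simp_all add: assms(3) clinear_add[OF assms(1)] clinear_add[OF assms(2)])

end

locale tensor_pair = V: cvec V + W: cvec W
  for V :: "(complex, 'v) module" and W :: "(complex, 'w) module"
begin

sublocale TS: tensor_setup UNIV "\<lambda>v c. c \<odot>\<^bsub>V\<^esub> v" "\<lambda>c w. c \<odot>\<^bsub>W\<^esub> w" V W
  by unfold_locales auto

lemma bil_balanced: "cbilinear V W U g \<Longrightarrow> TS.balanced g"
  using clinear_smult[OF cbilinear_left] clinear_smult[OF cbilinear_right] by fastforce

lemmas cvec_T = TS.T.cvec_axioms[folded tensor_def]
lemmas pure_closed = TS.pr_closed[folded tensor_def pure_def]
lemmas pure_bilinear = TS.pr_bilinear[folded tensor_def pure_def]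
lemmas induct = TS.tensor_induct[folded tensor_def pure_def, consumes 1, case_names pure add]
lemma lift_linear:
  "cvec U \<Longrightarrow> cbilinear V W U g \<Longrightarrow> clinear (tensor V W) U (tensor_lift U g)"
  unfolding tensor_def by (rule TS.lift_linear[OF _ _ bil_balanced])

lemma lift_pure:
  "cvec U \<Longrightarrow> cbilinear V W U g \<Longrightarrow> v \<in> carrier V \<Longrightarrow> w \<in> carrier W \<Longrightarrow>
    tensor_lift U g (pure V W v w) = g v w"
  unfolding pure_def by (rule TS.lift_pure[OF _ _ bil_balanced])

lemma lift_param:
  "cvec P \<Longrightarrow> cvec U \<Longrightarrow> (\<And>p. p \<in> carrier P \<Longrightarrow> cbilinear V W U (g p)) \<Longrightarrow>
    (\<And>v w. v \<in> carrier V \<Longrightarrow> w \<in> carrier W \<Longrightarrow> clinear P U (\<lambda>p. g p v w)) \<Longrightarrow>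
    x \<in> carrier (tensor V W) \<Longrightarrow> clinear P U (\<lambda>p. tensor_lift U (g p) x)"
  unfolding tensor_def by (rule TS.lift_param[OF _ _ _ bil_balanced])

lemmas linear_ext = TS.linear_ext[folded tensor_def pure_def]

lemmas pure_add_left = clinear_add[OF cbilinear_left[OF pure_bilinear]]
  and pure_add_right = clinear_add[OF cbilinear_right[OF pure_bilinear]]
  and pure_smult_left = clinear_smult[OF cbilinear_left[OF pure_bilinear]]
  and pure_smult_right = clinear_smult[OF cbilinear_right[OF pure_bilinear]]

lemma pure_zero_left: "w \<in> carrier W \<Longrightarrow> pure V W \<zero>\<^bsub>V\<^esub> w = \<zero>\<^bsub>tensor V W\<^esub>"
  using clinear_zero[OF V.cvec_axioms cvec_T cbilinear_left[OF pure_bilinear]] .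

lemma pure_zero_right: "v \<in> carrier V \<Longrightarrow> pure V W v \<zero>\<^bsub>W\<^esub> = \<zero>\<^bsub>tensor V W\<^esub>"
  using clinear_zero[OF W.cvec_axioms cvec_T cbilinear_right[OF pure_bilinear]] .

lemma pure_finsum_left:
  "finite I \<Longrightarrow> (\<And>i. i \<in> I \<Longrightarrow> f i \<in> carrier V) \<Longrightarrow> w \<in> carrier W \<Longrightarrow>
   pure V W (finsum V f I) w = finsum (tensor V W) (\<lambda>i. pure V W (f i) w) I"
  using clinear_finsum[OF V.cvec_axioms cvec_T cbilinear_left[OF pure_bilinear]] .

end

section \<open>Algebras\<close>

locale calg = cvec A + ring A for A :: "(complex, 'a) module" (structure) +
  assumes smult_mult_left: "a \<in> carrier A \<Longrightarrow> b \<in> carrier A \<Longrightarrow> (c \<odot> a) \<otimes> b = c \<odot> (a \<otimes> b)"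
    and smult_mult_right: "a \<in> carrier A \<Longrightarrow> b \<in> carrier A \<Longrightarrow> a \<otimes> (c \<odot> b) = c \<odot> (a \<otimes> b)"
begin

lemma mult_bilinear: "cbilinear A A A (\<lambda>a b. a \<otimes> b)"
  by (intro cbilinearI clinearI) (auto simp: l_distr r_distr smult_mult_left smult_mult_right)

lemmas mult_linear_left = cbilinear_left[OF mult_bilinear]
  and mult_linear_right = cbilinear_right[OF mult_bilinear]

lemma calg_opposite: "calg (opposite A)"
proof -
  have "cvec (opposite A)"
    by (rule cvec_restrict[OF cvec_axioms]) (auto simp: opposite_def)
  moreover have "ring (opposite A)"
    by (rule ringI) (auto simp: opposite_def l_distr r_distr m_assoc
      intro!: abelian_groupI monoidI add.m_comm add.m_assoc dest: l_neg)
  ultimately show ?thesis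
    by (intro calg.intro calg_axioms.intro) (auto simp: opposite_def smult_mult_left smult_mult_right)
qed

end

lemma tensor_alg_simps [simp]:
  "carrier (tensor_alg V W) = carrier (tensor V W)" "zero (tensor_alg V W) = zero (tensor V W)"
  "add (tensor_alg V W) = add (tensor V W)" "smult (tensor_alg V W) = smult (tensor V W)"
  "one (tensor_alg V W) = pure V W \<one>\<^bsub>V\<^esub> \<one>\<^bsub>W\<^esub>"
  by (simp_all add: tensor_alg_def)

lemma opposite_simps [simp]:
  "carrier (opposite A) = carrier A" "zero (opposite A) = zero A" "one (opposite A) = one A"
  "add (opposite A) = add A" "smult (opposite A) = smult A"
  "a \<otimes>\<^bsub>opposite A\<^esub> b = b \<otimes>\<^bsub>A\<^esub> a"
  by (simp_all add: opposite_def)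

lemma tensor_opposite [simp]: "tensor V (opposite W) = tensor V W" "pure V (opposite W) = pure V W"
  by (simp_all add: tensor_def tensor_over_def pure_def pure_over_def tensor_relations_def fun_eq_iff)

locale calg_pair = A: calg A + B: calg B
  for A :: "(complex, 'a) module" and B :: "(complex, 'b) module"
begin

sublocale tensor_pair A B ..

definition "inner v w = tensor_lift (tensor A B) (\<lambda>v' w'. pure A B (v \<otimes>\<^bsub>A\<^esub> v') (w \<otimes>\<^bsub>B\<^esub> w'))"

lemma inner_bilinear:
  "v \<in> carrier A \<Longrightarrow> w \<in> carrier B \<Longrightarrow>
    cbilinear A B (tensor A B) (\<lambda>v' w'. pure A B (v \<otimes>\<^bsub>A\<^esub> v') (w \<otimes>\<^bsub>B\<^esub> w'))"
  "v' \<in> carrier A \<Longrightarrow> w' \<in> carrier B \<Longrightarrow>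
    cbilinear A B (tensor A B) (\<lambda>v w. pure A B (v \<otimes>\<^bsub>A\<^esub> v') (w \<otimes>\<^bsub>B\<^esub> w'))"
  by (intro cbilinearI; rule clinear_compose, rule A.mult_linear_right B.mult_linear_right
      A.mult_linear_left B.mult_linear_left, assumption,
      rule cbilinear_left[OF pure_bilinear] cbilinear_right[OF pure_bilinear], simp)+

lemma inner_linear:
  "v \<in> carrier A \<Longrightarrow> w \<in> carrier B \<Longrightarrow> clinear (tensor A B) (tensor A B) (inner v w)"
  unfolding inner_def by (rule lift_linear[OF cvec_T inner_bilinear(1)])

lemma inner_param: "Y \<in> carrier (tensor A B) \<Longrightarrow> cbilinear A B (tensor A B) (\<lambda>v w. inner v w Y)"
  unfolding inner_def
  by (intro cbilinearI)
    (rule lift_param[OF _ cvec_T], rule A.cvec_axioms B.cvec_axioms, rule inner_bilinear, assumption+,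
     rule cbilinear_left[OF inner_bilinear(2)] cbilinear_right[OF inner_bilinear(2)], assumption+)+

lemma tensor_mult_def:
  "X \<otimes>\<^bsub>tensor_alg A B\<^esub> Y = tensor_lift (tensor A B) (\<lambda>v w. inner v w Y) X"
  by (simp add: tensor_alg_def inner_def)

lemma tensor_mult_bilinear:
  "cbilinear (tensor A B) (tensor A B) (tensor A B) (\<lambda>X Y. X \<otimes>\<^bsub>tensor_alg A B\<^esub> Y)"
  unfolding tensor_mult_def
  by (intro cbilinearI, rule lift_param[OF cvec_T cvec_T inner_param],
      assumption, rule inner_linear, assumption+, rule lift_linear[OF cvec_T inner_param])

lemma pure_mult:
  assumes "a \<in> carrier A" "a' \<in> carrier A" "b \<in> carrier B" "b' \<in> carrier B"
  shows "pure A B a b \<otimes>\<^bsub>tensor_alg A B\<^esub> pure A B a' b' = pure A B (a \<otimes>\<^bsub>A\<^esub> a') (b \<otimes>\<^bsub>B\<^esub> b')"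
  using assms unfolding tensor_mult_def
  by (simp add: lift_pure[OF cvec_T inner_param] pure_closed)
    (simp add: inner_def lift_pure[OF cvec_T inner_bilinear(1)])

end

lemma laurent_simps [simp]:
  "carrier laurent = UNIV" "zero laurent = 0" "one laurent = 1"
  "add laurent = (+)" "mult laurent = (*)" "smult laurent = fscale"
  by (simp_all add: laurent_def)

lemma fscale_mult: "fscale c (f :: 'x::monoid_add \<Rightarrow>\<^sub>0 complex) = Poly_Mapping.single 0 c * f"
  by (simp add: fscale_def mult_map_scale_conv_mult)

lemma fscale_mult_left: "fscale c (f :: 'x::monoid_add \<Rightarrow>\<^sub>0 complex) * g = fscale c (f * g)"
  by (simp add: fscale_mult mult.assoc)

lemma fscale_mult_right: "(f :: 'x::monoid_add \<Rightarrow>\<^sub>0 complex) * fscale c g = fscale c (f * g)"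
proof -
  \<comment> \<open>The exponent monoid need not be commutative (words, for instance), but 0 is
    neutral on both sides, so constants are central.\<close>
  have comm: "f * Poly_Mapping.single 0 c = Poly_Mapping.single 0 c * f"
  proof -
    have "(\<Sum>x\<in>S. Poly_Mapping.single x (h x)) * Poly_Mapping.single 0 c =
        Poly_Mapping.single 0 c * (\<Sum>x\<in>S. Poly_Mapping.single x (h x))" for S :: "'x set" and h
      by (simp add: sum_distrib_left sum_distrib_right mult_single mult.commute)
    from this[of "Poly_Mapping.lookup f" "Poly_Mapping.keys f"] show ?thesis
      by (simp only: sum_single_lookup)
  qed
  show ?thesis unfolding fscale_mult by (simp add: comm flip: mult.assoc)
qed

lemma calg_laurent: "calg laurent"
proof -
  have "abelian_group laurent"
    by (rule abelian_groupI) (auto simp: add_ac intro: exI[of _ "- x" for x] ab_left_minus)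
  moreover have "ring laurent"
    by (rule ringI) (use \<open>abelian_group laurent\<close> in \<open>auto intro!: monoidI simp: algebra_simps\<close>)
  ultimately show ?thesis
    by (intro calg.intro calg_axioms.intro cvec.intro cvec_axioms.intro)
      (auto simp: fvs.scale_left_distrib fvs.scale_right_distrib fscale_mult_left fscale_mult_right)
qed

lemma coefficient_bilinear:
  assumes "cvec V" shows "cbilinear V laurent V (\<lambda>a h. Poly_Mapping.lookup h k \<odot>\<^bsub>V\<^esub> a)"
proof -
  interpret cvec V by fact
  show ?thesis
    by (intro cbilinearI clinearI)
      (auto simp: smult_add_right smult_add_left smult_smult lookup_add mult.commute)
qed

text \<open>A linear map out of the Laurent polynomials may be prescribed freely on the powers of u.
  This allows definitions by one formula per degree, as for \<open>\<theta>\<close> and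
  \<open>F_of\<close>.\<close>

lemma lsum_bilinear:
  assumes "cvec V" "cvec U" "\<And>k. clinear V U (G k)"
  shows "cbilinear V laurent U (\<lambda>a h. lsum U (\<lambda>k. G k a) h)"
proof -
  interpret U: cvec U by fact
  have c: "G k a \<in> carrier U" if "a \<in> carrier V" for k a using clinear_closed[OF assms(3)] that .
  have s: "clinear U U (\<lambda>x. c \<odot>\<^bsub>U\<^esub> x)" for c by (rule U.clinear_scale)
  have "clinear laurent U (lsum U (\<lambda>k. G k a))" if "a \<in> carrier V" for a
    by (rule clinearI) (use c[OF that] in \<open>auto simp: U.lsum_add[of UNIV] U.lsum_fscale intro: U.lsum_closed\<close>)
  moreover have "clinear V U (\<lambda>a. lsum U (\<lambda>k. G k a) h)" for h
    unfolding lsum_def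
    by (rule clinear_finsum_maps[OF assms(1,2)]) (auto intro: clinear_compose[OF assms(3) s])
  ultimately show ?thesis by (simp add: cbilinear_def)
qed

section \<open>Strongly graded algebras\<close>

abbreviation upow :: "int \<Rightarrow> int \<Rightarrow>\<^sub>0 complex" where "upow k \<equiv> Poly_Mapping.single k 1"

definition homog ::
    "(complex, 'a) module \<Rightarrow> ('a \<Rightarrow> ('a \<times> (int \<Rightarrow>\<^sub>0 complex) \<Rightarrow>\<^sub>0 complex) set) \<Rightarrow> int \<Rightarrow> 'a set"
  where "homog A \<rho> k = {a \<in> carrier A. \<rho> a = pure A laurent a (upow k)}"

text \<open>A coaction of the Laurent polynomials is a grading by the integers.
  \<open>homog_induct0\<close> says that the homogeneous elements generate A additively; the
  families \<open>x k\<close> and \<open>y k\<close> witness that 1 lies in the product of the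
  components of degrees -k and k, which is the graded form of the Hopf-Galois condition.\<close>

locale strongly_graded = A: calg A
  for A :: "(complex, 'a) module" (structure)
    and \<rho> :: "'a \<Rightarrow> ('a \<times> (int \<Rightarrow>\<^sub>0 complex) \<Rightarrow>\<^sub>0 complex) set" +
  fixes N :: "int \<Rightarrow> nat" and x y :: "int \<Rightarrow> nat \<Rightarrow> 'a"
  assumes rho_linear: "clinear A (tensor A laurent) \<rho>"
    and homog_one: "\<one> \<in> homog A \<rho> 0"
    and homog_mult: "a \<in> homog A \<rho> k \<Longrightarrow> b \<in> homog A \<rho> l \<Longrightarrow> a \<otimes> b \<in> homog A \<rho> (k + l)"
    and homog_induct0: "\<And>Q a. a \<in> carrier A \<Longrightarrow> (\<And>k a. a \<in> homog A \<rho> k \<Longrightarrow> Q a) \<Longrightarrow>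
      (\<And>a b. a \<in> carrier A \<Longrightarrow> b \<in> carrier A \<Longrightarrow> Q a \<Longrightarrow> Q b \<Longrightarrow> Q (a \<oplus> b)) \<Longrightarrow> Q a"
    and x_homog: "i < N k \<Longrightarrow> x k i \<in> homog A \<rho> (- k)"
    and y_homog: "i < N k \<Longrightarrow> y k i \<in> homog A \<rho> k"
    and sum_xy: "(\<Oplus>i\<in>{..<N k}. x k i \<otimes> y k i) = \<one>"
begin

abbreviation "hm k \<equiv> homog A \<rho> k"
abbreviation "H \<equiv> (laurent :: (complex, int \<Rightarrow>\<^sub>0 complex) module)"
abbreviation "TA \<equiv> tensor A H"

sublocale H: calg H by (rule calg_laurent)
sublocale AH: tensor_pair A H ..
sublocale AA: calg_pair A "opposite A" using A.calg_opposite by (intro calg_pair.intro A.calg_axioms)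
sublocale A2: tensor_pair A A ..
sublocale TA: cvec TA by (rule AH.cvec_T)

lemmas homog_induct = homog_induct0[consumes 1, case_names homog add]

lemma hom_closed: "a \<in> hm k \<Longrightarrow> a \<in> carrier A"
  by (simp add: homog_def)

lemma rho_hom: "a \<in> hm k \<Longrightarrow> \<rho> a = pure A H a (upow k)"
  by (simp add: homog_def)

lemma hom_add: "a \<in> hm k \<Longrightarrow> b \<in> hm k \<Longrightarrow> a \<oplus> b \<in> hm k"
  by (auto simp: homog_def clinear_add[OF rho_linear] AH.pure_add_left)

lemma hom_smult: "a \<in> hm k \<Longrightarrow> c \<odot> a \<in> hm k"
  by (auto simp: homog_def clinear_smult[OF rho_linear] AH.pure_smult_left)

lemma hom_zero: "\<zero> \<in> hm k"
  using clinear_zero[OF A.cvec_axioms TA.cvec_axioms rho_linear] by (simp add: homog_def AH.pure_zero_left)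

declare hom_closed [simp, intro]

lemma hom_finsum: "finite I \<Longrightarrow> (\<And>i. i \<in> I \<Longrightarrow> f i \<in> hm k) \<Longrightarrow> finsum A f I \<in> hm k"
proof (induction I rule: finite_induct)
  case (insert i I)
  then have "f \<in> I \<rightarrow> carrier A" "f i \<in> carrier A" using hom_closed by blast+
  then show ?case using insert by (simp add: hom_add)
qed (simp add: hom_zero)

lemma x_closed [simp]: "i < N k \<Longrightarrow> x k i \<in> carrier A"
  and y_closed [simp]: "i < N k \<Longrightarrow> y k i \<in> carrier A"
  using x_homog y_homog by blast+

lemma hom_mult': "a \<in> hm k \<Longrightarrow> b \<in> hm l \<Longrightarrow> m = k + l \<Longrightarrow> a \<otimes> b \<in> hm m"
  using homog_mult by simp

lemma sum_axy:
  assumes "a \<in> carrier A"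
  shows "(\<Oplus>i\<in>{..<N k}. a \<otimes> x k i \<otimes> y k i) = a"
proof -
  have "a = a \<otimes> (\<Oplus>i\<in>{..<N k}. x k i \<otimes> y k i)" using assms by (simp add: sum_xy)
  also have "\<dots> = (\<Oplus>i\<in>{..<N k}. a \<otimes> (x k i \<otimes> y k i))"
    by (rule clinear_finsum[OF A.cvec_axioms A.cvec_axioms A.mult_linear_right[OF assms]]) auto
  also have "\<dots> = (\<Oplus>i\<in>{..<N k}. a \<otimes> x k i \<otimes> y k i)"
    by (rule A.finsum_cong') (auto simp: A.m_assoc assms)
  finally show ?thesis by simp
qed

text \<open>No single \<open>x k i\<close> is assumed to be cancellable; the whole family is,
  because multiplying by the \<open>y k i\<close> and summing restores the other factor.\<close>

lemma cancel_x:
  assumes "u \<in> carrier A" "v \<in> carrier A" "\<And>i. i < N k \<Longrightarrow> u \<otimes> x k i = v \<otimes> x k i"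
  shows "u = v"
proof -
  have "(\<Oplus>i\<in>{..<N k}. u \<otimes> x k i \<otimes> y k i) = (\<Oplus>i\<in>{..<N k}. v \<otimes> x k i \<otimes> y k i)"
    by (rule A.finsum_cong') (auto simp: assms)
  then show ?thesis using sum_axy assms by simp
qed

section \<open>The canonical map and its inverse\<close>

abbreviation "B \<equiv> coinvariants A H \<rho>"

lemma coinvariants_simps [simp]:
  "carrier B = hm 0" "zero B = \<zero>" "add B = add A" "smult B = smult A" "mult B = mult A" "one B = \<one>"
  by (simp_all add: coinvariants_def homog_def del: hom_closed)

lemma cvec_B: "cvec B"
  by (rule cvec_restrict[OF A.cvec_axioms]) (auto simp: hom_add hom_smult hom_zero)

sublocale TB: tensor_setup "hm 0" "\<lambda>a b. a \<otimes> b" "\<lambda>b a. b \<otimes> a" A A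
  by unfold_locales auto

abbreviation "T\<^sub>B \<equiv> tensor_B A H \<rho>"

lemma T\<^sub>B_eq: "T\<^sub>B = TB.T"
  by (simp add: tensor_B_def)

lemma chi_inner:
  "a \<in> carrier A \<Longrightarrow> cbilinear A H TA (\<lambda>b h. pure A H (a \<otimes> b) h)"
  "b \<in> carrier A \<Longrightarrow> clinear A TA (\<lambda>a. pure A H (a \<otimes> b) h)"
  by (intro cbilinearI) (auto intro!: clinear_compose[OF A.mult_linear_right] clinear_compose[OF A.mult_linear_left]
    cbilinear_left[OF AH.pure_bilinear] cbilinear_right[OF AH.pure_bilinear])

abbreviation "chi_lift a a' \<equiv> tensor_lift TA (\<lambda>a'0 a'1. pure A H (a \<otimes> a'0) a'1) (\<rho> a')"

lemma chi_lift_hom: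
  assumes "a \<in> carrier A" "a' \<in> hm k"
  shows "chi_lift a a' = pure A H (a \<otimes> a') (upow k)"
  using AH.lift_pure[OF AH.cvec_T chi_inner(1)[OF assms(1)]] assms by (simp add: rho_hom hom_closed)

lemma chi_lift_bilinear: "cbilinear A A TA chi_lift"
proof (rule cbilinearI)
  fix a assume a: "a \<in> carrier A"
  then show "clinear A TA (chi_lift a)"
    by (intro clinear_compose[OF rho_linear AH.lift_linear] AH.cvec_T chi_inner)
next
  fix a' assume "a' \<in> carrier A"
  then show "clinear A TA (\<lambda>a. chi_lift a a')"
    by (intro AH.lift_param A.cvec_axioms AH.cvec_T chi_inner) (auto intro: clinear_closed[OF rho_linear])
qed

lemma chi_lift_balanced: "TB.balanced chi_lift"
proof (intro ballI)
  fix b a a' assume b: "b \<in> hm 0" and a: "a \<in> carrier A" and a': "a' \<in> carrier A"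
  show "chi_lift (a \<otimes> b) a' = chi_lift a (b \<otimes> a')" using a'
  proof (induction rule: homog_induct)
    case (homog k a')
    moreover have "b \<otimes> a' \<in> hm k" using homog_mult[OF b homog] by simp
    ultimately show ?case using a b by (simp add: chi_lift_hom A.m_assoc hom_closed)
  next
    case (add u v)
    then show ?case using a b
      by (simp add: clinear_add[OF cbilinear_right[OF chi_lift_bilinear]] A.r_distr hom_closed)
  qed
qed

abbreviation "\<chi> \<equiv> canonical_map A H \<rho>"

lemma chi_linear: "clinear T\<^sub>B TA \<chi>"
  unfolding T\<^sub>B_eq canonical_map_def by (rule TB.lift_linear[OF AH.cvec_T chi_lift_bilinear chi_lift_balanced])

lemma chi_pr:
  assumes "a \<in> carrier A" "a' \<in> hm k" shows "\<chi> (TB.pr a a') = pure A H (a \<otimes> a') (upow k)"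
  using assms unfolding canonical_map_def
  by (subst TB.lift_pure[OF AH.cvec_T chi_lift_bilinear chi_lift_balanced]) (auto simp: chi_lift_hom)

text \<open>The inverse of the canonical map: a \<otimes> u^k goes to the sum of the a x_i \<otimes>
  y_i over the base, with the families belonging to k.\<close>

definition "\<theta> = tensor_lift T\<^sub>B (\<lambda>a h. lsum T\<^sub>B (\<lambda>k. \<Oplus>\<^bsub>T\<^sub>B\<^esub>i\<in>{..<N k}. TB.pr (a \<otimes> x k i) (y k i)) h)"

lemma cvec_T\<^sub>B: "cvec T\<^sub>B" by (simp add: T\<^sub>B_eq TB.T.cvec_axioms)

lemma theta_bilinear:
  "cbilinear A H T\<^sub>B (\<lambda>a h. lsum T\<^sub>B (\<lambda>k. \<Oplus>\<^bsub>T\<^sub>B\<^esub>i\<in>{..<N k}. TB.pr (a \<otimes> x k i) (y k i)) h)"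
  by (intro lsum_bilinear A.cvec_axioms cvec_T\<^sub>B clinear_finsum_maps)
    (auto simp: T\<^sub>B_eq intro!: clinear_compose[OF A.mult_linear_left cbilinear_left[OF TB.pr_bilinear]])

lemma theta_linear: "clinear TA T\<^sub>B \<theta>"
  unfolding \<theta>_def by (rule AH.lift_linear[OF cvec_T\<^sub>B theta_bilinear])

lemma theta_pure:
  assumes "a \<in> carrier A"
  shows "\<theta> (pure A H a (upow k)) = (\<Oplus>\<^bsub>T\<^sub>B\<^esub>i\<in>{..<N k}. TB.pr (a \<otimes> x k i) (y k i))"
proof -
  interpret U: cvec "T\<^sub>B" by (rule cvec_T\<^sub>B)
  have c: "(\<Oplus>\<^bsub>T\<^sub>B\<^esub>i\<in>{..<N k}. TB.pr (a \<otimes> x k i) (y k i)) \<in> carrier T\<^sub>B"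
    using assms by (intro U.finsum_closed) (auto simp: T\<^sub>B_eq)
  then show ?thesis unfolding \<theta>_def
    by (subst AH.lift_pure[OF cvec_T\<^sub>B theta_bilinear]) (simp_all add: assms)
qed

lemma H_decompose:
  assumes "cvec U" "clinear H U f" "clinear H U g" "\<And>k. f (upow k) = g (upow k)"
  shows "f h = g h"
proof -
  interpret U: cvec U by fact
  have s: "fscale (Poly_Mapping.lookup h k) (upow k) = Poly_Mapping.single k (Poly_Mapping.lookup h k)" for k
    by (rule poly_mapping_eqI) (auto simp: lookup_single when_def)
  have fs: "finsum H F S = sum F S" for F :: "int \<Rightarrow> int \<Rightarrow>\<^sub>0 complex" and S
    by (induction S rule: infinite_finite_induct) simp_all
  have *: "f' h = (\<Oplus>\<^bsub>U\<^esub>k\<in>Poly_Mapping.keys h. Poly_Mapping.lookup h k \<odot>\<^bsub>U\<^esub> f' (upow k))"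
    if "clinear H U f'" for f'
  proof -
    have "f' (finsum H (\<lambda>k. Poly_Mapping.single k (Poly_Mapping.lookup h k)) (Poly_Mapping.keys h))
        = (\<Oplus>\<^bsub>U\<^esub>k\<in>Poly_Mapping.keys h. f' (Poly_Mapping.single k (Poly_Mapping.lookup h k)))"
      by (rule clinear_finsum[OF H.cvec_axioms assms(1) that]) auto
    moreover have "f' (Poly_Mapping.single k (Poly_Mapping.lookup h k)) =
        Poly_Mapping.lookup h k \<odot>\<^bsub>U\<^esub> f' (upow k)" for k
      using clinear_smult[OF that, of "upow k" "Poly_Mapping.lookup h k"] by (simp add: s)
    ultimately show ?thesis by (simp add: fs sum_single_lookup)
  qed
  show ?thesis by (subst *[OF assms(2)], subst *[OF assms(3)]) (simp add: assms(4))
qed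

lemma chi_theta:
  assumes "t \<in> carrier TA" shows "\<chi> (\<theta> t) = t"
proof (rule AH.linear_ext[OF _ clinear_id _ assms])
  show l: "clinear TA TA (\<lambda>t. \<chi> (\<theta> t))" by (rule clinear_compose[OF theta_linear chi_linear])
  interpret U: cvec "T\<^sub>B" by (rule cvec_T\<^sub>B)
  fix a h assume a: "a \<in> carrier A"
  show "\<chi> (\<theta> (pure A H a h)) = pure A H a h"
  proof (rule H_decompose[OF AH.cvec_T])
    show "clinear H TA (\<lambda>h. \<chi> (\<theta> (pure A H a h)))"
      by (rule clinear_compose[OF cbilinear_right[OF AH.pure_bilinear a] l])
    show "clinear H TA (pure A H a)" by (rule cbilinear_right[OF AH.pure_bilinear a])
    fix k
    have "\<chi> (\<theta> (pure A H a (upow k))) = (\<Oplus>\<^bsub>TA\<^esub>i\<in>{..<N k}. \<chi> (TB.pr (a \<otimes> x k i) (y k i)))"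
      unfolding theta_pure[OF a]
      by (rule clinear_finsum[OF cvec_T\<^sub>B AH.cvec_T chi_linear]) (use a in \<open>auto simp: T\<^sub>B_eq\<close>)
    also have "\<dots> = (\<Oplus>\<^bsub>TA\<^esub>i\<in>{..<N k}. pure A H (a \<otimes> x k i \<otimes> y k i) (upow k))"
      by (rule TA.finsum_cong') (use a in \<open>auto simp: chi_pr[OF _ y_homog] intro!: AH.pure_closed\<close>)
    also have "\<dots> = pure A H a (upow k)"
      using a by (subst AH.pure_finsum_left[symmetric]) (auto simp: sum_axy)
    finally show "\<chi> (\<theta> (pure A H a (upow k))) = pure A H a (upow k)" .
  qed
qed

lemma theta_chi:
  assumes "t \<in> carrier T\<^sub>B" shows "\<theta> (\<chi> t) = t"
proof (rule TB.linear_ext[OF _ clinear_id])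
  show l: "clinear TB.T TB.T (\<lambda>t. \<theta> (\<chi> t))"
    using clinear_compose[OF chi_linear theta_linear] by (simp add: T\<^sub>B_eq)
  show "t \<in> carrier TB.T" using assms by (simp add: T\<^sub>B_eq)
  fix a a' assume a: "a \<in> carrier A" and a': "a' \<in> carrier A"
  from a' show "\<theta> (\<chi> (TB.pr a a')) = TB.pr a a'"
  proof (induction a' rule: homog_induct)
    case (homog k a')
    have "\<theta> (\<chi> (TB.pr a a')) = (\<Oplus>\<^bsub>T\<^sub>B\<^esub>i\<in>{..<N k}. TB.pr (a \<otimes> a' \<otimes> x k i) (y k i))"
      using a homog by (simp add: chi_pr theta_pure hom_closed)
    also have "\<dots> = (\<Oplus>\<^bsub>T\<^sub>B\<^esub>i\<in>{..<N k}. TB.pr a (a' \<otimes> x k i \<otimes> y k i))"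
    proof (rule abelian_monoid.finsum_cong')
      fix i assume i: "i \<in> {..<N k}"
      \<comment> \<open>The factor a' x_i has degree 0, so it lies in the base and may cross the
        tensor sign.\<close>
      then have "a' \<otimes> x k i \<in> hm 0" using homog_mult[OF homog x_homog[of i k]] by simp
      then show "TB.pr (a \<otimes> a' \<otimes> x k i) (y k i) = TB.pr a (a' \<otimes> x k i \<otimes> y k i)"
        using TB.pr_balanced[of "a' \<otimes> x k i" a "y k i"] a homog i by (simp add: A.m_assoc hom_closed)
    qed (use a homog cvec_T\<^sub>B in \<open>auto simp: T\<^sub>B_eq TB.T.abelian_monoid_axioms\<close>)
    also have "\<dots> = TB.pr a (\<Oplus>i\<in>{..<N k}. a' \<otimes> x k i \<otimes> y k i)"
      unfolding T\<^sub>B_eq using homog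
      by (intro clinear_finsum[symmetric, OF A.cvec_axioms TB.T.cvec_axioms cbilinear_right[OF TB.pr_bilinear a]])
        auto
    finally show ?case using homog by (simp add: sum_axy hom_closed)
  next
    case (add u v)
    then show ?case
      using clinear_add[OF clinear_compose[OF cbilinear_right[OF TB.pr_bilinear a] l], of u v]
        clinear_add[OF cbilinear_right[OF TB.pr_bilinear a], of u v] by simp
  qed
qed

text \<open>The choice in \<open>inv_into\<close> is forced: \<open>theta_chi\<close> makes the
  canonical map injective, and \<open>chi_theta\<close> provides the preimage.\<close>

lemma translation_eq: "translation_map A H \<rho> h = \<theta> (pure A H \<one> h)"
proof -
  have t: "pure A H \<one> h \<in> carrier TA" by (intro AH.pure_closed) auto
  have "inv_into (carrier T\<^sub>B) \<chi> (\<chi> (\<theta> (pure A H \<one> h))) = \<theta> (pure A H \<one> h)"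
    by (rule inv_into_f_f[OF inj_on_inverseI[where g = \<theta>]])
      (simp_all add: theta_chi clinear_closed[OF theta_linear t])
  then show ?thesis by (simp add: translation_map_def chi_theta[OF t])
qed

lemma translation_linear: "clinear H T\<^sub>B (translation_map A H \<rho>)"
  unfolding translation_eq[abs_def]
  by (rule clinear_compose[OF cbilinear_right[OF AH.pure_bilinear] theta_linear]) auto

lemma translation_upow: "translation_map A H \<rho> (upow k) = (\<Oplus>\<^bsub>T\<^sub>B\<^esub>i\<in>{..<N k}. TB.pr (x k i) (y k i))"
  unfolding translation_eq theta_pure[OF A.one_closed] T\<^sub>B_eq
  by (rule TB.T.finsum_cong') auto

end

lemma clinear_subspace:
  assumes "clinear V W f" "carrier V' \<subseteq> carrier V" "add V' = add V" "smult V' = smult V"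
  shows "clinear V' W f"
  using assms by (auto simp: clinear_def subset_iff)

section \<open>The Ehresmann--Schauenburg bialgebroid of a strongly graded algebra\<close>

context strongly_graded begin

abbreviation "E \<equiv> tensor_alg A (opposite A)"
abbreviation "AxA \<equiv> tensor A A"
abbreviation "pA \<equiv> pure A A"
abbreviation "TH \<equiv> tensor AxA H"
abbreviation "C \<equiv> ES_total A H \<rho>"
abbreviation "D \<equiv> diagonal_coaction A H \<rho>"

sublocale AxA: cvec AxA by (rule A2.cvec_T)
sublocale EH: tensor_pair AxA H ..
sublocale TH: cvec TH by (rule EH.cvec_T)

lemma cvec_E: "cvec E"
  by (rule cvec_restrict[OF AxA.cvec_axioms]) auto

section \<open>The diagonal coaction and its coinvariants\<close>

lemma D_inner1:
  "a0 \<in> carrier A \<Longrightarrow> cbilinear A H TH (\<lambda>b0 b1. pure AxA H (pA a0 b0) (a1 * b1))"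
  "b0 \<in> carrier A \<Longrightarrow> cbilinear A H TH (\<lambda>a0 a1. pure AxA H (pA a0 b0) (a1 * b1))"
proof -
  have "clinear H H (\<lambda>b1. a1 * b1)" "clinear H H (\<lambda>a1. a1 * b1)" for a1 b1 :: "int \<Rightarrow>\<^sub>0 complex"
    using H.mult_linear_left H.mult_linear_right by simp_all
  then show "a0 \<in> carrier A \<Longrightarrow> cbilinear A H TH (\<lambda>b0 b1. pure AxA H (pA a0 b0) (a1 * b1))"
    "b0 \<in> carrier A \<Longrightarrow> cbilinear A H TH (\<lambda>a0 a1. pure AxA H (pA a0 b0) (a1 * b1))"
    by (intro cbilinearI; intro clinear_compose[OF _ cbilinear_right[OF EH.pure_bilinear]]
      clinear_compose[OF _ cbilinear_left[OF EH.pure_bilinear]]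
      cbilinear_left[OF A2.pure_bilinear] cbilinear_right[OF A2.pure_bilinear] A2.pure_closed; simp)+
qed

abbreviation "D2 b a0 a1 \<equiv> tensor_lift TH (\<lambda>b0 b1. pure AxA H (pA a0 b0) (a1 * b1)) (\<rho> b)"
abbreviation "D1 a b \<equiv> tensor_lift TH (D2 b) (\<rho> a)"

lemma rho_closed: "a \<in> carrier A \<Longrightarrow> \<rho> a \<in> carrier TA"
  by (rule clinear_closed[OF rho_linear])

lemma D2_bilinear: "b \<in> carrier A \<Longrightarrow> cbilinear A H TH (D2 b)"
  by (intro cbilinearI; rule AH.lift_param)
    (auto intro!: D_inner1 rho_closed EH.cvec_T A.cvec_axioms H.cvec_axioms
      intro: cbilinear_left[OF D_inner1(2)] cbilinear_right[OF D_inner1(2)])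

lemma D2_linear: "a0 \<in> carrier A \<Longrightarrow> clinear A TH (\<lambda>b. D2 b a0 a1)"
  by (intro clinear_compose[OF rho_linear AH.lift_linear] EH.cvec_T D_inner1)

lemma D1_bilinear: "cbilinear A A TH D1"
  by (intro cbilinearI AH.lift_param clinear_compose[OF rho_linear AH.lift_linear] D2_bilinear D2_linear
      EH.cvec_T A.cvec_axioms rho_closed)

lemma D_def: "D = tensor_lift TH D1"
  by (simp add: diagonal_coaction_def Let_def fun_eq_iff)

lemma D_linear: "clinear AxA TH D"
  unfolding D_def by (rule A2.lift_linear[OF EH.cvec_T D1_bilinear])

lemma D_pure:
  assumes "a \<in> hm k" "b \<in> hm l"
  shows "D (pA a b) = pure AxA H (pA a b) (upow (k + l))"
proof -
  have c: "a \<in> carrier A" "b \<in> carrier A" using assms by auto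
  have "D (pA a b) = D2 b a (upow k)"
    unfolding D_def using c
    by (simp add: A2.lift_pure[OF EH.cvec_T D1_bilinear] rho_hom[OF assms(1)]
        AH.lift_pure[OF EH.cvec_T D2_bilinear])
  also have "\<dots> = pure AxA H (pA a b) (upow (k + l))"
    using c by (simp add: rho_hom[OF assms(2)] AH.lift_pure[OF EH.cvec_T D_inner1(1)] mult_single)
  finally show ?thesis .
qed

text \<open>The projection of \<open>A \<otimes> A\<close> onto the coinvariants of the diagonal coaction.\<close>

definition "P X = tensor_lift AxA (\<lambda>z h. Poly_Mapping.lookup h 0 \<odot>\<^bsub>AxA\<^esub> z) (D X)"

lemma P_linear: "clinear AxA AxA P"
  unfolding P_def[abs_def]
  by (rule clinear_compose[OF D_linear EH.lift_linear[OF AxA.cvec_axioms coefficient_bilinear[OF AxA.cvec_axioms]]])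

lemma P_pure:
  assumes "a \<in> hm k" "b \<in> hm l"
  shows "P (pA a b) = (if k + l = 0 then pA a b else \<zero>\<^bsub>AxA\<^esub>)"
proof -
  have c: "pA a b \<in> carrier AxA" using assms A2.pure_closed by blast
  show ?thesis unfolding P_def D_pure[OF assms]
    by (subst EH.lift_pure[OF AxA.cvec_axioms coefficient_bilinear[OF AxA.cvec_axioms] c])
      (auto simp: lookup_single c)
qed

lemma C_simps [simp]: "zero C = zero AxA" "add C = add AxA" "smult C = smult AxA" "mult C = mult E"
    "one C = pA \<one> \<one>"
  by (simp_all add: ES_total_def)

lemma carrier_C: "carrier C = {X \<in> carrier AxA. D X = pure AxA H X 1}"
  by (simp add: ES_total_def)

lemma C_closed: "X \<in> carrier C \<Longrightarrow> X \<in> carrier AxA"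
  by (simp add: carrier_C)

lemma C_add: "X \<in> carrier C \<Longrightarrow> Y \<in> carrier C \<Longrightarrow> X \<oplus>\<^bsub>AxA\<^esub> Y \<in> carrier C"
  by (simp add: carrier_C clinear_add[OF D_linear] EH.pure_add_left)

lemma C_smult: "X \<in> carrier C \<Longrightarrow> c \<odot>\<^bsub>AxA\<^esub> X \<in> carrier C"
  by (simp add: carrier_C clinear_smult[OF D_linear] EH.pure_smult_left)

lemma C_zero: "\<zero>\<^bsub>AxA\<^esub> \<in> carrier C"
  using clinear_zero[OF AxA.cvec_axioms TH.cvec_axioms D_linear] by (simp add: carrier_C EH.pure_zero_left)

lemma C_pure: "a \<in> hm k \<Longrightarrow> b \<in> hm (- k) \<Longrightarrow> pA a b \<in> carrier C"
  using D_pure[of a k b "-k"] by (auto simp: carrier_C intro!: A2.pure_closed)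

lemma cvec_C: "cvec C"
  by (rule cvec_restrict[OF AxA.cvec_axioms]) (auto simp: C_closed C_add C_smult C_zero)

sublocale C: cvec C by (rule cvec_C)

lemma AxA_homog_induct [consumes 1, case_names pure add]:
  assumes "X \<in> carrier AxA"
    and pure: "\<And>k l a b. a \<in> hm k \<Longrightarrow> b \<in> hm l \<Longrightarrow> Q (pA a b)"
    and add: "\<And>X Y. X \<in> carrier AxA \<Longrightarrow> Y \<in> carrier AxA \<Longrightarrow> Q X \<Longrightarrow> Q Y \<Longrightarrow> Q (X \<oplus>\<^bsub>AxA\<^esub> Y)"
  shows "Q X"
  using assms(1)
proof (induction rule: A2.induct)
  case (pure a b)
  from pure(1) show ?case
  proof (induction rule: homog_induct)
    case (homog k a)
    note a = this
    from pure(2) show ?case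
    proof (induction rule: homog_induct)
      case (homog l b) then show ?case using a assms(2) by blast
    next
      case (add u v)
      then show ?case using a assms(3) by (auto simp: A2.pure_add_right intro!: A2.pure_closed)
    qed
  next
    case (add u v)
    then show ?case using pure(2) assms(3) by (auto simp: A2.pure_add_left intro!: A2.pure_closed)
  qed
qed (use assms(3) in auto)

lemma P_C: "X \<in> carrier C \<Longrightarrow> P X = X"
  unfolding P_def carrier_C
  by (auto simp: EH.lift_pure[OF AxA.cvec_axioms coefficient_bilinear[OF AxA.cvec_axioms]])

lemma P_closed: "X \<in> carrier AxA \<Longrightarrow> P X \<in> carrier C"
proof (induction rule: AxA_homog_induct)
  case (pure k l a b)
  show ?case
  proof (cases "k + l = 0")
    case True
    then have "l = - k" by simp
    then show ?thesis using pure C_pure P_pure[of a k b l] by simp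
  qed (use pure C_zero in \<open>simp add: P_pure\<close>)
qed (simp add: clinear_add[OF P_linear] C_add)

text \<open>The pure summands of a coinvariant tensor need not be coinvariant. The induction
  therefore runs over A \<otimes> A with the property \<open>Q (P X)\<close>: the projection keeps
  summands of total degree 0 and sends the others to 0.\<close>

lemma C_induct [consumes 1, case_names pure add]:
  assumes "X \<in> carrier C"
    and pure: "\<And>k a b. a \<in> hm k \<Longrightarrow> b \<in> hm (- k) \<Longrightarrow> Q (pA a b)"
    and add: "\<And>X Y. X \<in> carrier C \<Longrightarrow> Y \<in> carrier C \<Longrightarrow> Q X \<Longrightarrow> Q Y \<Longrightarrow> Q (X \<oplus>\<^bsub>AxA\<^esub> Y)"
  shows "Q X"
proof -
  have zero: "Q \<zero>\<^bsub>AxA\<^esub>" using pure[of \<zero> 0 \<zero>] by (simp add: hom_zero A2.pure_zero_left)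
  have "Q (P X)" using C_closed[OF assms(1)]
  proof (induction rule: AxA_homog_induct)
    case (pure k l a b)
    show ?case
    proof (cases "k + l = 0")
      case True
      then have "l = - k" by simp
      then show ?thesis using pure assms(2) P_pure[of a k b l] by simp
    qed (use pure zero in \<open>simp add: P_pure\<close>)
  next
    case (add X Y) then show ?case using assms(3) P_closed by (simp add: clinear_add[OF P_linear])
  qed
  then show ?thesis using P_C assms(1) by simp
qed

section \<open>Actions of the base and tensor squares of the bialgebroid\<close>

abbreviation "rB X b \<equiv> pA \<one> b \<otimes>\<^bsub>E\<^esub> X"
abbreviation "lB b X \<equiv> pA b \<one> \<otimes>\<^bsub>E\<^esub> X"

lemma E_mult_linear: "Y \<in> carrier AxA \<Longrightarrow> clinear AxA AxA (\<lambda>X. Y \<otimes>\<^bsub>E\<^esub> X)"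
    "Y \<in> carrier AxA \<Longrightarrow> clinear AxA AxA (\<lambda>X. X \<otimes>\<^bsub>E\<^esub> Y)"
  using cbilinear_left[OF AA.tensor_mult_bilinear] cbilinear_right[OF AA.tensor_mult_bilinear] by simp_all

lemma E_mult_pure: "a \<in> carrier A \<Longrightarrow> b \<in> carrier A \<Longrightarrow> a' \<in> carrier A \<Longrightarrow> b' \<in> carrier A \<Longrightarrow>
    pA a b \<otimes>\<^bsub>E\<^esub> pA a' b' = pA (a \<otimes> a') (b' \<otimes> b)"
  using AA.pure_mult[of a a' b b'] by simp

lemma bimodule_linear: "b \<in> carrier A \<Longrightarrow> clinear AxA AxA (\<lambda>X. rB X b)"
    "b \<in> carrier A \<Longrightarrow> clinear AxA AxA (lB b)"
  by (intro E_mult_linear A2.pure_closed; simp)+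

text \<open>Elements of the base have degree 0, so multiplying by them preserves the degrees of both
  legs. This makes \<open>\<kappa>\<close> balanced and \<open>C\<close> stable under both
  actions.\<close>

lemma P_bimodule:
  assumes "b \<in> hm 0" "X \<in> carrier AxA"
  shows "P (rB X b) = rB (P X) b" "P (lB b X) = lB b (P X)"
proof -
  have b: "b \<in> carrier A" using assms by auto
  note z = clinear_zero[OF AxA.cvec_axioms AxA.cvec_axioms bimodule_linear(1)[OF b]]
    clinear_zero[OF AxA.cvec_axioms AxA.cvec_axioms bimodule_linear(2)[OF b]]
  show "P (rB X b) = rB (P X) b" using assms(2)
  proof (induction rule: AxA_homog_induct)
    case (pure k l a c)
    moreover have "c \<otimes> b \<in> hm l" using homog_mult[OF pure(2) assms(1)] by simp
    ultimately show ?case using b z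
      by (cases "k + l = 0") (simp_all add: E_mult_pure hom_closed[of a k] hom_closed[of c l] P_pure)
  next
    case (add X Y) then show ?case
      by (simp add: clinear_add[OF bimodule_linear(1)[OF b]] clinear_add[OF P_linear]
        clinear_closed[OF bimodule_linear(1)[OF b]] clinear_closed[OF P_linear])
  qed
  show "P (lB b X) = lB b (P X)" using assms(2)
  proof (induction rule: AxA_homog_induct)
    case (pure k l a c)
    moreover have "b \<otimes> a \<in> hm k" using homog_mult[OF assms(1) pure(1)] by simp
    ultimately show ?case using b z
      by (cases "k + l = 0") (simp_all add: E_mult_pure hom_closed[of a k] hom_closed[of c l] P_pure)
  next
    case (add X Y) then show ?case
      by (simp add: clinear_add[OF bimodule_linear(2)[OF b]] clinear_add[OF P_linear]
        clinear_closed[OF bimodule_linear(2)[OF b]] clinear_closed[OF P_linear])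
  qed
qed

lemma bimodule_C: "b \<in> hm 0 \<Longrightarrow> X \<in> carrier C \<Longrightarrow> rB X b \<in> carrier C"
    "b \<in> hm 0 \<Longrightarrow> X \<in> carrier C \<Longrightarrow> lB b X \<in> carrier C"
  using P_bimodule[of b X] P_closed[of "rB X b"] P_closed[of "lB b X"] C_closed[of X] P_C[of X]
    clinear_closed[OF bimodule_linear(1), of b X] clinear_closed[OF bimodule_linear(2), of b X]
  by (auto dest: hom_closed)

sublocale TC: tensor_setup "hm 0" "\<lambda>X b. rB X b" "\<lambda>b X. lB b X" C C
  by unfold_locales (auto intro: bimodule_C)

sublocale E: cvec E by (rule cvec_E)

sublocale TE: tensor_setup "hm 0" "\<lambda>X b. rB X b" "\<lambda>b X. lB b X" E E
  by unfold_locales (auto intro: clinear_closed[OF bimodule_linear(1)] clinear_closed[OF bimodule_linear(2)])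

abbreviation "\<iota> \<equiv> tensor_lift TE.T (\<lambda>h k. TE.pr h k)"

lemma iota_bilinear: "cbilinear C C TE.T TE.pr"
  by (intro cbilinearI clinear_subspace[OF cbilinear_left[OF TE.pr_bilinear]]
      clinear_subspace[OF cbilinear_right[OF TE.pr_bilinear]]) (auto dest: C_closed)

lemma iota_balanced: "TC.balanced TE.pr"
  using TE.pr_balanced by (auto dest: C_closed)

lemma iota_linear: "clinear TC.T TE.T \<iota>"
  by (rule TC.lift_linear[OF TE.T.cvec_axioms iota_bilinear iota_balanced])

lemma iota_pr: "h \<in> carrier C \<Longrightarrow> k \<in> carrier C \<Longrightarrow> \<iota> (TC.pr h k) = TE.pr h k"
  by (rule TC.lift_pure[OF TE.T.cvec_axioms iota_bilinear iota_balanced])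

text \<open>
  A left inverse of \<open>\<iota>\<close>: hence the coproduct, which is specified by its image in the larger
  tensor product, is uniquely determined.
\<close>

definition "\<kappa> = tensor_lift TC.T (\<lambda>h k. TC.pr (P h) (P k))"

lemma P_linear': "clinear E C P"
  using P_linear by (auto simp: clinear_def P_closed)

lemma kappa_bilinear: "cbilinear E E TC.T (\<lambda>h k. TC.pr (P h) (P k))"
  by (intro cbilinearI clinear_compose[OF P_linear'] cbilinear_left[OF TC.pr_bilinear]
      cbilinear_right[OF TC.pr_bilinear]) (auto intro: P_closed)

lemma kappa_balanced: "TE.balanced (\<lambda>h k. TC.pr (P h) (P k))"
  using TC.pr_balanced by (auto simp: P_bimodule P_closed)

lemma kappa_linear: "clinear TE.T TC.T \<kappa>"
  unfolding \<kappa>_def by (rule TE.lift_linear[OF TC.T.cvec_axioms kappa_bilinear kappa_balanced])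

lemma kappa_pr: "h \<in> carrier C \<Longrightarrow> k \<in> carrier C \<Longrightarrow> \<kappa> (TE.pr h k) = TC.pr h k"
  unfolding \<kappa>_def
  by (subst TE.lift_pure[OF TC.T.cvec_axioms kappa_bilinear kappa_balanced]) (auto simp: P_C C_closed)

lemma kappa_iota: "X \<in> carrier TC.T \<Longrightarrow> \<kappa> (\<iota> X) = X"
  by (rule TC.linear_ext[OF clinear_compose[OF iota_linear kappa_linear] clinear_id])
    (simp_all add: iota_pr kappa_pr)

section \<open>The coproduct on homogeneous tensors\<close>

abbreviation "\<tau> \<equiv> translation_map A H \<rho>"
text \<open>The nested lifts of the coproduct formula from the inside out: \<open>X3\<close> is
  lifted over a value of the translation map, \<open>X2\<close> over the coaction of the first leg,
  \<open>X1\<close> over the tensor itself.\<close>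

abbreviation "X3 a0 a' z z' \<equiv> TE.pr (pA a0 z) (pA z' a')"
abbreviation "X2 a' a0 h \<equiv> tensor_lift TE.T (X3 a0 a') (\<tau> h)"
abbreviation "X1 a a' \<equiv> tensor_lift TE.T (X2 a') (\<rho> a)"
abbreviation "\<Xi> \<equiv> tensor_lift TE.T X1"

lemma pA_linear: "a \<in> carrier A \<Longrightarrow> clinear A E (pA a)" "a \<in> carrier A \<Longrightarrow> clinear A E (\<lambda>b. pA b a)"
  using A2.pure_bilinear by (auto simp: cbilinear_def clinear_def)

lemma X3_linear:
  assumes "a \<in> carrier A" "b \<in> carrier A" "c \<in> carrier A"
  shows "clinear A TE.T (\<lambda>z. X3 z a b c)" "clinear A TE.T (\<lambda>z. X3 a z b c)"
    "clinear A TE.T (\<lambda>z. X3 a b z c)" "clinear A TE.T (\<lambda>z. X3 a b c z)"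
  by (rule clinear_compose[OF pA_linear(1) cbilinear_right[OF TE.pr_bilinear]]
      clinear_compose[OF pA_linear(2) cbilinear_right[OF TE.pr_bilinear]]
      clinear_compose[OF pA_linear(1) cbilinear_left[OF TE.pr_bilinear]]
      clinear_compose[OF pA_linear(2) cbilinear_left[OF TE.pr_bilinear]];
      simp add: assms A2.pure_closed)+

lemma X3_bilinear: "a \<in> carrier A \<Longrightarrow> b \<in> carrier A \<Longrightarrow> cbilinear A A TE.T (X3 a b)"
  by (intro cbilinearI X3_linear)

text \<open>A base element that moves from z to z' moves, in the bialgebroid, from the target action
  on the first factor to the source action on the second.\<close>

lemma X3_balanced: "a \<in> carrier A \<Longrightarrow> a' \<in> carrier A \<Longrightarrow> TB.balanced (X3 a a')"
proof (intro ballI)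
  fix b z z' assume *: "a \<in> carrier A" "a' \<in> carrier A" "b \<in> hm 0" "z \<in> carrier A" "z' \<in> carrier A"
  then show "X3 a a' (z \<otimes> b) z' = X3 a a' z (b \<otimes> z')"
    using TE.pr_balanced[of b "pA a z" "pA z' a'"] hom_closed[OF *(3)]
    by (simp add: A2.pure_closed E_mult_pure)
qed

lemma tau_closed: "\<tau> h \<in> carrier TB.T"
  using clinear_closed[OF translation_linear, of h] by (simp add: T\<^sub>B_eq)

lemma tau_linear: "clinear H TB.T \<tau>"
  using translation_linear by (simp add: T\<^sub>B_eq)

lemma X2_bilinear: "a' \<in> carrier A \<Longrightarrow> cbilinear A H TE.T (X2 a')"
  by (intro cbilinearI TB.lift_param[OF A.cvec_axioms TE.T.cvec_axioms X3_bilinear X3_balanced X3_linear(1)]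
    clinear_compose[OF tau_linear TB.lift_linear[OF TE.T.cvec_axioms X3_bilinear X3_balanced]] tau_closed)

lemma X1_bilinear: "cbilinear A A TE.T X1"
  by (intro cbilinearI clinear_compose[OF rho_linear AH.lift_linear] AH.lift_param[OF A.cvec_axioms]
      X2_bilinear TE.T.cvec_axioms rho_closed
      TB.lift_param[OF A.cvec_axioms TE.T.cvec_axioms X3_bilinear X3_balanced X3_linear(2)] tau_closed)

lemma Xi_linear: "clinear AxA TE.T \<Xi>"
  by (rule A2.lift_linear[OF TE.T.cvec_axioms X1_bilinear])

lemma Xi_pure:
  assumes "a \<in> hm k" "a' \<in> carrier A"
  shows "\<Xi> (pA a a') = (\<Oplus>\<^bsub>TE.T\<^esub>i\<in>{..<N k}. TE.pr (pA a (x k i)) (pA (y k i) a'))"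
proof -
  have a: "a \<in> carrier A" using assms by auto
  have "\<Xi> (pA a a') = X2 a' a (upow k)"
    using a assms(2)
    by (simp add: A2.lift_pure[OF TE.T.cvec_axioms X1_bilinear] rho_hom[OF assms(1)]
        AH.lift_pure[OF TE.T.cvec_axioms X2_bilinear])
  also have "\<dots> = (\<Oplus>\<^bsub>TE.T\<^esub>i\<in>{..<N k}. tensor_lift TE.T (X3 a a') (TB.pr (x k i) (y k i)))"
    unfolding translation_upow T\<^sub>B_eq
    by (rule clinear_finsum[OF TB.T.cvec_axioms TE.T.cvec_axioms
      TB.lift_linear[OF TE.T.cvec_axioms X3_bilinear X3_balanced]]) (use a assms in auto)
  also have "\<dots> = (\<Oplus>\<^bsub>TE.T\<^esub>i\<in>{..<N k}. TE.pr (pA a (x k i)) (pA (y k i) a'))"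
    by (rule TE.T.finsum_cong')
      (use a assms in \<open>auto simp: TB.lift_pure[OF TE.T.cvec_axioms X3_bilinear X3_balanced] A2.pure_closed\<close>)
  finally show ?thesis .
qed

definition "cop X = \<kappa> (\<Xi> X)"

lemma cop_linear: "clinear C TC.T cop"
proof -
  have "clinear AxA TC.T cop" unfolding cop_def[abs_def] by (rule clinear_compose[OF Xi_linear kappa_linear])
  then show ?thesis by (rule clinear_subspace) (auto dest: C_closed)
qed

lemma pA_xy_C:
  assumes "i < N k"
  shows "a \<in> hm k \<Longrightarrow> pA a (x k i) \<in> carrier C" "a' \<in> hm (- k) \<Longrightarrow> pA (y k i) a' \<in> carrier C"
  using C_pure[of a k "x k i"] C_pure[of "y k i" k a'] x_homog y_homog assms by auto

lemma cop_pure: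
  assumes "a \<in> hm k" "a' \<in> hm (- k)"
  shows "cop (pA a a') = (\<Oplus>\<^bsub>TC.T\<^esub>i\<in>{..<N k}. TC.pr (pA a (x k i)) (pA (y k i) a'))"
proof -
  have a: "a \<in> carrier A" "a' \<in> carrier A" using assms by auto
  have "cop (pA a a') = (\<Oplus>\<^bsub>TC.T\<^esub>i\<in>{..<N k}. \<kappa> (TE.pr (pA a (x k i)) (pA (y k i) a')))"
    unfolding cop_def Xi_pure[OF assms(1) a(2)]
    by (rule clinear_finsum[OF TE.T.cvec_axioms TC.T.cvec_axioms kappa_linear]) (use a in \<open>auto simp: A2.pure_closed\<close>)
  also have "\<dots> = (\<Oplus>\<^bsub>TC.T\<^esub>i\<in>{..<N k}. TC.pr (pA a (x k i)) (pA (y k i) a'))"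
    by (rule TC.T.finsum_cong') (use assms in \<open>auto simp: kappa_pr pA_xy_C\<close>)
  finally show ?thesis .
qed

text \<open>The tensors a \<otimes> x_i and y_i \<otimes> a' have total degree 0, so the formula for
  the coproduct, a priori in the large tensor product, comes from \<open>C\<close>. Hence
  \<open>inv_into\<close> is applied to a point of the image.\<close>

lemma iota_cop: "X \<in> carrier C \<Longrightarrow> \<iota> (cop X) = \<Xi> X"
proof (induction rule: C_induct)
  case (pure k a a')
  have "\<iota> (cop (pA a a')) = (\<Oplus>\<^bsub>TE.T\<^esub>i\<in>{..<N k}. \<iota> (TC.pr (pA a (x k i)) (pA (y k i) a')))"
    unfolding cop_pure[OF pure]
    by (rule clinear_finsum[OF TC.T.cvec_axioms TE.T.cvec_axioms iota_linear]) (use pure pA_xy_C in auto)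
  also have "\<dots> = (\<Oplus>\<^bsub>TE.T\<^esub>i\<in>{..<N k}. TE.pr (pA a (x k i)) (pA (y k i) a'))"
    by (rule TE.T.finsum_cong')
      (use pure in \<open>auto simp: iota_pr pA_xy_C A2.pure_closed hom_closed[OF pure(1)] hom_closed[OF pure(2)]\<close>)
  finally show ?case using Xi_pure[OF pure(1)] hom_closed[OF pure(2)] by simp
next
  case (add X Y)
  then show ?case
    using clinear_add[OF cop_linear, of X Y] clinear_add[OF iota_linear, of "cop X" "cop Y"]
      clinear_add[OF Xi_linear, of X Y] clinear_closed[OF cop_linear] C_closed by simp
qed

lemma coprod_eq:
  assumes "X \<in> carrier C" shows "ES_coprod A H \<rho> X = cop X"
proof -
  have "ES_coprod A H \<rho> X = inv_into (carrier TC.T) \<iota> (\<Xi> X)"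
    by (simp add: ES_coprod_def Let_def)
  also have "\<dots> = inv_into (carrier TC.T) \<iota> (\<iota> (cop X))" by (simp add: iota_cop[OF assms])
  also have "\<dots> = cop X"
    by (rule inv_into_f_f[OF inj_on_inverseI[where g = \<kappa>]])
      (simp_all add: kappa_iota clinear_closed[OF cop_linear assms])
  finally show ?thesis .
qed

end

section \<open>Twists as graded automorphisms\<close>

context strongly_graded begin

abbreviation "K \<equiv> ES_bialgebroid A H \<rho>"

lemma K_simps [simp]:
  "base K = B" "total K = C" "src K = (\<lambda>b. pA b \<one>)" "tgt K = (\<lambda>b. pA \<one> b)"
  "coprod K = ES_coprod A H \<rho>" "counit K = tensor_lift A (\<lambda>a a'. a \<otimes> a')"
  by (simp_all add: ES_bialgebroid_def)

lemma dual_iff: "\<phi> \<in> dual_carrier K \<longleftrightarrow>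
    \<phi> \<in> extensional (carrier C) \<and> clinear C B \<phi> \<and>
    (\<forall>b\<in>hm 0. \<forall>X\<in>carrier C. \<phi> (rB X b) = \<phi> X \<otimes> b)"
  by (auto simp: dual_carrier_def clinear_def PiE_def Pi_def)

text \<open>Associativity of the source action; together with right linearity of phi it balances the
  lift in \<open>lift_cop\<close>.\<close>

lemma lB_mult:
  assumes "b \<in> carrier A" "c \<in> carrier A" "X \<in> carrier AxA"
  shows "lB (b \<otimes> c) X = lB b (lB c X)"
  using assms(3)
proof (induction rule: A2.induct)
  case (pure u v) then show ?case using assms by (simp add: E_mult_pure A.m_assoc)
next
  case (add X Y)
  then show ?case using assms
    by (simp add: clinear_add[OF bimodule_linear(2)] clinear_closed[OF bimodule_linear(2)])
qed

lemma lB_bilinear: "cbilinear B C C lB"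
proof (rule cbilinearI)
  fix b assume "b \<in> carrier B"
  then have b: "b \<in> hm 0" by simp
  show "clinear C C (lB b)"
    by (rule clinearI) (use b bimodule_C clinear_add[OF bimodule_linear(2)[OF hom_closed[OF b]]]
      clinear_smult[OF bimodule_linear(2)[OF hom_closed[OF b]]] C_closed in auto)
next
  fix X assume X: "X \<in> carrier C"
  have l: "clinear A AxA (\<lambda>b. lB b X)"
    by (rule clinear_compose[OF cbilinear_left[OF A2.pure_bilinear A.one_closed] E_mult_linear(2)])
      (rule C_closed[OF X])
  show "clinear B C (\<lambda>b. lB b X)"
    by (rule clinearI) (use X bimodule_C clinear_add[OF l] clinear_smult[OF l] in \<open>auto dest: hom_closed\<close>)
qed

text \<open>Recovers F from phi: on degree k it is the sum of the phi(a \<otimes> x_i) y_i. The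
  projection \<open>P\<close> extends each formula linearly to all of A, since phi is controlled on
  coinvariant tensors only.\<close>

definition "F_of \<phi> a = tensor_lift A (\<lambda>a0 h. lsum A (\<lambda>k. \<Oplus>i\<in>{..<N k}. \<phi> (P (pA a0 (x k i))) \<otimes> y k i) h) (\<rho> a)"

context
  fixes \<phi> assumes dual: "\<phi> \<in> dual_carrier K"
begin

lemma phi_linear: "clinear C B \<phi>" and phi_ext: "\<phi> \<in> extensional (carrier C)"
  and phi_rB: "b \<in> hm 0 \<Longrightarrow> X \<in> carrier C \<Longrightarrow> \<phi> (rB X b) = \<phi> X \<otimes> b"
  using dual by (auto simp: dual_iff)

lemma phi_hom: "X \<in> carrier C \<Longrightarrow> \<phi> X \<in> hm 0"
  using clinear_closed[OF phi_linear] by simp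

lemma phi_closed: "X \<in> carrier C \<Longrightarrow> \<phi> X \<in> carrier A"
  using phi_hom by (rule hom_closed)

lemma phi_linear_A: "clinear C A \<phi>"
  using phi_linear by (auto simp: clinear_def)

lemma F_bilinear: "cbilinear A H A (\<lambda>a0 h. lsum A (\<lambda>k. \<Oplus>i\<in>{..<N k}. \<phi> (P (pA a0 (x k i))) \<otimes> y k i) h)"
proof (intro lsum_bilinear A.cvec_axioms clinear_finsum_maps)
  fix k i assume "i \<in> {..<N k}"
  then show "clinear A A (\<lambda>a0. \<phi> (P (pA a0 (x k i))) \<otimes> y k i)"
    by (intro clinear_compose[OF _ A.mult_linear_left] clinear_compose[OF _ phi_linear_A]
        clinear_compose[OF pA_linear(2) P_linear']) auto
qed simp

lemma F_linear: "clinear A A (F_of \<phi>)"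
  unfolding F_of_def[abs_def]
  by (rule clinear_compose[OF rho_linear AH.lift_linear[OF A.cvec_axioms F_bilinear]])

lemma F_term: "i < N k \<Longrightarrow> a \<in> hm k \<Longrightarrow> \<phi> (pA a (x k i)) \<otimes> y k i \<in> hm k"
  by (rule hom_mult'[OF phi_hom y_homog]) (auto intro: pA_xy_C)

lemma F_eq:
  assumes "a \<in> hm k"
  shows "F_of \<phi> a = (\<Oplus>i\<in>{..<N k}. \<phi> (pA a (x k i)) \<otimes> y k i)"
proof -
  have a: "a \<in> carrier A" using assms by auto
  have *: "\<phi> (P (pA a (x k i))) \<otimes> y k i = \<phi> (pA a (x k i)) \<otimes> y k i" if "i < N k" for i
    using P_C[OF pA_xy_C(1)[OF that assms]] by simp
  have **: "(\<Oplus>i\<in>{..<N k}. \<phi> (P (pA a (x k i))) \<otimes> y k i) = (\<Oplus>i\<in>{..<N k}. \<phi> (pA a (x k i)) \<otimes> y k i)"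
    by (rule A.finsum_cong') (use assms F_term * in auto)
  have "(\<Oplus>i\<in>{..<N k}. \<phi> (pA a (x k i)) \<otimes> y k i) \<in> carrier A"
    by (rule A.finsum_closed) (use F_term[OF _ assms] in auto)
  then show ?thesis
    unfolding F_of_def rho_hom[OF assms]
    by (subst AH.lift_pure[OF A.cvec_axioms F_bilinear a]) (simp_all add: **)
qed

lemma F_hom: "a \<in> hm k \<Longrightarrow> F_of \<phi> a \<in> hm k"
  unfolding F_eq by (rule hom_finsum) (auto intro: F_term)

text \<open>The elements y_i a' lie in the base, so right linearity moves them inside phi, where the
  x_i y_i a' sum up to a'.\<close>

lemma phi_pure:
  assumes "a \<in> hm k" "a' \<in> hm (- k)"
  shows "\<phi> (pA a a') = F_of \<phi> a \<otimes> a'"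
proof -
  have c: "a \<in> carrier A" "a' \<in> carrier A" using assms by auto
  have "F_of \<phi> a \<otimes> a' = (\<Oplus>i\<in>{..<N k}. \<phi> (pA a (x k i)) \<otimes> y k i \<otimes> a')"
    unfolding F_eq[OF assms(1)]
    by (rule clinear_finsum[OF A.cvec_axioms A.cvec_axioms A.mult_linear_left[OF c(2)]])
      (use F_term assms in auto)
  also have "\<dots> = (\<Oplus>i\<in>{..<N k}. \<phi> (pA a (x k i \<otimes> y k i \<otimes> a')))"
  proof (rule A.finsum_cong')
    have xy: "y k i \<otimes> a' \<in> hm 0" "x k i \<otimes> y k i \<otimes> a' \<in> hm (-k)" if "i < N k" for i
      using homog_mult[OF y_homog[OF that] assms(2)]
        homog_mult[OF homog_mult[OF x_homog[OF that] y_homog[OF that]] assms(2)] by simp_all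
    show "(\<lambda>i. \<phi> (pA a (x k i \<otimes> y k i \<otimes> a'))) \<in> {..<N k} \<rightarrow> carrier A"
      using xy C_pure[OF assms(1)] phi_closed by auto
    fix i assume "i \<in> {..<N k}"
    then have i: "i < N k" by simp
    have "\<phi> (pA a (x k i)) \<otimes> (y k i \<otimes> a') = \<phi> (pA a (x k i \<otimes> (y k i \<otimes> a')))"
      using phi_rB[OF xy(1)[OF i] pA_xy_C(1)[OF i assms(1)]] i c by (simp add: E_mult_pure)
    then show "\<phi> (pA a (x k i)) \<otimes> y k i \<otimes> a' = \<phi> (pA a (x k i \<otimes> y k i \<otimes> a'))"
      using i c phi_closed[OF pA_xy_C(1)[OF i assms(1)]] by (simp add: A.m_assoc)
  qed simp
  also have "\<dots> = \<phi> (pA a a')"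
  proof -
    have *: "(\<Oplus>i\<in>{..<N k}. x k i \<otimes> y k i \<otimes> a') = a'"
    proof -
      have "(\<Oplus>i\<in>{..<N k}. x k i \<otimes> y k i \<otimes> a') = (\<Oplus>i\<in>{..<N k}. x k i \<otimes> y k i) \<otimes> a'"
        by (rule clinear_finsum[symmetric, OF A.cvec_axioms A.cvec_axioms A.mult_linear_left[OF c(2)]]) auto
      then show ?thesis using c by (simp add: sum_xy)
    qed
    have xy: "x k i \<otimes> y k i \<otimes> a' \<in> hm (-k)" if "i < N k" for i
      using homog_mult[OF homog_mult[OF x_homog[OF that] y_homog[OF that]] assms(2)] by simp
    \<comment> \<open>Additivity of phi is available on \<open>C\<close> only, so the sum is taken
      out by an induction that keeps all partial sums in degree -k.\<close>
    have "\<phi> (pA a (\<Oplus>i\<in>I. f i)) = (\<Oplus>i\<in>I. \<phi> (pA a (f i)))"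
      if "finite I" "\<And>i. i \<in> I \<Longrightarrow> f i \<in> hm (- k)" for I and f :: "nat \<Rightarrow> 'a"
      using that
    proof (induction I rule: finite_induct)
      case empty
      show ?case using clinear_zero[OF C.cvec_axioms A.cvec_axioms phi_linear_A] c
        by (simp add: A2.pure_zero_right)
    next
      case (insert i I)
      have fi: "f i \<in> hm (-k)" and fI: "finsum A f I \<in> hm (-k)" using insert hom_finsum[of I f "-k"] by auto
      have cl: "f \<in> I \<rightarrow> carrier A" "(\<lambda>i. \<phi> (pA a (f i))) \<in> I \<rightarrow> carrier A" "\<phi> (pA a (f i)) \<in> carrier A"
        using insert.prems hom_closed phi_closed C_pure[OF assms(1)] by blast+
      have "\<phi> (pA a (f i \<oplus> finsum A f I)) = \<phi> (pA a (f i)) \<oplus> \<phi> (pA a (finsum A f I))"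
        using clinear_add[OF phi_linear_A C_pure[OF assms(1) fi] C_pure[OF assms(1) fI]] c
          hom_closed[OF fi] hom_closed[OF fI] by (simp add: A2.pure_add_right)
      then show ?case using insert cl hom_closed[OF fi] by simp
    qed
    from this[of "{..<N k}" "\<lambda>i. x k i \<otimes> y k i \<otimes> a'"] show ?thesis using xy * by simp
  qed
  finally show ?thesis by simp
qed

text \<open>For \<psi> the identity this is the action on the bialgebroid, for \<psi> a functional
  it is the convolution product. Both reduce to applying F to the first leg.\<close>

lemma lift_cop:
  assumes U: "cvec U" and psi: "clinear C U \<psi>"
  shows "clinear C U (\<lambda>X. tensor_lift U (\<lambda>h1 h2. \<psi> (lB (\<phi> h1) h2)) (ES_coprod A H \<rho> X))"
    and "a \<in> hm k \<Longrightarrow> a' \<in> hm (- k) \<Longrightarrow>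
      tensor_lift U (\<lambda>h1 h2. \<psi> (lB (\<phi> h1) h2)) (ES_coprod A H \<rho> (pA a a')) = \<psi> (pA (F_of \<phi> a) a')"
proof -
  interpret U: cvec U by fact
  have bil: "cbilinear C C U (\<lambda>h1 h2. \<psi> (lB (\<phi> h1) h2))"
    by (intro cbilinearI clinear_compose[OF _ psi] clinear_compose[OF phi_linear]
      cbilinear_left[OF lB_bilinear] cbilinear_right[OF lB_bilinear]) (auto intro: phi_hom)
  have bal: "TC.balanced (\<lambda>h1 h2. \<psi> (lB (\<phi> h1) h2))"
    by (auto simp: phi_rB lB_mult phi_closed C_closed)
  have lin: "clinear C U (\<lambda>X. tensor_lift U (\<lambda>h1 h2. \<psi> (lB (\<phi> h1) h2)) (cop X))"
    by (rule clinear_compose[OF cop_linear TC.lift_linear[OF U bil bal]])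
  then show "clinear C U (\<lambda>X. tensor_lift U (\<lambda>h1 h2. \<psi> (lB (\<phi> h1) h2)) (ES_coprod A H \<rho> X))"
    by (simp add: clinear_def coprod_eq C_add C_smult)
  assume a: "a \<in> hm k" and a': "a' \<in> hm (- k)"
  note c = hom_closed[OF a] hom_closed[OF a']
  have "tensor_lift U (\<lambda>h1 h2. \<psi> (lB (\<phi> h1) h2)) (ES_coprod A H \<rho> (pA a a'))
      = (\<Oplus>\<^bsub>U\<^esub>i\<in>{..<N k}. tensor_lift U (\<lambda>h1 h2. \<psi> (lB (\<phi> h1) h2)) (TC.pr (pA a (x k i)) (pA (y k i) a')))"
    unfolding coprod_eq[OF C_pure[OF a a']] cop_pure[OF a a']
    by (rule clinear_finsum[OF TC.T.cvec_axioms U TC.lift_linear[OF U bil bal]])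
      (use a a' pA_xy_C in auto)
  also have "\<dots> = (\<Oplus>\<^bsub>U\<^esub>i\<in>{..<N k}. \<psi> (pA (\<phi> (pA a (x k i)) \<otimes> y k i) a'))"
  proof (rule U.finsum_cong')
    show "(\<lambda>i. \<psi> (pA (\<phi> (pA a (x k i)) \<otimes> y k i) a')) \<in> {..<N k} \<rightarrow> carrier U"
      using F_term[OF _ a] C_pure[OF _ a'] clinear_closed[OF psi] by blast
    fix i assume "i \<in> {..<N k}"
    then show "tensor_lift U (\<lambda>h1 h2. \<psi> (lB (\<phi> h1) h2)) (TC.pr (pA a (x k i)) (pA (y k i) a')) =
        \<psi> (pA (\<phi> (pA a (x k i)) \<otimes> y k i) a')"
      using a a' c phi_closed
      by (subst TC.lift_pure[OF U bil bal]) (auto simp: pA_xy_C E_mult_pure)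
  qed simp
  also have "\<dots> = \<psi> (pA (F_of \<phi> a) a')"
  proof -
    have "\<psi> (pA (finsum A f I) a') = (\<Oplus>\<^bsub>U\<^esub>i\<in>I. \<psi> (pA (f i) a'))"
      if "finite I" "\<And>i. i \<in> I \<Longrightarrow> f i \<in> hm k" for I and f :: "nat \<Rightarrow> 'a"
      using that
    proof (induction I rule: finite_induct)
      case empty
      show ?case using clinear_zero[OF C.cvec_axioms U psi] c by (simp add: A2.pure_zero_left)
    next
      case (insert i I)
      have fi: "f i \<in> hm k" and fI: "finsum A f I \<in> hm k" using insert hom_finsum[of I f k] by auto
      have cl: "f \<in> I \<rightarrow> carrier A" "(\<lambda>i. \<psi> (pA (f i) a')) \<in> I \<rightarrow> carrier U" "\<psi> (pA (f i) a') \<in> carrier U"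
        using insert.prems hom_closed clinear_closed[OF psi] C_pure[OF _ a'] by blast+
      have "\<psi> (pA (f i \<oplus> finsum A f I) a') = \<psi> (pA (f i) a') \<oplus>\<^bsub>U\<^esub> \<psi> (pA (finsum A f I) a')"
        using clinear_add[OF psi C_pure[OF fi a'] C_pure[OF fI a']] c
          hom_closed[OF fi] hom_closed[OF fI] by (simp add: A2.pure_add_left)
      then show ?case using insert cl hom_closed[OF fi] by simp
    qed
    from this[of "{..<N k}"] show ?thesis unfolding F_eq[OF a] using F_term[OF _ a] by simp
  qed
  finally show "tensor_lift U (\<lambda>h1 h2. \<psi> (lB (\<phi> h1) h2)) (ES_coprod A H \<rho> (pA a a')) = \<psi> (pA (F_of \<phi> a) a')" .
qed

lemma action_linear: "clinear C C (\<lambda>X. dual_action K X \<phi>)"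
  and action_pure: "a \<in> hm k \<Longrightarrow> a' \<in> hm (- k) \<Longrightarrow> dual_action K (pA a a') \<phi> = pA (F_of \<phi> a) a'"
  using lift_cop[OF C.cvec_axioms clinear_id] by (simp_all add: dual_action_def)

end

section \<open>Functionals built from graded maps\<close>

definition graded_linear :: "('a \<Rightarrow> 'a) \<Rightarrow> bool"
  where "graded_linear F \<longleftrightarrow> clinear A A F \<and> (\<forall>k. \<forall>a\<in>hm k. F a \<in> hm k)"

lemma graded_linear_F_of: "\<phi> \<in> dual_carrier K \<Longrightarrow> graded_linear (F_of \<phi>)"
  by (simp add: graded_linear_def F_linear F_hom)

definition "phi_of F = (\<lambda>X\<in>carrier C. tensor_lift A (\<lambda>a a'. F a \<otimes> a') X)"

lemma C_ext:
  assumes "cvec U" "clinear C U f" "clinear C U g" "X \<in> carrier C"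
    and "\<And>k a a'. a \<in> hm k \<Longrightarrow> a' \<in> hm (- k) \<Longrightarrow> f (pA a a') = g (pA a a')"
  shows "f X = g X"
  using assms(4)
proof (induction rule: C_induct)
  case (add X Y) then show ?case using clinear_add[OF assms(2), of X Y] clinear_add[OF assms(3), of X Y] by simp
qed (rule assms(5))

context
  fixes F assumes F: "graded_linear F"
begin

lemma GF_linear: "clinear A A F" and GF_hom: "a \<in> hm k \<Longrightarrow> F a \<in> hm k"
  using F by (auto simp: graded_linear_def)

lemma F_mult_bilinear: "cbilinear A A A (\<lambda>a a'. F a \<otimes> a')"
  by (intro cbilinearI A.mult_linear_right clinear_compose[OF GF_linear A.mult_linear_left])
    (auto intro: clinear_closed[OF GF_linear])

lemma phi_of_pure:
  assumes "a \<in> hm k" "a' \<in> hm (- k)" shows "phi_of F (pA a a') = F a \<otimes> a'"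
  using C_pure[OF assms] hom_closed[OF assms(1)] hom_closed[OF assms(2)]
  by (simp add: phi_of_def A2.lift_pure[OF A.cvec_axioms F_mult_bilinear])

lemma phi_of_linear_A: "clinear C A (phi_of F)"
proof -
  have l: "clinear C A (tensor_lift A (\<lambda>a a'. F a \<otimes> a'))"
    by (rule clinear_subspace[OF A2.lift_linear[OF A.cvec_axioms F_mult_bilinear]]) (auto dest: C_closed)
  then show ?thesis by (simp add: clinear_def phi_of_def C_add C_smult)
qed

lemma phi_of_hom: "X \<in> carrier C \<Longrightarrow> phi_of F X \<in> hm 0"
proof (induction rule: C_induct)
  case (pure k a a') then show ?case by (simp add: phi_of_pure hom_mult'[OF GF_hom])
next
  case (add X Y) then show ?case using clinear_add[OF phi_of_linear_A, of X Y] by (simp add: hom_add)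
qed

lemma phi_of_dual: "phi_of F \<in> dual_carrier K"
proof -
  have "phi_of F (rB X b) = phi_of F X \<otimes> b" if b: "b \<in> hm 0" and X: "X \<in> carrier C" for b X
    using X
  proof (induction rule: C_induct)
    case (pure k a a')
    have "a' \<otimes> b \<in> hm (-k)" using homog_mult[OF pure(2) b] by simp
    then show ?case using pure b hom_closed[OF pure(1)] hom_closed[OF pure(2)] hom_closed[OF b]
        hom_closed[OF GF_hom[OF pure(1)]] by (simp add: E_mult_pure phi_of_pure A.m_assoc)
  next
    case (add X Y)
    note b' = hom_closed[OF b]
    have "rB X b \<in> carrier C" "rB Y b \<in> carrier C" using bimodule_C b add by auto
    then show ?case
      using add clinear_add[OF phi_of_linear_A, of X Y] clinear_add[OF phi_of_linear_A, of "rB X b" "rB Y b"]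
        clinear_add[OF bimodule_linear(1)[OF b'], of X Y] C_closed[of X] C_closed[of Y]
        clinear_closed[OF phi_of_linear_A] b'
      by (simp add: A.l_distr)
  qed
  moreover have "clinear C B (phi_of F)"
    using phi_of_linear_A phi_of_hom by (simp add: clinear_def)
  ultimately show ?thesis by (simp add: dual_iff phi_of_def)
qed

lemma F_of_phi_of: "a \<in> carrier A \<Longrightarrow> F_of (phi_of F) a = F a"
proof (induction rule: homog_induct)
  case (homog k a)
  have "F_of (phi_of F) a = (\<Oplus>i\<in>{..<N k}. F a \<otimes> x k i \<otimes> y k i)"
    unfolding F_eq[OF phi_of_dual homog]
    by (rule A.finsum_cong')
      (use homog hom_closed[OF GF_hom[OF homog]] phi_of_pure[OF homog x_homog] in auto)
  then show ?case using sum_axy[OF hom_closed[OF GF_hom[OF homog]]] by simp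
next
  case (add a b)
  then show ?case by (simp add: clinear_add[OF F_linear[OF phi_of_dual]] clinear_add[OF GF_linear])
qed

end

lemma dual_eqI:
  assumes "\<phi> \<in> dual_carrier K" "\<psi> \<in> dual_carrier K"
    and "\<And>a. a \<in> carrier A \<Longrightarrow> F_of \<phi> a = F_of \<psi> a"
  shows "\<phi> = \<psi>"
proof (rule extensionalityI[OF phi_ext phi_ext])
  fix X assume "X \<in> carrier C"
  then show "\<phi> X = \<psi> X"
    by (rule C_ext[OF A.cvec_axioms phi_linear_A[OF assms(1)] phi_linear_A[OF assms(2)]])
      (simp add: phi_pure[OF assms(1)] phi_pure[OF assms(2)] assms(3) hom_closed)
qed fact+

text \<open>The left factor acts first, so convolution corresponds to composition in reverse
  order.\<close>

lemma dual_mult: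
  assumes "\<phi> \<in> dual_carrier K" "\<psi> \<in> dual_carrier K"
  shows "\<phi> \<otimes>\<^bsub>dual_algebra K\<^esub> \<psi> = phi_of (\<lambda>a. F_of \<psi> (F_of \<phi> a))"
proof -
  note g = graded_linear_F_of[OF assms(1)] graded_linear_F_of[OF assms(2)]
  have gl: "graded_linear (\<lambda>a. F_of \<psi> (F_of \<phi> a))"
    using g clinear_compose unfolding graded_linear_def by blast
  let ?m = "\<lambda>X. tensor_lift B (\<lambda>h1 h2. \<psi> (lB (\<phi> h1) h2)) (ES_coprod A H \<rho> X)"
  note L = lift_cop[OF assms(1) cvec_B phi_linear[OF assms(2)]]
  have "?m X = phi_of (\<lambda>a. F_of \<psi> (F_of \<phi> a)) X" if "X \<in> carrier C" for X
  proof (rule C_ext[OF A.cvec_axioms _ phi_of_linear_A[OF gl] that])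
    show "clinear C A ?m" using L(1) by (auto simp: clinear_def)
    fix k a a' assume a: "a \<in> hm k" "a' \<in> hm (- k)"
    show "?m (pA a a') = phi_of (\<lambda>a. F_of \<psi> (F_of \<phi> a)) (pA a a')"
      unfolding L(2)[OF a] phi_pure[OF assms(2) F_hom[OF assms(1) a(1)] a(2)] phi_of_pure[OF gl a] ..
  qed
  then show ?thesis
    by (auto simp: dual_algebra_def phi_of_def fun_eq_iff)
qed

lemma graded_linear_id: "graded_linear (\<lambda>a. a)"
  by (auto simp: graded_linear_def clinear_id)

lemma dual_one: "\<one>\<^bsub>dual_algebra K\<^esub> = phi_of (\<lambda>a. a)"
  by (simp add: dual_algebra_def phi_of_def)

lemma dual_carrier_eq: "carrier (dual_algebra K) = dual_carrier K"
  by (simp add: dual_algebra_def)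

section \<open>Twists and multiplicativity\<close>

definition graded_auto :: "('a \<Rightarrow> 'a) \<Rightarrow> bool"
  where "graded_auto F \<longleftrightarrow> graded_linear F \<and> F \<one> = \<one> \<and>
    (\<forall>a\<in>carrier A. \<forall>b\<in>carrier A. F (a \<otimes> b) = F a \<otimes> F b) \<and>
    (\<exists>G. graded_linear G \<and> (\<forall>a\<in>carrier A. F (G a) = a \<and> G (F a) = a))"

text \<open>The action is F \<otimes> id, which is multiplicative on A \<otimes> A^op as soon as F
  is; the functional of the inverse map is the convolution inverse.\<close>

lemma twist_phi_of:
  assumes "graded_auto F" shows "is_twist K (phi_of F)"
proof -
  have F: "graded_linear F" "F \<one> = \<one>" "\<And>a b. a \<in> carrier A \<Longrightarrow> b \<in> carrier A \<Longrightarrow> F (a \<otimes> b) = F a \<otimes> F b"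
    using assms by (auto simp: graded_auto_def)
  obtain G where G: "graded_linear G" "\<And>a. a \<in> carrier A \<Longrightarrow> F (G a) = a" "\<And>a. a \<in> carrier A \<Longrightarrow> G (F a) = a"
    using assms by (auto simp: graded_auto_def)
  note d = phi_of_dual[OF F(1)] phi_of_dual[OF G(1)] phi_of_dual[OF graded_linear_id]
  have comp: "graded_linear (\<lambda>a. F_of u (F_of v a))" if "u \<in> dual_carrier K" "v \<in> dual_carrier K" for u v
    using graded_linear_F_of[OF that(1)] graded_linear_F_of[OF that(2)] clinear_compose
    unfolding graded_linear_def by blast
  have "phi_of F \<otimes>\<^bsub>dual_algebra K\<^esub> phi_of G = \<one>\<^bsub>dual_algebra K\<^esub>"
    unfolding dual_mult[OF d(1,2)] dual_one
    by (rule dual_eqI[OF phi_of_dual[OF comp[OF d(2,1)]] d(3)])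
      (simp add: F_of_phi_of[OF comp[OF d(2,1)]] F_of_phi_of[OF graded_linear_id] F_of_phi_of[OF F(1)]
        F_of_phi_of[OF G(1)] G clinear_closed[OF GF_linear[OF F(1)]])
  moreover have "phi_of G \<otimes>\<^bsub>dual_algebra K\<^esub> phi_of F = \<one>\<^bsub>dual_algebra K\<^esub>"
    unfolding dual_mult[OF d(2,1)] dual_one
    by (rule dual_eqI[OF phi_of_dual[OF comp[OF d(1,2)]] d(3)])
      (simp add: F_of_phi_of[OF comp[OF d(1,2)]] F_of_phi_of[OF graded_linear_id] F_of_phi_of[OF F(1)]
        F_of_phi_of[OF G(1)] G clinear_closed[OF GF_linear[OF G(1)]])
  ultimately have units: "phi_of F \<in> Units (dual_algebra K)"
    using d by (auto simp: Units_def dual_carrier_eq)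
  have act: "dual_action K (pA a a') (phi_of F) = pA (F a) a'" if "a \<in> hm k" "a' \<in> hm (-k)" for a a' k
    using action_pure[OF d(1) that] F_of_phi_of[OF F(1)] that hom_closed by simp
  have one: "dual_action K \<one>\<^bsub>C\<^esub> (phi_of F) = \<one>\<^bsub>C\<^esub>"
    using act[of \<one> 0 \<one>] homog_one F(2) by simp
  note al = action_linear[OF d(1)]
  have mlin: "clinear AxA AxA (\<lambda>X. X \<otimes>\<^bsub>E\<^esub> Y)" "clinear AxA AxA (\<lambda>X. Y \<otimes>\<^bsub>E\<^esub> X)"
    if "Y \<in> carrier C" for Y using E_mult_linear C_closed that by blast+
  have m1: "pA a a' \<otimes>\<^bsub>E\<^esub> pA b b' \<in> carrier C"
    if "a \<in> hm k" "a' \<in> hm (-k)" "b \<in> hm l" "b' \<in> hm (-l)" for a a' b b' k l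
  proof -
    have "b' \<otimes> a' \<in> hm (- (k + l))" by (rule hom_mult'[OF that(4,2)]) simp
    then show ?thesis using C_pure[OF homog_mult[OF that(1,3)]] that hom_closed by (simp add: E_mult_pure)
  qed
  \<comment> \<open>The action is known to be additive on \<open>C\<close> only, so products must
    first be shown to stay there.\<close>
  have mC: "X \<otimes>\<^bsub>E\<^esub> Y \<in> carrier C" if "X \<in> carrier C" "Y \<in> carrier C" for X Y
    using that
  proof (induction X rule: C_induct)
    case (pure k a a')
    note p = this
    from pure(3) show ?case
    proof (induction Y rule: C_induct)
      case (pure l b b') then show ?case using m1[OF p(1,2)] by blast
    next
      case (add Y Y') then show ?case
        using clinear_add[OF mlin(2)[OF C_pure[OF p(1,2)]], of Y Y'] C_closed C_add by simp
    qed
  next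
    case (add X X') then show ?case
      using clinear_add[OF mlin(1)[of Y], of X X'] C_closed C_add by simp
  qed
  have "dual_action K X (phi_of F) \<otimes>\<^bsub>E\<^esub> dual_action K Y (phi_of F) = dual_action K (X \<otimes>\<^bsub>E\<^esub> Y) (phi_of F)"
    if "X \<in> carrier C" "Y \<in> carrier C" for X Y
    using that
  proof (induction X rule: C_induct)
    case (pure k a a')
    note p = this
    note pc = hom_closed[OF p(1)] hom_closed[OF p(2)] hom_closed[OF GF_hom[OF F(1) p(1)]]
    from pure(3) show ?case
    proof (induction Y rule: C_induct)
      case (pure l b b')
      note q = this
      note qc = hom_closed[OF q(1)] hom_closed[OF q(2)] hom_closed[OF GF_hom[OF F(1) q(1)]]
      have h: "a \<otimes> b \<in> hm (k + l)" "b' \<otimes> a' \<in> hm (- (k + l))"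
        using homog_mult[OF p(1) q(1)] homog_mult[OF q(2) p(2)] by (simp_all add: algebra_simps)
      show ?case using p q act[OF h] pc qc by (simp add: act E_mult_pure F(3))
    next
      case (add Y Y')
      note pY = C_pure[OF p(1,2)]
      show ?case
        using add clinear_add[OF mlin(2)[OF pY], of Y Y'] C_closed clinear_add[OF al, of Y Y']
          clinear_add[OF al mC[OF pY add(1)] mC[OF pY add(2)]] clinear_closed[OF al]
          clinear_add[OF mlin(2)[OF clinear_closed[OF al pY]]] by simp
    qed
  next
    case (add X X')
    then show ?case
      using clinear_add[OF mlin(1)[of Y], of X X'] C_closed clinear_add[OF al, of X X']
          clinear_add[OF al mC[of X Y] mC[of X' Y]] clinear_closed[OF al]
          clinear_add[OF mlin(1)[OF clinear_closed[OF al]], of Y] by simp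
  qed
  then show ?thesis using units one by (simp add: is_twist_def)
qed

text \<open>Multiplicativity of the action only compares F(a) F(b) \<otimes> c with F(a b) \<otimes>
  c for special c. The multiplication map of A turns this into an equation in A, from which c is
  then cancelled.\<close>

lemma twist_auto:
  assumes "is_twist K \<phi>" shows "\<phi> \<in> dual_carrier K" "graded_auto (F_of \<phi>)"
proof -
  obtain \<psi> where psi: "\<phi> \<in> dual_carrier K" "\<psi> \<in> dual_carrier K"
    "\<psi> \<otimes>\<^bsub>dual_algebra K\<^esub> \<phi> = phi_of (\<lambda>a. a)" "\<phi> \<otimes>\<^bsub>dual_algebra K\<^esub> \<psi> = phi_of (\<lambda>a. a)"
    using assms by (auto simp: is_twist_def Units_def dual_carrier_eq dual_one)
  show "\<phi> \<in> dual_carrier K" by fact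
  let ?F = "F_of \<phi>" and ?G = "F_of \<psi>"
  note g = graded_linear_F_of[OF psi(1)] graded_linear_F_of[OF psi(2)]
  have comp: "graded_linear (\<lambda>a. ?F (?G a))" "graded_linear (\<lambda>a. ?G (?F a))"
    using g clinear_compose unfolding graded_linear_def by blast+
  have inv: "?F (?G a) = a" "?G (?F a) = a" if "a \<in> carrier A" for a
    using F_of_phi_of[OF comp(1) that] F_of_phi_of[OF comp(2) that] F_of_phi_of[OF graded_linear_id that]
      psi(3,4) dual_mult[OF psi(1,2)] dual_mult[OF psi(2,1)] by simp_all
  have prodl: "clinear AxA A (tensor_lift A (\<lambda>a b. a \<otimes> b))"
    by (rule A2.lift_linear[OF A.cvec_axioms A.mult_bilinear])
  have prodv: "tensor_lift A (\<lambda>a b. a \<otimes> b) (pA a b) = a \<otimes> b" if "a \<in> carrier A" "b \<in> carrier A" for a b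
    using A2.lift_pure[OF A.cvec_axioms A.mult_bilinear that] .
  have pA_eq: "u \<otimes> c = v \<otimes> c" if "pA u c = pA v c" "u \<in> carrier A" "v \<in> carrier A" "c \<in> carrier A" for u v c
    using prodv[of u c] prodv[of v c] that by simp
  have F_closed: "?F a \<in> carrier A" if "a \<in> carrier A" for a
    using clinear_closed[OF F_linear[OF psi(1)] that] .
  have tw: "dual_action K X \<phi> \<otimes>\<^bsub>E\<^esub> dual_action K Y \<phi> = dual_action K (X \<otimes>\<^bsub>E\<^esub> Y) \<phi>"
    if "X \<in> carrier C" "Y \<in> carrier C" for X Y
    using assms that by (simp add: is_twist_def)
  have "dual_action K \<one>\<^bsub>C\<^esub> \<phi> = pA \<one> \<one>" using assms by (simp add: is_twist_def)
  then have "?F \<one> = \<one>"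
    using action_pure[OF psi(1) homog_one, of \<one>] homog_one pA_eq[of "?F \<one>" \<one> \<one>] F_closed by simp
  moreover have "?F (a \<otimes> b) = ?F a \<otimes> ?F b" if "a \<in> carrier A" "b \<in> carrier A" for a b
    using that
  proof (induction a rule: homog_induct)
    case (homog k a)
    note a = this
    from homog(2) show ?case
    proof (induction b rule: homog_induct)
      case (homog l b)
      note cl = hom_closed[OF a(1)] hom_closed[OF homog] F_closed
      show ?case
      \<comment> \<open>Second legs multiply in the opposite order, so the common right factor is
        \<open>x l j \<otimes> x k i\<close>. Reasoning backwards, the family \<open>x l\<close> is
        cancelled before the family \<open>x k\<close>.\<close>
      proof (rule cancel_x[of _ _ l], goal_cases)
        case (3 j)
        show ?case
        proof (rule cancel_x[of _ _ k], goal_cases)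
          case (3 i)
          have h: "a \<otimes> b \<in> hm (k + l)" "x l j \<otimes> x k i \<in> hm (- (k + l))"
            using homog_mult[OF a(1) homog] homog_mult[OF x_homog x_homog, of j l i k] 3 \<open>j < N l\<close>
            by (simp_all add: algebra_simps)
          have X: "pA a (x k i) \<in> carrier C" and Y: "pA b (x l j) \<in> carrier C"
            using pA_xy_C(1)[OF 3 a(1)] pA_xy_C(1)[OF \<open>j < N l\<close> homog] by auto
          have "pA (?F a) (x k i) \<otimes>\<^bsub>E\<^esub> pA (?F b) (x l j) = dual_action K (pA a (x k i) \<otimes>\<^bsub>E\<^esub> pA b (x l j)) \<phi>"
            using tw[OF X Y] action_pure[OF psi(1) a(1) x_homog[OF 3]]
              action_pure[OF psi(1) homog x_homog[OF \<open>j < N l\<close>]] by simp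
          then have "pA (?F a \<otimes> ?F b) (x l j \<otimes> x k i) = pA (?F (a \<otimes> b)) (x l j \<otimes> x k i)"
            using cl 3 \<open>j < N l\<close> action_pure[OF psi(1) h] by (simp add: E_mult_pure)
          then have "(?F a \<otimes> ?F b) \<otimes> (x l j \<otimes> x k i) = ?F (a \<otimes> b) \<otimes> (x l j \<otimes> x k i)"
            by (rule pA_eq) (use cl 3 \<open>j < N l\<close> in auto)
          then show ?case using cl 3 \<open>j < N l\<close> by (simp add: A.m_assoc)
        qed (use cl 3 in auto)
      qed (use cl in auto)
    next
      case (add b b')
      then show ?case using hom_closed[OF a(1)] F_closed
        by (simp add: A.r_distr clinear_add[OF F_linear[OF psi(1)]])
    qed
  next
    case (add a a')
    then show ?case using F_closed by (simp add: A.l_distr clinear_add[OF F_linear[OF psi(1)]])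
  qed
  ultimately show "graded_auto ?F" using g inv by (auto simp: graded_auto_def)
qed

end

section \<open>A quantum torus\<close>

lemma additive_ext:
  fixes f g :: "('x \<Rightarrow>\<^sub>0 'c::ab_group_add) \<Rightarrow> 'd::ab_group_add"
  assumes "\<And>s t. f (s + t) = f s + f t" "\<And>s t. g (s + t) = g s + g t"
    and "\<And>k c. f (Poly_Mapping.single k c) = g (Poly_Mapping.single k c)"
  shows "f s = g s"
proof -
  have z: "f 0 = 0" "g 0 = 0" using assms(1)[of 0 0] assms(2)[of 0 0] by auto
  have "f (\<Sum>x\<in>S. Poly_Mapping.single x (h x)) = g (\<Sum>x\<in>S. Poly_Mapping.single x (h x))" for S h
    by (induction S rule: infinite_finite_induct) (auto simp: z assms)
  then show ?thesis using sum_single_lookup[of s] by metis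
qed

type_synonym qindex = "nat \<Rightarrow>\<^sub>0 int"
type_synonym torus = "qindex \<Rightarrow>\<^sub>0 complex"

abbreviation mon :: "qindex \<Rightarrow> torus" where "mon e \<equiv> Poly_Mapping.single e 1"

text \<open>
  The exponent of \<open>z\<^sub>j\<close> sits at position \<open>2 * j\<close> of an index and that of
  \<open>x\<^sub>k = \<Sum>j\<le>k. z\<^sub>j z\<^sub>j\<^sup>*\<close>, for \<open>k < n\<close>, at position \<open>2 * k + 1\<close>; there is no \<open>x\<^sub>n\<close> because it equals \<open>1\<close>.
\<close>

definition zpart :: "qindex \<Rightarrow> nat \<Rightarrow> int" where "zpart g j = Poly_Mapping.lookup g (2 * j)"
definition xpart :: "qindex \<Rightarrow> nat \<Rightarrow> int" where "xpart g k = Poly_Mapping.lookup g (2 * k + 1)"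

lemma part_add [simp]: "zpart (g + h) j = zpart g j + zpart h j" "xpart (g + h) k = xpart g k + xpart h k"
  and part_diff [simp]: "zpart (g - h) j = zpart g j - zpart h j" "xpart (g - h) k = xpart g k - xpart h k"
  and part_uminus [simp]: "zpart (- g) j = - zpart g j" "xpart (- g) k = - xpart g k"
  and part_zero [simp]: "zpart 0 j = 0" "xpart 0 k = 0"
  by (simp_all add: zpart_def xpart_def lookup_add lookup_minus)

lemma index_eqI:
  assumes "\<And>j. zpart g j = zpart h j" "\<And>k. xpart g k = xpart h k" shows "g = h"
proof (rule poly_mapping_eqI)
  fix k show "Poly_Mapping.lookup g k = Poly_Mapping.lookup h k"
    using assms(1)[of "k div 2"] assms(2)[of "k div 2"] by (cases "even k") (auto simp: zpart_def xpart_def)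
qed

locale qtorus =
  fixes n :: nat and q :: real
  assumes n_pos: "n \<ge> 1" and q_pos: "0 < q" and q_less: "q < 1"
begin

definition qp :: "int \<Rightarrow> complex" where "qp k = complex_of_real (q powi k)"

lemma qp_0 [simp]: "qp 0 = 1" and qp_1: "qp 1 = q"
  and qp_add: "qp (a + b) = qp a * qp b" and qp_nonzero [simp]: "qp a \<noteq> 0"
  and qp_uminus: "qp (- a) = inverse (qp a)"
  using q_pos by (auto simp: qp_def power_int_add power_int_minus)

lemma qp_2: "qp 2 = complex_of_real q ^ 2"
  using qp_add[of 1 1] by (simp add: qp_1 power2_eq_square)

text \<open>As q lies strictly between 0 and 1, it is no root of unity. Hence the exponents of
  commutation factors can be compared instead of the factors.\<close>

lemma qp_eq_1: "qp a = 1 \<longleftrightarrow> a = 0"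
proof
  assume "qp a = 1"
  then have 1: "q powi a = 1" unfolding qp_def of_real_eq_1_iff .
  have *: "q ^ m = 1 \<longleftrightarrow> m = 0" for m
    using power_less_one_iff[of q m] q_pos q_less by (cases m) (auto simp: power_Suc_less_one less_le)
  show "a = 0"
  proof (cases "a \<ge> 0")
    case True then show ?thesis using 1 * by (auto simp: power_int_def)
  next
    case False then show ?thesis using 1 *[of "nat (- a)"] by (auto simp: power_int_def power_inverse)
  qed
qed simp

lemma qp_inj: "qp a = qp b \<longleftrightarrow> a = b"
  using qp_eq_1[of "a - b"] qp_add[of "a - b" b] by auto

text \<open>The commutation exponents: \<open>u\<^sup>g u\<^sup>h = q\<^bsup>om g (zpart h)\<^esup> u\<^bsup>g + h\<^esup>\<close>.\<close>

definition om :: "qindex \<Rightarrow> (nat \<Rightarrow> int) \<Rightarrow> int"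
  where "om g m = (\<Sum>j=1..n. (\<Sum>i=1..<j. zpart g i + 2 * xpart g i) * m j)"

lemma om_add_left: "om (g + h) m = om g m + om h m"
  by (simp add: om_def sum.distrib algebra_simps)

lemma om_add_right: "om g (\<lambda>j. m j + m' j) = om g m + om g m'"
  by (simp add: om_def sum.distrib algebra_simps)

lemma om_uminus_left: "om (- g) m = - om g m"
  using om_add_left[of g "- g" m] by (simp add: om_def)

lemma om_zero [simp]: "om 0 m = 0" "om g (\<lambda>_. 0) = 0" "om g (zpart 0) = 0"
  by (simp_all add: om_def)

lemma om_diff_left: "om (g - h) m = om g m - om h m"
  using om_add_left[of g "- h" m] by (simp add: om_uminus_left)

lemma om_zpart_add: "om g (zpart (h + k)) = om g (zpart h) + om g (zpart k)"
  using om_add_right[of g "zpart h" "zpart k"] by (simp add: fun_eq_iff flip: part_add)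

lemma om_zpart_diff: "om g (zpart (h - k)) = om g (zpart h) - om g (zpart k)"
  using om_zpart_add[of g "h - k" k] by simp

lemma om_zpart_uminus: "om g (zpart (- h)) = - om g (zpart h)"
  using om_zpart_add[of g h "- h"] by simp

lemmas om_simps = om_add_left om_uminus_left om_diff_left om_zpart_add om_zpart_diff om_zpart_uminus

text \<open>The group algebra of the exponents twisted by a bicharacter. Its values encode z_i z_j =
  q z_j z_i and x_i z_j = q^2 z_j x_i for i < j; all other pairs of generators commute.\<close>

definition tmul :: "torus \<Rightarrow> torus \<Rightarrow> torus" (infixl \<open>\<star>\<close> 70)
  where "s \<star> t = (\<Sum>g\<in>Poly_Mapping.keys s. \<Sum>h\<in>Poly_Mapping.keys t.
    Poly_Mapping.single (g + h) (Poly_Mapping.lookup s g * Poly_Mapping.lookup t h * qp (om g (zpart h))))"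

lemma tmul_superset:
  assumes "finite S" "finite D" "Poly_Mapping.keys s \<subseteq> S" "Poly_Mapping.keys t \<subseteq> D"
  shows "s \<star> t = (\<Sum>g\<in>S. \<Sum>h\<in>D.
    Poly_Mapping.single (g + h) (Poly_Mapping.lookup s g * Poly_Mapping.lookup t h * qp (om g (zpart h))))"
proof -
  have "(\<Sum>h\<in>Poly_Mapping.keys t.
      Poly_Mapping.single (g + h) (Poly_Mapping.lookup s g * Poly_Mapping.lookup t h * qp (om g (zpart h)))) =
    (\<Sum>h\<in>D. Poly_Mapping.single (g + h) (Poly_Mapping.lookup s g * Poly_Mapping.lookup t h * qp (om g (zpart h))))" for g
    using assms by (intro sum.mono_neutral_left) (auto simp: in_keys_iff)
  then show ?thesis
    unfolding tmul_def using assms by (auto simp: in_keys_iff intro!: sum.mono_neutral_left)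
qed

lemma tmul_add_left: "(s + s') \<star> t = s \<star> t + s' \<star> t"
proof -
  let ?S = "Poly_Mapping.keys s \<union> Poly_Mapping.keys s'" and ?D = "Poly_Mapping.keys t"
  have k: "Poly_Mapping.keys (s + s') \<subseteq> ?S" by (rule Poly_Mapping.keys_add)
  show ?thesis
    by (simp add: tmul_superset[of ?S ?D] k lookup_add distrib_right single_add sum.distrib)
qed

lemma tmul_add_right: "s \<star> (t + t') = s \<star> t + s \<star> t'"
proof -
  let ?D = "Poly_Mapping.keys t \<union> Poly_Mapping.keys t'" and ?S = "Poly_Mapping.keys s"
  have k: "Poly_Mapping.keys (t + t') \<subseteq> ?D" by (rule Poly_Mapping.keys_add)
  show ?thesis
    by (simp add: tmul_superset[of ?S ?D] k lookup_add distrib_right distrib_left single_add sum.distrib)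
qed

lemma tmul_zero [simp]: "0 \<star> t = 0" "s \<star> 0 = 0"
  by (simp_all add: tmul_def)

lemma tmul_uminus: "(- s) \<star> t = - (s \<star> t)" "s \<star> (- t) = - (s \<star> t)"
  using tmul_add_left[of s "- s" t] tmul_add_right[of s t "- t"] by (simp_all add: eq_neg_iff_add_eq_0 add.commute)

lemma tmul_diff_left: "(s - s') \<star> t = s \<star> t - s' \<star> t"
  and tmul_diff_right: "s \<star> (t - t') = s \<star> t - s \<star> t'"
  using tmul_add_left[of s "- s'" t] tmul_add_right[of s t "- t'"] by (simp_all add: tmul_uminus)

lemma tmul_single:
  "Poly_Mapping.single g a \<star> Poly_Mapping.single h b = Poly_Mapping.single (g + h) (a * b * qp (om g (zpart h)))"
  by (cases "a = 0"; cases "b = 0") (simp_all add: tmul_def)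

lemma tmul_fscale: "fscale c s \<star> t = fscale c (s \<star> t)" "s \<star> fscale c t = fscale c (s \<star> t)"
proof -
  have 1: "Poly_Mapping.single k a \<star> fscale c t = fscale c (Poly_Mapping.single k a \<star> t)" for k a t
    by (rule additive_ext[of "\<lambda>t. Poly_Mapping.single k a \<star> fscale c t"])
      (simp_all add: fvs.scale_right_distrib tmul_add_right fscale_single tmul_single mult_ac)
  show "s \<star> fscale c t = fscale c (s \<star> t)"
    by (rule additive_ext[of "\<lambda>s. s \<star> fscale c t"]) (simp_all add: fvs.scale_right_distrib tmul_add_left 1)
  have 2: "fscale c s \<star> Poly_Mapping.single k a = fscale c (s \<star> Poly_Mapping.single k a)" for k a s
    by (rule additive_ext[of "\<lambda>s. fscale c s \<star> Poly_Mapping.single k a"])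
      (simp_all add: fvs.scale_right_distrib tmul_add_left fscale_single tmul_single mult_ac)
  show "fscale c s \<star> t = fscale c (s \<star> t)"
    by (rule additive_ext[of "\<lambda>t. fscale c s \<star> t"]) (simp_all add: fvs.scale_right_distrib tmul_add_right 2)
qed

text \<open>Both sides are additive in each argument, and on monomials the identity is the
  additivity of \<open>om\<close> in both arguments.\<close>

lemma tmul_assoc: "(s \<star> t) \<star> u = s \<star> (t \<star> u)"
proof -
  have 1: "(Poly_Mapping.single g a \<star> Poly_Mapping.single h b) \<star> u = Poly_Mapping.single g a \<star> (Poly_Mapping.single h b \<star> u)" for g h a b u
    by (rule additive_ext[of "\<lambda>u. (Poly_Mapping.single g a \<star> Poly_Mapping.single h b) \<star> u"])
      (simp_all add: tmul_add_right tmul_single om_simps qp_add add_ac mult_ac)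
  have 2: "(Poly_Mapping.single g a \<star> t) \<star> u = Poly_Mapping.single g a \<star> (t \<star> u)" for g a t u
    by (rule additive_ext[of "\<lambda>t. (Poly_Mapping.single g a \<star> t) \<star> u"])
      (simp_all add: tmul_add_right tmul_add_left 1)
  show ?thesis
    by (rule additive_ext[of "\<lambda>s. (s \<star> t) \<star> u"]) (simp_all add: tmul_add_left 2)
qed

lemma tmul_one [simp]: "1 \<star> t = t" "t \<star> 1 = t"
proof -
  show "1 \<star> t = t"
    by (rule additive_ext[of "\<lambda>t. 1 \<star> t"]) (simp_all add: tmul_add_right tmul_single flip: single_one)
  show "t \<star> 1 = t"
    by (rule additive_ext[of "\<lambda>t. t \<star> 1"]) (simp_all add: tmul_add_left tmul_single flip: single_one)
qed

lemma lookup_single_tmul: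
  "Poly_Mapping.lookup (Poly_Mapping.single e c \<star> t) (e + g) = c * Poly_Mapping.lookup t g * qp (om e (zpart g))"
  by (rule additive_ext[of "\<lambda>t. Poly_Mapping.lookup (Poly_Mapping.single e c \<star> t) (e + g)"])
    (auto simp: tmul_add_right lookup_add tmul_single lookup_single when_def algebra_simps)

lemma lookup_tmul_single:
  "Poly_Mapping.lookup (t \<star> Poly_Mapping.single e c) (g + e) = c * Poly_Mapping.lookup t g * qp (om g (zpart e))"
  by (rule additive_ext[of "\<lambda>t. Poly_Mapping.lookup (t \<star> Poly_Mapping.single e c) (g + e)"])
    (auto simp: tmul_add_left lookup_add tmul_single lookup_single when_def algebra_simps)

lemma keys_tmul:
  "Poly_Mapping.keys (s \<star> t) \<subseteq> {g + h | g h. g \<in> Poly_Mapping.keys s \<and> h \<in> Poly_Mapping.keys t}"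
proof
  fix e assume "e \<in> Poly_Mapping.keys (s \<star> t)"
  then have "Poly_Mapping.lookup (s \<star> t) e \<noteq> 0" by (simp add: in_keys_iff)
  then have "(\<Sum>g\<in>Poly_Mapping.keys s. \<Sum>h\<in>Poly_Mapping.keys t.
    (Poly_Mapping.lookup s g * Poly_Mapping.lookup t h * qp (om g (zpart h))) when (g + h = e)) \<noteq> 0"
    by (simp add: tmul_def lookup_sum lookup_single)
  then obtain g where g: "g \<in> Poly_Mapping.keys s" "(\<Sum>h\<in>Poly_Mapping.keys t.
    (Poly_Mapping.lookup s g * Poly_Mapping.lookup t h * qp (om g (zpart h))) when (g + h = e)) \<noteq> 0"
    by (meson sum.not_neutral_contains_not_neutral)
  then obtain h where "h \<in> Poly_Mapping.keys t" "g + h = e"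
    by (metis (mono_tags, lifting) sum.not_neutral_contains_not_neutral when_neq_zero)
  then show "e \<in> {g + h | g h. g \<in> Poly_Mapping.keys s \<and> h \<in> Poly_Mapping.keys t}" using g by blast
qed

section \<open>Leading and lowest terms\<close>

lemma lookup_tmul_unique:
  assumes "\<And>g h. g \<in> Poly_Mapping.keys s \<Longrightarrow> h \<in> Poly_Mapping.keys t \<Longrightarrow> g + h = g0 + h0 \<Longrightarrow> g = g0"
    and "g0 \<in> Poly_Mapping.keys s" "h0 \<in> Poly_Mapping.keys t"
  shows "Poly_Mapping.lookup (s \<star> t) (g0 + h0) =
    Poly_Mapping.lookup s g0 * Poly_Mapping.lookup t h0 * qp (om g0 (zpart h0))"
proof -
  let ?c = "\<lambda>g h. Poly_Mapping.lookup s g * Poly_Mapping.lookup t h * qp (om g (zpart h))"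
  have "Poly_Mapping.lookup (s \<star> t) (g0 + h0) =
      (\<Sum>g\<in>Poly_Mapping.keys s. \<Sum>h\<in>Poly_Mapping.keys t. ?c g h when (g + h = g0 + h0))"
    by (simp add: tmul_def lookup_sum lookup_single)
  also have "\<dots> = (\<Sum>g\<in>{g0}. \<Sum>h\<in>Poly_Mapping.keys t. ?c g h when (g + h = g0 + h0))"
  proof (rule sum.mono_neutral_right)
    show "\<forall>g\<in>Poly_Mapping.keys s - {g0}. (\<Sum>h\<in>Poly_Mapping.keys t. ?c g h when (g + h = g0 + h0)) = 0"
      using assms(1) by (auto simp: when_def intro!: sum.neutral)
  qed (use assms in auto)
  also have "\<dots> = (\<Sum>h\<in>Poly_Mapping.keys t. ?c g0 h when (g0 + h = g0 + h0))" by simp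
  also have "\<dots> = (\<Sum>h\<in>{h0}. ?c g0 h when (g0 + h = g0 + h0))"
    by (rule sum.mono_neutral_right) (use assms in auto)
  finally show ?thesis by simp
qed

text \<open>The order of the exponents is lexicographic, hence linear and translation invariant. So
  extreme exponents add under multiplication, the torus has no zero divisors, and an element whose
  two extremes agree is a monomial.\<close>

definition "lead t = Max (Poly_Mapping.keys (t :: torus))"
definition "low t = Min (Poly_Mapping.keys (t :: torus))"

lemma lead_in: "t \<noteq> 0 \<Longrightarrow> lead t \<in> Poly_Mapping.keys t" and low_in: "t \<noteq> 0 \<Longrightarrow> low t \<in> Poly_Mapping.keys t"
  by (simp_all add: lead_def low_def)

lemma lead_ge: "g \<in> Poly_Mapping.keys t \<Longrightarrow> g \<le> lead t" and low_le: "g \<in> Poly_Mapping.keys t \<Longrightarrow> low t \<le> g"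
  by (simp_all add: lead_def low_def)

text \<open>By monotonicity of addition, g + h reaches the sum of the extremes only if g and h are
  themselves extreme, so this coefficient comes from a single pair of terms.\<close>

lemma lead_mult_lookup:
  assumes "s \<noteq> 0" "t \<noteq> 0"
  shows "Poly_Mapping.lookup (s \<star> t) (lead s + lead t) \<noteq> 0"
    "Poly_Mapping.lookup (s \<star> t) (low s + low t) \<noteq> 0"
proof -
  have "Poly_Mapping.lookup (s \<star> t) (lead s + lead t) =
      Poly_Mapping.lookup s (lead s) * Poly_Mapping.lookup t (lead t) * qp (om (lead s) (zpart (lead t)))"
    by (rule lookup_tmul_unique)
      (use assms lead_in in \<open>auto dest!: lead_ge simp: antisym_conv dest: add_less_le_mono add_le_less_mono\<close>,
       metis add_less_le_mono less_irrefl order_le_imp_less_or_eq)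
  then show "Poly_Mapping.lookup (s \<star> t) (lead s + lead t) \<noteq> 0"
    using lead_in assms by (simp add: in_keys_iff)
  have "Poly_Mapping.lookup (s \<star> t) (low s + low t) =
      Poly_Mapping.lookup s (low s) * Poly_Mapping.lookup t (low t) * qp (om (low s) (zpart (low t)))"
    by (rule lookup_tmul_unique)
      (use assms low_in in \<open>auto dest!: low_le\<close>,
       metis add_less_le_mono less_irrefl order_le_imp_less_or_eq)
  then show "Poly_Mapping.lookup (s \<star> t) (low s + low t) \<noteq> 0"
    using low_in assms by (simp add: in_keys_iff)
qed

lemma tmul_nonzero: "s \<noteq> 0 \<Longrightarrow> t \<noteq> 0 \<Longrightarrow> s \<star> t \<noteq> 0"
  using lead_mult_lookup(1)[of s t] by auto

lemma lead_mult: assumes "s \<noteq> 0" "t \<noteq> 0" shows "lead (s \<star> t) = lead s + lead t"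
  unfolding lead_def[of "s \<star> t"]
proof (rule Max_eqI)
  show "lead s + lead t \<in> Poly_Mapping.keys (s \<star> t)" using lead_mult_lookup assms by (simp add: in_keys_iff)
  fix e assume "e \<in> Poly_Mapping.keys (s \<star> t)"
  then show "e \<le> lead s + lead t" using keys_tmul by (auto intro!: add_mono lead_ge)
qed simp

lemma low_mult: assumes "s \<noteq> 0" "t \<noteq> 0" shows "low (s \<star> t) = low s + low t"
  unfolding low_def[of "s \<star> t"]
proof (rule Min_eqI)
  show "low s + low t \<in> Poly_Mapping.keys (s \<star> t)" using lead_mult_lookup assms by (simp add: in_keys_iff)
  fix e assume "e \<in> Poly_Mapping.keys (s \<star> t)"
  then show "low s + low t \<le> e" using keys_tmul by (auto intro!: add_mono low_le)
qed simp

lemma lead_single [simp]: "c \<noteq> 0 \<Longrightarrow> lead (Poly_Mapping.single e c) = e"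
  and low_single [simp]: "c \<noteq> 0 \<Longrightarrow> low (Poly_Mapping.single e c) = e"
  by (simp_all add: lead_def low_def)

lemma lead_eq_low: assumes "t \<noteq> 0" "lead t = low t" shows "t = Poly_Mapping.single (lead t) (Poly_Mapping.lookup t (lead t))"
proof (rule poly_mapping_eqI)
  fix g show "Poly_Mapping.lookup t g = Poly_Mapping.lookup (Poly_Mapping.single (lead t) (Poly_Mapping.lookup t (lead t))) g"
    using lead_ge[of g t] low_le[of g t] assms by (cases "g \<in> Poly_Mapping.keys t") (auto simp: in_keys_iff lookup_single when_def)
qed

text \<open>
  The matrix coefficients of the module on which \<open>u\<^sup>g\<close> acts by
  \<open>|m\<rangle> \<mapsto> q\<^bsup>om g m\<^esup> |m + zpart g\<rangle>\<close>: the coefficient of \<open>|m + a\<rangle>\<close> in \<open>t |m\<rangle>\<close>.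
\<close>

definition coef :: "torus \<Rightarrow> (nat \<Rightarrow> int) \<Rightarrow> (nat \<Rightarrow> int) \<Rightarrow> complex"
  where "coef t m a = (\<Sum>g\<in>Poly_Mapping.keys t. if zpart g = a then Poly_Mapping.lookup t g * qp (om g m) else 0)"

lemma coef_superset:
  "finite S \<Longrightarrow> Poly_Mapping.keys t \<subseteq> S \<Longrightarrow>
    coef t m a = (\<Sum>g\<in>S. if zpart g = a then Poly_Mapping.lookup t g * qp (om g m) else 0)"
  unfolding coef_def by (intro sum.mono_neutral_left) (auto simp: in_keys_iff)

lemma coef_add: "coef (s + t) m a = coef s m a + coef t m a"
proof -
  let ?S = "Poly_Mapping.keys s \<union> Poly_Mapping.keys t"
  have "Poly_Mapping.keys (s + t) \<subseteq> ?S" by (rule Poly_Mapping.keys_add)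
  then show ?thesis
    by (simp add: coef_superset[of ?S] lookup_add distrib_right flip: sum.distrib) (intro sum.cong; simp add: lookup_add distrib_right)
qed

lemma coef_single: "coef (Poly_Mapping.single g c) m a = (if zpart g = a then c * qp (om g m) else 0)"
  by (cases "c = 0") (simp_all add: coef_def)

lemma coef_zero [simp]: "coef 0 m a = 0" by (simp add: coef_def)

lemma coef_diff: "coef (s - t) m a = coef s m a - coef t m a"
  using coef_add[of "s - t" t m a] by simp

lemma coef_fscale: "coef (fscale c t) m a = c * coef t m a"
  by (rule additive_ext[of "\<lambda>t. coef (fscale c t) m a"])
    (simp_all add: coef_add fvs.scale_right_distrib distrib_left fscale_single coef_single)

text \<open>The monomial acts after \<open>t\<close>: it meets the weight m + a - zpart e and shifts
  it by zpart e.\<close>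

lemma coef_single_tmul:
  "coef (Poly_Mapping.single e c \<star> t) m a = c * qp (om e (\<lambda>j. m j + a j - zpart e j)) * coef t m (\<lambda>j. a j - zpart e j)"
proof (rule additive_ext[of "\<lambda>t. coef (Poly_Mapping.single e c \<star> t) m a"])
  fix h b
  show "coef (Poly_Mapping.single e c \<star> Poly_Mapping.single h b) m a =
    c * qp (om e (\<lambda>j. m j + a j - zpart e j)) * coef (Poly_Mapping.single h b) m (\<lambda>j. a j - zpart e j)"
  proof (cases "zpart (e + h) = a")
    case True
    then have "a = (\<lambda>j. zpart e j + zpart h j)" by (auto simp: fun_eq_iff)
    then show ?thesis
      by (simp add: tmul_single coef_single om_simps om_add_right qp_add fun_eq_iff)
  next
    case False
    then have "zpart h \<noteq> (\<lambda>j. a j - zpart e j)" by (metis ext add.commute diff_add_cancel part_add(1))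
    then show ?thesis using False by (simp add: tmul_single coef_single)
  qed
qed (simp_all add: tmul_add_right coef_add distrib_left)

text \<open>
  Invariance of the span of the \<open>|m\<rangle>\<close> with \<open>m i \<ge> 0\<close> for \<open>2 \<le> i\<close>. The elements \<open>z\<^sub>i\<^sup>*\<close> have it although
  they involve \<open>z\<^sub>i\<^sup>-\<^sup>1\<close>, because \<open>x\<^sub>i - x\<^sub>i\<^sub>-\<^sub>1\<close> kills every \<open>|m\<rangle>\<close> with \<open>m i = 0\<close>.
\<close>

definition preserves_positive :: "torus \<Rightarrow> bool"
  where "preserves_positive t \<longleftrightarrow> (\<forall>m a. (\<forall>i\<in>{2..n}. m i \<ge> 0) \<longrightarrow> (\<exists>i\<in>{2..n}. m i + a i < 0) \<longrightarrow> coef t m a = 0)"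

section \<open>The images of the generators and their relations\<close>

definition zc :: "nat \<Rightarrow> qindex" where "zc j = Poly_Mapping.single (2 * j) 1"
definition xc :: "nat \<Rightarrow> qindex" where "xc k = (if k < n then Poly_Mapping.single (2 * k + 1) 1 else 0)"

lemma part_zc [simp]: "zpart (zc j) i = (if i = j then 1 else 0)" "xpart (zc j) i = 0"
  by (auto simp: zpart_def xpart_def zc_def lookup_single when_def) presburger

lemma part_xc [simp]: "zpart (xc k) i = 0" "xpart (xc k) i = (if i = k \<and> k < n then 1 else 0)"
  by (auto simp: zpart_def xpart_def xc_def lookup_single when_def) presburger

lemma om_zc: "i \<ge> 1 \<Longrightarrow> om (zc i) m = (\<Sum>j\<in>{i<..n}. m j)"
proof -
  assume "i \<ge> 1"
  then have "om (zc i) m = (\<Sum>j=1..n. if i < j then m j else 0)"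
    by (auto simp: om_def sum.delta' intro!: sum.cong)
  also have "\<dots> = (\<Sum>j\<in>{j\<in>{1..n}. i < j}. m j)" by (rule sum.inter_filter[symmetric]) simp
  also have "{j\<in>{1..n}. i < j} = {i<..n}" using \<open>i \<ge> 1\<close> by auto
  finally show ?thesis .
qed

lemma om_xc: "k \<ge> 1 \<Longrightarrow> om (xc k) m = 2 * (\<Sum>j\<in>{k<..n}. m j)"
proof -
  assume k: "k \<ge> 1"
  have "om (xc k) m = (\<Sum>j=1..n. if k < j then 2 * m j else 0)"
    using k by (auto simp: om_def sum.delta' intro!: sum.cong simp flip: sum_distrib_left)
  also have "\<dots> = (\<Sum>j\<in>{j\<in>{1..n}. k < j}. 2 * m j)" by (rule sum.inter_filter[symmetric]) simp
  also have "{j\<in>{1..n}. k < j} = {k<..n}" using k by auto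
  finally show ?thesis by (simp add: sum_distrib_left)
qed

lemma om_zc_zc: "i \<ge> 1 \<Longrightarrow> j \<le> n \<Longrightarrow> om (zc i) (zpart (zc j)) = (if i < j then 1 else 0)"
  by (simp add: om_zc sum.delta')

lemma om_xc_zc: "k \<ge> 1 \<Longrightarrow> j \<le> n \<Longrightarrow> om (xc k) (zpart (zc j)) = (if k < j then 2 else 0)"
  by (simp add: om_xc sum.delta')

lemma om_xc_right [simp]: "om g (zpart (xc k)) = 0"
  by (simp add: om_def)

text \<open>The image of \<open>x\<^sub>k\<close>; the junk value \<open>k = 0\<close> stands for the empty sum.\<close>

definition X :: "nat \<Rightarrow> torus" where "X k = (if k = 0 then 0 else mon (xc k))"

definition gimg :: "gen \<Rightarrow> torus"
  where "gimg g = (case g of Z j \<Rightarrow> mon (zc j) | Zstar j \<Rightarrow> mon (- zc j) \<star> (X j - X (j - 1)))"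

lemma X_n [simp]: "X n = 1" using n_pos by (simp add: X_def xc_def)

lemma X_zc: "j \<le> n \<Longrightarrow> X k \<star> mon (zc j) = fscale (qp (if k < j then 2 else 0)) (mon (zc j) \<star> X k)"
  "j \<le> n \<Longrightarrow> X k \<star> mon (- zc j) = fscale (qp (if k < j then - 2 else 0)) (mon (- zc j) \<star> X k)"
  by (auto simp: X_def tmul_single om_simps om_xc_zc fscale_single add.commute)

lemma zc_inv [simp]: "j \<ge> 1 \<Longrightarrow> j \<le> n \<Longrightarrow> mon (zc j) \<star> mon (- zc j) = 1"
  "j \<ge> 1 \<Longrightarrow> j \<le> n \<Longrightarrow> mon (- zc j) \<star> mon (zc j) = 1"
  by (simp_all add: tmul_single om_simps om_zc_zc)

lemma zc_zc: "i \<ge> 1 \<Longrightarrow> i < j \<Longrightarrow> j \<le> n \<Longrightarrow> mon (zc i) \<star> mon (zc j) = fscale q (mon (zc j) \<star> mon (zc i))"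
  by (simp add: tmul_single om_simps om_zc_zc fscale_single qp_1 add.commute)

lemma gimg_Z_Zstar: "j \<ge> 1 \<Longrightarrow> j \<le> n \<Longrightarrow> gimg (Z j) \<star> gimg (Zstar j) = X j - X (j - 1)"
  by (simp add: gimg_def flip: tmul_assoc)

lemma gimg_Zstar_Z: "j \<ge> 1 \<Longrightarrow> j \<le> n \<Longrightarrow> gimg (Zstar j) \<star> gimg (Z j) = X j - fscale (q\<^sup>2) (X (j - 1))"
  by (simp add: gimg_def tmul_assoc tmul_diff_left tmul_diff_right X_zc qp_2 tmul_fscale)
    (simp add: tmul_diff_left tmul_diff_right flip: tmul_assoc)

lemma gimg_Zstar_Z':
  assumes "i \<ge> 1" "j \<ge> 1" "i \<le> n" "j \<le> n" "i \<noteq> j"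
  shows "gimg (Zstar i) \<star> gimg (Z j) = fscale q (gimg (Z j) \<star> gimg (Zstar i))"
proof -
  let ?c = "qp (if i < j then 2 else 0)"
  have X: "(X i - X (i - 1)) \<star> mon (zc j) = fscale ?c (mon (zc j) \<star> (X i - X (i - 1)))"
    using assms by (auto simp: tmul_diff_left tmul_diff_right X_zc fvs.scale_right_diff_distrib)
  \<comment> \<open>For i < j the factor q^2 from moving x_i - x_{i-1} past z_j combines with q^{-1}
    from the inverse of z_i; for i > j the inverse of z_i alone contributes q.\<close>
  have z: "fscale ?c (mon (- zc i) \<star> mon (zc j)) = fscale q (mon (zc j) \<star> mon (- zc i))"
  proof -
    have "complex_of_real q * qp (- 1) = 1" "qp 2 * qp (- 1) = complex_of_real q"
      using qp_add[of 1 "-1"] qp_add[of 2 "-1"] by (simp_all add: qp_1)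
    then show ?thesis using assms by (auto simp: tmul_single om_simps om_zc_zc fscale_single add.commute)
  qed
  show ?thesis
  proof -
    have "gimg (Zstar i) \<star> gimg (Z j) = fscale ?c (mon (- zc i) \<star> mon (zc j)) \<star> (X i - X (i - 1))"
      unfolding gimg_def gen.case by (simp only: tmul_assoc X tmul_fscale)
    also have "\<dots> = fscale q (gimg (Z j) \<star> gimg (Zstar i))"
      unfolding gimg_def gen.case by (simp only: z tmul_assoc tmul_fscale)
    finally show ?thesis .
  qed
qed

lemma gimg_Zstar_Zstar:
  assumes "i \<ge> 1" "i < j" "j \<le> n"
  shows "gimg (Zstar j) \<star> gimg (Zstar i) = fscale q (gimg (Zstar i) \<star> gimg (Zstar j))"
proof -
  let ?X = "\<lambda>i. X i - X (i - 1)"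
  have X1: "?X j \<star> mon (- zc i) = mon (- zc i) \<star> ?X j"
    using assms by (auto simp: tmul_diff_left tmul_diff_right X_zc)
  have X2: "?X i \<star> mon (- zc j) = fscale (qp (-2)) (mon (- zc j) \<star> ?X i)"
    using assms by (auto simp: tmul_diff_left tmul_diff_right X_zc fvs.scale_right_diff_distrib)
  have XX: "?X i \<star> ?X j = ?X j \<star> ?X i"
    by (auto simp: X_def tmul_diff_left tmul_diff_right tmul_single add.commute)
  have z: "mon (- zc i) \<star> mon (- zc j) = fscale q (mon (- zc j) \<star> mon (- zc i))"
    using assms by (auto simp: tmul_single om_simps om_zc_zc fscale_single add.commute qp_1)
  have "gimg (Zstar j) \<star> gimg (Zstar i) = mon (- zc j) \<star> (?X j \<star> mon (- zc i)) \<star> ?X i"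
    by (simp add: gimg_def tmul_assoc)
  also have "\<dots> = mon (- zc j) \<star> mon (- zc i) \<star> (?X j \<star> ?X i)" by (simp only: X1 tmul_assoc)
  finally have 1: "gimg (Zstar j) \<star> gimg (Zstar i) = mon (- zc j) \<star> mon (- zc i) \<star> (?X j \<star> ?X i)" .
  have "gimg (Zstar i) \<star> gimg (Zstar j) = mon (- zc i) \<star> (?X i \<star> mon (- zc j)) \<star> ?X j"
    by (simp add: gimg_def tmul_assoc)
  also have "\<dots> = fscale (qp (-2) * q) (mon (- zc j) \<star> mon (- zc i) \<star> (?X j \<star> ?X i))"
  proof -
    have "mon (- zc i) \<star> (?X i \<star> mon (- zc j)) \<star> ?X j
        = fscale (qp (-2)) ((mon (- zc i) \<star> mon (- zc j)) \<star> (?X i \<star> ?X j))"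
      by (simp only: X2 tmul_fscale tmul_assoc)
    then show ?thesis by (simp only: z XX tmul_fscale fvs.scale_scale)
  qed
  also have "fscale q \<dots> = mon (- zc j) \<star> mon (- zc i) \<star> (?X j \<star> ?X i)"
    using qp_2 q_pos by (simp add: qp_uminus power2_eq_square field_simps)
  finally show ?thesis using 1 by simp
qed

lemma sum_gimg: "k \<le> n \<Longrightarrow> (\<Sum>j=1..k. gimg (Z j) \<star> gimg (Zstar j)) = X k"
  by (induction k) (simp_all add: gimg_Z_Zstar X_def)

text \<open>Positions 2 to 2 n hold z_1, ..., z_n and x_1, ..., x_{n-1}. The last condition says
  that a negative power of z_1 is paid for by x_1, as in z_1^* = z_1^{-1} x_1. For n = 1 it is void
  because x_1 = 1 leaves no trace in the exponent.\<close>

definition cone :: "qindex \<Rightarrow> bool"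
  where "cone g \<longleftrightarrow> Poly_Mapping.keys g \<subseteq> {2..2 * n} \<and> (\<forall>k. xpart g k \<ge> 0) \<and> (n \<ge> 2 \<longrightarrow> zpart g 1 + xpart g 1 \<ge> 0)"

lemma cone_add: "cone g \<Longrightarrow> cone h \<Longrightarrow> cone (g + h)"
  using Poly_Mapping.keys_add[of g h] by (auto simp: cone_def)

lemma cone_gimg:
  assumes "g \<in> sphere_gens n" "e \<in> Poly_Mapping.keys (gimg g)" shows "cone e"
proof -
  have zc: "Poly_Mapping.keys (zc j) \<subseteq> {2..2 * n}" if "j \<in> {1..n}" for j
    using that by (auto simp: zc_def)
  have xc: "Poly_Mapping.keys (xc k) \<subseteq> {2..2 * n}" if "k \<ge> 1" for k
    using that by (auto simp: xc_def)
  show ?thesis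
  proof (cases g)
    case (Z j)
    then have "e = zc j" "j \<in> {1..n}" using assms by (auto simp: gimg_def sphere_gens_def)
    then show ?thesis using zc by (simp add: cone_def)
  next
    case (Zstar j)
    then have j: "j \<in> {1..n}" using assms by (auto simp: sphere_gens_def)
    have "gimg g = mon (- zc j + xc j) - (if j = 1 then 0 else mon (- zc j + xc (j - 1)))"
      using Zstar j by (auto simp: gimg_def X_def tmul_diff_right tmul_single)
    then have e: "e = - zc j + xc j \<or> j \<ge> 2 \<and> e = - zc j + xc (j - 1)"
      using assms(2) j by (auto simp: in_keys_iff lookup_minus lookup_single when_def split: if_splits)
    have k: "Poly_Mapping.keys (- zc j + xc k) \<subseteq> {2..2 * n}" if "k \<ge> 1" for k
      using zc[OF j] xc[OF that] Poly_Mapping.keys_add[of "- zc j" "xc k"] keys_minus[of "zc j"] by blast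
    have "Poly_Mapping.keys e \<subseteq> {2..2 * n}" using e
    proof
      assume "e = - zc j + xc j" then show ?thesis using k[of j] j by simp
    next
      assume e: "2 \<le> j \<and> e = - zc j + xc (j - 1)"
      then have "1 \<le> j - 1" by arith
      from k[OF this] have "Poly_Mapping.keys (- zc j + xc (j - 1)) \<subseteq> {2..2 * n}" .
      then show ?thesis using e by simp
    qed
    then show ?thesis using e j unfolding cone_def by (elim disjE conjE) simp_all
  qed
qed

lemma positive_gimg:
  assumes "g \<in> sphere_gens n" "preserves_positive t" shows "preserves_positive (gimg g \<star> t)"
  unfolding preserves_positive_def
proof (intro allI impI)
  fix m a :: "nat \<Rightarrow> int" assume m: "\<forall>i\<in>{2..n}. 0 \<le> m i" and a: "\<exists>i\<in>{2..n}. m i + a i < 0"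
  note t = assms(2)[unfolded preserves_positive_def, rule_format, of m]
  show "coef (gimg g \<star> t) m a = 0"
  proof (cases g)
    case (Z j)
    have "coef t m (\<lambda>i. a i - zpart (zc j) i) = 0" by (rule t) (use m a in force)+
    then show ?thesis using Z by (simp add: gimg_def coef_single_tmul)
  next
    case (Zstar j)
    then have j: "j \<in> {1..n}" using assms by (auto simp: sphere_gens_def)
    let ?a = "\<lambda>i. a i - zpart (- zc j) i"
    let ?M = "\<lambda>i. m i + a i - zpart (- zc j) i"
    have co: "coef (mon (- zc j) \<star> X k \<star> t) m a = qp (om (- zc j) ?M) * qp (om (xc k) ?M) * coef t m ?a"
      if "k \<ge> 1" for k
      using that
      by (simp add: X_def tmul_single coef_single_tmul om_diff_left om_uminus_left flip: qp_add tmul_assoc)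
    show ?thesis
    proof (cases "\<exists>i\<in>{2..n}. m i + ?a i < 0")
      case True
      show ?thesis
      proof -
      have "coef t m ?a = 0" by (rule t) (use True m in auto)
      then have "coef (mon (- zc j) \<star> X k \<star> t) m a = 0" for k
        using co[of k] by (cases "k = 0") (auto simp: X_def)
      then show ?thesis using Zstar by (simp add: gimg_def tmul_diff_left tmul_diff_right coef_diff)
      qed
    next
      case False
      then have *: "j \<ge> 2" "m j + ?a j = 0" using a by (force split: if_splits)+
      \<comment> \<open>Here the inverse of z_j would lower coordinate j from 0 to -1. On a vector
        with coordinate j equal to 0 the elements x_j and x_{j-1} have the same eigenvalue, so their
        difference annihilates it.\<close>
      have "{j - 1<..n} = insert j {j<..n}" using j * by auto
      then have "om (xc (j - 1)) ?M = om (xc j) ?M" using * by (simp add: om_xc algebra_simps)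
      then show ?thesis using Zstar * co[of j] co[of "j - 1"]
        by (simp add: gimg_def tmul_diff_left tmul_diff_right coef_diff)
    qed
  qed
qed

lemma positive_one: "preserves_positive 1"
  by (auto simp: preserves_positive_def coef_single fun_eq_iff simp flip: single_one)

lemma positive_add: "preserves_positive s \<Longrightarrow> preserves_positive t \<Longrightarrow> preserves_positive (s + t)"
  and positive_fscale: "preserves_positive t \<Longrightarrow> preserves_positive (fscale c t)"
  by (auto simp: preserves_positive_def coef_add coef_fscale)

end

section \<open>The quantum sphere as a strongly graded algebra\<close>

abbreviation word :: "'g list \<Rightarrow> ('g list \<Rightarrow>\<^sub>0 complex)" where "word w \<equiv> Poly_Mapping.single w 1"

lemma word_mult: "Poly_Mapping.single v a * Poly_Mapping.single w b = Poly_Mapping.single (v @ w) (a * b :: complex)"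
  by (simp add: mult_single plus_list_def)

lemma word_Nil: "Poly_Mapping.single [] c = fscale c 1"
  by (rule poly_mapping_eqI) (auto simp: lookup_single lookup_one when_def zero_list_def)

lemma one_word: "1 = word []"
  by (simp add: word_Nil)

lemma free_alg_simps [simp]:
  "carrier (free_alg G) = {f. Poly_Mapping.keys f \<subseteq> lists G}" "mult (free_alg G) = (*)" "one (free_alg G) = 1"
  "zero (free_alg G) = 0" "add (free_alg G) = (+)" "smult (free_alg G) = fscale"
  by (simp_all add: free_alg_def)

lemma free_mult_closed:
  assumes "Poly_Mapping.keys f \<subseteq> lists G" "Poly_Mapping.keys h \<subseteq> lists G"
  shows "Poly_Mapping.keys (f * h :: 'g list \<Rightarrow>\<^sub>0 complex) \<subseteq> lists G"
proof
  fix w assume "w \<in> Poly_Mapping.keys (f * h)"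
  then obtain a b where "w = a + b" "a \<in> Poly_Mapping.keys f" "b \<in> Poly_Mapping.keys h"
    using keys_mult[of f h] by blast
  then show "w \<in> lists G" using assms by (auto simp: plus_list_def)
qed

lemma calg_free_alg: "calg (free_alg G)"
proof -
  have neg: "Poly_Mapping.keys (- f) \<subseteq> lists G" if "Poly_Mapping.keys f \<subseteq> lists G" for f :: "'a list \<Rightarrow>\<^sub>0 complex"
    using fvs.subspace_neg[OF subspace_keys] that by blast
  have add: "Poly_Mapping.keys (f + h) \<subseteq> lists G" if "Poly_Mapping.keys f \<subseteq> lists G" "Poly_Mapping.keys h \<subseteq> lists G"
    for f h :: "'a list \<Rightarrow>\<^sub>0 complex"
    using fvs.subspace_add[OF subspace_keys] that by blast
  have sc: "Poly_Mapping.keys (fscale c f) \<subseteq> lists G" if "Poly_Mapping.keys f \<subseteq> lists G" for c and f :: "'a list \<Rightarrow>\<^sub>0 complex"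
    using fvs.subspace_scale[OF subspace_keys] that by blast
  have one: "Poly_Mapping.keys (1 :: 'a list \<Rightarrow>\<^sub>0 complex) \<subseteq> lists G" by (simp add: zero_list_def)
  have "abelian_group (free_alg G)"
  proof (rule abelian_groupI)
    fix f assume "f \<in> carrier (free_alg G)"
    then have "- f \<in> carrier (free_alg G)" "- f \<oplus>\<^bsub>free_alg G\<^esub> f = \<zero>\<^bsub>free_alg G\<^esub>" using neg by auto
    then show "\<exists>y\<in>carrier (free_alg G). y \<oplus>\<^bsub>free_alg G\<^esub> f = \<zero>\<^bsub>free_alg G\<^esub>" by blast
  qed (simp_all add: add add_ac)
  moreover have "ring (free_alg G)"
    by (rule ringI) (use \<open>abelian_group (free_alg G)\<close> in
      \<open>auto intro!: monoidI simp: distrib_left distrib_right mult.assoc free_mult_closed one simp del: keys_one\<close>)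
  ultimately show ?thesis
    by (intro calg.intro calg_axioms.intro cvec.intro cvec_axioms.intro)
      (simp_all add: fvs.scale_left_distrib fvs.scale_right_distrib fscale_mult_left fscale_mult_right sc)
qed

lemma (in free_quotient) lsum_cls:
  assumes "cvec U" "clinear (quotient M N) U \<psi>" "f \<in> carrier M"
  shows "lsum U (\<lambda>x. \<psi> (cls (Poly_Mapping.single x 1))) f = \<psi> (cls f)"
proof -
  interpret U: cvec U by fact
  interpret Q: cvec "quotient M N" by (rule cvec_quotient)
  have c: "\<psi> (cls (Poly_Mapping.single x 1)) \<in> carrier U" if "x \<in> X" for x
    using that carrier_single cls_closed clinear_closed[OF assms(2)] by blast
  let ?g = "\<lambda>x. \<psi> (cls (Poly_Mapping.single x 1))"
  have "lsum U ?g (\<Sum>x\<in>S. Poly_Mapping.single x (h x)) = \<psi> (cls (\<Sum>x\<in>S. Poly_Mapping.single x (h x)))"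
    if "finite S" "S \<subseteq> X" for S h
    using that
  proof (induction S rule: finite_induct)
    case empty
    show ?case using clinear_zero[OF Q.cvec_axioms U.cvec_axioms assms(2)] by (simp add: zero_quotient)
  next
    case (insert x S)
    let ?s = "\<Sum>x\<in>S. Poly_Mapping.single x (h x)"
    have m: "Poly_Mapping.single x (h x) \<in> carrier M" "?s \<in> carrier M"
      using insert.prems by (auto intro!: carrier_single carrier_sum)
    have "cls (Poly_Mapping.single x (h x)) = h x \<odot>\<^bsub>quotient M N\<^esub> cls (Poly_Mapping.single x 1)"
      by (simp add: smult_cls) (rule arg_cong[of _ _ cls], rule poly_mapping_eqI, auto simp: lookup_single when_def)
    then have 1: "\<psi> (cls (Poly_Mapping.single x (h x))) = h x \<odot>\<^bsub>U\<^esub> ?g x"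
      using insert.prems carrier_single cls_closed by (simp add: clinear_smult[OF assms(2)])
    have "lsum U ?g (Poly_Mapping.single x (h x) + ?s) = h x \<odot>\<^bsub>U\<^esub> ?g x \<oplus>\<^bsub>U\<^esub> \<psi> (cls ?s)"
      using U.lsum_add[of X ?g "Poly_Mapping.single x (h x)" ?s] m insert c by (simp add: carrier_M)
    also have "\<dots> = \<psi> (cls (Poly_Mapping.single x (h x) + ?s))"
      using m by (simp add: clinear_add[OF assms(2)] cls_closed 1 flip: add_cls)
    finally show ?case using insert by simp
  qed
  from this[of "Poly_Mapping.keys f" "Poly_Mapping.lookup f"] show ?thesis
    using assms(3) by (simp add: carrier_M sum_single_lookup)
qed

lemma free_star_add: "free_star (f + g) = free_star f + free_star g"
proof -
  let ?S = "Poly_Mapping.keys f \<union> Poly_Mapping.keys g"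
  have *: "free_star h = (\<Sum>w\<in>?S. Poly_Mapping.single (rev (map gen_star w)) (cnj (Poly_Mapping.lookup h w)))"
    if "Poly_Mapping.keys h \<subseteq> ?S" for h
    unfolding free_star_def using that by (intro sum.mono_neutral_left) (auto simp: in_keys_iff)
  have "Poly_Mapping.keys (f + g) \<subseteq> ?S" by (rule Poly_Mapping.keys_add)
  then show ?thesis by (simp add: * lookup_add single_add sum.distrib)
qed

lemma free_star_zero [simp]: "free_star 0 = 0" by (simp add: free_star_def)

lemma free_star_diff: "free_star (f - g) = free_star f - free_star g"
  using free_star_add[of "f - g" g] by simp

lemma free_star_sum: "free_star (sum f S) = (\<Sum>i\<in>S. free_star (f i))"
  by (induction S rule: infinite_finite_induct) (simp_all add: free_star_add)

lemma free_star_single: "free_star (Poly_Mapping.single w c) = Poly_Mapping.single (rev (map gen_star w)) (cnj c)"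
  by (cases "c = 0") (simp_all add: free_star_def)

section \<open>The presented algebra\<close>

locale qsphere = qtorus
begin

abbreviation "G \<equiv> sphere_gens n"
abbreviation "Fr \<equiv> {f :: gen list \<Rightarrow>\<^sub>0 complex. Poly_Mapping.keys f \<subseteq> lists G}"
abbreviation "I \<equiv> sphere_ideal n q"
abbreviation "S \<equiv> sphere n q"
abbreviation "zz i j \<equiv> word [Z i, Zstar j]"
abbreviation "rels \<equiv> sphere_relations n q \<union> free_star ` sphere_relations n q"
abbreviation "cq \<equiv> complex_of_real q"

lemma gens [simp]: "i \<in> {1..n} \<Longrightarrow> Z i \<in> G" "i \<in> {1..n} \<Longrightarrow> Zstar i \<in> G"
  by (auto simp: sphere_gens_def)

text \<open>The adjoint of a mixed relation is a mixed relation with exchanged indices, and the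
  commutator and sphere relations are self-adjoint. So passing to adjoints adds only the relations
  between two starred generators.\<close>

lemma rels_subset:
  assumes J: "fvs.subspace J"
    and 1: "\<And>i j. 1 \<le> i \<Longrightarrow> i < j \<Longrightarrow> j \<le> n \<Longrightarrow> word [Z i, Z j] - fscale cq (word [Z j, Z i]) \<in> J"
    and 2: "\<And>i j. 1 \<le> i \<Longrightarrow> i < j \<Longrightarrow> j \<le> n \<Longrightarrow> word [Zstar j, Zstar i] - fscale cq (word [Zstar i, Zstar j]) \<in> J"
    and 3: "\<And>i j. i \<in> {1..n} \<Longrightarrow> j \<in> {1..n} \<Longrightarrow> i \<noteq> j \<Longrightarrow> word [Zstar i, Z j] - fscale cq (word [Z j, Zstar i]) \<in> J"
    and 4: "\<And>k. k \<in> {1..n} \<Longrightarrow>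
      word [Zstar k, Z k] - word [Z k, Zstar k] - fscale (1 - cq\<^sup>2) (\<Sum>j=1..k - 1. word [Z j, Zstar j]) \<in> J"
    and 5: "(\<Sum>j=1..n. word [Z j, Zstar j]) - 1 \<in> J"
  shows "rels \<subseteq> J"
proof -
  have c: "cnj (1 - cq\<^sup>2) = 1 - cq\<^sup>2" by simp
  have 40: "word [Zstar 1, Z 1] - word [Z 1, Zstar 1] \<in> J" using 4[of 1] n_pos by simp
  have R4: "word [Zstar k, Z k] - word [Z k, Zstar k] - (\<Sum>j=1..k - 1. fscale (1 - cq\<^sup>2) (word [Z j, Zstar j])) \<in> J"
    if "k \<in> {1..n}" for k using 4[OF that] by (simp add: fvs.scale_sum_right)
  have R: "sphere_relations n q \<subseteq> J"
    unfolding sphere_relations_def Let_def word_mult append_Cons append_Nil mult_1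
    using 1 3 4 5 40 by (intro Un_least subsetI) auto
  have star: "free_star ` sphere_relations n q \<subseteq> J"
    unfolding sphere_relations_def Let_def image_Un word_mult append_Cons append_Nil mult_1
  proof (intro Un_least image_subsetI)
    fix r assume "r \<in> {word [Z i, Z j] - fscale cq (word [Z j, Z i]) | i j. i \<in> {1..n} \<and> j \<in> {1..n} \<and> i < j}"
    then show "free_star r \<in> J" using 2 by (auto simp: free_star_diff free_star_single fscale_single)
  next
    fix r assume "r \<in> {word [Zstar i, Z j] - fscale cq (word [Z j, Zstar i]) | i j. i \<in> {1..n} \<and> j \<in> {1..n} \<and> i \<noteq> j}"
    then obtain i j where "i \<in> {1..n}" "j \<in> {1..n}" "i \<noteq> j" "r = word [Zstar i, Z j] - fscale cq (word [Z j, Zstar i])" by blast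
    then show "free_star r \<in> J" using 3[of j i] by (simp add: free_star_diff free_star_single fscale_single)
  next
    fix r assume "r \<in> {word [Zstar 1, Z 1] - word [Z 1, Zstar 1]}"
    then show "free_star r \<in> J" using 40 by (simp add: free_star_diff free_star_single)
  next
    fix r assume "r \<in> {word [Zstar k, Z k] - word [Z k, Zstar k] - fscale (1 - cq\<^sup>2) (\<Sum>j=1..k - 1. word [Z j, Zstar j]) | k. 1 < k \<and> k \<le> n}"
    then obtain k where k: "1 < k" "k \<le> n"
      "r = word [Zstar k, Z k] - word [Z k, Zstar k] - fscale (1 - cq\<^sup>2) (\<Sum>j=1..k - 1. word [Z j, Zstar j])" by blast
    then show "free_star r \<in> J" using R4[of k]
      by (simp add: k(3) free_star_diff free_star_single free_star_sum fscale_single fvs.scale_sum_right)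
  next
    fix r assume "r \<in> {(\<Sum>j=1..n. word [Z j, Zstar j]) - (1 :: gen list \<Rightarrow>\<^sub>0 complex)}"
    then show "free_star r \<in> J" using 5
      by (simp add: free_star_diff free_star_single free_star_sum one_word)
  qed
  show ?thesis using R star by blast
qed

sublocale FA: calg "free_alg G" by (rule calg_free_alg)

lemma rels_carrier: "rels \<subseteq> Fr"
proof (rule rels_subset[OF subspace_keys])
  have d: "f - g \<in> Fr" if "f \<in> Fr" "g \<in> Fr" for f g using fvs.subspace_diff[OF subspace_keys that] .
  have s: "fscale c f \<in> Fr" if "f \<in> Fr" for c f using fvs.subspace_scale[OF subspace_keys that] .
  have su: "sum f T \<in> Fr" if "\<And>i. i \<in> T \<Longrightarrow> f i \<in> Fr" for f and T :: "nat set"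
    using that by (rule fvs.subspace_sum[OF subspace_keys])
  have w: "word w \<in> Fr" if "w \<in> lists G" for w using that by simp
  show "\<And>i j. 1 \<le> i \<Longrightarrow> i < j \<Longrightarrow> j \<le> n \<Longrightarrow> word [Z i, Z j] - fscale cq (word [Z j, Z i]) \<in> Fr"
    "\<And>i j. 1 \<le> i \<Longrightarrow> i < j \<Longrightarrow> j \<le> n \<Longrightarrow> word [Zstar j, Zstar i] - fscale cq (word [Zstar i, Zstar j]) \<in> Fr"
    "\<And>i j. i \<in> {1..n} \<Longrightarrow> j \<in> {1..n} \<Longrightarrow> i \<noteq> j \<Longrightarrow> word [Zstar i, Z j] - fscale cq (word [Z j, Zstar i]) \<in> Fr"
    by (intro d s w; simp)+
  show "\<And>k. k \<in> {1..n} \<Longrightarrow>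
      word [Zstar k, Z k] - word [Z k, Zstar k] - fscale (1 - cq\<^sup>2) (\<Sum>j=1..k - 1. word [Z j, Zstar j]) \<in> Fr"
    by (intro d s w su; auto)
  show "(\<Sum>j=1..n. word [Z j, Zstar j]) - 1 \<in> Fr" unfolding one_word by (intro d s w su; simp)
qed

lemma ideal_I: "ideal I (free_alg G)"
  unfolding sphere_ideal_def using rels_carrier by (intro FA.genideal_ideal) simp

lemma rels_I: "r \<in> rels \<Longrightarrow> r \<in> I"
  unfolding sphere_ideal_def using FA.genideal_self[of rels] rels_carrier by auto

lemma I_Fr: "I \<subseteq> Fr"
  using ideal.axioms(1)[OF ideal_I] additive_subgroup.a_subset by force

lemma I_mult: "f \<in> I \<Longrightarrow> h \<in> Fr \<Longrightarrow> h * f \<in> I" "f \<in> I \<Longrightarrow> h \<in> Fr \<Longrightarrow> f * h \<in> I"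
  using ideal.I_l_closed[OF ideal_I, of f h] ideal.I_r_closed[OF ideal_I, of f h] by simp_all

lemma subspace_I: "fvs.subspace I"
proof -
  have "0 \<in> I" "\<And>f g. f \<in> I \<Longrightarrow> g \<in> I \<Longrightarrow> f + g \<in> I"
    using additive_subgroup.zero_closed[OF ideal.axioms(1)[OF ideal_I]]
      additive_subgroup.a_closed[OF ideal.axioms(1)[OF ideal_I]] by simp_all
  moreover have "fscale c f \<in> I" if "f \<in> I" for c f
    using I_mult(1)[OF that, of "Poly_Mapping.single [] c"] by (simp add: fscale_mult zero_list_def)
  ultimately show ?thesis by (auto simp: fvs.subspace_def)
qed

text \<open>Closure under multiplication by words suffices, since words span the free algebra and
  \<open>J\<close> is a subspace.\<close>

lemma I_minimal:
  assumes "fvs.subspace J" "J \<subseteq> Fr" "rels \<subseteq> J"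
    and "\<And>w f. w \<in> lists G \<Longrightarrow> f \<in> J \<Longrightarrow> word w * f \<in> J"
    and "\<And>w f. w \<in> lists G \<Longrightarrow> f \<in> J \<Longrightarrow> f * word w \<in> J"
  shows "I \<subseteq> J"
proof -
  have dec: "h = (\<Sum>w\<in>Poly_Mapping.keys h. fscale (Poly_Mapping.lookup h w) (word w))" for h :: "gen list \<Rightarrow>\<^sub>0 complex"
    using sum_single_lookup[of h] by (simp add: fscale_single)
  have l: "h * f \<in> J" "f * h \<in> J" if f: "f \<in> J" and h: "h \<in> Fr" for f h
  proof -
    have "(\<Sum>w\<in>Poly_Mapping.keys h. fscale (Poly_Mapping.lookup h w) (word w)) * f \<in> J"
      unfolding sum_distrib_right fscale_mult_left
      by (intro fvs.subspace_sum fvs.subspace_scale assms f) (use h in auto)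
    then show "h * f \<in> J" by (simp flip: dec)
    have "f * (\<Sum>w\<in>Poly_Mapping.keys h. fscale (Poly_Mapping.lookup h w) (word w)) \<in> J"
      unfolding sum_distrib_left fscale_mult_right
      by (intro fvs.subspace_sum fvs.subspace_scale assms f) (use h in auto)
    then show "f * h \<in> J" by (simp flip: dec)
  qed
  have "subgroup J (add_monoid (free_alg G))"
  proof (rule group.subgroupI[OF FA.a_group])
    show "J \<subseteq> carrier (add_monoid (free_alg G))" using assms(2) by simp
    show "J \<noteq> {}" using fvs.subspace_0[OF assms(1)] by blast
    fix a assume a: "a \<in> J"
    then have "\<ominus>\<^bsub>free_alg G\<^esub> a = - a"
      using assms(2) fvs.subspace_neg[OF assms(1)] by (intro FA.minus_equality) auto
    then show "inv\<^bsub>add_monoid (free_alg G)\<^esub> a \<in> J"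
      using fvs.subspace_neg[OF assms(1) a] by (simp add: a_inv_def)
    fix b assume "b \<in> J"
    then show "a \<otimes>\<^bsub>add_monoid (free_alg G)\<^esub> b \<in> J" using a fvs.subspace_add[OF assms(1)] by simp
  qed
  then have "ideal J (free_alg G)"
    by (intro idealI FA.ring_axioms) (use l in auto)
  then show ?thesis unfolding sphere_ideal_def by (rule FA.genideal_minimal) (rule assms(3))
qed

sublocale Q: free_quotient "free_alg G" "lists G" I
  using I_Fr subspace_I by unfold_locales auto

abbreviation "cl \<equiv> Q.cls"

lemma S_def: "S = quotient (free_alg G) I"
  by (simp add: sphere_def)

lemma carrier_S: "carrier S = cl ` Fr"
  using Q.carrier_quotient by (simp add: S_def)

lemma cl_closed: "f \<in> Fr \<Longrightarrow> cl f \<in> carrier S"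
  by (simp add: carrier_S)

lemma cl_exhaust: assumes "a \<in> carrier S" obtains f where "f \<in> Fr" "a = cl f"
  using assms by (auto simp: carrier_S)

lemma cl_eq: "cl f = cl g \<longleftrightarrow> f - g \<in> I"
  by (rule Q.cls_eq_iff)

lemma cl_ops: "cl f \<oplus>\<^bsub>S\<^esub> cl g = cl (f + g)" "c \<odot>\<^bsub>S\<^esub> cl f = cl (fscale c f)" "\<zero>\<^bsub>S\<^esub> = cl 0"
  "\<one>\<^bsub>S\<^esub> = cl 1"
  by (simp_all only: S_def Q.add_cls Q.smult_cls Q.zero_quotient)
    (simp add: quotient_def ring.defs module.defs FactRing_def)

lemma cl_mult: "f \<in> Fr \<Longrightarrow> g \<in> Fr \<Longrightarrow> cl f \<otimes>\<^bsub>S\<^esub> cl g = cl (f * g)"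
  using ideal.rcoset_mult_add[OF ideal_I, of f g]
  by (simp add: S_def quotient_def ring.defs module.defs FactRing_def)

lemma Fr_closed: "f \<in> Fr \<Longrightarrow> g \<in> Fr \<Longrightarrow> f + g \<in> Fr" "f \<in> Fr \<Longrightarrow> g \<in> Fr \<Longrightarrow> f - g \<in> Fr"
  "f \<in> Fr \<Longrightarrow> g \<in> Fr \<Longrightarrow> f * g \<in> Fr" "f \<in> Fr \<Longrightarrow> fscale c f \<in> Fr" "w \<in> lists G \<Longrightarrow> Poly_Mapping.single w c \<in> Fr"
  "0 \<in> Fr" "1 \<in> Fr"
  using fvs.subspace_add[OF subspace_keys, of f "lists G" g] fvs.subspace_diff[OF subspace_keys, of f "lists G" g]
    fvs.subspace_scale[OF subspace_keys, of f "lists G" c] free_mult_closed[of f G g]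
  by (auto simp: zero_list_def)

lemma cvec_S: "cvec S"
  unfolding S_def by (rule Q.cvec_quotient)

lemma calg_S: "calg S"
proof -
  interpret cvec S by (rule cvec_S)
  have "ring S"
  proof (rule ringI)
    show "Group.monoid S"
    proof (rule monoidI)
      fix x y z assume "x \<in> carrier S" "y \<in> carrier S" "z \<in> carrier S"
      then obtain f g h where "f \<in> Fr" "g \<in> Fr" "h \<in> Fr" "x = cl f" "y = cl g" "z = cl h"
        unfolding carrier_S by blast
      then show "x \<otimes>\<^bsub>S\<^esub> y \<otimes>\<^bsub>S\<^esub> z = x \<otimes>\<^bsub>S\<^esub> (y \<otimes>\<^bsub>S\<^esub> z)"
        using Fr_closed(3)[of f g] Fr_closed(3)[of g h] by (simp only: cl_mult mult.assoc)
    next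
      fix x y assume "x \<in> carrier S" "y \<in> carrier S"
      then obtain f g where "f \<in> Fr" "g \<in> Fr" "x = cl f" "y = cl g" unfolding carrier_S by blast
      then show "x \<otimes>\<^bsub>S\<^esub> y \<in> carrier S" using Fr_closed(3)[of f g] by (simp only: cl_mult cl_closed)
    next
      show "\<one>\<^bsub>S\<^esub> \<in> carrier S" using cl_closed[OF Fr_closed(7)] by (simp only: cl_ops)
    next
      fix x assume "x \<in> carrier S"
      then obtain f where "f \<in> Fr" "x = cl f" unfolding carrier_S by blast
      then show "\<one>\<^bsub>S\<^esub> \<otimes>\<^bsub>S\<^esub> x = x" "x \<otimes>\<^bsub>S\<^esub> \<one>\<^bsub>S\<^esub> = x"
        using Fr_closed(7) by (simp_all only: cl_ops cl_mult mult_1_left mult_1_right)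
    qed
  next
    fix x y z assume "x \<in> carrier S" "y \<in> carrier S" "z \<in> carrier S"
    then obtain f g h where *: "f \<in> Fr" "g \<in> Fr" "h \<in> Fr" "x = cl f" "y = cl g" "z = cl h"
      unfolding carrier_S by blast
    show "(x \<oplus>\<^bsub>S\<^esub> y) \<otimes>\<^bsub>S\<^esub> z = x \<otimes>\<^bsub>S\<^esub> z \<oplus>\<^bsub>S\<^esub> y \<otimes>\<^bsub>S\<^esub> z"
      using * Fr_closed(1)[of f g] by (simp only: cl_mult cl_ops distrib_right)
    show "z \<otimes>\<^bsub>S\<^esub> (x \<oplus>\<^bsub>S\<^esub> y) = z \<otimes>\<^bsub>S\<^esub> x \<oplus>\<^bsub>S\<^esub> z \<otimes>\<^bsub>S\<^esub> y"
      using * Fr_closed(1)[of f g] by (simp only: cl_mult cl_ops distrib_left)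
  qed (rule abelian_group_axioms)
  then show ?thesis
  proof (intro calg.intro cvec_axioms calg_axioms.intro)
    fix a b c assume "a \<in> carrier S" "b \<in> carrier S"
    then obtain f g where *: "f \<in> Fr" "g \<in> Fr" "a = cl f" "b = cl g" unfolding carrier_S by blast
    show "(c \<odot>\<^bsub>S\<^esub> a) \<otimes>\<^bsub>S\<^esub> b = c \<odot>\<^bsub>S\<^esub> (a \<otimes>\<^bsub>S\<^esub> b)"
      using * Fr_closed(4)[of f c] by (simp only: cl_mult cl_ops fscale_mult_left)
    show "a \<otimes>\<^bsub>S\<^esub> (c \<odot>\<^bsub>S\<^esub> b) = c \<odot>\<^bsub>S\<^esub> (a \<otimes>\<^bsub>S\<^esub> b)"
      using * Fr_closed(4)[of g c] by (simp only: cl_mult cl_ops fscale_mult_right)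
  qed
qed

sublocale S: calg S by (rule calg_S)
sublocale H: calg laurent by (rule calg_laurent)
sublocale SH: calg_pair S laurent ..

section \<open>The coaction and the degree\<close>

fun gdeg :: "gen \<Rightarrow> int" where "gdeg (Z i) = 1" | "gdeg (Zstar i) = - 1"
definition "deg w = sum_list (map gdeg w)"

lemma deg_simps [simp]: "deg [] = 0" "deg (g # w) = gdeg g + deg w" "deg (v @ w) = deg v + deg w"
  by (simp_all add: deg_def)

abbreviation "R \<equiv> tensor_alg S laurent"
abbreviation "\<rho> \<equiv> sphere_coaction n q"

lemma cvec_R: "cvec R"
  by (rule cvec_restrict[OF SH.cvec_T]) (auto intro: cvec.smult_closed[OF SH.cvec_T]
      abelian_monoid.a_closed abelian_monoid.zero_closed abelian_group.axioms(1) cvec.axioms(1) SH.cvec_T)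

text \<open>The value that the coaction has to take on the class of a word;
  \<open>foldr_cogen\<close> identifies it with the iterated product in
  \<open>alg_lift\<close>.\<close>

definition "wimg w = pure S laurent (cl (word w)) (upow (deg w))"

lemma wimg_closed: "w \<in> lists G \<Longrightarrow> wimg w \<in> carrier R"
  unfolding wimg_def using SH.pure_closed cl_closed Fr_closed(5) by simp

definition "cogen g = (case g of Z i \<Rightarrow> pure S laurent (cl (word [Z i])) (upow 1)
  | Zstar i \<Rightarrow> pure S laurent (cl (word [Zstar i])) (upow (- 1)))"

lemma foldr_cogen: "w \<in> lists G \<Longrightarrow> foldr (\<lambda>g y. cogen g \<otimes>\<^bsub>R\<^esub> y) w \<one>\<^bsub>R\<^esub> = wimg w"
proof (induction w)
  case Nil show ?case by (simp add: wimg_def cl_ops one_word)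
next
  case (Cons g w)
  have "cogen g = wimg [g]" by (cases g) (simp_all add: cogen_def wimg_def)
  moreover have "wimg [g] \<otimes>\<^bsub>R\<^esub> wimg w = wimg (g # w)"
    unfolding wimg_def using Cons.prems
    by (subst SH.pure_mult) (auto simp: cl_closed Fr_closed cl_mult word_mult mult_single)
  ultimately show ?case using Cons by simp
qed

lemma rho_def: "\<rho> Y = lsum R (\<lambda>w. foldr (\<lambda>g y. cogen g \<otimes>\<^bsub>R\<^esub> y) w \<one>\<^bsub>R\<^esub>) (SOME f. f \<in> Y)"
  by (simp add: sphere_coaction_def alg_lift_def lsum_def Let_def cogen_def[abs_def])

lemma lsum_cong_keys:
  assumes "cvec U" "\<And>x. x \<in> Poly_Mapping.keys f \<Longrightarrow> g x = h x" "\<And>x. x \<in> Poly_Mapping.keys f \<Longrightarrow> h x \<in> carrier U"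
  shows "lsum U g f = lsum U h f"
proof -
  interpret U: cvec U by fact
  show ?thesis unfolding lsum_def by (rule U.finsum_cong') (use assms in auto)
qed

text \<open>On words of one degree the power of u is constant and can be taken out of the sum,
  leaving the class of \<open>f\<close>. Hence homogeneous relations are sent to zero.\<close>

lemma lsum_homogeneous:
  assumes "f \<in> Fr" "\<And>w. w \<in> Poly_Mapping.keys f \<Longrightarrow> deg w = k"
  shows "lsum R wimg f = pure S laurent (cl f) (upow k)"
proof -
  let ?psi = "\<lambda>a. pure S laurent a (upow k)"
  have l: "clinear S R ?psi"
    using cbilinear_left[OF SH.pure_bilinear, of "upow k"] by (simp add: clinear_def)
  have "lsum R wimg f = lsum R (\<lambda>w. ?psi (cl (word w))) f"
    by (rule lsum_cong_keys[OF cvec_R])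
      (use assms in \<open>auto simp: wimg_def intro!: SH.pure_closed cl_closed Fr_closed(5)\<close>)
  also have "\<dots> = ?psi (cl f)"
    by (rule Q.lsum_cls[OF cvec_R]) (use l assms in \<open>auto simp: S_def\<close>)
  finally show ?thesis .
qed

lemma lsum_word_mult:
  assumes "w \<in> lists G" "f \<in> Fr"
  shows "lsum R wimg (word w * f) = wimg w \<otimes>\<^bsub>R\<^esub> lsum R wimg f"
    and "lsum R wimg (f * word w) = lsum R wimg f \<otimes>\<^bsub>R\<^esub> wimg w"
proof -
  interpret R: cvec R by (rule cvec_R)
  have m: "clinear R R (\<lambda>Y. wimg w \<otimes>\<^bsub>R\<^esub> Y)" "clinear R R (\<lambda>Y. Y \<otimes>\<^bsub>R\<^esub> wimg w)"
    using cbilinear_right[OF SH.tensor_mult_bilinear, of "wimg w"] cbilinear_left[OF SH.tensor_mult_bilinear, of "wimg w"]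
      wimg_closed[OF assms(1)] by (simp_all add: clinear_def)
  have wm: "wimg v \<otimes>\<^bsub>R\<^esub> wimg v' = wimg (v @ v')" if "v \<in> lists G" "v' \<in> lists G" for v v'
    unfolding wimg_def using that
    by (subst SH.pure_mult) (auto simp: cl_closed Fr_closed cl_mult word_mult mult_single)
  have "lsum R wimg (word w * (\<Sum>v\<in>V. Poly_Mapping.single v (h v))) = wimg w \<otimes>\<^bsub>R\<^esub> lsum R wimg (\<Sum>v\<in>V. Poly_Mapping.single v (h v)) \<and>
     lsum R wimg ((\<Sum>v\<in>V. Poly_Mapping.single v (h v)) * word w) = lsum R wimg (\<Sum>v\<in>V. Poly_Mapping.single v (h v)) \<otimes>\<^bsub>R\<^esub> wimg w"
    if "finite V" "V \<subseteq> lists G" for V h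
    using that
  proof (induction V rule: finite_induct)
    case empty
    show ?case using clinear_zero[OF cvec_R cvec_R m(1)] clinear_zero[OF cvec_R cvec_R m(2)] by simp
  next
    case (insert v V)
    let ?s = "\<Sum>v\<in>V. Poly_Mapping.single v (h v)"
    have v: "v \<in> lists G" using insert.prems by auto
    have s: "?s \<in> Fr" by (rule fvs.subspace_sum[OF subspace_keys]) (use insert.prems in auto)
    have wv: "word w * Poly_Mapping.single v (h v) = Poly_Mapping.single (w @ v) (h v)"
      "Poly_Mapping.single v (h v) * word w = Poly_Mapping.single (v @ w) (h v)" by (simp_all add: word_mult)
    have fr: "Poly_Mapping.single (w @ v) (h v) \<in> Fr" "word w * ?s \<in> Fr" "?s * word w \<in> Fr"
        "Poly_Mapping.single (v @ w) (h v) \<in> Fr" "Poly_Mapping.single v (h v) \<in> Fr"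
      using Fr_closed(5)[of "w @ v" "h v"] Fr_closed(5)[of "v @ w" "h v"] Fr_closed(5)[of v "h v"] assms(1) v
        Fr_closed(3)[OF Fr_closed(5)[OF assms(1), of 1] s] Fr_closed(3)[OF s Fr_closed(5)[OF assms(1), of 1]]
      by simp_all
    have cl: "lsum R wimg ?s \<in> carrier R" "h v \<odot>\<^bsub>R\<^esub> wimg v \<in> carrier R"
      by (rule R.lsum_closed, use s wimg_closed in blast) (rule R.smult_closed[OF wimg_closed[OF v]])
    have add: "lsum R wimg (f + g) = lsum R wimg f \<oplus>\<^bsub>R\<^esub> lsum R wimg g" if "f \<in> Fr" "g \<in> Fr" for f g
      using R.lsum_add[of "lists G" wimg f g] wimg_closed that by simp
    have si: "lsum R wimg (Poly_Mapping.single u c) = c \<odot>\<^bsub>R\<^esub> wimg u" if "u \<in> lists G" for u c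
      by (rule R.lsum_single[of wimg u c, OF wimg_closed[OF that]])
    have "lsum R wimg (word w * (Poly_Mapping.single v (h v) + ?s)) =
        h v \<odot>\<^bsub>R\<^esub> wimg (w @ v) \<oplus>\<^bsub>R\<^esub> wimg w \<otimes>\<^bsub>R\<^esub> lsum R wimg ?s"
      unfolding distrib_left wv add[OF fr(1,2)] using insert assms v by (simp add: si del: tensor_alg_simps)
    moreover have "lsum R wimg ((Poly_Mapping.single v (h v) + ?s) * word w) =
        h v \<odot>\<^bsub>R\<^esub> wimg (v @ w) \<oplus>\<^bsub>R\<^esub> lsum R wimg ?s \<otimes>\<^bsub>R\<^esub> wimg w"
      unfolding distrib_right wv add[OF fr(4,3)] using insert assms v by (simp add: si del: tensor_alg_simps)
    ultimately show ?case
      using insert.hyps add[OF fr(5) s] si[OF v] clinear_add[OF m(1) cl(2,1)] clinear_add[OF m(2) cl(2,1)]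
        clinear_smult[OF m(1) wimg_closed[OF v]] clinear_smult[OF m(2) wimg_closed[OF v]]
        wm[OF assms(1) v] wm[OF v assms(1)] by (simp del: tensor_alg_simps)
  qed
  from this[of "Poly_Mapping.keys f" "Poly_Mapping.lookup f"] assms(2)
  show "lsum R wimg (word w * f) = wimg w \<otimes>\<^bsub>R\<^esub> lsum R wimg f"
    "lsum R wimg (f * word w) = lsum R wimg f \<otimes>\<^bsub>R\<^esub> wimg w" by (simp_all add: sum_single_lookup del: tensor_alg_simps)
qed

lemma relations_in_I:
  shows "1 \<le> i \<Longrightarrow> i < j \<Longrightarrow> j \<le> n \<Longrightarrow> word [Z i, Z j] - fscale cq (word [Z j, Z i]) \<in> I" (is "_ \<Longrightarrow> _ \<Longrightarrow> _ \<Longrightarrow> ?r1 \<in> _")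
    and "1 \<le> i \<Longrightarrow> i < j \<Longrightarrow> j \<le> n \<Longrightarrow> word [Zstar j, Zstar i] - fscale cq (word [Zstar i, Zstar j]) \<in> I"
    and "i \<in> {1..n} \<Longrightarrow> j \<in> {1..n} \<Longrightarrow> i \<noteq> j \<Longrightarrow> word [Zstar i, Z j] - fscale cq (word [Z j, Zstar i]) \<in> I"
    and "k \<in> {1..n} \<Longrightarrow>
      word [Zstar k, Z k] - word [Z k, Zstar k] - fscale (1 - cq\<^sup>2) (\<Sum>j=1..k - 1. word [Z j, Zstar j]) \<in> I"
    and "(\<Sum>j=1..n. word [Z j, Zstar j]) - 1 \<in> I"
proof -
  note sr = sphere_relations_def Let_def word_mult append_Cons append_Nil mult_1
  have R: "r \<in> I" if "r \<in> sphere_relations n q" for r using that rels_I by blast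
  have r1: "?r1 \<in> sphere_relations n q" if "1 \<le> i" "i < j" "j \<le> n"
  proof -
    have "i \<in> {1..n}" "j \<in> {1..n}" using that by auto
    then show ?thesis unfolding sr using that by blast
  qed
  then show "?r1 \<in> I" if "1 \<le> i" "i < j" "j \<le> n" using that by (intro R)
  have "free_star ?r1 \<in> I" if "1 \<le> i" "i < j" "j \<le> n" using r1[OF that] rels_I by blast
  then show "word [Zstar j, Zstar i] - fscale cq (word [Zstar i, Zstar j]) \<in> I" if "1 \<le> i" "i < j" "j \<le> n"
    using that by (simp add: free_star_diff free_star_single fscale_single)
  show "word [Zstar i, Z j] - fscale cq (word [Z j, Zstar i]) \<in> I" if "i \<in> {1..n}" "j \<in> {1..n}" "i \<noteq> j"
    by (rule R) (unfold sr, use that in blast)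
  show "word [Zstar k, Z k] - word [Z k, Zstar k] - fscale (1 - cq\<^sup>2) (\<Sum>j=1..k - 1. word [Z j, Zstar j]) \<in> I"
    if "k \<in> {1..n}"
  proof (cases "k = 1")
    case True
    have "word [Zstar 1, Z 1] - word [Z 1, Zstar 1] \<in> I" by (rule R) (unfold sr, blast)
    then show ?thesis using True by simp
  next
    case False
    then have "1 < k" "k \<le> n" using that by auto
    then show ?thesis by (intro R) (unfold sr, blast)
  qed
  show "(\<Sum>j=1..n. word [Z j, Zstar j]) - 1 \<in> I" by (rule R) (unfold sr, blast)
qed

text \<open>All relations are homogeneous for every grading \<open>\<theta>\<close> that respects the symmetries below.\<close>

lemma homogeneous_relations:
  assumes J: "fvs.subspace J"
    and IJ: "\<And>f v. f \<in> I \<Longrightarrow> (\<And>w. w \<in> Poly_Mapping.keys f \<Longrightarrow> \<theta> w = v) \<Longrightarrow> f \<in> J"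
    and t1: "\<And>i j. \<theta> [Z i, Z j] = \<theta> [Z j, Z i]" and t2: "\<And>i j. \<theta> [Zstar i, Zstar j] = \<theta> [Zstar j, Zstar i]"
    and t3: "\<And>i j. \<theta> [Zstar i, Z j] = \<theta> [Z j, Zstar i]" and t4: "\<And>i. i \<in> {1..n} \<Longrightarrow> \<theta> [Z i, Zstar i] = \<theta> []"
  shows "rels \<subseteq> J"
proof (rule rels_subset[OF J])
  have d: "\<forall>w\<in>Poly_Mapping.keys (f - g). \<theta> w = v"
    if "\<forall>w\<in>Poly_Mapping.keys f. \<theta> w = v" "\<forall>w\<in>Poly_Mapping.keys g. \<theta> w = v"
    for f g :: "gen list \<Rightarrow>\<^sub>0 complex" and v
    using keys_diff[of f g] that by blast
  have s: "\<forall>w\<in>Poly_Mapping.keys (fscale c f). \<theta> w = v"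
    if "\<forall>w\<in>Poly_Mapping.keys f. \<theta> w = v" for f c v
    using keys_fscale[of c f] that by blast
  have su: "\<forall>w\<in>Poly_Mapping.keys (sum f T). \<theta> w = v"
    if "\<And>i. i \<in> T \<Longrightarrow> \<forall>w\<in>Poly_Mapping.keys (f i). \<theta> w = v" for f v and T :: "nat set"
    using Poly_Mapping.keys_sum[of f T] that by blast
  have w: "\<forall>u\<in>Poly_Mapping.keys (word w). \<theta> u = v" if "\<theta> w = v" for w v using that by simp
  have J': "f \<in> J" if "f \<in> I" "\<forall>w\<in>Poly_Mapping.keys f. \<theta> w = v" for f v using IJ that by blast
  show "word [Z i, Z j] - fscale cq (word [Z j, Z i]) \<in> J" if "1 \<le> i" "i < j" "j \<le> n" for i j
    by (rule J'[OF relations_in_I(1)[OF that], of "\<theta> [Z i, Z j]"], intro d s w) (rule refl t1)+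
  show "word [Zstar j, Zstar i] - fscale cq (word [Zstar i, Zstar j]) \<in> J" if "1 \<le> i" "i < j" "j \<le> n" for i j
    by (rule J'[OF relations_in_I(2)[OF that], of "\<theta> [Zstar i, Zstar j]"], intro d s w) (rule refl t2)+
  show "word [Zstar i, Z j] - fscale cq (word [Z j, Zstar i]) \<in> J" if "i \<in> {1..n}" "j \<in> {1..n}" "i \<noteq> j" for i j
    by (rule J'[OF relations_in_I(3)[OF that], of "\<theta> [Z j, Zstar i]"], intro d s w) (rule refl t3)+
  show "word [Zstar k, Z k] - word [Z k, Zstar k] - fscale (1 - cq\<^sup>2) (\<Sum>j=1..k - 1. word [Z j, Zstar j]) \<in> J"
    if "k \<in> {1..n}" for k
    by (rule J'[OF relations_in_I(4)[OF that], of "\<theta> []"], intro d s w su) (use that in \<open>auto simp: t3 t4\<close>)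
  show "(\<Sum>j=1..n. word [Z j, Zstar j]) - 1 \<in> J"
    unfolding one_word
    by (rule J'[OF relations_in_I(5)[unfolded one_word], of "\<theta> []"], intro d s w su) (auto simp: t4)
qed

text \<open>A homogeneous element of the ideal has class 0, so its value 0 \<otimes> u^k vanishes.
  Since all relations are homogeneous, the coaction is well defined.\<close>

lemma lsum_I: "f \<in> I \<Longrightarrow> lsum R wimg f = \<zero>\<^bsub>R\<^esub>"
proof -
  interpret R: cvec R by (rule cvec_R)
  let ?J = "{f. Poly_Mapping.keys f \<subseteq> lists G \<and> lsum R wimg f = \<zero>\<^bsub>R\<^esub>}"
  have wz: "wimg w \<otimes>\<^bsub>R\<^esub> \<zero>\<^bsub>R\<^esub> = \<zero>\<^bsub>R\<^esub>" "\<zero>\<^bsub>R\<^esub> \<otimes>\<^bsub>R\<^esub> wimg w = \<zero>\<^bsub>R\<^esub>" if "w \<in> lists G" for w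
    using clinear_zero[OF SH.cvec_T SH.cvec_T cbilinear_right[OF SH.tensor_mult_bilinear, of "wimg w"]]
      clinear_zero[OF SH.cvec_T SH.cvec_T cbilinear_left[OF SH.tensor_mult_bilinear, of "wimg w"]]
      wimg_closed[OF that] by simp_all
  have J: "fvs.subspace ?J" by (rule R.subspace_lsum_kernel) (rule wimg_closed)
  have "rels \<subseteq> ?J"
  proof (rule homogeneous_relations[OF J, of deg])
    fix f v assume f: "f \<in> I" "\<And>w. w \<in> Poly_Mapping.keys f \<Longrightarrow> deg w = v"
    then have "lsum R wimg f = pure S laurent (cl 0) (upow v)"
      using lsum_homogeneous[of f v] I_Fr cl_eq[of f 0] by auto
    moreover have "Poly_Mapping.keys f \<subseteq> lists G" using f(1) I_Fr by blast
    ultimately show "f \<in> ?J" using SH.pure_zero_left[of "upow v"] by (simp add: cl_ops)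
  qed auto
  then have "I \<subseteq> ?J"
    using wz by (intro I_minimal[OF J]) (auto simp: lsum_word_mult Fr_closed(3)[simplified] simp del: tensor_alg_simps
        intro!: free_mult_closed)
  then show "f \<in> I \<Longrightarrow> lsum R wimg f = \<zero>\<^bsub>R\<^esub>" by blast
qed

lemma foldr_closed: "w \<in> lists G \<Longrightarrow> foldr (\<lambda>g y. cogen g \<otimes>\<^bsub>R\<^esub> y) w \<one>\<^bsub>R\<^esub> \<in> carrier R"
  using wimg_closed by (simp only: foldr_cogen)

lemma lsum_foldr: "f \<in> Fr \<Longrightarrow> lsum R (\<lambda>w. foldr (\<lambda>g y. cogen g \<otimes>\<^bsub>R\<^esub> y) w \<one>\<^bsub>R\<^esub>) f = lsum R wimg f"
  by (rule lsum_cong_keys[OF cvec_R]) (use foldr_cogen wimg_closed in blast)+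

lemma lsum_foldr_I: "f \<in> I \<Longrightarrow> lsum R (\<lambda>w. foldr (\<lambda>g y. cogen g \<otimes>\<^bsub>R\<^esub> y) w \<one>\<^bsub>R\<^esub>) f = \<zero>\<^bsub>R\<^esub>"
  using I_Fr lsum_foldr[of f] lsum_I by auto

lemma rho_linear: "clinear S (tensor S laurent) \<rho>"
proof -
  have "clinear S R \<rho>"
    unfolding rho_def[abs_def]
    by (rule Q.clinear_lsum_some[folded S_def]) (rule cvec_R foldr_closed lsum_foldr_I; assumption?)+
  then show ?thesis by (simp add: clinear_def)
qed

lemma rho_cl:
  assumes "f \<in> Fr" "\<And>w. w \<in> Poly_Mapping.keys f \<Longrightarrow> deg w = k"
  shows "\<rho> (cl f) = pure S laurent (cl f) (upow k)"
proof -
  have "\<rho> (cl f) = lsum R (\<lambda>w. foldr (\<lambda>g y. cogen g \<otimes>\<^bsub>R\<^esub> y) w \<one>\<^bsub>R\<^esub>) f"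
    unfolding rho_def
    by (rule Q.lsum_some_cls[OF cvec_R]) (use assms(1) lsum_foldr_I foldr_closed in auto)
  then show ?thesis using lsum_foldr[OF assms(1)] lsum_homogeneous[OF assms] by simp
qed

text \<open>Degree measured on representatives, for which closure under products and generation of
  the algebra are immediate; \<open>hom_eq\<close> identifies it with degree measured by the
  coaction.\<close>

definition "Hk k = {cl f | f. f \<in> Fr \<and> (\<forall>w\<in>Poly_Mapping.keys f. deg w = k)}"

lemma HkI: "f \<in> Fr \<Longrightarrow> \<forall>w\<in>Poly_Mapping.keys f. deg w = k \<Longrightarrow> cl f \<in> Hk k"
  unfolding Hk_def by blast

lemma Hk_hom: "Hk k \<subseteq> homog S \<rho> k"
  using rho_cl cl_closed by (auto simp: Hk_def homog_def)

lemma Hk_add: "a \<in> Hk k \<Longrightarrow> b \<in> Hk k \<Longrightarrow> a \<oplus>\<^bsub>S\<^esub> b \<in> Hk k"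
proof -
  assume "a \<in> Hk k" "b \<in> Hk k"
  then obtain f g where *: "a = cl f" "b = cl g" "f \<in> Fr" "g \<in> Fr"
    "\<forall>w\<in>Poly_Mapping.keys f. deg w = k" "\<forall>w\<in>Poly_Mapping.keys g. deg w = k" by (auto simp: Hk_def)
  then have "\<forall>w\<in>Poly_Mapping.keys (f + g). deg w = k" using Poly_Mapping.keys_add[of f g] by blast
  then show ?thesis using * HkI[OF Fr_closed(1)[OF *(3,4)]] by (simp add: cl_ops)
qed

lemma S_induct [consumes 1, case_names homog add]:
  assumes "a \<in> carrier S" and "\<And>k a. a \<in> Hk k \<Longrightarrow> Q a"
    and "\<And>a b. a \<in> carrier S \<Longrightarrow> b \<in> carrier S \<Longrightarrow> Q a \<Longrightarrow> Q b \<Longrightarrow> Q (a \<oplus>\<^bsub>S\<^esub> b)"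
  shows "Q a"
  using assms(1)[unfolded S_def]
proof (induction rule: Q.cls_induct)
  case (1 c w)
  have "cl (Poly_Mapping.single w c) \<in> Hk (deg w)" using 1 by (intro HkI) auto
  then show ?case using assms(2) cl_ops(2)[of c "word w"] by (simp add: S_def fscale_single)
next
  case 2
  have "cl 0 \<in> Hk 0" by (rule HkI) auto
  then show ?case using assms(2) cl_ops(3) by (simp add: S_def)
next
  case (3 Y Z) then show ?case using assms(3) by (simp add: S_def)
qed

lemma hom_eq: "homog S \<rho> k = Hk k"
proof
  \<comment> \<open>Taking the coefficient of u^k in the coaction is the projection onto degree k:
    it maps every element into \<open>Hk k\<close> and fixes the elements of coaction degree
    k.\<close>
  let ?pi = "\<lambda>a. tensor_lift S (\<lambda>a0 h. Poly_Mapping.lookup h k \<odot>\<^bsub>S\<^esub> a0) (\<rho> a)"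
  note cb = coefficient_bilinear[OF cvec_S]
  have l: "clinear S S ?pi" by (rule clinear_compose[OF rho_linear SH.lift_linear[OF cvec_S cb]])
  have v: "?pi a = (if k = l then a else \<zero>\<^bsub>S\<^esub>)" if "a \<in> homog S \<rho> l" for a l
    using that SH.lift_pure[OF cvec_S cb, of a "upow l" k] by (auto simp: homog_def lookup_single)
  have z: "\<zero>\<^bsub>S\<^esub> \<in> Hk k" unfolding cl_ops by (rule HkI) auto
  have "?pi a \<in> Hk k" if "a \<in> carrier S" for a using that
  proof (induction rule: S_induct)
    case (homog l a)
    then have "a \<in> homog S \<rho> l" using Hk_hom by blast
    then show ?case using v[of a l] z homog by (cases "k = l") simp_all
  next
    case (add a b) then show ?case by (simp add: clinear_add[OF l] Hk_add)
  qed
  then show "homog S \<rho> k \<subseteq> Hk k" using v[of _ k] by (force simp: homog_def)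
qed (rule Hk_hom)

lemma Hk_mult: "a \<in> Hk k \<Longrightarrow> b \<in> Hk l \<Longrightarrow> a \<otimes>\<^bsub>S\<^esub> b \<in> Hk (k + l)"
proof -
  assume "a \<in> Hk k" "b \<in> Hk l"
  then obtain f g where *: "a = cl f" "b = cl g" "f \<in> Fr" "g \<in> Fr"
    "\<forall>w\<in>Poly_Mapping.keys f. deg w = k" "\<forall>w\<in>Poly_Mapping.keys g. deg w = l" by (auto simp: Hk_def)
  then have "\<forall>w\<in>Poly_Mapping.keys (f * g). deg w = k + l"
    using keys_mult[of f g] by (fastforce simp: plus_list_def)
  then show ?thesis using * HkI[OF Fr_closed(3)[OF *(3,4)]] by (simp add: cl_mult)
qed

lemma Hk_closed: "a \<in> Hk k \<Longrightarrow> a \<in> carrier S"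
  by (auto simp: Hk_def intro: cl_closed)

lemma Hk_smult: "a \<in> Hk k \<Longrightarrow> c \<odot>\<^bsub>S\<^esub> a \<in> Hk k"
proof -
  assume "a \<in> Hk k"
  then obtain f where f: "a = cl f" "f \<in> Fr" "\<forall>w\<in>Poly_Mapping.keys f. deg w = k" by (auto simp: Hk_def)
  then have "\<forall>w\<in>Poly_Mapping.keys (fscale c f). deg w = k" using keys_fscale[of c f] by blast
  then show ?thesis using f HkI[OF Fr_closed(4)[OF f(2)]] by (simp add: cl_ops)
qed

section \<open>Strong grading of the sphere\<close>

inductive_set prodsum :: "int \<Rightarrow> (gen list \<Rightarrow>\<^sub>0 complex) set set" for k where
  zero: "\<zero>\<^bsub>S\<^esub> \<in> prodsum k"
| step: "a \<in> Hk (- k) \<Longrightarrow> b \<in> Hk k \<Longrightarrow> s \<in> prodsum k \<Longrightarrow> a \<otimes>\<^bsub>S\<^esub> b \<oplus>\<^bsub>S\<^esub> s \<in> prodsum k"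

lemma prodsum_closed: "s \<in> prodsum k \<Longrightarrow> s \<in> carrier S"
  by (induction rule: prodsum.induct) (auto intro: Hk_closed)

lemma prodsum_add: "s \<in> prodsum k \<Longrightarrow> t \<in> prodsum k \<Longrightarrow> s \<oplus>\<^bsub>S\<^esub> t \<in> prodsum k"
proof (induction rule: prodsum.induct)
  case zero then show ?case using prodsum_closed by simp
next
  case (step a b s)
  have "a \<otimes>\<^bsub>S\<^esub> b \<oplus>\<^bsub>S\<^esub> (s \<oplus>\<^bsub>S\<^esub> t) \<in> prodsum k" using step by (intro prodsum.step) auto
  then show ?case using step prodsum_closed Hk_closed by (simp add: S.a_assoc)
qed

lemma prodsum_mult: "a \<in> Hk (- k) \<Longrightarrow> b \<in> Hk k \<Longrightarrow> a \<otimes>\<^bsub>S\<^esub> b \<in> prodsum k"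
  using prodsum.step[OF _ _ prodsum.zero] Hk_closed by fastforce

lemma prodsum_smult: "s \<in> prodsum k \<Longrightarrow> c \<odot>\<^bsub>S\<^esub> s \<in> prodsum k"
proof (induction rule: prodsum.induct)
  case zero then show ?case by (simp add: prodsum.zero)
next
  case (step a b s)
  have "(c \<odot>\<^bsub>S\<^esub> a) \<otimes>\<^bsub>S\<^esub> b \<oplus>\<^bsub>S\<^esub> c \<odot>\<^bsub>S\<^esub> s \<in> prodsum k" using step Hk_smult by (intro prodsum.step) auto
  then show ?case using step prodsum_closed Hk_closed by (simp add: S.smult_mult_left S.smult_add_right)
qed

lemma prodsum_sandwich: "s \<in> prodsum k \<Longrightarrow> a \<in> Hk (- l) \<Longrightarrow> b \<in> Hk l \<Longrightarrow> a \<otimes>\<^bsub>S\<^esub> s \<otimes>\<^bsub>S\<^esub> b \<in> prodsum (k + l)"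
proof (induction rule: prodsum.induct)
  case zero then show ?case using Hk_closed by (simp add: prodsum.zero)
next
  case (step a' b' s)
  have h: "a \<otimes>\<^bsub>S\<^esub> a' \<in> Hk (- (k + l))" "b' \<otimes>\<^bsub>S\<^esub> b \<in> Hk (k + l)"
    using Hk_mult[OF step.prems(1) step.hyps(1)] Hk_mult[OF step.hyps(2) step.prems(2)]
    by (simp_all add: algebra_simps)
  have "a \<otimes>\<^bsub>S\<^esub> (a' \<otimes>\<^bsub>S\<^esub> b' \<oplus>\<^bsub>S\<^esub> s) \<otimes>\<^bsub>S\<^esub> b = (a \<otimes>\<^bsub>S\<^esub> a') \<otimes>\<^bsub>S\<^esub> (b' \<otimes>\<^bsub>S\<^esub> b) \<oplus>\<^bsub>S\<^esub> a \<otimes>\<^bsub>S\<^esub> s \<otimes>\<^bsub>S\<^esub> b"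
    using step prodsum_closed Hk_closed by (simp add: S.r_distr S.l_distr S.m_assoc)
  then show ?case using prodsum.step[OF h step.IH[OF step.prems]] by simp
qed

text \<open>A sum of products that equals 1 is inserted between the two factors of each term, which
  shifts the degree by \<open>k\<close>. So all degrees follow from 1 and -1.\<close>

lemma prodsum_compose: "\<one>\<^bsub>S\<^esub> \<in> prodsum k \<Longrightarrow> s \<in> prodsum l \<Longrightarrow> s \<in> prodsum (k + l)"
proof (rotate_tac, induction rule: prodsum.induct)
  case zero then show ?case by (simp add: prodsum.zero)
next
  case (step a b s)
  then show ?case using prodsum_add[OF prodsum_sandwich[OF step.prems step.hyps(1,2)] step.IH] Hk_closed
    by simp
qed

lemma word_Hk: "w \<in> lists G \<Longrightarrow> k = deg w \<Longrightarrow> cl (word w) \<in> Hk k"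
  by (rule HkI) auto

definition xs :: "nat \<Rightarrow> gen list \<Rightarrow>\<^sub>0 complex" where "xs k = (\<Sum>j=1..k. word [Z j, Zstar j])"

lemma xs_Fr: "k \<le> n \<Longrightarrow> xs k \<in> Fr"
  unfolding xs_def by (intro fvs.subspace_sum[OF subspace_keys]) auto

lemma xs_simps: "xs 0 = 0" "xs (Suc k) = xs k + word [Z (Suc k), Zstar (Suc k)]"
  by (simp_all add: xs_def)

lemma xs_n: "cl (xs n) = cl 1"
  using relations_in_I(5) by (simp add: cl_eq xs_def)

lemma zs_z: assumes "k \<in> {1..n}" shows "cl (word [Zstar k, Z k]) = cl (xs k - fscale (cq\<^sup>2) (xs (k - 1)))"
proof -
  have "xs k = xs (k - 1) + word [Z k, Zstar k]" using assms xs_simps(2)[of "k - 1"] by auto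
  then have "word [Zstar k, Z k] - (xs k - fscale (cq\<^sup>2) (xs (k - 1)))
    = word [Zstar k, Z k] - word [Z k, Zstar k] - fscale (1 - cq\<^sup>2) (xs (k - 1))"
    by (simp add: fvs.scale_left_diff_distrib algebra_simps)
  moreover have "word [Zstar k, Z k] - word [Z k, Zstar k] - fscale (1 - cq\<^sup>2) (xs (k - 1)) \<in> I"
    using relations_in_I(4)[OF assms] by (simp add: xs_def)
  ultimately show ?thesis by (simp only: cl_eq)
qed

text \<open>Degree -1 is the sphere relation for the z_j z_j^* summing up to 1. For degree 1 the
  recursion x_k = z_k^* z_k + q^2 x_{k-1} rewrites x_n with the adjoints on the left; unfolded, it
  produces the weights q^{2(n-j)}.\<close>

lemma one_prodsum: "\<one>\<^bsub>S\<^esub> \<in> prodsum k"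
proof -
  have m: "cl (xs k) \<in> prodsum (-1)" if "k \<le> n" for k using that
  proof (induction k)
    case 0 show ?case using prodsum.zero by (simp add: xs_simps cl_ops)
  next
    case (Suc k)
    have "cl (word [Z (Suc k)]) \<otimes>\<^bsub>S\<^esub> cl (word [Zstar (Suc k)]) \<in> prodsum (-1)"
      using Suc by (intro prodsum_mult word_Hk) auto
    then have "cl (word [Z (Suc k), Zstar (Suc k)]) \<in> prodsum (-1)"
      using Suc.prems by (subst (asm) cl_mult) (auto simp: word_mult)
    then show ?case using Suc prodsum_add by (fastforce simp: xs_simps simp flip: cl_ops)
  qed
  have p: "cl (xs k) \<in> prodsum 1" if "k \<le> n" for k using that
  proof (induction k)
    case 0 show ?case using prodsum.zero by (simp add: xs_simps cl_ops)
  next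
    case (Suc k)
    have "cl (word [Zstar (Suc k)]) \<otimes>\<^bsub>S\<^esub> cl (word [Z (Suc k)]) \<in> prodsum 1"
      using Suc by (intro prodsum_mult word_Hk) auto
    then have "cl (word [Zstar (Suc k), Z (Suc k)]) \<in> prodsum 1"
      using Suc.prems by (subst (asm) cl_mult) (auto simp: word_mult)
    then have "cl (xs (Suc k) - fscale (cq\<^sup>2) (xs k)) \<in> prodsum 1" using zs_z[of "Suc k"] Suc.prems by simp
    moreover have "cl (fscale (cq\<^sup>2) (xs k)) \<in> prodsum 1"
      using prodsum_smult Suc by (simp flip: cl_ops)
    ultimately have "cl (xs (Suc k) - fscale (cq\<^sup>2) (xs k)) \<oplus>\<^bsub>S\<^esub> cl (fscale (cq\<^sup>2) (xs k)) \<in> prodsum 1"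
      by (rule prodsum_add)
    then show ?case by (simp add: cl_ops)
  qed
  have one: "\<one>\<^bsub>S\<^esub> \<in> prodsum 1" "\<one>\<^bsub>S\<^esub> \<in> prodsum (-1)" using m[of n] p[of n] xs_n by (simp_all add: cl_ops)
  show ?thesis
  proof (induction k rule: int_induct[where k = 0])
    case base show ?case using prodsum_compose[OF one] by simp
  next
    case (step1 i) then show ?case using prodsum_compose[OF one(1) step1(2)] by (simp add: add.commute)
  next
    case (step2 i) then show ?case using prodsum_compose[OF one(2) step2(2)] by simp
  qed
qed

lemma prodsum_finsum:
  "s \<in> prodsum k \<Longrightarrow> \<exists>N x y. (\<forall>i<N. x i \<in> Hk (- k) \<and> y i \<in> Hk k) \<and> s = (\<Oplus>\<^bsub>S\<^esub>i\<in>{..<N::nat}. x i \<otimes>\<^bsub>S\<^esub> y i)"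
proof (induction rule: prodsum.induct)
  case zero show ?case by (intro exI[of _ 0]) simp
next
  case (step a b s)
  then obtain N x y where *: "\<forall>i<N. x i \<in> Hk (- k) \<and> y i \<in> Hk k" "s = (\<Oplus>\<^bsub>S\<^esub>i\<in>{..<N::nat}. x i \<otimes>\<^bsub>S\<^esub> y i)" by blast
  let ?x = "x(N := a)" and ?y = "y(N := b)"
  have c: "(\<lambda>i. x i \<otimes>\<^bsub>S\<^esub> y i) \<in> {..<N} \<rightarrow> carrier S" using * Hk_closed by (auto intro!: S.m_closed)
  have "(\<Oplus>\<^bsub>S\<^esub>i\<in>{..<N}. ?x i \<otimes>\<^bsub>S\<^esub> ?y i) = s" unfolding *(2)
    by (rule S.finsum_cong') (use c in auto)
  moreover have "(\<Oplus>\<^bsub>S\<^esub>i\<in>{..<Suc N}. ?x i \<otimes>\<^bsub>S\<^esub> ?y i) = a \<otimes>\<^bsub>S\<^esub> b \<oplus>\<^bsub>S\<^esub> (\<Oplus>\<^bsub>S\<^esub>i\<in>{..<N}. ?x i \<otimes>\<^bsub>S\<^esub> ?y i)"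
    unfolding lessThan_Suc using c step Hk_closed by (subst S.finsum_insert) (auto simp: Pi_def)
  ultimately show ?case using * step by (intro exI[of _ "Suc N"] exI[of _ ?x] exI[of _ ?y]) auto
qed

lemma strongly_graded_sphere: "\<exists>N x y. strongly_graded S \<rho> N x y"
proof -
  let ?P = "\<lambda>k N x y. (\<forall>i<N. x i \<in> Hk (- k) \<and> y i \<in> Hk k) \<and> \<one>\<^bsub>S\<^esub> = (\<Oplus>\<^bsub>S\<^esub>i\<in>{..<N::nat}. x i \<otimes>\<^bsub>S\<^esub> y i)"
  have "\<forall>k. \<exists>N x y. ?P k N x y" using prodsum_finsum[OF one_prodsum] by blast
  from choice[OF this] obtain N where "\<forall>k. \<exists>x y. ?P k (N k) x y" ..
  from choice[OF this] obtain x where "\<forall>k. \<exists>y. ?P k (N k) (x k) y" ..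
  from choice[OF this] obtain y where *: "\<forall>k. ?P k (N k) (x k) (y k)" ..
  have one: "\<one>\<^bsub>S\<^esub> \<in> Hk 0" using word_Hk[of "[]" 0] by (simp add: cl_ops one_word)
  have "strongly_graded S \<rho> N x y"
  proof (intro strongly_graded.intro strongly_graded_axioms.intro calg_S rho_linear; (unfold hom_eq)?)
    show "a \<in> Hk k \<Longrightarrow> b \<in> Hk l \<Longrightarrow> a \<otimes>\<^bsub>S\<^esub> b \<in> Hk (k + l)" for a b k l by (rule Hk_mult)
    show "Q a" if "a \<in> carrier S" "\<And>k a. a \<in> Hk k \<Longrightarrow> Q a"
      "\<And>a b. a \<in> carrier S \<Longrightarrow> b \<in> carrier S \<Longrightarrow> Q a \<Longrightarrow> Q b \<Longrightarrow> Q (a \<oplus>\<^bsub>S\<^esub> b)" for Q a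
      using that by (rule S_induct)
  qed (use * one in auto)
  then show ?thesis by blast
qed

end

section \<open>Commutation up to a scalar\<close>

context calg begin

text \<open>Requiring a nonzero scalar makes the relation reversible, see
  \<open>qc_sym\<close>.\<close>

definition qc :: "complex \<Rightarrow> 'a \<Rightarrow> 'a \<Rightarrow> bool"
  where "qc c a b \<longleftrightarrow> a \<in> carrier A \<and> b \<in> carrier A \<and> c \<noteq> 0 \<and> a \<otimes> b = c \<odot> (b \<otimes> a)"

lemma qc_closed: "qc c a b \<Longrightarrow> a \<in> carrier A" "qc c a b \<Longrightarrow> b \<in> carrier A"
  by (auto simp: qc_def)

lemma qc_sym: "qc c a b \<Longrightarrow> qc (inverse c) b a"
  by (auto simp: qc_def smult_smult)

lemma qc_mult_right: assumes "qc c a b" "qc d a b'" shows "qc (c * d) a (b \<otimes> b')"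
proof -
  have *: "a \<in> carrier A" "b \<in> carrier A" "b' \<in> carrier A" "c \<noteq> 0" "d \<noteq> 0" "a \<otimes> b = c \<odot> (b \<otimes> a)" "a \<otimes> b' = d \<odot> (b' \<otimes> a)"
    using assms by (auto simp: qc_def)
  have "a \<otimes> (b \<otimes> b') = c \<odot> (b \<otimes> (a \<otimes> b'))" using * by (simp add: smult_mult_left m_assoc flip: m_assoc[of a b b'])
  also have "\<dots> = (c * d) \<odot> (b \<otimes> b' \<otimes> a)" using * by (simp add: smult_mult_right smult_smult m_assoc)
  finally show ?thesis using * by (simp add: qc_def)
qed

lemma qc_mult_left: assumes "qc c a b" "qc d a' b" shows "qc (c * d) (a \<otimes> a') b"
  using qc_sym[OF qc_mult_right[OF qc_sym[OF assms(1)] qc_sym[OF assms(2)]]] by (simp add: mult.commute)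

lemma qc_add_left: assumes "qc c a b" "qc c a' b" shows "qc c (a \<oplus> a') b"
  using assms by (auto simp: qc_def l_distr r_distr smult_add_right)

lemma qc_add_right: assumes "qc c a b" "qc c a b'" shows "qc c a (b \<oplus> b')"
  using assms by (auto simp: qc_def l_distr r_distr smult_add_right)

lemma qc_one: "a \<in> carrier A \<Longrightarrow> qc 1 a \<one>" "a \<in> carrier A \<Longrightarrow> qc 1 \<one> a"
  by (auto simp: qc_def)

lemma qc_zero: "c \<noteq> 0 \<Longrightarrow> a \<in> carrier A \<Longrightarrow> qc c \<zero> a" "c \<noteq> 0 \<Longrightarrow> a \<in> carrier A \<Longrightarrow> qc c a \<zero>"
  by (auto simp: qc_def)

lemma qc_pow_left: "qc c a b \<Longrightarrow> qc (c ^ m) (a [^] (m::nat)) b"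
proof (induction m)
  case 0 then show ?case using qc_one qc_closed by simp
next
  case (Suc m) then show ?case using qc_mult_left[of "c ^ m" "a [^] m" b c a] by (simp add: mult.commute)
qed

lemma qc_pow_right: "qc c a b \<Longrightarrow> qc (c ^ m) a (b [^] (m::nat))"
proof (induction m)
  case 0 then show ?case using qc_one qc_closed by simp
next
  case (Suc m) then show ?case using qc_mult_right[of "c ^ m" a "b [^] m" c b] by (simp add: mult.commute)
qed

end

section \<open>The embedding of the quantum sphere into the quantum torus\<close>

context qsphere begin

declare One_nat_def [simp del] pow_nat [simp del]

lemma q_nonzero [simp]: "q \<noteq> 0" using q_pos by simp

lemma mon_nonzero [simp]: "mon e \<noteq> 0"
  by (metis keys_single keys_zero empty_not_insert one_neq_zero)

lemma mon_eq_iff [simp]: "mon e = mon e' \<longleftrightarrow> e = e'"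
  by (metis keys_single singleton_inject one_neq_zero)

section \<open>Evaluation in the quantum torus\<close>

definition "evw w = foldr (\<lambda>g y. gimg g \<star> y) w 1"

lemma evw_simps [simp]: "evw [] = 1" "evw (g # w) = gimg g \<star> evw w"
  by (simp_all add: evw_def)

lemma evw_append: "evw (v @ w) = evw v \<star> evw w"
  by (induction v) (simp_all add: tmul_assoc)

definition "ev f = (\<Sum>w\<in>Poly_Mapping.keys f. fscale (Poly_Mapping.lookup f w) (evw w))"

lemma ev_add: "ev (f + g) = ev f + ev g"
proof -
  let ?S = "Poly_Mapping.keys f \<union> Poly_Mapping.keys g"
  have *: "ev h = (\<Sum>w\<in>?S. fscale (Poly_Mapping.lookup h w) (evw w))" if "Poly_Mapping.keys h \<subseteq> ?S" for h
    unfolding ev_def using that by (intro sum.mono_neutral_left) (auto simp: in_keys_iff)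
  have "Poly_Mapping.keys (f + g) \<subseteq> ?S" by (rule Poly_Mapping.keys_add)
  then show ?thesis by (simp add: * lookup_add fvs.scale_left_distrib sum.distrib)
qed

lemma ev_single [simp]: "ev (Poly_Mapping.single w c) = fscale c (evw w)"
  by (cases "c = 0") (simp_all add: ev_def)

lemma ev_zero [simp]: "ev 0 = 0" by (simp add: ev_def)

lemma ev_diff: "ev (f - g) = ev f - ev g"
  using ev_add[of "f - g" g] by simp

lemma ev_sum: "ev (sum f T) = (\<Sum>i\<in>T. ev (f i))"
  by (induction T rule: infinite_finite_induct) (simp_all add: ev_add)

lemma ev_fscale: "ev (fscale c f) = fscale c (ev f)"
  by (rule additive_ext[of "\<lambda>f. ev (fscale c f)"])
    (simp_all add: ev_add fvs.scale_right_distrib fscale_single)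

lemma ev_one [simp]: "ev 1 = 1" by (simp add: one_word)

lemma ev_mult: "ev (f * g) = ev f \<star> ev g"
proof -
  have "ev (Poly_Mapping.single v a * g) = ev (Poly_Mapping.single v a) \<star> ev g" for v a g
    by (rule additive_ext[of "\<lambda>g. ev (Poly_Mapping.single v a * g)"])
      (simp_all add: distrib_left ev_add tmul_add_right word_mult evw_append tmul_fscale)
  then show ?thesis
    by (intro additive_ext[of "\<lambda>f. ev (f * g)" "\<lambda>f. ev f \<star> ev g" f])
      (simp_all add: distrib_right ev_add tmul_add_left del: ev_single)
qed

lemma ev_I: "f \<in> I \<Longrightarrow> ev f = 0"
proof -
  let ?J = "{f \<in> Fr. ev f = 0}"
  have J: "fvs.subspace ?J"
    using fvs.subspace_add[OF subspace_keys[of "lists G"]] fvs.subspace_scale[OF subspace_keys[of "lists G"]]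
    by (auto simp: fvs.subspace_def ev_add ev_fscale)
  have rF: "r \<in> Fr" if "r \<in> I" for r using that I_Fr by blast
  have "rels \<subseteq> ?J"
  proof (rule rels_subset[OF J])
    show "word [Z i, Z j] - fscale cq (word [Z j, Z i]) \<in> ?J" if "1 \<le> i" "i < j" "j \<le> n" for i j
      using rF[OF relations_in_I(1)[OF that]] zc_zc[OF that] by (simp add: ev_diff ev_fscale gimg_def)
    show "word [Zstar j, Zstar i] - fscale cq (word [Zstar i, Zstar j]) \<in> ?J" if "1 \<le> i" "i < j" "j \<le> n" for i j
      using rF[OF relations_in_I(2)[OF that]] gimg_Zstar_Zstar[OF that] by (simp add: ev_diff ev_fscale)
    show "word [Zstar i, Z j] - fscale cq (word [Z j, Zstar i]) \<in> ?J" if "i \<in> {1..n}" "j \<in> {1..n}" "i \<noteq> j" for i j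
      using rF[OF relations_in_I(3)[OF that]] gimg_Zstar_Z'[of i j] that by (simp add: ev_diff ev_fscale)
    show "word [Zstar k, Z k] - word [Z k, Zstar k] - fscale (1 - cq\<^sup>2) (\<Sum>j=1..k - 1. word [Z j, Zstar j]) \<in> ?J"
      if "k \<in> {1..n}" for k
    proof -
      have "(\<Sum>j=1..k - 1. gimg (Z j) \<star> gimg (Zstar j)) = X (k - 1)" using that by (intro sum_gimg) auto
      then have "ev (word [Zstar k, Z k] - word [Z k, Zstar k] - fscale (1 - cq\<^sup>2) (\<Sum>j=1..k - 1. word [Z j, Zstar j])) = 0"
        using gimg_Zstar_Z[of k] gimg_Z_Zstar[of k] that
        by (simp add: ev_diff ev_fscale ev_sum fvs.scale_left_diff_distrib)
      then show ?thesis using rF[OF relations_in_I(4)[OF that]] by simp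
    qed
    show "(\<Sum>j=1..n. word [Z j, Zstar j]) - 1 \<in> ?J"
      using rF[OF relations_in_I(5)] sum_gimg[of n] by (simp add: ev_diff ev_sum)
  qed
  then have "I \<subseteq> ?J"
  proof (intro I_minimal[OF J])
    fix w f assume w: "w \<in> lists G" and f: "f \<in> ?J"
    show "word w * f \<in> ?J" "f * word w \<in> ?J"
      using Fr_closed(3)[OF Fr_closed(5)[OF w, of 1], of f] Fr_closed(3)[OF _ Fr_closed(5)[OF w, of 1], of f] f
      by (simp_all add: ev_mult)
  qed auto
  then show "f \<in> I \<Longrightarrow> ev f = 0" by blast
qed

definition "evS Y = ev (SOME f. f \<in> Y)"

lemma evS_cl: "f \<in> Fr \<Longrightarrow> evS (cl f) = ev f"
  using Q.some_cls[of f] ev_I[of "(SOME g. g \<in> cl f) - f"] by (simp add: evS_def ev_diff)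

lemma evS_add: "a \<in> carrier S \<Longrightarrow> b \<in> carrier S \<Longrightarrow> evS (a \<oplus>\<^bsub>S\<^esub> b) = evS a + evS b"
  and evS_mult: "a \<in> carrier S \<Longrightarrow> b \<in> carrier S \<Longrightarrow> evS (a \<otimes>\<^bsub>S\<^esub> b) = evS a \<star> evS b"
  and evS_smult: "a \<in> carrier S \<Longrightarrow> evS (c \<odot>\<^bsub>S\<^esub> a) = fscale c (evS a)"
  and evS_zero: "evS \<zero>\<^bsub>S\<^esub> = 0" and evS_one: "evS \<one>\<^bsub>S\<^esub> = 1"
proof -
  show "a \<in> carrier S \<Longrightarrow> b \<in> carrier S \<Longrightarrow> evS (a \<oplus>\<^bsub>S\<^esub> b) = evS a + evS b"
    "a \<in> carrier S \<Longrightarrow> b \<in> carrier S \<Longrightarrow> evS (a \<otimes>\<^bsub>S\<^esub> b) = evS a \<star> evS b"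
    using evS_cl Fr_closed(1,3)
    by (auto elim!: cl_exhaust simp: cl_ops cl_mult ev_add ev_mult)
  show "a \<in> carrier S \<Longrightarrow> evS (c \<odot>\<^bsub>S\<^esub> a) = fscale c (evS a)"
    using evS_cl Fr_closed(4) by (auto elim!: cl_exhaust simp: cl_ops ev_fscale)
  show "evS \<zero>\<^bsub>S\<^esub> = 0" "evS \<one>\<^bsub>S\<^esub> = 1"
    unfolding cl_ops using evS_cl[OF Fr_closed(6)] evS_cl[OF Fr_closed(7)] by simp_all
qed

definition "zS i = cl (word [Z i])"
definition "zsS i = cl (word [Zstar i])"
definition "xS k = cl (xs k)"

lemma gens_closed [simp]: "i \<in> {1..n} \<Longrightarrow> zS i \<in> carrier S" "i \<in> {1..n} \<Longrightarrow> zsS i \<in> carrier S"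
  by (auto simp: zS_def zsS_def intro!: cl_closed)

lemma xS_closed [simp]: "k \<le> n \<Longrightarrow> xS k \<in> carrier S"
  unfolding xS_def by (intro cl_closed xs_Fr)

lemma xS_0: "xS 0 = \<zero>\<^bsub>S\<^esub>" and xS_n: "xS n = \<one>\<^bsub>S\<^esub>"
  using xs_n by (simp_all add: xS_def xs_simps cl_ops)

lemma xS_step: assumes "k \<in> {1..n}" shows "xS k = xS (k - 1) \<oplus>\<^bsub>S\<^esub> zS k \<otimes>\<^bsub>S\<^esub> zsS k"
proof -
  have "xs k = xs (k - 1) + word [Z k, Zstar k]" using assms xs_simps(2)[of "k - 1"] by auto
  moreover have "zS k \<otimes>\<^bsub>S\<^esub> zsS k = cl (word [Z k, Zstar k])"
    unfolding zS_def zsS_def using assms by (subst cl_mult) (auto simp: word_mult)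
  ultimately show ?thesis by (simp add: xS_def cl_ops)
qed

lemma xS_step': assumes "k \<in> {1..n}" shows "xS k = zsS k \<otimes>\<^bsub>S\<^esub> zS k \<oplus>\<^bsub>S\<^esub> (cq\<^sup>2) \<odot>\<^bsub>S\<^esub> xS (k - 1)"
proof -
  have "zsS k \<otimes>\<^bsub>S\<^esub> zS k = cl (word [Zstar k, Z k])"
    unfolding zS_def zsS_def using assms by (subst cl_mult) (auto simp: word_mult)
  then show ?thesis using zs_z[OF assms] by (simp add: xS_def cl_ops)
qed

lemma evS_gens: "i \<in> {1..n} \<Longrightarrow> evS (zS i) = gimg (Z i)" "i \<in> {1..n} \<Longrightarrow> evS (zsS i) = gimg (Zstar i)"
  using evS_cl[OF Fr_closed(5), of "[Z i]" 1] evS_cl[OF Fr_closed(5), of "[Zstar i]" 1]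
  by (auto simp: zS_def zsS_def)

lemma evS_xS: "k \<le> n \<Longrightarrow> evS (xS k) = X k"
  unfolding xS_def by (subst evS_cl[OF xs_Fr]) (simp_all add: xs_def ev_sum sum_gimg[symmetric])

lemma cq_nonzero: "cq \<noteq> 0" by simp

section \<open>Commutation relations in the sphere\<close>

lemma qc_z_z: assumes "1 \<le> i" "i < j" "j \<le> n" shows "S.qc cq (zS i) (zS j)"
proof -
  have g: "word [Z i] \<in> Fr" "word [Z j] \<in> Fr" "word [Z j, Z i] \<in> Fr" using assms by auto
  have "cl (word [Z i] * word [Z j]) = cl (fscale cq (word [Z j] * word [Z i]))"
    using relations_in_I(1)[OF assms] by (simp only: cl_eq word_mult append_Cons append_Nil mult_1)
  then show ?thesis using g assms by (simp only: S.qc_def zS_def cl_mult cl_ops cq_nonzero cl_closed) simp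
qed

lemma qc_zs_zs: assumes "1 \<le> i" "i < j" "j \<le> n" shows "S.qc cq (zsS j) (zsS i)"
proof -
  have g: "word [Zstar i] \<in> Fr" "word [Zstar j] \<in> Fr" using assms by auto
  have "cl (word [Zstar j] * word [Zstar i]) = cl (fscale cq (word [Zstar i] * word [Zstar j]))"
    using relations_in_I(2)[OF assms] by (simp only: cl_eq word_mult append_Cons append_Nil mult_1)
  then show ?thesis using g assms by (simp only: S.qc_def zsS_def cl_mult cl_ops cq_nonzero cl_closed) simp
qed

lemma qc_zs_z: assumes "i \<in> {1..n}" "j \<in> {1..n}" "i \<noteq> j" shows "S.qc cq (zsS i) (zS j)"
proof -
  have g: "word [Zstar i] \<in> Fr" "word [Z j] \<in> Fr" using assms by auto
  have "cl (word [Zstar i] * word [Z j]) = cl (fscale cq (word [Z j] * word [Zstar i]))"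
    using relations_in_I(3)[OF assms] by (simp only: cl_eq word_mult append_Cons append_Nil mult_1)
  then show ?thesis using g assms by (simp only: S.qc_def zS_def zsS_def cl_mult cl_ops cq_nonzero cl_closed) simp
qed

definition "xexp k j = (if k < j then cq\<^sup>2 else 1)"

lemma xexp_nonzero [simp]: "xexp k j \<noteq> 0" by (simp add: xexp_def)

text \<open>Derived from the presentation rather than in the torus: these relations enter the proof
  that PBW monomials span, on which injectivity of the evaluation rests.\<close>

lemma qc_x_z_less: "k < j \<Longrightarrow> j \<le> n \<Longrightarrow> S.qc (cq\<^sup>2) (xS k) (zS j)"
    "k < j \<Longrightarrow> j \<le> n \<Longrightarrow> S.qc (inverse (cq\<^sup>2)) (xS k) (zsS j)"
proof (induction k)
  case 0 { case 1 then show ?case by (auto simp: xS_0 intro!: S.qc_zero) }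
  case 2 then show ?case by (auto simp: xS_0 intro!: S.qc_zero)
next
  case (Suc k)
  { case 1
    have "S.qc (cq * cq) (zS (Suc k) \<otimes>\<^bsub>S\<^esub> zsS (Suc k)) (zS j)"
      by (rule S.qc_mult_left[OF qc_z_z qc_zs_z]) (use 1 in auto)
    then show ?case using S.qc_add_left[OF Suc(1)] 1 xS_step[of "Suc k"] by (simp add: power2_eq_square) }
  case 2
  have "S.qc (inverse cq * inverse cq) (zS (Suc k) \<otimes>\<^bsub>S\<^esub> zsS (Suc k)) (zsS j)"
    by (rule S.qc_mult_left[OF S.qc_sym[OF qc_zs_z] S.qc_sym[OF qc_zs_zs]]) (use 2 in auto)
  then show ?case using S.qc_add_left[OF Suc(2)] 2 xS_step[of "Suc k"] by (simp add: power2_eq_square)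
qed

lemma qc_x_z_ge:
  assumes "j \<in> {1..n}" shows "j \<le> k \<Longrightarrow> k \<le> n \<Longrightarrow> S.qc 1 (xS k) (zS j)" "j \<le> k \<Longrightarrow> k \<le> n \<Longrightarrow> S.qc 1 (xS k) (zsS j)"
proof (induction k rule: dec_induct)
  \<comment> \<open>At k = j the two expressions for x_j, one with z_j z_j^* and one with z_j^* z_j,
    differ exactly by the factor q^2 that x_{j-1} picks up when it crosses z_j.\<close>
  case base
  have c: "zS j \<in> carrier S" "zsS j \<in> carrier S" "xS (j - 1) \<in> carrier S" "xS j \<in> carrier S" using assms by auto
  have q1: "xS (j - 1) \<otimes>\<^bsub>S\<^esub> zS j = cq\<^sup>2 \<odot>\<^bsub>S\<^esub> (zS j \<otimes>\<^bsub>S\<^esub> xS (j - 1))"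
    and q2: "xS (j - 1) \<otimes>\<^bsub>S\<^esub> zsS j = inverse (cq\<^sup>2) \<odot>\<^bsub>S\<^esub> (zsS j \<otimes>\<^bsub>S\<^esub> xS (j - 1))"
    using qc_x_z_less[of "j - 1" j] assms by (auto simp: S.qc_def)
  { case 1
    have "xS j \<otimes>\<^bsub>S\<^esub> zS j = xS (j - 1) \<otimes>\<^bsub>S\<^esub> zS j \<oplus>\<^bsub>S\<^esub> zS j \<otimes>\<^bsub>S\<^esub> (zsS j \<otimes>\<^bsub>S\<^esub> zS j)"
      using c by (subst xS_step[OF assms]) (simp add: S.l_distr S.m_assoc)
    also have "\<dots> = zS j \<otimes>\<^bsub>S\<^esub> (zsS j \<otimes>\<^bsub>S\<^esub> zS j \<oplus>\<^bsub>S\<^esub> (cq\<^sup>2) \<odot>\<^bsub>S\<^esub> xS (j - 1))"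
      using c by (simp add: q1 S.r_distr S.smult_mult_right S.a_comm)
    also have "\<dots> = zS j \<otimes>\<^bsub>S\<^esub> xS j" by (simp flip: xS_step'[OF assms])
    finally show ?case using c by (simp add: S.qc_def) }
  case 2
  have "xS j \<otimes>\<^bsub>S\<^esub> zsS j = zsS j \<otimes>\<^bsub>S\<^esub> zS j \<otimes>\<^bsub>S\<^esub> zsS j \<oplus>\<^bsub>S\<^esub> zsS j \<otimes>\<^bsub>S\<^esub> xS (j - 1)"
    using c by (subst xS_step'[OF assms]) (simp add: S.l_distr S.smult_mult_left q2 S.smult_smult)
  also have "\<dots> = zsS j \<otimes>\<^bsub>S\<^esub> (xS (j - 1) \<oplus>\<^bsub>S\<^esub> zS j \<otimes>\<^bsub>S\<^esub> zsS j)"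
    using c by (simp add: S.r_distr S.m_assoc S.a_comm)
  also have "\<dots> = zsS j \<otimes>\<^bsub>S\<^esub> xS j" by (simp flip: xS_step[OF assms])
  finally show ?case using c by (simp add: S.qc_def)
next
  case (step k)
  have j: "1 \<le> j" "j < Suc k" using assms step by auto
  { case 1
    have "S.qc (inverse cq * cq) (zS (Suc k) \<otimes>\<^bsub>S\<^esub> zsS (Suc k)) (zS j)"
      by (rule S.qc_mult_left[OF S.qc_sym[OF qc_z_z] qc_zs_z]) (use 1 j in auto)
    then show ?case using S.qc_add_left[OF step(3)] 1 xS_step[of "Suc k"] by simp }
  case 2
  have "S.qc (inverse cq * cq) (zS (Suc k) \<otimes>\<^bsub>S\<^esub> zsS (Suc k)) (zsS j)"
    by (rule S.qc_mult_left[OF S.qc_sym[OF qc_zs_z] qc_zs_zs]) (use 2 j in auto)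
  then show ?case using S.qc_add_left[OF step(4)] 2 xS_step[of "Suc k"] by simp
qed

lemma qc_x_z: "k \<le> n \<Longrightarrow> j \<in> {1..n} \<Longrightarrow> S.qc (xexp k j) (xS k) (zS j)"
  "k \<le> n \<Longrightarrow> j \<in> {1..n} \<Longrightarrow> S.qc (inverse (xexp k j)) (xS k) (zsS j)"
  using qc_x_z_less[of k j] qc_x_z_ge[of j k] by (auto simp: xexp_def not_less)

lemma qc_x_x: "k \<le> n \<Longrightarrow> l \<le> n \<Longrightarrow> S.qc 1 (xS k) (xS l)"
proof (induction l)
  case 0 then show ?case using S.qc_zero by (simp add: xS_0)
next
  case (Suc l)
  have "S.qc (xexp k (Suc l) * inverse (xexp k (Suc l))) (xS k) (zS (Suc l) \<otimes>\<^bsub>S\<^esub> zsS (Suc l))"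
    by (rule S.qc_mult_right) (use Suc in \<open>auto intro!: qc_x_z\<close>)
  then show ?case using S.qc_add_right[OF Suc.IH] Suc.prems xS_step[of "Suc l"] by simp
qed

section \<open>Spanning by PBW monomials\<close>

definition "pz a j = (if a j \<ge> (0::int) then zS j [^]\<^bsub>S\<^esub> nat (a j) else zsS j [^]\<^bsub>S\<^esub> nat (- a j))"
primrec PZ :: "(nat \<Rightarrow> int) \<Rightarrow> nat \<Rightarrow> (gen list \<Rightarrow>\<^sub>0 complex) set"
  where "PZ a 0 = \<one>\<^bsub>S\<^esub>" | "PZ a (Suc j) = PZ a j \<otimes>\<^bsub>S\<^esub> pz a (Suc j)"
primrec PX :: "(nat \<Rightarrow> nat) \<Rightarrow> nat \<Rightarrow> (gen list \<Rightarrow>\<^sub>0 complex) set"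
  where "PX b 0 = \<one>\<^bsub>S\<^esub>" | "PX b (Suc k) = PX b k \<otimes>\<^bsub>S\<^esub> xS (Suc k) [^]\<^bsub>S\<^esub> b (Suc k)"

text \<open>Each index j contributes powers of z_j or of its adjoint, never of both, since the mixed
  products are expressed by the x_k. Only x_1, ..., x_{n-1} occur because x_n = 1.\<close>

definition "NF = {PZ a n \<otimes>\<^bsub>S\<^esub> PX b (n - 1) | a b. True}"

lemma pz_closed [simp]: "j \<in> {1..n} \<Longrightarrow> pz a j \<in> carrier S"
  by (simp add: pz_def)

lemma PZ_closed [simp]: "m \<le> n \<Longrightarrow> PZ a m \<in> carrier S"
  by (induction m) auto

lemma PX_closed [simp]: "m \<le> n \<Longrightarrow> PX b m \<in> carrier S"
  by (induction m) auto

lemma NF_closed: "p \<in> NF \<Longrightarrow> p \<in> carrier S"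
  by (auto simp: NF_def)

lemma PZ_cong: "(\<And>j. j \<in> {1..m} \<Longrightarrow> a j = a' j) \<Longrightarrow> PZ a m = PZ a' m"
  by (induction m) (auto simp: pz_def)

lemma PX_cong: "(\<And>j. j \<in> {1..m} \<Longrightarrow> b j = b' j) \<Longrightarrow> PX b m = PX b' m"
  by (induction m) auto

lemma qc_pz:
  assumes "j \<in> {1..n}" "i \<in> {1..n}" "i \<noteq> j"
  shows "\<exists>c. S.qc c (pz a j) (zS i)" "\<exists>c. S.qc c (pz a j) (zsS i)"
proof -
  have z: "\<exists>c. S.qc c (zS j) (zS i)" using assms qc_z_z[of i j] qc_z_z[of j i] S.qc_sym by (cases "i < j") force+
  have zs: "\<exists>c. S.qc c (zsS j) (zsS i)" using assms qc_zs_zs[of i j] qc_zs_zs[of j i] S.qc_sym by (cases "i < j") force+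
  have "\<exists>c. S.qc c (zS j) (zsS i)" "\<exists>c. S.qc c (zsS j) (zS i)" using assms qc_zs_z S.qc_sym by blast+
  then show "\<exists>c. S.qc c (pz a j) (zS i)" "\<exists>c. S.qc c (pz a j) (zsS i)"
    unfolding pz_def using z zs S.qc_pow_left by (auto; blast)+
qed

lemma qc_x_pz: "k \<le> n \<Longrightarrow> j \<in> {1..n} \<Longrightarrow> \<exists>c. S.qc c (xS k) (pz a j)"
  unfolding pz_def using S.qc_pow_right[OF qc_x_z(1)] S.qc_pow_right[OF qc_x_z(2)] by (auto; blast)

text \<open>What may be left over when a generator is absorbed into a PBW monomial: 1 if a power
  grows, and z_i z_i^* or z_i^* z_i if a generator meets its adjoint. The span can be carried
  through the remaining factors because x_i and x_{i-1} commute with them up to scalars.\<close>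

definition "Lx i = {\<alpha> \<odot>\<^bsub>S\<^esub> \<one>\<^bsub>S\<^esub> \<oplus>\<^bsub>S\<^esub> \<beta> \<odot>\<^bsub>S\<^esub> xS i \<oplus>\<^bsub>S\<^esub> \<gamma> \<odot>\<^bsub>S\<^esub> xS (i - 1) | \<alpha> \<beta> \<gamma>. True}"

lemma Lx_closed: "i \<in> {1..n} \<Longrightarrow> u \<in> Lx i \<Longrightarrow> u \<in> carrier S"
  by (auto simp: Lx_def)

lemma Lx_move:
  assumes "i \<in> {1..n}" "j \<in> {1..n}" "u \<in> Lx i"
  shows "\<exists>u'\<in>Lx i. u \<otimes>\<^bsub>S\<^esub> pz a j = pz a j \<otimes>\<^bsub>S\<^esub> u'"
proof -
  obtain \<alpha> \<beta> \<gamma> where u: "u = \<alpha> \<odot>\<^bsub>S\<^esub> \<one>\<^bsub>S\<^esub> \<oplus>\<^bsub>S\<^esub> \<beta> \<odot>\<^bsub>S\<^esub> xS i \<oplus>\<^bsub>S\<^esub> \<gamma> \<odot>\<^bsub>S\<^esub> xS (i - 1)"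
    using assms by (auto simp: Lx_def)
  obtain c where "S.qc c (xS i) (pz a j)" using qc_x_pz[of i j a] assms by auto
  moreover obtain d where "S.qc d (xS (i - 1)) (pz a j)" using qc_x_pz[of "i - 1" j a] assms by force
  ultimately have c: "xS i \<otimes>\<^bsub>S\<^esub> pz a j = c \<odot>\<^bsub>S\<^esub> (pz a j \<otimes>\<^bsub>S\<^esub> xS i)"
    and d: "xS (i - 1) \<otimes>\<^bsub>S\<^esub> pz a j = d \<odot>\<^bsub>S\<^esub> (pz a j \<otimes>\<^bsub>S\<^esub> xS (i - 1))" by (auto simp: S.qc_def)
  have cl: "xS i \<in> carrier S" "xS (i - 1) \<in> carrier S" "pz a j \<in> carrier S" using assms by auto
  let ?u' = "\<alpha> \<odot>\<^bsub>S\<^esub> \<one>\<^bsub>S\<^esub> \<oplus>\<^bsub>S\<^esub> (\<beta> * c) \<odot>\<^bsub>S\<^esub> xS i \<oplus>\<^bsub>S\<^esub> (\<gamma> * d) \<odot>\<^bsub>S\<^esub> xS (i - 1)"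
  have "u \<otimes>\<^bsub>S\<^esub> pz a j = pz a j \<otimes>\<^bsub>S\<^esub> ?u'"
    using cl by (simp add: u S.l_distr S.r_distr S.smult_mult_left S.smult_mult_right S.smult_smult c d)
  moreover have "?u' \<in> Lx i" unfolding Lx_def by blast
  ultimately show ?thesis by blast
qed

lemma one_Lx: "i \<in> {1..n} \<Longrightarrow> \<one>\<^bsub>S\<^esub> \<in> Lx i"
proof -
  assume "i \<in> {1..n}"
  then have "xS i \<in> carrier S" "xS (i - 1) \<in> carrier S" by auto
  then have "\<one>\<^bsub>S\<^esub> = 1 \<odot>\<^bsub>S\<^esub> \<one>\<^bsub>S\<^esub> \<oplus>\<^bsub>S\<^esub> 0 \<odot>\<^bsub>S\<^esub> xS i \<oplus>\<^bsub>S\<^esub> 0 \<odot>\<^bsub>S\<^esub> xS (i - 1)" by simp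
  then show ?thesis unfolding Lx_def by blast
qed

lemma zzs_Lx: assumes "i \<in> {1..n}" shows "zS i \<otimes>\<^bsub>S\<^esub> zsS i \<in> Lx i" "zsS i \<otimes>\<^bsub>S\<^esub> zS i \<in> Lx i"
proof -
  have c: "xS i \<in> carrier S" "xS (i - 1) \<in> carrier S" "zS i \<otimes>\<^bsub>S\<^esub> zsS i \<in> carrier S" "zsS i \<otimes>\<^bsub>S\<^esub> zS i \<in> carrier S"
    using assms by auto
  have "zS i \<otimes>\<^bsub>S\<^esub> zsS i = 0 \<odot>\<^bsub>S\<^esub> \<one>\<^bsub>S\<^esub> \<oplus>\<^bsub>S\<^esub> 1 \<odot>\<^bsub>S\<^esub> xS i \<oplus>\<^bsub>S\<^esub> (-1) \<odot>\<^bsub>S\<^esub> xS (i - 1)"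
    using c by (simp add: S.smult_minus_one) (subst xS_step[OF assms], simp add: S.a_ac S.r_neg1 S.r_neg2 S.r_neg)
  then show "zS i \<otimes>\<^bsub>S\<^esub> zsS i \<in> Lx i" unfolding Lx_def by blast
  have "zsS i \<otimes>\<^bsub>S\<^esub> zS i = 0 \<odot>\<^bsub>S\<^esub> \<one>\<^bsub>S\<^esub> \<oplus>\<^bsub>S\<^esub> 1 \<odot>\<^bsub>S\<^esub> xS i \<oplus>\<^bsub>S\<^esub> (- (cq\<^sup>2)) \<odot>\<^bsub>S\<^esub> xS (i - 1)"
    using c by (simp, subst xS_step'[OF assms], simp add: S.a_assoc flip: S.smult_add_left)
  then show "zsS i \<otimes>\<^bsub>S\<^esub> zS i \<in> Lx i" unfolding Lx_def by blast
qed

lemma pz_step: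
  assumes i: "i \<in> {1..n}"
  shows "\<exists>u\<in>Lx i. pz a i \<otimes>\<^bsub>S\<^esub> zS i = pz (a(i := a i + 1)) i \<otimes>\<^bsub>S\<^esub> u"
    "\<exists>u\<in>Lx i. pz a i \<otimes>\<^bsub>S\<^esub> zsS i = pz (a(i := a i - 1)) i \<otimes>\<^bsub>S\<^esub> u"
proof -
  show "\<exists>u\<in>Lx i. pz a i \<otimes>\<^bsub>S\<^esub> zS i = pz (a(i := a i + 1)) i \<otimes>\<^bsub>S\<^esub> u"
  proof (cases "a i \<ge> 0")
    case True
    then have "nat (a i + 1) = Suc (nat (a i))" by simp
    then show ?thesis using True i by (intro bexI[OF _ one_Lx[OF i]]) (simp add: pz_def)
  next
    case False
    then obtain k where k: "a i = - int (Suc k)" by (metis int_cases2 nat_int_comparison(3) neg_int_cases not_le of_nat_Suc of_nat_less_0_iff gr0_conv_Suc)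
    show ?thesis using k i
      by (intro bexI[OF _ zzs_Lx(2)[OF i]]) (auto simp: pz_def S.m_assoc nat_add_distrib)
  qed
  show "\<exists>u\<in>Lx i. pz a i \<otimes>\<^bsub>S\<^esub> zsS i = pz (a(i := a i - 1)) i \<otimes>\<^bsub>S\<^esub> u"
  proof (cases "a i > 0")
    case True
    then obtain k where k: "a i = int (Suc k)" by (metis zero_less_imp_eq_int gr0_conv_Suc)
    show ?thesis using k i
      by (intro bexI[OF _ zzs_Lx(1)[OF i]]) (auto simp: pz_def S.m_assoc nat_add_distrib)
  next
    case False
    then have "nat (1 - a i) = Suc (nat (- a i))" by simp
    then show ?thesis using False i by (intro bexI[OF _ one_Lx[OF i]]) (auto simp: pz_def)
  qed
qed

text \<open>The generator travels left, up to scalars, through the factors of index above i and is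
  merged at position i; the remainder in \<open>Lx i\<close> travels back to the right.\<close>

lemma PZ_step:
  assumes "i \<in> {1..n}"
  shows "i \<le> m \<Longrightarrow> m \<le> n \<Longrightarrow> \<exists>u\<in>Lx i. PZ a m \<otimes>\<^bsub>S\<^esub> zS i = PZ (a(i := a i + 1)) m \<otimes>\<^bsub>S\<^esub> u"
    "i \<le> m \<Longrightarrow> m \<le> n \<Longrightarrow> \<exists>u\<in>Lx i. PZ a m \<otimes>\<^bsub>S\<^esub> zsS i = PZ (a(i := a i - 1)) m \<otimes>\<^bsub>S\<^esub> u"
proof -
  \<comment> \<open>Both generators are handled at once: \<open>w\<close> is the generator and
    \<open>a'\<close> the altered exponents, which agree with \<open>a\<close> away from i.\<close>
  have gen: "\<exists>u\<in>Lx i. PZ a m \<otimes>\<^bsub>S\<^esub> w = PZ a' m \<otimes>\<^bsub>S\<^esub> u"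
    if w: "w \<in> carrier S" and a': "\<And>j. j \<noteq> i \<Longrightarrow> a' j = a j"
      and s: "\<exists>u\<in>Lx i. pz a i \<otimes>\<^bsub>S\<^esub> w = pz a' i \<otimes>\<^bsub>S\<^esub> u"
      and c: "\<And>j. j \<in> {1..n} \<Longrightarrow> j \<noteq> i \<Longrightarrow> \<exists>c. S.qc c (pz a j) w" and m: "i \<le> m" "m \<le> n" for w a'
    using m
  proof (induction m rule: dec_induct)
    case base
    obtain k where k: "i = Suc k" using assms by (cases i) auto
    have "PZ a' k = PZ a k" by (rule PZ_cong) (auto simp: k intro!: a')
    moreover obtain u where "u \<in> Lx i" "pz a i \<otimes>\<^bsub>S\<^esub> w = pz a' i \<otimes>\<^bsub>S\<^esub> u" using s by blast
    ultimately show ?case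
      using assms w Lx_closed[OF assms] unfolding k by (intro bexI[of _ u]) (simp_all add: S.m_assoc)
  next
    case (step m)
    obtain c where "S.qc c (pz a (Suc m)) w" using c[of "Suc m"] step by auto
    then have c: "pz a (Suc m) \<otimes>\<^bsub>S\<^esub> w = c \<odot>\<^bsub>S\<^esub> (w \<otimes>\<^bsub>S\<^esub> pz a (Suc m))" by (simp add: S.qc_def)
    obtain u where u: "u \<in> Lx i" "PZ a m \<otimes>\<^bsub>S\<^esub> w = PZ a' m \<otimes>\<^bsub>S\<^esub> u" using step by auto
    obtain u' where u': "u' \<in> Lx i" "u \<otimes>\<^bsub>S\<^esub> pz a (Suc m) = pz a (Suc m) \<otimes>\<^bsub>S\<^esub> u'"
      using Lx_move[OF assms _ u(1), of "Suc m" a] step by auto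
    have pz: "pz a' (Suc m) = pz a (Suc m)" using step a'[of "Suc m"] by (simp add: pz_def)
    have cl: "pz a (Suc m) \<in> carrier S" "PZ a m \<in> carrier S" "PZ a' m \<in> carrier S"
      "u \<in> carrier S" "u' \<in> carrier S"
      using step Lx_closed[OF assms] u u' by auto
    have "PZ a (Suc m) \<otimes>\<^bsub>S\<^esub> w = c \<odot>\<^bsub>S\<^esub> ((PZ a m \<otimes>\<^bsub>S\<^esub> w) \<otimes>\<^bsub>S\<^esub> pz a (Suc m))"
      using cl w by (simp add: S.m_assoc c S.smult_mult_right)
    also have "\<dots> = c \<odot>\<^bsub>S\<^esub> (PZ a' m \<otimes>\<^bsub>S\<^esub> (u \<otimes>\<^bsub>S\<^esub> pz a (Suc m)))"
      using cl w by (simp add: u S.m_assoc)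
    also have "\<dots> = PZ a' (Suc m) \<otimes>\<^bsub>S\<^esub> (c \<odot>\<^bsub>S\<^esub> u')"
      using cl by (simp add: u' pz S.m_assoc S.smult_mult_right)
    finally have "PZ a (Suc m) \<otimes>\<^bsub>S\<^esub> w = PZ a' (Suc m) \<otimes>\<^bsub>S\<^esub> (c \<odot>\<^bsub>S\<^esub> u')" .
    moreover have "c \<odot>\<^bsub>S\<^esub> u' \<in> Lx i"
    proof -
      obtain \<alpha> \<beta> \<gamma> where "u' = \<alpha> \<odot>\<^bsub>S\<^esub> \<one>\<^bsub>S\<^esub> \<oplus>\<^bsub>S\<^esub> \<beta> \<odot>\<^bsub>S\<^esub> xS i \<oplus>\<^bsub>S\<^esub> \<gamma> \<odot>\<^bsub>S\<^esub> xS (i - 1)"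
        using u' by (auto simp: Lx_def)
      moreover have "xS i \<in> carrier S" "xS (i - 1) \<in> carrier S" using assms by auto
      ultimately have "c \<odot>\<^bsub>S\<^esub> u' = (c * \<alpha>) \<odot>\<^bsub>S\<^esub> \<one>\<^bsub>S\<^esub> \<oplus>\<^bsub>S\<^esub> (c * \<beta>) \<odot>\<^bsub>S\<^esub> xS i \<oplus>\<^bsub>S\<^esub> (c * \<gamma>) \<odot>\<^bsub>S\<^esub> xS (i - 1)"
        by (simp add: S.smult_add_right S.smult_smult)
      then show ?thesis unfolding Lx_def by blast
    qed
    ultimately show ?case by blast
  qed
  show "i \<le> m \<Longrightarrow> m \<le> n \<Longrightarrow> \<exists>u\<in>Lx i. PZ a m \<otimes>\<^bsub>S\<^esub> zS i = PZ (a(i := a i + 1)) m \<otimes>\<^bsub>S\<^esub> u"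
    by (rule gen) (use assms pz_step(1) qc_pz in auto)
  show "i \<le> m \<Longrightarrow> m \<le> n \<Longrightarrow> \<exists>u\<in>Lx i. PZ a m \<otimes>\<^bsub>S\<^esub> zsS i = PZ (a(i := a i - 1)) m \<otimes>\<^bsub>S\<^esub> u"
    by (rule gen) (use assms pz_step(2) qc_pz in auto)
qed

lemma qc_PX: assumes "w = zS i \<or> w = zsS i" "i \<in> {1..n}" shows "m \<le> n \<Longrightarrow> \<exists>c. S.qc c (PX b m) w"
proof (induction m)
  case 0
  have "w \<in> carrier S" using assms by auto
  then show ?case using S.qc_one(2)[of w] by auto
next
  case (Suc m)
  obtain d where "S.qc d (xS (Suc m)) w" using qc_x_z[of "Suc m" i] Suc assms by blast
  then show ?case using S.qc_mult_left[OF _ S.qc_pow_left[of d "xS (Suc m)" w]] Suc by auto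
qed

text \<open>The x_k commute with one another, so an additional factor can be sorted into its
  place.\<close>

lemma x_PX:
  assumes "1 \<le> i" and b': "b' i = Suc (b i)" "\<And>j. j \<noteq> i \<Longrightarrow> b' j = b j"
  shows "i \<le> m \<Longrightarrow> m \<le> n \<Longrightarrow> xS i \<otimes>\<^bsub>S\<^esub> PX b m = PX b' m"
proof -
  have comm: "xS i \<otimes>\<^bsub>S\<^esub> PX b k = PX b k \<otimes>\<^bsub>S\<^esub> xS i" if "k \<le> n" "i \<le> n" for k
    using that
  proof (induction k)
    case (Suc k)
    have "S.qc 1 (xS i) (xS (Suc k) [^]\<^bsub>S\<^esub> b (Suc k))"
      using S.qc_pow_right[OF qc_x_x, of i "Suc k" "b (Suc k)"] Suc by simp
    then have "S.qc (1 * 1) (xS i) (PX b k \<otimes>\<^bsub>S\<^esub> xS (Suc k) [^]\<^bsub>S\<^esub> b (Suc k))"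
      using Suc by (intro S.qc_mult_right) (auto simp: S.qc_def)
    then show ?case using Suc by (simp add: S.qc_def)
  qed simp
  assume "i \<le> m" "m \<le> n"
  then show ?thesis
  proof (induction m rule: dec_induct)
    case base
    obtain k where k: "i = Suc k" using assms by (cases i) auto
    have "PX b' k = PX b k" by (rule PX_cong) (auto simp: k b'(2))
    moreover have "xS (Suc k) \<otimes>\<^bsub>S\<^esub> xS (Suc k) [^]\<^bsub>S\<^esub> b (Suc k) = xS (Suc k) [^]\<^bsub>S\<^esub> Suc (b (Suc k))"
      using base k by (intro S.nat_pow_Suc2[symmetric]) simp
    ultimately show ?case using comm[of k] base b'(1) unfolding k
      by (simp add: S.m_assoc flip: S.m_assoc[of "xS (Suc k)" "PX b k"] del: S.nat_pow_Suc)
  next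
    case (step m)
    then show ?case using b'(2)[of "Suc m"] by (simp flip: S.m_assoc)
  qed
qed

inductive_set SP :: "(gen list \<Rightarrow>\<^sub>0 complex) set set" where
  zero: "\<zero>\<^bsub>S\<^esub> \<in> SP"
| step: "p \<in> NF \<Longrightarrow> s \<in> SP \<Longrightarrow> c \<odot>\<^bsub>S\<^esub> p \<oplus>\<^bsub>S\<^esub> s \<in> SP"

lemma SP_closed: "s \<in> SP \<Longrightarrow> s \<in> carrier S"
  by (induction rule: SP.induct) (auto intro: NF_closed)

lemma SP_add: "s \<in> SP \<Longrightarrow> t \<in> SP \<Longrightarrow> s \<oplus>\<^bsub>S\<^esub> t \<in> SP"
proof (induction rule: SP.induct)
  case zero then show ?case using SP_closed by simp
next
  case (step p s c)
  have "c \<odot>\<^bsub>S\<^esub> p \<oplus>\<^bsub>S\<^esub> (s \<oplus>\<^bsub>S\<^esub> t) \<in> SP" using step by (intro SP.step) auto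
  then show ?case using step SP_closed NF_closed by (simp add: S.a_assoc)
qed

lemma SP_NF: "p \<in> NF \<Longrightarrow> c \<odot>\<^bsub>S\<^esub> p \<in> SP"
  using SP.step[OF _ SP.zero, of p c] NF_closed by simp

lemma SP_smult: "s \<in> SP \<Longrightarrow> c \<odot>\<^bsub>S\<^esub> s \<in> SP"
proof (induction rule: SP.induct)
  case zero then show ?case by (simp add: SP.zero)
next
  case (step p s d)
  then show ?case using SP_closed NF_closed SP.step[OF step(1,3), of "c * d"]
    by (simp add: S.smult_add_right S.smult_smult)
qed

lemma Lx_NF:
  assumes "i \<in> {1..n}" "u \<in> Lx i" shows "PZ a n \<otimes>\<^bsub>S\<^esub> (u \<otimes>\<^bsub>S\<^esub> PX b (n - 1)) \<in> SP"
proof -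
  obtain \<alpha> \<beta> \<gamma> where u: "u = \<alpha> \<odot>\<^bsub>S\<^esub> \<one>\<^bsub>S\<^esub> \<oplus>\<^bsub>S\<^esub> \<beta> \<odot>\<^bsub>S\<^esub> xS i \<oplus>\<^bsub>S\<^esub> \<gamma> \<odot>\<^bsub>S\<^esub> xS (i - 1)"
    using assms by (auto simp: Lx_def)
  have nf: "PZ a n \<otimes>\<^bsub>S\<^esub> PX b (n - 1) \<in> NF" for b unfolding NF_def by blast
  have x: "PZ a n \<otimes>\<^bsub>S\<^esub> (xS k \<otimes>\<^bsub>S\<^esub> PX b (n - 1)) \<in> SP" if "k \<le> n" for k
  proof -
    \<comment> \<open>The end cases are the conventions x_0 = 0 and x_n = 1; any other x_k raises
      one exponent of the \<open>PX\<close> part.\<close>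
    have "k = 0 \<or> k = n \<or> (1 \<le> k \<and> k \<le> n - 1)" using that by arith
    then consider "k = 0" | "k = n" | "1 \<le> k" "k \<le> n - 1" by blast
    then show ?thesis
    proof cases
      case 1 then show ?thesis by (simp add: xS_0 SP.zero)
    next
      case 2 then show ?thesis using SP_NF[OF nf, of 1] by (simp add: xS_n)
    next
      case 3
      then show ?thesis using SP_NF[OF nf, of 1] x_PX[of k "b(k := Suc (b k))" b "n - 1"] by simp
    qed
  qed
  have c: "xS i \<in> carrier S" "xS (i - 1) \<in> carrier S" "PX b (n - 1) \<in> carrier S" "PZ a n \<in> carrier S" using assms by auto
  have "PZ a n \<otimes>\<^bsub>S\<^esub> (u \<otimes>\<^bsub>S\<^esub> PX b (n - 1)) =
    \<alpha> \<odot>\<^bsub>S\<^esub> (PZ a n \<otimes>\<^bsub>S\<^esub> PX b (n - 1)) \<oplus>\<^bsub>S\<^esub> \<beta> \<odot>\<^bsub>S\<^esub> (PZ a n \<otimes>\<^bsub>S\<^esub> (xS i \<otimes>\<^bsub>S\<^esub> PX b (n - 1)))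
      \<oplus>\<^bsub>S\<^esub> \<gamma> \<odot>\<^bsub>S\<^esub> (PZ a n \<otimes>\<^bsub>S\<^esub> (xS (i - 1) \<otimes>\<^bsub>S\<^esub> PX b (n - 1)))"
    using c by (simp add: u S.l_distr S.r_distr S.smult_mult_left S.smult_mult_right)
  moreover have "i - 1 \<le> n" "i \<le> n" using assms by auto
  moreover have "PZ a n \<otimes>\<^bsub>S\<^esub> PX b (n - 1) \<in> SP" using SP_NF[OF nf, of 1] by simp
  ultimately show ?thesis using x by (auto intro!: SP_add SP_smult)
qed

lemma NF_gen:
  assumes "p \<in> NF" "w = zS i \<or> w = zsS i" "i \<in> {1..n}" shows "p \<otimes>\<^bsub>S\<^esub> w \<in> SP"
proof -
  obtain a b where p: "p = PZ a n \<otimes>\<^bsub>S\<^esub> PX b (n - 1)" using assms by (auto simp: NF_def)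
  obtain c where "S.qc c (PX b (n - 1)) w" using qc_PX[OF assms(2,3), of "n - 1" b] by auto
  then have c: "PX b (n - 1) \<otimes>\<^bsub>S\<^esub> w = c \<odot>\<^bsub>S\<^esub> (w \<otimes>\<^bsub>S\<^esub> PX b (n - 1))" by (simp add: S.qc_def)
  obtain u a' where u: "u \<in> Lx i" "PZ a n \<otimes>\<^bsub>S\<^esub> w = PZ a' n \<otimes>\<^bsub>S\<^esub> u"
    using PZ_step[OF assms(3), of n a] assms(2,3) by auto
  have cl: "w \<in> carrier S" "u \<in> carrier S" using assms Lx_closed u by auto
  have "p \<otimes>\<^bsub>S\<^esub> w = c \<odot>\<^bsub>S\<^esub> (PZ a n \<otimes>\<^bsub>S\<^esub> w \<otimes>\<^bsub>S\<^esub> PX b (n - 1))"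
    using cl by (simp add: p S.m_assoc c S.smult_mult_right)
  also have "\<dots> = c \<odot>\<^bsub>S\<^esub> (PZ a' n \<otimes>\<^bsub>S\<^esub> (u \<otimes>\<^bsub>S\<^esub> PX b (n - 1)))"
    using cl by (simp add: u S.m_assoc)
  finally show ?thesis using Lx_NF[OF assms(3) u(1)] SP_smult by simp
qed

lemma SP_gen: assumes "s \<in> SP" "w = zS i \<or> w = zsS i" "i \<in> {1..n}" shows "s \<otimes>\<^bsub>S\<^esub> w \<in> SP"
  using assms(1)
proof (induction rule: SP.induct)
  case zero then show ?case using assms by (auto simp: SP.zero)
next
  case (step p s c)
  have "w \<in> carrier S" using assms by auto
  then have "(c \<odot>\<^bsub>S\<^esub> p \<oplus>\<^bsub>S\<^esub> s) \<otimes>\<^bsub>S\<^esub> w = c \<odot>\<^bsub>S\<^esub> (p \<otimes>\<^bsub>S\<^esub> w) \<oplus>\<^bsub>S\<^esub> s \<otimes>\<^bsub>S\<^esub> w"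
    using step NF_closed SP_closed by (simp add: S.l_distr S.smult_mult_left)
  then show ?case using step NF_gen[OF step(1) assms(2,3)] by (auto intro!: SP_add SP_smult)
qed

lemma one_SP: "\<one>\<^bsub>S\<^esub> \<in> SP"
proof -
  have "PZ (\<lambda>_. 0) m = \<one>\<^bsub>S\<^esub>" if "m \<le> n" for m using that by (induction m) (auto simp: pz_def)
  moreover have "PX (\<lambda>_. 0) m = \<one>\<^bsub>S\<^esub>" if "m \<le> n" for m using that by (induction m) auto
  ultimately have "\<one>\<^bsub>S\<^esub> \<in> NF" unfolding NF_def
    by (intro CollectI exI[of _ "\<lambda>_. 0"]) simp
  from SP_NF[OF this, of 1] show ?thesis by simp
qed

lemma word_SP: "w \<in> lists G \<Longrightarrow> cl (word w) \<in> SP"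
proof (induction w rule: rev_induct)
  case Nil then show ?case using one_SP by (simp add: cl_ops one_word)
next
  case (snoc g w)
  then have w: "w \<in> lists G" "g \<in> G" by auto
  then obtain i where i: "i \<in> {1..n}" "g = Z i \<or> g = Zstar i" by (auto simp: sphere_gens_def)
  have "cl (word w) \<otimes>\<^bsub>S\<^esub> cl (word [g]) \<in> SP"
    by (rule SP_gen[OF _ _ i(1)]) (use snoc w i in \<open>auto simp: zS_def zsS_def\<close>)
  moreover have "cl (word w) \<otimes>\<^bsub>S\<^esub> cl (word [g]) = cl (word (w @ [g]))"
    using w by (subst cl_mult) (auto simp: word_mult)
  ultimately show ?case by simp
qed

lemma carrier_SP: "s \<in> carrier S \<Longrightarrow> s \<in> SP"
  unfolding S_def
proof (induction rule: Q.cls_induct)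
  case (1 c w) then show ?case using word_SP SP_smult by (simp add: S_def)
next
  case 2 then show ?case using SP.zero by (simp add: S_def)
next
  case (3 Y Z) then show ?case using SP_add by (simp add: S_def)
qed

section \<open>Injectivity by leading terms\<close>

lemma gimg_Zstar: assumes "j \<in> {1..n}" shows "gimg (Zstar j) \<noteq> 0" "e \<in> Poly_Mapping.keys (gimg (Zstar j)) \<Longrightarrow> zpart e i = - zpart (zc j) i"
proof -
  have "X j - X (j - 1) \<noteq> 0"
  proof
    assume "X j - X (j - 1) = 0"
    then have "X j = X (j - 1)" by simp
    then have "j \<noteq> 1" "xc j = xc (j - 1)" using assms by (auto simp: X_def split: if_splits)
    moreover have "xpart (xc j) (j - 1) = 0" "xpart (xc (j - 1)) (j - 1) = 1"
      using \<open>j \<noteq> 1\<close> assms by auto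
    ultimately show False by simp
  qed
  then show "gimg (Zstar j) \<noteq> 0" by (simp add: gimg_def tmul_nonzero)
  assume "e \<in> Poly_Mapping.keys (gimg (Zstar j))"
  then obtain h where h: "e = - zc j + h" "h \<in> Poly_Mapping.keys (X j - X (j - 1))"
    using keys_tmul[of "mon (- zc j)" "X j - X (j - 1)"] by (auto simp: gimg_def)
  then have "h \<in> Poly_Mapping.keys (X j) \<union> Poly_Mapping.keys (X (j - 1))" using keys_diff[of "X j" "X (j - 1)"] by blast
  then have "zpart h i = 0" by (auto simp: X_def split: if_splits)
  then show "zpart e i = - zpart (zc j) i" using h by simp
qed

abbreviation "ld p \<equiv> lead (evS p)"

lemma ld_mult: "a \<in> carrier S \<Longrightarrow> b \<in> carrier S \<Longrightarrow> evS a \<noteq> 0 \<Longrightarrow> evS b \<noteq> 0 \<Longrightarrow>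
    evS (a \<otimes>\<^bsub>S\<^esub> b) \<noteq> 0 \<and> ld (a \<otimes>\<^bsub>S\<^esub> b) = ld a + ld b"
  by (simp add: evS_mult tmul_nonzero lead_mult)

lemma ld_pow: "a \<in> carrier S \<Longrightarrow> evS a \<noteq> 0 \<Longrightarrow>
    evS (a [^]\<^bsub>S\<^esub> m) \<noteq> 0 \<and> (\<forall>j. zpart (ld (a [^]\<^bsub>S\<^esub> (m::nat))) j = int m * zpart (ld a) j \<and>
      xpart (ld (a [^]\<^bsub>S\<^esub> m)) j = int m * xpart (ld a) j)"
proof (induction m)
  case 0
  then show ?case by (simp add: evS_one lead_single[of 1 0, simplified])
next
  case (Suc m)
  then show ?case using ld_mult[of "a [^]\<^bsub>S\<^esub> m" a] by (simp add: algebra_simps)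
qed

text \<open>All terms in the image of z_j^* have the same z-exponents, so these are known whichever
  term leads.\<close>

lemma ld_pz: assumes "j \<in> {1..n}" shows "evS (pz a j) \<noteq> 0" "zpart (ld (pz a j)) i = a j * zpart (zc j) i"
proof -
  have z: "evS (zS j) \<noteq> 0" "ld (zS j) = zc j" using assms by (simp_all add: evS_gens gimg_def)
  have zs: "evS (zsS j) \<noteq> 0" "zpart (ld (zsS j)) i = - zpart (zc j) i"
    using gimg_Zstar[OF assms] lead_in[of "gimg (Zstar j)"] assms by (simp_all add: evS_gens)
  show "evS (pz a j) \<noteq> 0" "zpart (ld (pz a j)) i = a j * zpart (zc j) i"
    using ld_pow[OF gens_closed(1)[OF assms] z(1), of "nat (a j)"] ld_pow[OF gens_closed(2)[OF assms] zs(1), of "nat (- a j)"]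
      z zs by (auto simp: pz_def)
qed

lemma ld_PZ: "m \<le> n \<Longrightarrow> evS (PZ a m) \<noteq> 0 \<and> (\<forall>j. zpart (ld (PZ a m)) j = (if j \<in> {1..m} then a j else 0))"
proof (induction m)
  case 0 show ?case by (simp add: evS_one lead_single[of 1 0, simplified])
next
  case (Suc m)
  then have m: "Suc m \<in> {1..n}" "m \<le> n" by auto
  show ?case using Suc ld_mult[of "PZ a m" "pz a (Suc m)"] ld_pz[OF m(1), of a] pz_closed[OF m(1), of a] PZ_closed[OF m(2), of a]
    by (auto simp: le_Suc_eq)
qed

lemma ld_PX: "m < n \<Longrightarrow> evS (PX b m) \<noteq> 0 \<and>
  (\<forall>j. zpart (ld (PX b m)) j = 0 \<and> xpart (ld (PX b m)) j = (if j \<in> {1..m} then int (b j) else 0))"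
proof (induction m)
  case 0 show ?case by (simp add: evS_one lead_single[of 1 0, simplified])
next
  case (Suc m)
  have x: "evS (xS (Suc m)) \<noteq> 0" "ld (xS (Suc m)) = xc (Suc m)" using Suc.prems by (simp_all add: evS_xS X_def)
  show ?case using Suc ld_mult[of "PX b m" "xS (Suc m) [^]\<^bsub>S\<^esub> b (Suc m)"] ld_pow[OF xS_closed x(1), of "b (Suc m)"] x(2)
    by (auto simp: le_Suc_eq)
qed

text \<open>The z-exponents of the leading term determine \<open>a\<close>, because the
  \<open>PX\<close> part contributes none. Then the \<open>PZ\<close> parts agree, their leading
  exponent cancels, and the x-exponents determine \<open>b\<close>.\<close>

lemma ld_NF_inj:
  assumes "p \<in> NF" "p' \<in> NF" "ld p = ld p'" shows "p = p'"
proof -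
  obtain a b a' b' where p: "p = PZ a n \<otimes>\<^bsub>S\<^esub> PX b (n - 1)" "p' = PZ a' n \<otimes>\<^bsub>S\<^esub> PX b' (n - 1)"
    using assms by (auto simp: NF_def)
  have m: "n - 1 < n" using n_pos by simp
  have l: "ld (PZ a n \<otimes>\<^bsub>S\<^esub> PX b (n - 1)) = ld (PZ a n) + ld (PX b (n - 1))" for a b
    using ld_mult[of "PZ a n" "PX b (n - 1)"] ld_PZ[of n a] ld_PX[OF m, of b] by simp
  have "a j = a' j" if "j \<in> {1..n}" for j
  proof -
    have "zpart (ld p) j = zpart (ld p') j" using assms by simp
    then show ?thesis using that ld_PZ[of n a] ld_PZ[of n a'] ld_PX[OF m, of b] ld_PX[OF m, of b'] by (simp add: p l)
  qed
  then have PZ: "PZ a n = PZ a' n" by (rule PZ_cong)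
  then have lx: "ld (PX b (n - 1)) = ld (PX b' (n - 1))" using assms(3) by (simp add: p l)
  have "b j = b' j" if "j \<in> {1..n - 1}" for j
    using arg_cong[OF lx, of "\<lambda>e. xpart e j"] that ld_PX[OF m, of b] ld_PX[OF m, of b'] by simp
  then have "PX b (n - 1) = PX b' (n - 1)" by (rule PX_cong)
  then show ?thesis using PZ p by simp
qed

lemma NF_nonzero: "p \<in> NF \<Longrightarrow> evS p \<noteq> 0"
  using ld_mult ld_PZ ld_PX[of "n - 1"] n_pos by (force simp: NF_def)

text \<open>Linear combinations are indexed by the PBW elements themselves and not by their
  exponents; this is why \<open>ld_NF_inj\<close> concludes an equality of elements.\<close>

definition "ET t = (\<Sum>p\<in>Poly_Mapping.keys t. fscale (Poly_Mapping.lookup t p) (evS p))"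

lemma ET_add: "ET (s + t) = ET s + ET t"
proof -
  let ?S = "Poly_Mapping.keys s \<union> Poly_Mapping.keys t"
  have *: "ET h = (\<Sum>w\<in>?S. fscale (Poly_Mapping.lookup h w) (evS w))" if "Poly_Mapping.keys h \<subseteq> ?S" for h
    unfolding ET_def using that by (intro sum.mono_neutral_left) (auto simp: in_keys_iff)
  have "Poly_Mapping.keys (s + t) \<subseteq> ?S" by (rule Poly_Mapping.keys_add)
  then show ?thesis by (simp add: * lookup_add fvs.scale_left_distrib sum.distrib)
qed

lemma SP_expansion: "s \<in> SP \<Longrightarrow> \<exists>t. Poly_Mapping.keys t \<subseteq> NF \<and> s = lsum S (\<lambda>p. p) t \<and> evS s = ET t"
proof (induction rule: SP.induct)
  case zero show ?case by (intro exI[of _ 0]) (simp add: ET_def evS_zero)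
next
  case (step p s c)
  then obtain t where t: "Poly_Mapping.keys t \<subseteq> NF" "s = lsum S (\<lambda>p. p) t" "evS s = ET t" by blast
  let ?t = "Poly_Mapping.single p c + t"
  have k: "Poly_Mapping.keys (Poly_Mapping.single p c) \<subseteq> NF" using step by simp
  then have "Poly_Mapping.keys ?t \<subseteq> NF" using t(1) Poly_Mapping.keys_add[of "Poly_Mapping.single p c" t] by blast
  moreover have "lsum S (\<lambda>p. p) ?t = c \<odot>\<^bsub>S\<^esub> p \<oplus>\<^bsub>S\<^esub> s"
    using S.lsum_add[of NF "\<lambda>p. p", OF NF_closed k t(1)] NF_closed[OF step(1)] t(2) by simp
  moreover have "ET (Poly_Mapping.single p c) = fscale c (evS p)" by (cases "c = 0") (simp_all add: ET_def)
  ultimately show ?case using step NF_closed SP_closed t(3)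
    by (intro exI[of _ ?t]) (simp add: evS_add evS_smult ET_add)
qed

text \<open>The largest leading exponent occurs in one summand only, so its coefficient cannot
  cancel.\<close>

lemma ET_nonzero:
  assumes "Poly_Mapping.keys t \<subseteq> NF" "t \<noteq> 0" shows "ET t \<noteq> 0"
proof -
  let ?L = "ld ` Poly_Mapping.keys t"
  have "finite ?L" "?L \<noteq> {}" using assms by auto
  then have "Max ?L \<in> ?L" by (rule Max_in)
  then obtain p where p: "p \<in> Poly_Mapping.keys t" "ld p = Max ?L" by force
  have z: "Poly_Mapping.lookup (evS p') (ld p) = 0" if "p' \<in> Poly_Mapping.keys t" "p' \<noteq> p" for p'
  proof (rule ccontr)
    assume "Poly_Mapping.lookup (evS p') (ld p) \<noteq> 0"
    then have "ld p \<le> ld p'" by (intro lead_ge) (simp add: in_keys_iff)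
    moreover have "ld p' \<le> ld p" using p that by simp
    ultimately have "ld p' = ld p" by simp
    then show False using ld_NF_inj assms(1) p that by blast
  qed
  have "Poly_Mapping.lookup (ET t) (ld p) = (\<Sum>p'\<in>Poly_Mapping.keys t. Poly_Mapping.lookup t p' * Poly_Mapping.lookup (evS p') (ld p))"
    by (simp add: ET_def lookup_sum)
  also have "\<dots> = (\<Sum>p'\<in>{p}. Poly_Mapping.lookup t p' * Poly_Mapping.lookup (evS p') (ld p))"
    by (rule sum.mono_neutral_right) (use p z in auto)
  also have "\<dots> \<noteq> 0" using p lead_in[OF NF_nonzero, of p] assms(1) by (auto simp: in_keys_iff)
  finally show ?thesis by auto
qed

lemma evS_injective: assumes "a \<in> carrier S" "b \<in> carrier S" "evS a = evS b" shows "a = b"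
proof -
  let ?d = "a \<oplus>\<^bsub>S\<^esub> (-1) \<odot>\<^bsub>S\<^esub> b"
  have d: "?d \<in> carrier S" "evS ?d = 0" using assms by (simp_all add: evS_add evS_smult)
  then obtain t where "Poly_Mapping.keys t \<subseteq> NF" "?d = lsum S (\<lambda>p. p) t" "evS ?d = ET t"
    using SP_expansion[OF carrier_SP] by blast
  then have "?d = \<zero>\<^bsub>S\<^esub>" using ET_nonzero[of t] d by (cases "t = 0") auto
  then show ?thesis using assms S.minus_unique S.smult_minus_one
    by (metis S.a_comm S.minus_equality S.minus_minus S.smult_closed)
qed

end

section \<open>Graded automorphisms of the quantum sphere\<close>

context qsphere begin

section \<open>Exponents and weights in the image of the sphere\<close>

definition "zdeg e = (\<Sum>j=1..n. zpart e j)"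

lemma zdeg_add [simp]: "zdeg (g + h) = zdeg g + zdeg h"
  by (simp add: zdeg_def sum.distrib)

lemma zdeg_gimg: "g \<in> G \<Longrightarrow> e \<in> Poly_Mapping.keys (gimg g) \<Longrightarrow> zdeg e = gdeg g"
proof -
  assume g: "g \<in> G" "e \<in> Poly_Mapping.keys (gimg g)"
  then obtain j where j: "j \<in> {1..n}" "g = Z j \<or> g = Zstar j" by (auto simp: sphere_gens_def)
  have zc: "zdeg (zc j) = 1" using j by (simp add: zdeg_def sum.delta)
  from j(2) show ?thesis
  proof
    assume "g = Z j" then show ?thesis using g zc by (simp add: gimg_def)
  next
    assume *: "g = Zstar j"
    then have "zdeg e = - zdeg (zc j)" using gimg_Zstar(2)[OF j(1), of e] g by (simp add: zdeg_def sum_negf)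
    then show ?thesis using zc * by simp
  qed
qed

lemma evw_props:
  "w \<in> lists G \<Longrightarrow> (\<forall>e\<in>Poly_Mapping.keys (evw w). cone e \<and> zdeg e = deg w) \<and> preserves_positive (evw w)"
proof (induction w)
  case Nil then show ?case by (simp add: cone_def zdeg_def positive_one)
next
  case (Cons g w)
  have "cone e \<and> zdeg e = deg (g # w)" if e: "e \<in> Poly_Mapping.keys (gimg g \<star> evw w)" for e
  proof -
    obtain a b where "e = a + b" "a \<in> Poly_Mapping.keys (gimg g)" "b \<in> Poly_Mapping.keys (evw w)"
      using keys_tmul[of "gimg g" "evw w"] e by blast
    then show ?thesis using Cons cone_add cone_gimg[of g a] zdeg_gimg[of g a] by auto
  qed
  then show ?case using Cons positive_gimg by auto
qed

lemma keys_ev: "e \<in> Poly_Mapping.keys (ev f) \<Longrightarrow> \<exists>w\<in>Poly_Mapping.keys f. e \<in> Poly_Mapping.keys (evw w)"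
proof -
  assume "e \<in> Poly_Mapping.keys (ev f)"
  then obtain w where "w \<in> Poly_Mapping.keys f" "e \<in> Poly_Mapping.keys (fscale (Poly_Mapping.lookup f w) (evw w))"
    unfolding ev_def using Poly_Mapping.keys_sum[of "\<lambda>w. fscale (Poly_Mapping.lookup f w) (evw w)" "Poly_Mapping.keys f"] by blast
  then show ?thesis using keys_fscale[of "Poly_Mapping.lookup f w" "evw w"] by blast
qed

lemma evS_cone: assumes "a \<in> carrier S" "e \<in> Poly_Mapping.keys (evS a)" shows "cone e"
proof -
  obtain f where f: "f \<in> Fr" "a = cl f" using assms(1) by (rule cl_exhaust)
  then obtain w where "w \<in> Poly_Mapping.keys f" "e \<in> Poly_Mapping.keys (evw w)"
    using keys_ev[of e f] assms(2) by (auto simp: evS_cl)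
  then show ?thesis using f evw_props[of w] by blast
qed

lemma evS_zdeg: assumes "a \<in> Hk k" "e \<in> Poly_Mapping.keys (evS a)" shows "zdeg e = k"
proof -
  obtain f where f: "f \<in> Fr" "a = cl f" "\<forall>w\<in>Poly_Mapping.keys f. deg w = k" using assms(1) by (auto simp: Hk_def)
  then obtain w where "w \<in> Poly_Mapping.keys f" "e \<in> Poly_Mapping.keys (evw w)"
    using keys_ev[of e f] assms(2) by (auto simp: evS_cl)
  moreover from this have "w \<in> lists G" using f(1) by blast
  ultimately show ?thesis using f(3) evw_props[of w] by simp
qed

lemma evS_positive: assumes "a \<in> carrier S" shows "preserves_positive (evS a)"
proof -
  obtain f where f: "f \<in> Fr" "a = cl f" using assms(1) by (rule cl_exhaust)
  have "preserves_positive (\<Sum>w\<in>W. fscale (h w) (evw w))" if "W \<subseteq> lists G" for W h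
    using that
  proof (induction W rule: infinite_finite_induct)
    case (insert w W) then show ?case using evw_props[of w] by (simp add: positive_add positive_fscale)
  qed (simp_all add: preserves_positive_def)
  then show ?thesis using f by (simp add: evS_cl ev_def)
qed

lemma S_gen_induct [consumes 1, case_names one add smult mult]:
  assumes "a \<in> carrier S" and one: "Q \<one>\<^bsub>S\<^esub>"
    and add: "\<And>a b. a \<in> carrier S \<Longrightarrow> b \<in> carrier S \<Longrightarrow> Q a \<Longrightarrow> Q b \<Longrightarrow> Q (a \<oplus>\<^bsub>S\<^esub> b)"
    and smult: "\<And>c a. a \<in> carrier S \<Longrightarrow> Q a \<Longrightarrow> Q (c \<odot>\<^bsub>S\<^esub> a)"
    and mult: "\<And>a w i. a \<in> carrier S \<Longrightarrow> Q a \<Longrightarrow> i \<in> {1..n} \<Longrightarrow> w = zS i \<or> w = zsS i \<Longrightarrow> Q (a \<otimes>\<^bsub>S\<^esub> w)"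
  shows "Q a"
proof -
  have w: "Q (cl (word w))" if "w \<in> lists G" for w using that
  proof (induction w rule: rev_induct)
    case Nil show ?case using one by (simp add: cl_ops one_word)
  next
    case (snoc g w)
    then have w: "w \<in> lists G" "g \<in> G" by auto
    then obtain i where i: "i \<in> {1..n}" "g = Z i \<or> g = Zstar i" by (auto simp: sphere_gens_def)
    have "Q (cl (word w) \<otimes>\<^bsub>S\<^esub> cl (word [g]))"
      by (rule mult[OF _ _ i(1)]) (use snoc w i in \<open>auto simp: zS_def zsS_def intro!: cl_closed Fr_closed(5)\<close>)
    moreover have "cl (word w) \<otimes>\<^bsub>S\<^esub> cl (word [g]) = cl (word (w @ [g]))"
      using w by (subst cl_mult) (auto simp: word_mult)
    ultimately show ?case by simp
  qed
  show ?thesis using assms(1)[unfolded S_def]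
  proof (induction rule: Q.cls_induct)
    case (1 c v) then show ?case using smult[OF _ w[of v], of c] cl_closed Fr_closed(5)[of v 1] by (simp add: S_def)
  next
    case 2
    have "Q \<zero>\<^bsub>S\<^esub>" using smult[OF S.one_closed one, of 0] by simp
    then show ?case by (simp only: S_def)
  next
    case (3 Y Z) then show ?case using add by (simp add: S_def)
  qed
qed

text \<open>Since x_k commutes with every generator up to a scalar, it can be moved through a
  product one factor at a time.\<close>

lemma x_normal: assumes "k \<le> n" "r \<in> carrier S" shows "\<exists>r'\<in>carrier S. xS k \<otimes>\<^bsub>S\<^esub> r = r' \<otimes>\<^bsub>S\<^esub> xS k"
  using assms(2)
proof (induction rule: S_gen_induct)
  case one then show ?case using assms by (intro bexI[of _ "\<one>\<^bsub>S\<^esub>"]) auto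
next
  case (add a b)
  then obtain a' b' where "a' \<in> carrier S" "b' \<in> carrier S" "xS k \<otimes>\<^bsub>S\<^esub> a = a' \<otimes>\<^bsub>S\<^esub> xS k" "xS k \<otimes>\<^bsub>S\<^esub> b = b' \<otimes>\<^bsub>S\<^esub> xS k" by blast
  then show ?case using assms add by (intro bexI[of _ "a' \<oplus>\<^bsub>S\<^esub> b'"]) (auto simp: S.l_distr S.r_distr)
next
  case (smult c a)
  then obtain a' where "a' \<in> carrier S" "xS k \<otimes>\<^bsub>S\<^esub> a = a' \<otimes>\<^bsub>S\<^esub> xS k" by blast
  then show ?case using assms smult by (intro bexI[of _ "c \<odot>\<^bsub>S\<^esub> a'"]) (auto simp: S.smult_mult_left S.smult_mult_right)
next
  case (mult a w i)
  then obtain a' where a': "a' \<in> carrier S" "xS k \<otimes>\<^bsub>S\<^esub> a = a' \<otimes>\<^bsub>S\<^esub> xS k" by blast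
  obtain c where "S.qc c (xS k) w" using qc_x_z[OF assms(1) \<open>i \<in> {1..n}\<close>] \<open>w = zS i \<or> w = zsS i\<close> by blast
  then have w: "w \<in> carrier S" "xS k \<otimes>\<^bsub>S\<^esub> w = c \<odot>\<^bsub>S\<^esub> (w \<otimes>\<^bsub>S\<^esub> xS k)" by (auto simp: S.qc_def)
  have x: "xS k \<in> carrier S" using assms by simp
  have "xS k \<otimes>\<^bsub>S\<^esub> (a \<otimes>\<^bsub>S\<^esub> w) = a' \<otimes>\<^bsub>S\<^esub> (xS k \<otimes>\<^bsub>S\<^esub> w)"
    using x a' w(1) mult(1) by (simp flip: S.m_assoc)
  also have "\<dots> = (c \<odot>\<^bsub>S\<^esub> (a' \<otimes>\<^bsub>S\<^esub> w)) \<otimes>\<^bsub>S\<^esub> xS k"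
    using x a' w by (simp add: S.smult_mult_left S.smult_mult_right S.m_assoc)
  finally show ?case using a' w by (intro bexI[of _ "c \<odot>\<^bsub>S\<^esub> (a' \<otimes>\<^bsub>S\<^esub> w)"]) auto
qed

text \<open>Half the power of q that arises when x_l is moved past a monomial with exponent
  \<open>e\<close>, see \<open>om_xc_tail\<close>; for l = 0 it is the total degree. Differences of
  consecutive tails return the z-exponents.\<close>

definition tail :: "nat \<Rightarrow> qindex \<Rightarrow> int" where "tail l e = (\<Sum>j\<in>{l<..n}. zpart e j)"

lemma tail_0: "tail 0 e = zdeg e"
  by (simp add: tail_def zdeg_def) (rule sum.cong, auto)

lemma om_xc_tail: "l \<ge> 1 \<Longrightarrow> om (xc l) (zpart e) = 2 * tail l e"
  by (simp add: om_xc tail_def)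

lemma zpart_tail: assumes "j \<in> {1..n}" shows "zpart e j = tail (j - 1) e - tail j e"
proof -
  have "{j - 1<..n} = insert j {j<..n}" using assms by auto
  then show ?thesis by (simp add: tail_def)
qed

lemma cone_zpart: "cone e \<Longrightarrow> j \<notin> {1..n} \<Longrightarrow> zpart e j = 0"
  and cone_xpart: "cone e \<Longrightarrow> k \<notin> {1..<n} \<Longrightarrow> xpart e k = 0"
proof -
  assume e: "cone e"
  then have "Poly_Mapping.lookup e i = 0" if "i \<notin> {2..2 * n}" for i using that by (auto simp: cone_def in_keys_iff)
  then show "j \<notin> {1..n} \<Longrightarrow> zpart e j = 0" "k \<notin> {1..<n} \<Longrightarrow> xpart e k = 0"
    by (auto simp: zpart_def xpart_def)
qed

lemma cone_zpart_eqI: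
  assumes "cone e" "cone e'" "zdeg e = zdeg e'" "\<And>l. l \<in> {1..<n} \<Longrightarrow> tail l e = tail l e'"
  shows "zpart e j = zpart e' j"
proof (cases "j \<in> {1..n}")
  case True
  have t: "tail l e = tail l e'" if "l \<le> n" for l
    using that assms(3,4) tail_0 by (cases "l = 0"; cases "l = n") (auto simp: tail_def)
  have "j - 1 \<le> n" "j \<le> n" using True by auto
  then show ?thesis using zpart_tail[OF True] t[of j] t[of "j - 1"] by simp
next
  case False then show ?thesis using cone_zpart assms by metis
qed

lemma om_zc_right: "j \<in> {1..n} \<Longrightarrow> om g (zpart (zc j)) = (\<Sum>i=1..<j. zpart g i + 2 * xpart g i)"
  by (simp add: om_def sum.delta if_distrib[of "\<lambda>x. _ * x"] cong: if_cong)

text \<open>Both the leading and the lowest term of \<open>T\<close> must be \<open>e\<close>, so \<open>T\<close> is a monomial.\<close>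

lemma commute_equal_brackets:
  assumes "T \<star> Y = Y \<star> mon e" "Y \<noteq> 0" "g \<in> Poly_Mapping.keys Y" "h \<in> Poly_Mapping.keys Y"
  shows "om g (zpart e) - om e (zpart g) = om h (zpart e) - om e (zpart h)"
proof -
  have nz: "Y \<star> mon e \<noteq> 0" by (rule tmul_nonzero) (use assms in auto)
  then have T: "T \<noteq> 0" using assms(1) by auto
  have "lead T + lead Y = lead Y + e" "low T + low Y = low Y + e"
    using lead_mult[OF T assms(2)] lead_mult[OF assms(2), of "mon e"] low_mult[OF T assms(2)] low_mult[OF assms(2), of "mon e"]
    by (simp_all add: assms(1))
  then have "lead T = e" "low T = e" by (simp_all add: add.commute)
  then obtain c where c: "T = Poly_Mapping.single e c" using lead_eq_low[OF T] by metis
  have *: "c = qp (om g (zpart e) - om e (zpart g))" if g: "g \<in> Poly_Mapping.keys Y" for g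
  proof -
    have "c * Poly_Mapping.lookup Y g * qp (om e (zpart g)) = 1 * Poly_Mapping.lookup Y g * qp (om g (zpart e))"
      using assms(1) lookup_single_tmul[of e c Y g] lookup_tmul_single[of Y e 1 g] by (simp add: c add.commute)
    then have "c * qp (om e (zpart g)) = qp (om g (zpart e))" using g by (simp add: in_keys_iff)
    moreover have "qp (om g (zpart e)) = qp (om g (zpart e) - om e (zpart g)) * qp (om e (zpart g))"
      using qp_add[of "om g (zpart e) - om e (zpart g)" "om e (zpart g)"] by simp
    ultimately show ?thesis by simp
  qed
  show ?thesis using *[OF assms(3)] *[OF assms(4)] by (simp add: qp_inj)
qed

section \<open>Images of the partial sums x_k\<close>

definition graded_iso where
  "graded_iso F F' \<longleftrightarrow> clinear S S F \<and> clinear S S F' \<and> (\<forall>k. \<forall>a\<in>Hk k. F a \<in> Hk k \<and> F' a \<in> Hk k) \<and>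
    F \<one>\<^bsub>S\<^esub> = \<one>\<^bsub>S\<^esub> \<and> F' \<one>\<^bsub>S\<^esub> = \<one>\<^bsub>S\<^esub> \<and>
    (\<forall>a\<in>carrier S. \<forall>b\<in>carrier S. F (a \<otimes>\<^bsub>S\<^esub> b) = F a \<otimes>\<^bsub>S\<^esub> F b \<and> F' (a \<otimes>\<^bsub>S\<^esub> b) = F' a \<otimes>\<^bsub>S\<^esub> F' b) \<and>
    (\<forall>a\<in>carrier S. F (F' a) = a \<and> F' (F a) = a)"

lemma graded_iso_sym: "graded_iso F F' \<Longrightarrow> graded_iso F' F"
  by (auto simp: graded_iso_def)

lemma xS_Hk: "k \<le> n \<Longrightarrow> xS k \<in> Hk 0"
proof (induction k)
  case 0 have "\<zero>\<^bsub>S\<^esub> \<in> Hk 0" unfolding cl_ops by (rule HkI) auto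
  then show ?case by (simp add: xS_0)
next
  case (Suc k)
  have "zS (Suc k) \<otimes>\<^bsub>S\<^esub> zsS (Suc k) \<in> Hk (1 + - 1)"
    unfolding zS_def zsS_def using Suc.prems by (intro Hk_mult word_Hk) auto
  then show ?case using Suc xS_step[of "Suc k"] Hk_add by simp
qed

lemma gens_Hk: "j \<in> {1..n} \<Longrightarrow> zS j \<in> Hk 1" "j \<in> {1..n} \<Longrightarrow> zsS j \<in> Hk (- 1)"
  unfolding zS_def zsS_def by (auto intro!: word_Hk)

lemma gimg_Zstar_expand:
  "i \<ge> 2 \<Longrightarrow> gimg (Zstar i) = mon (- zc i + xc i) - mon (- zc i + xc (i - 1))"
  by (simp add: gimg_def X_def tmul_diff_right tmul_single)

context
  fixes F F' assumes iso: "graded_iso F F'"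
begin

lemma iso_linear: "clinear S S F" and iso_mult: "a \<in> carrier S \<Longrightarrow> b \<in> carrier S \<Longrightarrow> F (a \<otimes>\<^bsub>S\<^esub> b) = F a \<otimes>\<^bsub>S\<^esub> F b"
  and iso_one: "F \<one>\<^bsub>S\<^esub> = \<one>\<^bsub>S\<^esub>" and iso_Hk: "a \<in> Hk k \<Longrightarrow> F a \<in> Hk k"
  and iso_inv: "a \<in> carrier S \<Longrightarrow> F (F' a) = a" "a \<in> carrier S \<Longrightarrow> F' (F a) = a"
  and iso_linear': "clinear S S F'"
  using iso by (auto simp: graded_iso_def)

lemma iso_closed: "a \<in> carrier S \<Longrightarrow> F a \<in> carrier S"
  by (rule clinear_closed[OF iso_linear])

lemma iso_zero: "a \<in> carrier S \<Longrightarrow> evS (F a) = 0 \<Longrightarrow> a = \<zero>\<^bsub>S\<^esub>"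
proof -
  assume a: "a \<in> carrier S" "evS (F a) = 0"
  then have "F a = \<zero>\<^bsub>S\<^esub>" using iso_closed by (intro evS_injective) (auto simp: evS_zero)
  then show ?thesis using iso_inv(2)[OF a(1)] clinear_zero[OF cvec_S cvec_S iso_linear'] by simp
qed

lemma x_image:
  assumes k: "k \<in> {1..<n}"
  shows "\<exists>c g. c \<noteq> 0 \<and> evS (F (xS k)) = Poly_Mapping.single g c \<and> (\<forall>j. zpart g j = 0) \<and> cone g"
proof -
  let ?y = "F (xS k)" and ?Y = "evS (F (xS k))"
  have kn: "k \<le> n" "k \<ge> 1" using k by auto
  have y: "?y \<in> carrier S" using iso_closed kn by simp
  have Y0: "?Y \<noteq> 0"
  proof
    assume "?Y = 0"
    then have "xS k = \<zero>\<^bsub>S\<^esub>" using iso_zero kn by simp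
    then have "X k = 0" using evS_xS[OF kn(1)] evS_zero by simp
    then show False using kn by (simp add: X_def)
  qed
  \<comment> \<open>Normality of x_k is applied to F'(s) and carried over by F.\<close>
  have comm: "\<exists>s'\<in>carrier S. evS s' \<star> ?Y = ?Y \<star> evS s" if s: "s \<in> carrier S" for s
  proof -
    have c: "F' s \<in> carrier S" using clinear_closed[OF iso_linear' s] .
    obtain r where r: "r \<in> carrier S" "xS k \<otimes>\<^bsub>S\<^esub> F' s = r \<otimes>\<^bsub>S\<^esub> xS k" using x_normal[OF kn(1) c] by blast
    then have "?y \<otimes>\<^bsub>S\<^esub> s = F r \<otimes>\<^bsub>S\<^esub> ?y"
      using iso_mult[of "xS k" "F' s"] iso_mult[of r "xS k"] c kn iso_inv(1)[OF s] by simp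
    then have "?Y \<star> evS s = evS (F r) \<star> ?Y" using evS_mult[OF y s] evS_mult[OF iso_closed[OF r(1)] y] by simp
    then show ?thesis using iso_closed[OF r(1)] by metis
  qed
  have cone: "cone g" if "g \<in> Poly_Mapping.keys ?Y" for g using evS_cone[OF y that] .
  have zdeg: "zdeg g = 0" if "g \<in> Poly_Mapping.keys ?Y" for g
    using evS_zdeg[OF iso_Hk[OF xS_Hk[OF kn(1)]] that] .
  have br: "om g (zpart e) - om e (zpart g) = om h (zpart e) - om e (zpart h)"
    if "s \<in> carrier S" "evS s = mon e" "g \<in> Poly_Mapping.keys ?Y" "h \<in> Poly_Mapping.keys ?Y" for s e g h
    using comm[OF that(1)] commute_equal_brackets[OF _ Y0 that(3,4)] that(2) by metis
  \<comment> \<open>Testing against s = x_l fixes the tails and hence the z-exponents; testing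
    against s = z_j then fixes the partial sums of the x-exponents. So all exponents of
    \<open>?Y\<close> coincide.\<close>
  have eq: "g = h" if g: "g \<in> Poly_Mapping.keys ?Y" and h: "h \<in> Poly_Mapping.keys ?Y" for g h
  proof (rule index_eqI)
    have "tail l g = tail l h" if l: "l \<in> {1..<n}" for l
      using br[OF xS_closed[of l] _ g h, of "xc l"] l by (simp add: evS_xS X_def om_xc_tail)
    then show z: "zpart g j = zpart h j" for j
      using cone_zpart_eqI[OF cone[OF g] cone[OF h]] zdeg g h by simp
    then have zz: "zpart g = zpart h" by (simp add: fun_eq_iff)
    have s: "(\<Sum>i=1..<j. xpart g i) = (\<Sum>i=1..<j. xpart h i)" if j: "j \<in> {1..n}" for j
      using br[OF gens_closed(1)[OF j] _ g h, of "zc j"] j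
      by (simp add: evS_gens gimg_def om_zc_right zz sum.distrib flip: sum_distrib_left)
    show "xpart g k = xpart h k" for k
    proof (cases "k \<in> {1..<n}")
      case True
      then have "(\<Sum>i=1..<Suc k. xpart g i) = (\<Sum>i=1..<Suc k. xpart h i)" "(\<Sum>i=1..<k. xpart g i) = (\<Sum>i=1..<k. xpart h i)"
        using s[of "Suc k"] s[of k] by auto
      then show ?thesis using True by simp
    next
      case False then show ?thesis using cone_xpart cone g h by metis
    qed
  qed
  have "lead ?Y = low ?Y" using eq lead_in[OF Y0] low_in[OF Y0] by blast
  then obtain g c where Y: "?Y = Poly_Mapping.single g c" using lead_eq_low[OF Y0] by blast
  then have c: "c \<noteq> 0" "g \<in> Poly_Mapping.keys ?Y" using Y0 by auto
  \<comment> \<open>Conjugating z_i^* by the monomial \<open>?Y\<close> rescales its two terms, and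
    the result is again the image of an element of the sphere. It must not send the weight 0 to a
    weight with coordinate i equal to -1, so the two terms are rescaled equally, which means that g
    does not involve z_i.\<close>
  have z2: "zpart g i = 0" if i: "i \<in> {2..n}" for i
  proof -
    have i': "i \<in> {1..n}" "i \<ge> 2" using i by auto
    obtain s' where s': "s' \<in> carrier S" "evS s' \<star> ?Y = ?Y \<star> gimg (Zstar i)"
      using comm[OF gens_closed(2)[OF i'(1)]] i' by (auto simp: evS_gens)
    let ?T = "evS s'" and ?e1 = "- zc i + xc i" and ?e2 = "- zc i + xc (i - 1)"
    let ?al = "\<lambda>e. qp (om g (zpart e) - om e (zpart g))"
    have lk: "Poly_Mapping.lookup ?T e = Poly_Mapping.lookup (gimg (Zstar i)) e * ?al e" for e
    proof -
      have "c * Poly_Mapping.lookup ?T e * qp (om e (zpart g)) = c * Poly_Mapping.lookup (gimg (Zstar i)) e * qp (om g (zpart e))"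
        using s'(2) lookup_tmul_single[of ?T g c e] lookup_single_tmul[of g c "gimg (Zstar i)" e] by (simp add: Y add.commute)
      moreover have "qp (om g (zpart e)) = ?al e * qp (om e (zpart g))"
        using qp_add[of "om g (zpart e) - om e (zpart g)" "om e (zpart g)"] by simp
      ultimately show ?thesis using c by simp
    qed
    have T: "?T = Poly_Mapping.single ?e1 (?al ?e1) - Poly_Mapping.single ?e2 (?al ?e2)"
      by (rule poly_mapping_eqI) (auto simp: lk gimg_Zstar_expand[OF i'(2)] lookup_minus lookup_single when_def left_diff_distrib)
    have "coef ?T (\<lambda>_. 0) (zpart (- zc i)) = 0"
      using evS_positive[OF s'(1)] i unfolding preserves_positive_def by (elim allE impE) auto
    moreover have "zpart ?e1 = zpart (- zc i)" "zpart ?e2 = zpart (- zc i)" by (auto simp: fun_eq_iff)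
    ultimately have "?al ?e1 = ?al ?e2" by (simp add: T coef_diff coef_single)
    then have "om (xc i) (zpart g) = om (xc (i - 1)) (zpart g)"
      by (simp add: qp_inj om_add_left om_zpart_add om_diff_left om_zpart_diff)
    then show ?thesis using i' by (simp add: om_xc_tail zpart_tail)
  qed
  \<comment> \<open>Positivity is silent about coordinate 1; there the total degree 0
    decides.\<close>
  moreover have "zpart g 1 = 0"
  proof -
    have "{1..n} = insert 1 {2..n}" using n_pos by auto
    then have "zdeg g = zpart g 1" using z2 by (simp add: zdeg_def)
    then show ?thesis using zdeg c(2) by simp
  qed
  ultimately have "zpart g j = 0" for j
    using cone_zpart[OF cone[OF c(2)], of j] by (cases "j \<in> {1..n}"; cases "j = 1") auto
  then show ?thesis using Y c cone by blast
qed

end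

text \<open>The total degree \<open>d\<close> in the x_k is additive under products; through it an
  automorphism is compared with its inverse in \<open>x_permuted\<close>.\<close>

definition xmon :: "int \<Rightarrow> torus \<Rightarrow> bool" where
  "xmon d t \<longleftrightarrow> (\<exists>c g. c \<noteq> 0 \<and> t = Poly_Mapping.single g c \<and> (\<forall>j. zpart g j = 0) \<and> (\<Sum>k=1..<n. xpart g k) = d)"

lemma xmon_mult: "xmon d s \<Longrightarrow> xmon d' t \<Longrightarrow> xmon (d + d') (s \<star> t)"
proof -
  assume "xmon d s" "xmon d' t"
  then obtain c g c' g' where *: "c \<noteq> 0" "s = Poly_Mapping.single g c" "\<forall>j. zpart g j = 0" "(\<Sum>k=1..<n. xpart g k) = d"
    "c' \<noteq> 0" "t = Poly_Mapping.single g' c'" "\<forall>j. zpart g' j = 0" "(\<Sum>k=1..<n. xpart g' k) = d'" unfolding xmon_def by blast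
  then have "zpart g' = (\<lambda>_. 0)" by auto
  then have "s \<star> t = Poly_Mapping.single (g + g') (c * c')" using * by (simp add: tmul_single)
  then show ?thesis unfolding xmon_def using * by (intro exI[of _ "c * c'"] exI[of _ "g + g'"]) (auto simp: sum.distrib)
qed

lemma xmon_one: "xmon 0 1"
  unfolding xmon_def by (intro exI[of _ 1] exI[of _ 0]) simp

lemma single_eq_iff: "c \<noteq> 0 \<Longrightarrow> Poly_Mapping.single g c = Poly_Mapping.single g' c' \<longleftrightarrow> g = g' \<and> c = (c'::complex)"
  by (metis keys_single lookup_single_eq singleton_inject empty_not_insert)

lemma xmon_unique: "xmon d t \<Longrightarrow> xmon d' t \<Longrightarrow> d = d'"
  unfolding xmon_def by (auto simp: single_eq_iff)

lemma xmon_fscale: "c \<noteq> 0 \<Longrightarrow> xmon d t \<Longrightarrow> xmon d (fscale c t)"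
  unfolding xmon_def by (auto simp: fscale_single) (metis mult_eq_0_iff)

lemma xmon_X: "k \<in> {1..<n} \<Longrightarrow> xmon 1 (X k)"
  unfolding xmon_def by (intro exI[of _ 1] exI[of _ "xc k"]) (auto simp: X_def sum.delta)

lemma evS_pow: "a \<in> carrier S \<Longrightarrow> xmon d (evS a) \<Longrightarrow> xmon (int m * d) (evS (a [^]\<^bsub>S\<^esub> (m::nat)))"
proof (induction m)
  case 0 then show ?case by (simp add: evS_one xmon_one)
next
  case (Suc m)
  then show ?case using xmon_mult[of "int m * d" "evS (a [^]\<^bsub>S\<^esub> m)" d "evS a"] by (simp add: evS_mult algebra_simps)
qed

lemma evS_PX: "m < n \<Longrightarrow> \<exists>e. evS (PX b m) = mon e \<and> (\<forall>j. zpart e j = 0) \<and> (\<forall>k. xpart e k = (if k \<in> {1..m} then int (b k) else 0))"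
proof (induction m)
  case 0 show ?case by (intro exI[of _ 0]) (simp add: evS_one)
next
  case (Suc m)
  obtain e where e: "evS (PX b m) = mon e" "\<forall>j. zpart e j = 0" "\<forall>k. xpart e k = (if k \<in> {1..m} then int (b k) else 0)"
    using Suc by auto
  have p: "\<exists>e. evS (xS (Suc m) [^]\<^bsub>S\<^esub> (i::nat)) = mon e \<and> (\<forall>j. zpart e j = 0) \<and> (\<forall>k. xpart e k = (if k = Suc m then int i else 0))" for i
  proof (induction i)
    case 0 show ?case by (intro exI[of _ 0]) (simp add: evS_one)
  next
    case (Suc i)
    then obtain e where e: "evS (xS (Suc m) [^]\<^bsub>S\<^esub> i) = mon e" "\<forall>j. zpart e j = 0" "\<forall>k. xpart e k = (if k = Suc m then int i else 0)" by blast
    show ?case using e \<open>Suc m < n\<close>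
      by (intro exI[of _ "e + xc (Suc m)"]) (simp add: evS_mult evS_xS X_def tmul_single)
  qed
  obtain e' where e': "evS (xS (Suc m) [^]\<^bsub>S\<^esub> b (Suc m)) = mon e'" "\<forall>j. zpart e' j = 0" "\<forall>k. xpart e' k = (if k = Suc m then int (b (Suc m)) else 0)"
    using p by blast
  have "zpart e' = (\<lambda>_. 0)" using e' by auto
  then show ?case using e e' Suc.prems
    by (intro exI[of _ "e + e'"]) (auto simp: evS_mult tmul_single)
qed

text \<open>A monomial of degree 0 with nonnegative exponents is a scalar. Applying the inverse
  automorphism, x_k itself would be a scalar, whereas its exponent in the torus is not 0.\<close>

lemma x_degree:
  assumes iso: "graded_iso F F'" and k: "k \<in> {1..<n}" shows "\<exists>d\<ge>1. xmon d (evS (F (xS k)))"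
proof -
  obtain c g where g: "c \<noteq> 0" "evS (F (xS k)) = Poly_Mapping.single g c" "\<forall>j. zpart g j = 0" "cone g"
    using x_image[OF iso k] by blast
  have nn: "xpart g i \<ge> 0" for i using g(4) by (simp add: cone_def)
  let ?d = "\<Sum>i=1..<n. xpart g i"
  have "?d \<noteq> 0"
  proof
    assume "?d = 0"
    then have "\<forall>i\<in>{1..<n}. xpart g i = 0" using nn by (subst (asm) sum_nonneg_eq_0_iff) auto
    then have "xpart g i = 0" for i using cone_xpart[OF g(4)] by (cases "i \<in> {1..<n}") auto
    then have "g = 0" using g(3) by (intro index_eqI) auto
    then have "evS (F (xS k)) = evS (c \<odot>\<^bsub>S\<^esub> \<one>\<^bsub>S\<^esub>)"
      using g(2) by (simp add: evS_smult evS_one fscale_single flip: single_one)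
    then have "F (xS k) = c \<odot>\<^bsub>S\<^esub> \<one>\<^bsub>S\<^esub>" using k iso_closed[OF iso] by (intro evS_injective) auto
    then have "xS k = F' (c \<odot>\<^bsub>S\<^esub> \<one>\<^bsub>S\<^esub>)" using iso_inv(2)[OF iso, of "xS k"] k by simp
    also have "\<dots> = c \<odot>\<^bsub>S\<^esub> \<one>\<^bsub>S\<^esub>"
      using clinear_smult[OF iso_linear'[OF iso], of "\<one>\<^bsub>S\<^esub>" c] iso_one[OF graded_iso_sym[OF iso]] by simp
    finally have "evS (xS k) = evS (c \<odot>\<^bsub>S\<^esub> \<one>\<^bsub>S\<^esub>)" by simp
    then have "mon (xc k) = Poly_Mapping.single 0 c"
      using k by (simp add: evS_xS X_def evS_smult evS_one fscale_single flip: single_one)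
    then have "xc k = 0" by (metis keys_single singleton_inject one_neq_zero empty_not_insert)
    then have "xpart (xc k) k = 0" by simp
    then show False using k by simp
  qed
  moreover have "?d \<ge> 0" using nn by (intro sum_nonneg) auto
  ultimately show ?thesis using g unfolding xmon_def by (intro exI[of _ ?d]) auto
qed

text \<open>Write F(x_k) as a multiple of a product of powers of the x_i with exponents b_i. The
  inverse maps each x_i to a monomial of some degree d_i \<ge> 1 and returns x_k, so the b_i d_i sum
  up to 1 and exactly one b_i equals 1.\<close>

lemma x_permuted:
  assumes iso: "graded_iso F F'" and k: "k \<in> {1..<n}"
  shows "\<exists>c l. c \<noteq> 0 \<and> l \<in> {1..<n} \<and> F (xS k) = c \<odot>\<^bsub>S\<^esub> xS l"
proof -
  note iso' = graded_iso_sym[OF iso]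
  obtain c g where g: "c \<noteq> 0" "evS (F (xS k)) = Poly_Mapping.single g c" "\<forall>j. zpart g j = 0" "cone g"
    using x_image[OF iso k] by blast
  define b where "b = (\<lambda>i. nat (xpart g i))"
  have m: "n - 1 < n" "{1..n - 1} = {1..<n}" using n_pos by auto
  have nn: "int (b i) = xpart g i" for i using g(4) by (simp add: cone_def b_def)
  obtain e where e: "evS (PX b (n - 1)) = mon e" "\<forall>j. zpart e j = 0"
    "\<forall>k. xpart e k = (if k \<in> {1..n - 1} then int (b k) else 0)" using evS_PX[OF m(1)] by blast
  have "e = g" using e g(3) cone_xpart[OF g(4)] nn m(2) by (intro index_eqI) auto
  then have "evS (F (xS k)) = evS (c \<odot>\<^bsub>S\<^esub> PX b (n - 1))" using g(2) e(1) by (simp add: evS_smult fscale_single)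
  then have Fx: "F (xS k) = c \<odot>\<^bsub>S\<^esub> PX b (n - 1)" using k iso_closed[OF iso] by (intro evS_injective) auto
  obtain d where d: "\<And>i. i \<in> {1..<n} \<Longrightarrow> d i \<ge> 1 \<and> xmon (d i) (evS (F' (xS i)))" using x_degree[OF iso'] by metis
  have P: "xmon (\<Sum>i=1..<Suc m. int (b i) * d i) (evS (F' (PX b m)))" if "m < n" for m using that
  proof (induction m)
    case 0 show ?case using iso_one[OF iso'] by (simp add: evS_one xmon_one)
  next
    case (Suc m)
    have pw: "F' (xS (Suc m) [^]\<^bsub>S\<^esub> (i::nat)) = F' (xS (Suc m)) [^]\<^bsub>S\<^esub> i" for i
      using Suc.prems iso_one[OF iso'] by (induction i) (simp_all add: iso_mult[OF iso'])
    have "evS (F' (PX b (Suc m))) = evS (F' (PX b m)) \<star> evS (F' (xS (Suc m)) [^]\<^bsub>S\<^esub> b (Suc m))"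
      using Suc.prems iso_closed[OF iso'] by (simp add: iso_mult[OF iso'] pw evS_mult)
    then show ?case using Suc xmon_mult[OF _ evS_pow[of "F' (xS (Suc m))" "d (Suc m)" "b (Suc m)"]] d[of "Suc m"] iso_closed[OF iso']
      by simp
  qed
  have "xS k = c \<odot>\<^bsub>S\<^esub> F' (PX b (n - 1))"
    using iso_inv(2)[OF iso, of "xS k"] clinear_smult[OF iso_linear'[OF iso]] k by (simp add: Fx)
  then have "X k = fscale c (evS (F' (PX b (n - 1))))"
    using k iso_closed[OF iso'] evS_xS[of k] by (simp add: evS_smult)
  then have "xmon (\<Sum>i=1..<Suc (n - 1). int (b i) * d i) (X k)" using P[OF m(1)] xmon_fscale[OF g(1)] by simp
  then have s: "(\<Sum>i=1..<n. int (b i) * d i) = 1" using xmon_unique xmon_X[OF k] n_pos by fastforce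
  have "(\<Sum>i=1..<n. int (b i)) \<le> (\<Sum>i=1..<n. int (b i) * d i)"
    by (intro sum_mono) (use d in \<open>auto simp: mult_le_cancel_left1\<close>)
  then have "(\<Sum>i=1..<n. b i) \<le> 1" using s by (simp flip: of_nat_sum)
  moreover have "(\<Sum>i=1..<n. b i) \<noteq> 0"
  proof
    assume "(\<Sum>i=1..<n. b i) = 0"
    then have "\<forall>i\<in>{1..<n}. b i = 0" by simp
    then show False using s by simp
  qed
  ultimately have "(\<Sum>i=1..<n. b i) = 1" by linarith
  then obtain l where l: "l \<in> {1..<n}" "b l = 1" "\<forall>i\<in>{1..<n}. l \<noteq> i \<longrightarrow> b i = 0"
    by (auto simp: sum_eq_1_iff)
  have "g = xc l"
  proof (rule index_eqI)
    show "zpart g j = zpart (xc l) j" for j using g by simp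
    show "xpart g i = xpart (xc l) i" for i
      using l cone_xpart[OF g(4), of i] nn[of i] by (cases "i \<in> {1..<n}"; cases "i = l") auto
  qed
  then have "evS (F (xS k)) = evS (c \<odot>\<^bsub>S\<^esub> xS l)" using g l by (simp add: evS_smult evS_xS X_def fscale_single)
  then have "F (xS k) = c \<odot>\<^bsub>S\<^esub> xS l" using k l iso_closed[OF iso] by (intro evS_injective) auto
  then show ?thesis using g l by blast
qed

end

section \<open>Images of the generators\<close>

lemma nonneg_le_zero_lex:
  fixes g :: "nat \<Rightarrow>\<^sub>0 int"
  assumes "\<And>k. Poly_Mapping.lookup g k \<ge> 0" shows "0 \<le> g"
proof (rule ccontr)
  assume "\<not> 0 \<le> g"
  then have "g < 0" by simp
  then obtain k where "Poly_Mapping.lookup g k < Poly_Mapping.lookup 0 k"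
    by (auto simp: less_poly_mapping.rep_eq less_fun_def)
  then show False using assms[of k] by simp
qed

context qsphere begin

lemma positive_single:
  assumes "preserves_positive (Poly_Mapping.single g c)" "c \<noteq> 0" "i \<in> {2..n}" shows "zpart g i \<ge> 0"
proof (rule ccontr)
  assume "\<not> zpart g i \<ge> 0"
  then have "\<exists>t\<in>{2..n}. 0 + zpart g t < 0" using assms(3) by (intro bexI[of _ i]) auto
  then have "coef (Poly_Mapping.single g c) (\<lambda>_. 0) (zpart g) = 0"
    using assms(1)[unfolded preserves_positive_def, rule_format, of "\<lambda>_. 0" "zpart g"] by simp
  then show False using assms(2) by (simp add: coef_single)
qed

text \<open>All exponents share their z-part and have nonnegative x-part, while the x-part of the
  leading one is 0. So the lowest exponent is coordinatewise at least the leading one, and the two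
  coincide.\<close>

lemma single_if_no_x:
  assumes "t \<noteq> 0" and c: "\<And>g. g \<in> Poly_Mapping.keys t \<Longrightarrow> cone g"
    and z: "\<And>g h j. g \<in> Poly_Mapping.keys t \<Longrightarrow> h \<in> Poly_Mapping.keys t \<Longrightarrow> zpart g j = zpart h j"
    and x: "\<And>k. xpart (lead t) k = 0"
  shows "t = Poly_Mapping.single (lead t) (Poly_Mapping.lookup t (lead t))"
proof (rule lead_eq_low[OF assms(1)])
  have "0 \<le> low t - lead t"
  proof (rule nonneg_le_zero_lex)
    fix k
    have z': "zpart (low t - lead t) m \<ge> 0" for m using z[OF low_in lead_in] assms(1) by simp
    have x': "xpart (low t - lead t) m \<ge> 0" for m using c[OF low_in[OF assms(1)]] x by (simp add: cone_def)
    show "Poly_Mapping.lookup (low t - lead t) k \<ge> 0"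
    proof (cases "even k")
      case True
      then obtain m where "k = 2 * m" by blast
      then show ?thesis using z'[of m] by (simp add: zpart_def)
    next
      case False
      then obtain m where "k = 2 * m + 1" by (rule oddE)
      then show ?thesis using x'[of m] by (simp add: xpart_def)
    qed
  qed
  then have "lead t \<le> low t" by simp
  moreover have "low t \<le> lead t" using low_le lead_in[OF assms(1)] by blast
  ultimately show "lead t = low t" by simp
qed

lemma tail_zc: "i \<in> {1..n} \<Longrightarrow> tail l (zc i) = (if l < i then 1 else 0)"
  by (auto simp: tail_def sum.delta)

context
  fixes F F' assumes iso: "graded_iso F F'"
begin

lemma iso_values: "\<exists>lam sg. (\<forall>k\<in>{1..n}. F (xS k) = lam k \<odot>\<^bsub>S\<^esub> xS (sg k) \<and> lam k \<noteq> 0 \<and> sg k \<in> {1..n}) \<and>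
    lam n = 1 \<and> sg n = n \<and> (\<forall>k\<in>{1..<n}. sg k \<in> {1..<n}) \<and> (\<forall>l\<in>{1..<n}. \<exists>k\<in>{1..<n}. sg k = l)"
proof -
  have "\<forall>k\<in>{1..<n}. \<exists>cl. fst cl \<noteq> 0 \<and> snd cl \<in> {1..<n} \<and> F (xS k) = fst cl \<odot>\<^bsub>S\<^esub> xS (snd cl)"
    using x_permuted[OF iso] by fastforce
  from bchoice[OF this] obtain f where f: "\<And>k. k \<in> {1..<n} \<Longrightarrow> fst (f k) \<noteq> 0 \<and> snd (f k) \<in> {1..<n} \<and> F (xS k) = fst (f k) \<odot>\<^bsub>S\<^esub> xS (snd (f k))"
    by blast
  \<comment> \<open>\<open>x_permuted\<close> covers the indices below n; as x_n = 1 is fixed, the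
    data are completed by the scalar 1 and the index n.\<close>
  define lam where "lam = (\<lambda>k. if k = n then 1 else fst (f k))"
  define sg where "sg = (\<lambda>k. if k = n then n else snd (f k))"
  have 1: "F (xS k) = lam k \<odot>\<^bsub>S\<^esub> xS (sg k) \<and> lam k \<noteq> 0 \<and> sg k \<in> {1..n}" if "k \<in> {1..n}" for k
  proof (cases "k = n")
    case True then show ?thesis using iso_one[OF iso] n_pos by (simp add: lam_def sg_def xS_n)
  next
    case False
    then have "k \<in> {1..<n}" using that by auto
    from f[OF this] show ?thesis using False by (auto simp: lam_def sg_def)
  qed
  have 2: "sg k \<in> {1..<n}" if "k \<in> {1..<n}" for k using f[OF that] that by (auto simp: sg_def)
  \<comment> \<open>Surjectivity comes from the inverse automorphism, which sends x_l to a multiple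
    of some x_k as well.\<close>
  have 3: "\<exists>k\<in>{1..<n}. sg k = l" if l: "l \<in> {1..<n}" for l
  proof -
    obtain c k where k: "c \<noteq> 0" "k \<in> {1..<n}" "F' (xS l) = c \<odot>\<^bsub>S\<^esub> xS k" using x_permuted[OF graded_iso_sym[OF iso] l] by blast
    then have "xS l = c \<odot>\<^bsub>S\<^esub> F (xS k)"
      using iso_inv(1)[OF iso, of "xS l"] clinear_smult[OF iso_linear[OF iso], of "xS k" c] l by simp
    moreover have sk: "F (xS k) = lam k \<odot>\<^bsub>S\<^esub> xS (sg k)" "lam k \<noteq> 0" using 1[of k] k(2) by auto
    ultimately have "X l = fscale (c * lam k) (X (sg k))"
      using l 2[OF k(2)] evS_xS[of l] by (simp add: evS_smult evS_xS)
    then have "mon (xc l) = Poly_Mapping.single (xc (sg k)) (c * lam k)"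
      using l 2[OF k(2)] by (simp add: X_def fscale_single)
    then have "xc l = xc (sg k)" by (simp add: single_eq_iff)
    then have "xpart (xc l) l = xpart (xc (sg k)) l" by simp
    then show ?thesis using l k by (intro bexI[of _ k]) (auto split: if_splits)
  qed
  show ?thesis using 1 2 3 by (intro exI[of _ lam] exI[of _ sg]) (auto simp: lam_def sg_def)
qed

context
  fixes lam sg
  assumes val: "\<And>k. k \<in> {1..n} \<Longrightarrow> F (xS k) = lam k \<odot>\<^bsub>S\<^esub> xS (sg k)"
    and lam: "\<And>k. k \<in> {1..n} \<Longrightarrow> lam k \<noteq> 0" and sg: "\<And>k. k \<in> {1..n} \<Longrightarrow> sg k \<in> {1..n}"
    and lam_n: "lam n = 1" and sg_n: "sg n = n" and sg': "\<And>k. k \<in> {1..<n} \<Longrightarrow> sg k \<in> {1..<n}"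
    and sg_surj: "\<And>l. l \<in> {1..<n} \<Longrightarrow> \<exists>k\<in>{1..<n}. sg k = l"
begin

abbreviation "ff j \<equiv> evS (F (zS j))"
abbreviation "gg j \<equiv> evS (F (zsS j))"

lemma evS_Fx: "k \<in> {1..n} \<Longrightarrow> evS (F (xS k)) = Poly_Mapping.single (xc (sg k)) (lam k)"
  using sg[of k] by (simp add: val evS_smult evS_xS X_def fscale_single)

lemma zS_closed: "j \<in> {1..n} \<Longrightarrow> F (zS j) \<in> carrier S" "j \<in> {1..n} \<Longrightarrow> F (zsS j) \<in> carrier S"
  using iso_closed[OF iso] by simp_all

text \<open>Applying F to x_k w = q^{2m} w x_k turns x_k into a multiple of the x with index
  \<open>sg k\<close>. Comparing one coefficient yields the tail, as distinct powers of q
  differ.\<close>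

lemma tail_value:
  assumes w: "w \<in> carrier S" and comm: "S.qc (qp (2 * m)) (xS k) w" and k: "k \<in> {1..<n}"
    and g: "g \<in> Poly_Mapping.keys (evS (F w))"
  shows "tail (sg k) g = m"
proof -
  have x: "xS k \<in> carrier S" and k': "k \<in> {1..n}" using k by auto
  have c: "F (xS k) \<in> carrier S" "F w \<in> carrier S" using x w iso_closed[OF iso] by auto
  have "xS k \<otimes>\<^bsub>S\<^esub> w = qp (2 * m) \<odot>\<^bsub>S\<^esub> (w \<otimes>\<^bsub>S\<^esub> xS k)" using comm by (simp add: S.qc_def)
  then have "F (xS k) \<otimes>\<^bsub>S\<^esub> F w = qp (2 * m) \<odot>\<^bsub>S\<^esub> (F w \<otimes>\<^bsub>S\<^esub> F (xS k))"
    using iso_mult[OF iso x w] iso_mult[OF iso w x] clinear_smult[OF iso_linear[OF iso], of "w \<otimes>\<^bsub>S\<^esub> xS k" "qp (2 * m)"] x w by simp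
  then have "Poly_Mapping.single (xc (sg k)) (lam k) \<star> evS (F w)
      = fscale (qp (2 * m)) (evS (F w) \<star> Poly_Mapping.single (xc (sg k)) (lam k))"
    using c evS_mult[OF c] evS_mult[OF c(2,1)] evS_Fx[OF k'] by (simp add: evS_smult)
  then have "Poly_Mapping.lookup (Poly_Mapping.single (xc (sg k)) (lam k) \<star> evS (F w)) (xc (sg k) + g)
      = qp (2 * m) * Poly_Mapping.lookup (evS (F w) \<star> Poly_Mapping.single (xc (sg k)) (lam k)) (g + xc (sg k))"
    by (simp add: add.commute)
  then have "qp (om (xc (sg k)) (zpart g)) = qp (2 * m)"
    using g lam[OF k'] by (simp add: lookup_single_tmul lookup_tmul_single in_keys_iff)
  then show ?thesis using sg[OF k'] by (simp add: qp_inj om_xc_tail)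
qed

lemma tails:
  assumes j: "j \<in> {1..n}" and k: "k \<in> {1..<n}"
  shows "g \<in> Poly_Mapping.keys (ff j) \<Longrightarrow> tail (sg k) g = (if k < j then 1 else 0)"
    "g \<in> Poly_Mapping.keys (gg j) \<Longrightarrow> tail (sg k) g = (if k < j then - 1 else 0)"
proof -
  have e: "xexp k j = qp (2 * (if k < j then 1 else 0))" "inverse (xexp k j) = qp (2 * (if k < j then - 1 else 0))"
    by (auto simp: xexp_def qp_2 qp_uminus)
  show "g \<in> Poly_Mapping.keys (ff j) \<Longrightarrow> tail (sg k) g = (if k < j then 1 else 0)"
    using tail_value[OF gens_closed(1)[OF j] _ k] qc_x_z(1)[of k j] j k by (simp only: e) simp
  show "g \<in> Poly_Mapping.keys (gg j) \<Longrightarrow> tail (sg k) g = (if k < j then - 1 else 0)"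
    using tail_value[OF gens_closed(2)[OF j] _ k] qc_x_z(2)[of k j, unfolded e(2)] j k by simp
qed

lemma gens_cone: "j \<in> {1..n} \<Longrightarrow> g \<in> Poly_Mapping.keys (ff j) \<Longrightarrow> cone g"
  "j \<in> {1..n} \<Longrightarrow> g \<in> Poly_Mapping.keys (gg j) \<Longrightarrow> cone g"
  using evS_cone zS_closed by blast+

lemma gens_zdeg: "j \<in> {1..n} \<Longrightarrow> g \<in> Poly_Mapping.keys (ff j) \<Longrightarrow> zdeg g = 1"
  "j \<in> {1..n} \<Longrightarrow> g \<in> Poly_Mapping.keys (gg j) \<Longrightarrow> zdeg g = - 1"
  using evS_zdeg iso_Hk[OF iso] gens_Hk by blast+

text \<open>Every x_l with l < n is, up to a scalar, the image of some x_k, so all tails are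
  prescribed; together with the degree they fix the z-exponents.\<close>

lemma gens_zpart:
  assumes j: "j \<in> {1..n}"
  shows "g \<in> Poly_Mapping.keys (ff j) \<Longrightarrow> h \<in> Poly_Mapping.keys (ff j) \<Longrightarrow> zpart g i = zpart h i"
    "g \<in> Poly_Mapping.keys (gg j) \<Longrightarrow> h \<in> Poly_Mapping.keys (gg j) \<Longrightarrow> zpart g i = zpart h i"
proof -
  show "zpart g i = zpart h i" if "g \<in> Poly_Mapping.keys (ff j)" "h \<in> Poly_Mapping.keys (ff j)"
  proof (rule cone_zpart_eqI)
    show "tail l g = tail l h" if "l \<in> {1..<n}" for l
      using sg_surj[OF that] tails(1)[OF j] \<open>g \<in> _\<close> \<open>h \<in> _\<close> by metis
  qed (use that gens_cone[OF j] gens_zdeg[OF j] in auto)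
  show "zpart g i = zpart h i" if "g \<in> Poly_Mapping.keys (gg j)" "h \<in> Poly_Mapping.keys (gg j)"
  proof (rule cone_zpart_eqI)
    show "tail l g = tail l h" if "l \<in> {1..<n}" for l
      using sg_surj[OF that] tails(2)[OF j] \<open>g \<in> _\<close> \<open>h \<in> _\<close> by metis
  qed (use that gens_cone[OF j] gens_zdeg[OF j] in auto)
qed

lemma gens_nonzero: "j \<in> {1..n} \<Longrightarrow> ff j \<noteq> 0" "j \<in> {1..n} \<Longrightarrow> gg j \<noteq> 0"
proof -
  assume j: "j \<in> {1..n}"
  have "zS j \<noteq> \<zero>\<^bsub>S\<^esub>" "zsS j \<noteq> \<zero>\<^bsub>S\<^esub>"
    using evS_gens[OF j] evS_zero gimg_Zstar(1)[OF j] by (auto simp: gimg_def)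
  then show "ff j \<noteq> 0" "gg j \<noteq> 0" using iso_zero[OF iso] gens_closed j by blast+
qed

text \<open>The image of x_j - x_{j-1} = z_j z_j^*; the case distinction accounts for x_0 =
  0.\<close>

definition "PP j = Poly_Mapping.single (xc (sg j)) (lam j) - (if j = 1 then 0 else Poly_Mapping.single (xc (sg (j - 1))) (lam (j - 1)))"

lemma ff_gg: assumes j: "j \<in> {1..n}" shows "ff j \<star> gg j = PP j"
proof -
  have c: "zS j \<in> carrier S" "zsS j \<in> carrier S" "xS (j - 1) \<in> carrier S" using j by auto
  have "evS (F (xS j)) = evS (F (xS (j - 1))) + ff j \<star> gg j"
    using c iso_closed[OF iso]
    by (subst xS_step[OF j]) (simp add: clinear_add[OF iso_linear[OF iso]] iso_mult[OF iso] evS_add evS_mult)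
  moreover have "evS (F (xS (j - 1))) = (if j = 1 then 0 else Poly_Mapping.single (xc (sg (j - 1))) (lam (j - 1)))"
  proof (cases "j = 1")
    case True
    then show ?thesis using clinear_zero[OF cvec_S cvec_S iso_linear[OF iso]] by (simp add: xS_0 evS_zero)
  next
    case False
    then have "j - 1 \<in> {1..n}" using j by auto
    then show ?thesis using False evS_Fx by simp
  qed
  ultimately show ?thesis using evS_Fx[OF j] by (simp add: PP_def)
qed

text \<open>Leading exponents add up to an exponent of \<open>PP j\<close>, in which at most one x
  occurs, and only to the first power. As x-exponents are nonnegative, one of the two leading terms
  is free of x, and \<open>single_if_no_x\<close> applies to its factor.\<close>

lemma one_monomial:
  assumes j: "j \<in> {1..n}"
  shows "(\<exists>g c. c \<noteq> 0 \<and> ff j = Poly_Mapping.single g c \<and> (\<forall>k. xpart g k = 0)) \<or>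
    (\<exists>g c. c \<noteq> 0 \<and> gg j = Poly_Mapping.single g c \<and> (\<forall>k. xpart g k = 0))"
proof -
  let ?a = "lead (ff j)" and ?b = "lead (gg j)"
  note nz = gens_nonzero[OF j]
  note ab = lead_in[OF nz(1)] lead_in[OF nz(2)]
  have cab: "cone ?a" "cone ?b" using gens_cone[OF j] ab by auto
  have "?a + ?b \<in> Poly_Mapping.keys (PP j)"
    using lead_mult_lookup(1)[OF nz] by (simp add: ff_gg[OF j] in_keys_iff)
  then have "?a + ?b = xc (sg j) \<or> ?a + ?b = xc (sg (j - 1))"
    by (auto simp: PP_def in_keys_iff lookup_minus lookup_single when_def split: if_splits)
  then obtain l where l: "?a + ?b = xc l" by blast
  have s: "xpart ?a k + xpart ?b k = (if k = l \<and> l < n then 1 else 0)" for k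
    using arg_cong[OF l, of "\<lambda>e. xpart e k"] by simp
  have nn: "xpart ?a k \<ge> 0" "xpart ?b k \<ge> 0" for k using cab by (auto simp: cone_def)
  have "(\<forall>k. xpart ?a k = 0) \<or> (\<forall>k. xpart ?b k = 0)"
  proof (cases "xpart ?a l = 0")
    case True
    have "xpart ?a k = 0" for k using True s[of k] nn[of k] by (cases "k = l") auto
    then show ?thesis by blast
  next
    case False
    have "xpart ?b k = 0" for k
      using False s[of k] nn[of k] by (cases "k = l") (auto split: if_splits)
    then show ?thesis by blast
  qed
  then show ?thesis
  proof
    assume "\<forall>k. xpart ?a k = 0"
    then have "ff j = Poly_Mapping.single ?a (Poly_Mapping.lookup (ff j) ?a)"
      by (intro single_if_no_x nz gens_cone[OF j] gens_zpart[OF j]) auto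
    then show ?thesis using ab(1) \<open>\<forall>k. xpart ?a k = 0\<close> by (metis in_keys_iff)
  next
    assume "\<forall>k. xpart ?b k = 0"
    then have "gg j = Poly_Mapping.single ?b (Poly_Mapping.lookup (gg j) ?b)"
      by (intro single_if_no_x nz gens_cone[OF j] gens_zpart[OF j]) auto
    then show ?thesis using ab(2) \<open>\<forall>k. xpart ?b k = 0\<close> by (metis in_keys_iff)
  qed
qed

text \<open>Since z_i is invertible in the torus, the product \<open>PP j\<close> determines the
  second factor.\<close>

lemma gg_eq:
  assumes j: "j \<in> {1..n}" and i: "i \<in> {1..n}" and f: "ff j = Poly_Mapping.single (zc i) c" "c \<noteq> 0"
  shows "gg j = fscale (inverse c) (mon (- zc i) \<star> PP j)"
proof -
  have "mon (- zc i) \<star> PP j = mon (- zc i) \<star> (fscale c (mon (zc i)) \<star> gg j)"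
    using ff_gg[OF j] f by (simp add: fscale_single)
  also have "\<dots> = fscale c (gg j)" using i by (simp add: tmul_fscale flip: tmul_assoc)
  finally show ?thesis using f by simp
qed

lemma first_generator: "(\<exists>c. c \<noteq> 0 \<and> ff 1 = Poly_Mapping.single (zc 1) c) \<and> sg 1 = 1"
proof -
  have j: "1 \<in> {1..n}" using n_pos by simp
  note nz = gens_nonzero[OF j]
  \<comment> \<open>For j = 1 all tails at 1, ..., n - 1 vanish and the degree is 1, which leaves
    the z-exponents of z_1.\<close>
  have z1: "zpart g i = zpart (zc 1) i" if g: "g \<in> Poly_Mapping.keys (ff 1)" for g i
  proof (rule cone_zpart_eqI)
    show "cone (zc 1)" using cone_gimg[of "Z 1" "zc 1"] j by (simp add: gimg_def)
    show "zdeg g = zdeg (zc 1)" using gens_zdeg(1)[OF j g] n_pos by (simp add: zdeg_def sum.delta)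
    show "tail l g = tail l (zc 1)" if "l \<in> {1..<n}" for l
      using sg_surj[OF that] tails(1)[OF j _ g] that j by (auto simp: tail_zc split: if_splits)
  qed (use gens_cone[OF j] g in auto)
  have ff: "\<exists>c. c \<noteq> 0 \<and> ff 1 = Poly_Mapping.single (zc 1) c"
    if "c \<noteq> 0" "ff 1 = Poly_Mapping.single g c" "\<And>k. xpart g k = 0" for g c
  proof -
    have "g = zc 1" using z1[of g] that by (intro index_eqI) auto
    then show ?thesis using that by blast
  qed
  show ?thesis
  proof (cases "n = 1")
    case True
    have "xpart (lead (ff 1)) k = 0" for k using cone_xpart[OF gens_cone(1)[OF j lead_in[OF nz(1)]]] True by simp
    then have "ff 1 = Poly_Mapping.single (lead (ff 1)) (Poly_Mapping.lookup (ff 1) (lead (ff 1)))"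
      by (intro single_if_no_x nz gens_cone[OF j] gens_zpart[OF j]) auto
    then show ?thesis using ff lead_in[OF nz(1)] \<open>\<And>k. xpart (lead (ff 1)) k = 0\<close> sg_n True by (metis in_keys_iff)
  next
    case False
    then have n2: "n \<ge> 2" using n_pos by simp
    \<comment> \<open>The image of z_1^* has z_1-exponent -1, which the cone condition permits only
      together with x_1. So by \<open>one_monomial\<close> it is the image of z_1 that is an x-free
      monomial.\<close>
    have "\<not> (\<exists>g c. c \<noteq> 0 \<and> gg 1 = Poly_Mapping.single g c \<and> (\<forall>k. xpart g k = 0))"
    proof
      assume "\<exists>g c. c \<noteq> 0 \<and> gg 1 = Poly_Mapping.single g c \<and> (\<forall>k. xpart g k = 0)"
      then obtain g c where g: "c \<noteq> 0" "gg 1 = Poly_Mapping.single g c" "\<forall>k. xpart g k = 0" by blast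
      then have gk: "g \<in> Poly_Mapping.keys (gg 1)" by simp
      obtain k where "k \<in> {1..<n}" "sg k = 1" using sg_surj[of 1] n2 by auto
      then have "tail 1 g = 0" using tails(2)[OF j _ gk, of k] by (auto split: if_splits)
      then have "zpart g 1 = - 1" using zpart_tail[OF j, of g] gens_zdeg(2)[OF j gk] tail_0 by simp
      then show False using gens_cone(2)[OF j gk] g(3) n2 by (simp add: cone_def)
    qed
    then obtain c where c: "c \<noteq> 0" "ff 1 = Poly_Mapping.single (zc 1) c" using one_monomial[OF j] ff by blast
    have "gg 1 = fscale (inverse c) (mon (- zc 1) \<star> PP 1)" by (rule gg_eq[OF j j c(2,1)])
    also have "\<dots> = Poly_Mapping.single (- zc 1 + xc (sg 1)) (inverse c * lam 1)"
      by (simp add: PP_def tmul_single fscale_single)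
    finally have "- zc 1 + xc (sg 1) \<in> Poly_Mapping.keys (gg 1)" using c lam[OF j] by simp
    \<comment> \<open>The cone condition once more: the only x that can compensate the exponent -1
      is x_1.\<close>
    then have "cone (- zc 1 + xc (sg 1))" using gens_cone(2)[OF j] by blast
    then have "sg 1 = 1" using n2 by (auto simp: cone_def split: if_splits)
    then show ?thesis using c by blast
  qed
qed

text \<open>Once x_{j-1} is known to be fixed up to a scalar, positivity of the image of z_j^* pins
  down both the z_i in the image of z_j and the x in the image of x_j.\<close>

lemma next_generator:
  assumes j: "j \<in> {2..n}" and IH: "sg (j - 1) = j - 1"
  shows "(\<exists>c. c \<noteq> 0 \<and> ff j = Poly_Mapping.single (zc j) c) \<and> sg j = j \<and> lam j = lam (j - 1)"
proof -
  have j': "j \<in> {1..n}" "j - 1 \<in> {1..<n}" and n2: "n \<ge> 2" and j2: "j \<ge> 2" "j \<le> n" using j by auto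
  have sg1: "sg 1 = 1" using first_generator by blast
  \<comment> \<open>A monomial that preserves positivity has nonnegative coordinates 2, ..., n, but
    here the tail at 1 is -1.\<close>
  have "\<not> (\<exists>g c. c \<noteq> 0 \<and> gg j = Poly_Mapping.single g c \<and> (\<forall>k. xpart g k = 0))"
  proof
    assume "\<exists>g c. c \<noteq> 0 \<and> gg j = Poly_Mapping.single g c \<and> (\<forall>k. xpart g k = 0)"
    then obtain g c where g: "c \<noteq> 0" "gg j = Poly_Mapping.single g c" by blast
    then have "zpart g i \<ge> 0" if "i \<in> {2..n}" for i
      using positive_single[OF _ g(1) that] evS_positive[OF zS_closed(2)[OF j'(1)]] by simp
    then have "tail 1 g \<ge> 0" unfolding tail_def by (intro sum_nonneg) auto
    moreover have "tail 1 g = - 1" using tails(2)[OF j'(1), of 1 g] sg1 g n2 j2 by simp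
    ultimately show False by simp
  qed
  then obtain g c where g: "c \<noteq> 0" "ff j = Poly_Mapping.single g c" "\<forall>k. xpart g k = 0" using one_monomial[OF j'(1)] by blast
  then have gk: "g \<in> Poly_Mapping.keys (ff j)" by simp
  have nn: "zpart g i \<ge> 0" if "i \<in> {2..n}" for i
    using positive_single[OF _ g(1) that] evS_positive[OF zS_closed(1)[OF j'(1)]] g by simp
  have t1: "tail 1 g = 1" using tails(1)[OF j'(1), of 1 g] sg1 gk n2 j2 by simp
  have z1: "zpart g 1 = 0" using zpart_tail[of 1 g] n2 t1 gens_zdeg(1)[OF j'(1) gk] tail_0 by simp
  \<comment> \<open>Nonnegative integers with sum 1: exactly one of them is 1, and this singles out
    the index i with z_i in the image of z_j.\<close>
  have "int (\<Sum>i=2..n. nat (zpart g i)) = (\<Sum>i=2..n. zpart g i)"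
    unfolding of_nat_sum using nn by (intro sum.cong) auto
  moreover have "(\<Sum>i=2..n. zpart g i) = 1" using t1 by (simp add: tail_def) (metis atLeastSucAtMost_greaterThanAtMost One_nat_def numeral_2_eq_2)
  ultimately have "(\<Sum>i=2..n. nat (zpart g i)) = 1" by linarith
  then obtain i where i: "i \<in> {2..n}" "nat (zpart g i) = 1" "\<forall>k\<in>{2..n}. i \<noteq> k \<longrightarrow> nat (zpart g k) = 0"
    by (auto simp: sum_eq_1_iff)
  have i1: "i \<in> {1..n}" using i by auto
  have gi: "g = zc i"
  proof (rule index_eqI)
    show "xpart g k = xpart (zc i) k" for k using g by simp
    show "zpart g k = zpart (zc i) k" for k
    proof (cases "k \<in> {2..n}")
      case True then show ?thesis using i nn[OF True] by (cases "k = i") auto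
    next
      case False
      then show ?thesis using i z1 cone_zpart[OF gens_cone(1)[OF j'(1) gk], of k] by (cases "k = 1") auto
    qed
  qed
  \<comment> \<open>The induction hypothesis makes the tail at j - 1 known: it is 1, so the single
    z_i lies above j - 1.\<close>
  have ij: "j \<le> i"
    using tails(1)[OF j'(1) j'(2) gk] tail_zc[OF i1, of "j - 1"] IH j2 by (simp add: gi split: if_splits)
  have P: "PP j = Poly_Mapping.single (xc (sg j)) (lam j) - Poly_Mapping.single (xc (j - 1)) (lam (j - 1))"
    using j2 IH by (simp add: PP_def)
  have gg: "gg j = fscale (inverse c) (mon (- zc i) \<star> PP j)" by (rule gg_eq[OF j'(1) i1 _ g(1)]) (use g gi in simp)
  \<comment> \<open>On a weight with m i = 0 the inverse of z_i leaves the positive part, so the two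
    terms of \<open>PP j\<close> must cancel there.\<close>
  have pos: "lam j * qp (om (xc (sg j)) m) = lam (j - 1) * qp (om (xc (j - 1)) m)"
    if m: "\<forall>t\<in>{2..n}. m t \<ge> 0" "m i = 0" for m :: "nat \<Rightarrow> int"
  proof -
    have "coef (gg j) m (zpart (- zc i)) = 0"
      using evS_positive[OF zS_closed(2)[OF j'(1)]] m i(1) unfolding preserves_positive_def by (elim allE impE) auto
    moreover have "coef (gg j) m (zpart (- zc i)) =
      inverse c * (qp (om (- zc i) m) * (lam j * qp (om (xc (sg j)) m) - lam (j - 1) * qp (om (xc (j - 1)) m)))"
    proof -
      have z: "zpart (- zc i + xc l) = zpart (- zc i)" for l by (auto simp: fun_eq_iff)
      show ?thesis unfolding gg P
        by (simp add: coef_fscale tmul_diff_right tmul_single coef_diff coef_single z om_add_left qp_add del: add_uminus_conv_diff uminus_add_conv_diff)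
          (simp add: algebra_simps)
    qed
    ultimately show ?thesis using g(1) by simp
  qed
  \<comment> \<open>The weight 0 sees the scalars alone; once these agree, other weights compare the
    indices.\<close>
  have ll: "lam j = lam (j - 1)" using pos[of "\<lambda>_. 0"] by simp
  have om_eq: "(\<Sum>t\<in>{sg j<..n}. m t) = (\<Sum>t\<in>{j - 1<..n}. m t)" if m: "\<forall>t\<in>{2..n}. m t \<ge> 0" "m i = 0" for m :: "nat \<Rightarrow> int"
  proof -
    have "lam (j - 1) \<noteq> 0" using lam[of "j - 1"] j'(2) by simp
    then have "om (xc (sg j)) m = om (xc (j - 1)) m" using pos[OF m] ll by (simp add: qp_inj)
    then show ?thesis using sg[OF j'(1)] j'(2) by (simp add: om_xc)
  qed
  \<comment> \<open>The test weight is the unit vector at t; t \<noteq> i keeps coordinate i equal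
    to 0. So on {2..n} the indices above \<open>sg j\<close> and those above j - 1 agree except
    possibly at i.\<close>
  have test: "t \<le> sg j \<longleftrightarrow> t \<le> j - 1" if t: "t \<in> {2..n}" "t \<noteq> i" for t
  proof -
    have "(\<Sum>s\<in>{sg j<..n}. if s = t then (1::int) else 0) = (\<Sum>s\<in>{j - 1<..n}. if s = t then 1 else 0)"
      using om_eq[of "\<lambda>s. if s = t then 1 else 0"] t by auto
    then show ?thesis using t by (auto simp: sum.delta split: if_splits)
  qed
  have "sg j \<noteq> j - 1"
  proof
    assume "sg j = j - 1"
    then have "PP j = 0" using P ll by simp
    then show False using ff_gg[OF j'(1)] tmul_nonzero[OF gens_nonzero[OF j'(1)]] by simp
  qed
  moreover have "\<not> sg j < j - 1"
  proof
    assume "sg j < j - 1"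
    moreover have "j - 1 \<noteq> i" "1 \<le> sg j" using ij j2 sg[OF j'(1)] by auto
    ultimately show False using test[of "j - 1"] j2 by (simp add: le_diff_conv)
  qed
  ultimately have ge: "sg j \<ge> j" by linarith
  \<comment> \<open>As \<open>sg j\<close> is at least j, the two index sets differ at j, so i = j;
    they differ nowhere else, so \<open>sg j\<close> is not larger than j.\<close>
  have "\<not> j \<le> j - 1" using j2 by linarith
  then have "i = j" using test[of j] ge j2 by auto
  moreover have "sg j = j"
  proof (rule ccontr)
    assume "sg j \<noteq> j"
    then have "Suc j \<le> sg j" using ge by simp
    moreover from this have "Suc j \<in> {2..n}" "\<not> Suc j \<le> j - 1" using sg[OF j'(1)] j2 by auto
    ultimately show False using test[of "Suc j"] \<open>i = j\<close> by simp
  qed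
  ultimately show ?thesis using g gi ll by blast
qed

lemma all_generators:
  "j \<in> {1..n} \<Longrightarrow> (\<exists>c. c \<noteq> 0 \<and> ff j = Poly_Mapping.single (zc j) c) \<and> sg j = j \<and> lam j = lam 1"
proof -
  have "1 \<le> j \<Longrightarrow> j \<le> n \<Longrightarrow> (\<exists>c. c \<noteq> 0 \<and> ff j = Poly_Mapping.single (zc j) c) \<and> sg j = j \<and> lam j = lam 1"
  proof (induction j rule: dec_induct)
    case base then show ?case using first_generator by blast
  next
    case (step j) then show ?case using next_generator[of "Suc j"] by auto
  qed
  then show "j \<in> {1..n} \<Longrightarrow> ?thesis" by auto
qed

lemma generator_images_of_values:
  assumes j: "j \<in> {1..n}"
  shows "\<exists>c. c \<noteq> 0 \<and> F (zS j) = c \<odot>\<^bsub>S\<^esub> zS j \<and> F (zsS j) = inverse c \<odot>\<^bsub>S\<^esub> zsS j"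
proof -
  obtain c where c: "c \<noteq> 0" "ff j = Poly_Mapping.single (zc j) c" using all_generators[OF j] by blast
  \<comment> \<open>All \<open>lam k\<close> agree with \<open>lam 1\<close>, and
    \<open>lam n\<close> is 1 because x_n = 1 is fixed.\<close>
  have lam1: "lam k = 1" if "k \<in> {1..n}" for k
    using all_generators[OF that] all_generators[of n] lam_n n_pos by simp
  have "F (zS j) = c \<odot>\<^bsub>S\<^esub> zS j"
    using c j zS_closed[OF j] by (intro evS_injective) (simp_all add: evS_smult evS_gens gimg_def fscale_single)
  moreover have PX: "PP j = X j - X (j - 1)"
  proof (cases "j = 1")
    case True
    then show ?thesis using j lam1[OF j] all_generators[OF j] by (simp add: PP_def X_def)
  next
    case False
    then have "j - 1 \<in> {1..n}" using j by auto
    then show ?thesis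
      using False j lam1[OF j] all_generators[OF j] lam1[of "j - 1"] all_generators[of "j - 1"] by (simp add: PP_def X_def)
  qed
  have "gg j = evS (inverse c \<odot>\<^bsub>S\<^esub> zsS j)"
    using gg_eq[OF j j c(2,1)] j by (simp add: PX evS_smult evS_gens gimg_def)
  then have "F (zsS j) = inverse c \<odot>\<^bsub>S\<^esub> zsS j" using j zS_closed[OF j] by (intro evS_injective) simp_all
  ultimately show ?thesis using c by blast
qed

end

lemma generator_images:
  assumes j: "j \<in> {1..n}"
  shows "\<exists>c. c \<noteq> 0 \<and> F (zS j) = c \<odot>\<^bsub>S\<^esub> zS j \<and> F (zsS j) = inverse c \<odot>\<^bsub>S\<^esub> zsS j"
proof -
  obtain lam sg where *: "\<forall>k\<in>{1..n}. F (xS k) = lam k \<odot>\<^bsub>S\<^esub> xS (sg k) \<and> lam k \<noteq> 0 \<and> sg k \<in> {1..n}"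
    "lam n = 1" "sg n = n" "\<forall>k\<in>{1..<n}. sg k \<in> {1..<n}" "\<forall>l\<in>{1..<n}. \<exists>k\<in>{1..<n}. sg k = l"
    using iso_values by blast
  show ?thesis by (rule generator_images_of_values[of lam sg, OF _ _ _ _ _ _ _ j]) (use * in auto)
qed

end

section \<open>The diagonal automorphisms\<close>

text \<open>The scalar by which the diagonal automorphism with parameters \<open>l\<close>
  multiplies a word.\<close>

definition "kap l w = prod_list (map (\<lambda>g. case g of Z i \<Rightarrow> l i | Zstar i \<Rightarrow> inverse (l i :: complex)) w)"

lemma kap_simps [simp]: "kap l [] = 1" "kap l (v @ w) = kap l v * kap l w"
  "kap l (g # w) = (case g of Z i \<Rightarrow> l i | Zstar i \<Rightarrow> inverse (l i)) * kap l w"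
  by (simp_all add: kap_def)

definition "sc l f = (\<Sum>w\<in>Poly_Mapping.keys f. Poly_Mapping.single w (kap l w * Poly_Mapping.lookup f w))"

lemma lookup_sc [simp]: "Poly_Mapping.lookup (sc l f) w = kap l w * Poly_Mapping.lookup f w"
proof -
  have "Poly_Mapping.lookup (sc l f) w = (\<Sum>v\<in>Poly_Mapping.keys f. if v = w then kap l v * Poly_Mapping.lookup f v else 0)"
    by (simp add: sc_def lookup_sum lookup_single when_def)
  then show ?thesis by (simp add: sum.delta in_keys_iff)
qed

lemma sc_add: "sc l (f + g) = sc l f + sc l g" and sc_diff: "sc l (f - g) = sc l f - sc l g"
  and sc_fscale: "sc l (fscale c f) = fscale c (sc l f)" and sc_zero [simp]: "sc l 0 = 0"
  by (rule poly_mapping_eqI, simp add: lookup_add lookup_minus algebra_simps)+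

lemma sc_single: "sc l (Poly_Mapping.single w c) = Poly_Mapping.single w (kap l w * c)"
  by (rule poly_mapping_eqI) (auto simp: lookup_single when_def)

lemma sc_mult: "sc l (f * g) = sc l f * sc l g"
proof -
  have "sc l (Poly_Mapping.single v a * g) = sc l (Poly_Mapping.single v a) * sc l g" for v a g
    by (rule additive_ext[of "\<lambda>g. sc l (Poly_Mapping.single v a * g)"])
      (simp_all add: distrib_left sc_add word_mult sc_single mult_ac)
  then show ?thesis
    by (intro additive_ext[of "\<lambda>f. sc l (f * g)" "\<lambda>f. sc l f * sc l g" f]) (simp_all add: distrib_right sc_add)
qed

lemma keys_sc: "Poly_Mapping.keys (sc l f) \<subseteq> Poly_Mapping.keys f"
  by (auto simp: in_keys_iff)

lemma sc_Fr: "f \<in> Fr \<Longrightarrow> sc l f \<in> Fr"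
  using keys_sc[of l f] by blast

definition "nonzero_on l \<longleftrightarrow> (\<forall>i\<in>{1..n}. l i \<noteq> (0::complex))"

text \<open>All words of one relation carry the same factor \<open>kap l\<close>, so each relation
  is merely rescaled.\<close>

lemma sc_I: assumes "nonzero_on l" shows "f \<in> I \<Longrightarrow> sc l f \<in> I"
proof -
  let ?J = "{f \<in> Fr. sc l f \<in> I}"
  have J: "fvs.subspace ?J"
    using fvs.subspace_add[OF subspace_keys[of "lists G"]] fvs.subspace_scale[OF subspace_keys[of "lists G"]]
      fvs.subspace_add[OF subspace_I] fvs.subspace_scale[OF subspace_I] fvs.subspace_0[OF subspace_I]
    by (auto simp: fvs.subspace_def sc_add sc_fscale)
  have "rels \<subseteq> ?J"
  proof (rule homogeneous_relations[OF J, of "kap l"])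
    fix f v assume f: "f \<in> I" "\<And>w. w \<in> Poly_Mapping.keys f \<Longrightarrow> kap l w = v"
    have "sc l f = fscale v f" by (rule poly_mapping_eqI) (use f(2) in \<open>auto simp: in_keys_iff\<close>)
    then show "f \<in> ?J" using f(1) I_Fr fvs.subspace_scale[OF subspace_I] by auto
  qed (use assms in \<open>auto simp: nonzero_on_def mult.commute\<close>)
  then have "I \<subseteq> ?J"
  proof (rule I_minimal[OF J, rotated])
    fix w f assume w: "w \<in> lists G" and f: "f \<in> ?J"
    show "word w * f \<in> ?J" "f * word w \<in> ?J"
      using Fr_closed(3)[OF Fr_closed(5)[OF w, of 1], of f] Fr_closed(3)[OF _ Fr_closed(5)[OF w, of 1], of f] f
        I_mult[of "sc l f" "sc l (word w)"] sc_Fr[OF Fr_closed(5)[OF w, of 1], of l]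
      by (simp_all add: sc_mult)
  qed auto
  then show "f \<in> I \<Longrightarrow> sc l f \<in> I" by blast
qed

definition "diag l Y = cl (sc l (SOME f. f \<in> Y))"

lemma diag_cl: assumes "nonzero_on l" "f \<in> Fr" shows "diag l (cl f) = cl (sc l f)"
  using Q.some_cls[of f] sc_I[OF assms(1), of "(SOME g. g \<in> cl f) - f"] assms(2)
  by (simp add: diag_def cl_eq sc_diff)

context
  fixes l assumes l: "nonzero_on l"
begin

lemma diag_linear: "clinear S S (diag l)"
proof (rule clinearI)
  fix a assume "a \<in> carrier S"
  then obtain f where f: "f \<in> Fr" "a = cl f" by (rule cl_exhaust)
  then show "diag l a \<in> carrier S" using diag_cl[OF l f(1)] sc_Fr[OF f(1)] cl_closed by metis
  show "diag l (c \<odot>\<^bsub>S\<^esub> a) = c \<odot>\<^bsub>S\<^esub> diag l a" for c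
    unfolding f(2) using diag_cl[OF l f(1)] diag_cl[OF l Fr_closed(4)[OF f(1)]] by (simp only: cl_ops sc_fscale)
next
  fix a b assume "a \<in> carrier S" "b \<in> carrier S"
  then obtain f g where f: "f \<in> Fr" "a = cl f" and g: "g \<in> Fr" "b = cl g" unfolding carrier_S by blast
  show "diag l (a \<oplus>\<^bsub>S\<^esub> b) = diag l a \<oplus>\<^bsub>S\<^esub> diag l b"
    unfolding f(2) g(2) using diag_cl[OF l f(1)] diag_cl[OF l g(1)] diag_cl[OF l Fr_closed(1)[OF f(1) g(1)]]
    by (simp only: cl_ops sc_add)
qed

lemma diag_mult: assumes "a \<in> carrier S" "b \<in> carrier S" shows "diag l (a \<otimes>\<^bsub>S\<^esub> b) = diag l a \<otimes>\<^bsub>S\<^esub> diag l b"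
proof -
  obtain f g where f: "f \<in> Fr" "a = cl f" and g: "g \<in> Fr" "b = cl g" using assms unfolding carrier_S by blast
  show ?thesis
    unfolding f(2) g(2) using diag_cl[OF l f(1)] diag_cl[OF l g(1)] diag_cl[OF l Fr_closed(3)[OF f(1) g(1)]]
      cl_mult[OF f(1) g(1)] cl_mult[OF sc_Fr[OF f(1)] sc_Fr[OF g(1)]]
    by (simp only: sc_mult)
qed

lemma diag_one: "diag l \<one>\<^bsub>S\<^esub> = \<one>\<^bsub>S\<^esub>"
  unfolding cl_ops using diag_cl[OF l Fr_closed(7)] by (simp add: one_word sc_single)

lemma diag_Hk: "a \<in> Hk k \<Longrightarrow> diag l a \<in> Hk k"
proof -
  assume "a \<in> Hk k"
  then obtain f where f: "f \<in> Fr" "a = cl f" "\<forall>w\<in>Poly_Mapping.keys f. deg w = k" by (auto simp: Hk_def)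
  have "\<forall>w\<in>Poly_Mapping.keys (sc l f). deg w = k" using f(3) keys_sc[of l f] by blast
  then show "diag l a \<in> Hk k" using HkI[OF sc_Fr[OF f(1)]] diag_cl[OF l f(1)] f(2) by simp
qed

lemma diag_gens: assumes "i \<in> {1..n}"
  shows "diag l (zS i) = l i \<odot>\<^bsub>S\<^esub> zS i" "diag l (zsS i) = inverse (l i) \<odot>\<^bsub>S\<^esub> zsS i"
  using diag_cl[OF l Fr_closed(5), of "[Z i]" 1] diag_cl[OF l Fr_closed(5), of "[Zstar i]" 1] assms
  by (simp_all add: zS_def zsS_def sc_single cl_ops fscale_single)

end

lemma linear_eq_on_gens:
  assumes F: "clinear S S F" "clinear S S F'"
    and m: "\<And>a b. a \<in> carrier S \<Longrightarrow> b \<in> carrier S \<Longrightarrow> F (a \<otimes>\<^bsub>S\<^esub> b) = F a \<otimes>\<^bsub>S\<^esub> F b"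
      "\<And>a b. a \<in> carrier S \<Longrightarrow> b \<in> carrier S \<Longrightarrow> F' (a \<otimes>\<^bsub>S\<^esub> b) = F' a \<otimes>\<^bsub>S\<^esub> F' b"
    and one: "F \<one>\<^bsub>S\<^esub> = F' \<one>\<^bsub>S\<^esub>"
    and g: "\<And>i. i \<in> {1..n} \<Longrightarrow> F (zS i) = F' (zS i)" "\<And>i. i \<in> {1..n} \<Longrightarrow> F (zsS i) = F' (zsS i)"
    and a: "a \<in> carrier S"
  shows "F a = F' a"
  using a
proof (induction rule: S_gen_induct)
  case one show ?case by fact
next
  case (add a b) then show ?case by (simp add: clinear_add[OF F(1)] clinear_add[OF F(2)])
next
  case (smult c a) then show ?case by (simp add: clinear_smult[OF F(1)] clinear_smult[OF F(2)])
next
  case (mult a w i)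
  have "w \<in> carrier S" "F w = F' w" using \<open>w = zS i \<or> w = zsS i\<close> \<open>i \<in> {1..n}\<close> g by auto
  then show ?case using mult by (simp add: m)
qed

lemma diag_compose:
  assumes "nonzero_on l" "nonzero_on l'" "nonzero_on m" "\<And>i. i \<in> {1..n} \<Longrightarrow> m i = l i * l' i" "a \<in> carrier S"
  shows "diag l' (diag l a) = diag m a"
proof (rule linear_eq_on_gens[OF _ _ _ _ _ _ _ assms(5)])
  note L = diag_linear[OF assms(1)] diag_linear[OF assms(2)]
  show "clinear S S (\<lambda>a. diag l' (diag l a))" by (rule clinear_compose[OF L])
  show "clinear S S (diag m)" by (rule diag_linear[OF assms(3)])
  show "diag l' (diag l (a \<otimes>\<^bsub>S\<^esub> b)) = diag l' (diag l a) \<otimes>\<^bsub>S\<^esub> diag l' (diag l b)" if "a \<in> carrier S" "b \<in> carrier S" for a b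
    using that clinear_closed[OF L(1)] by (simp add: diag_mult assms)
  show "diag m (a \<otimes>\<^bsub>S\<^esub> b) = diag m a \<otimes>\<^bsub>S\<^esub> diag m b" if "a \<in> carrier S" "b \<in> carrier S" for a b
    using that by (simp add: diag_mult assms)
  show "diag l' (diag l \<one>\<^bsub>S\<^esub>) = diag m \<one>\<^bsub>S\<^esub>" by (simp add: diag_one assms)
  show "diag l' (diag l (zS i)) = diag m (zS i)" if i: "i \<in> {1..n}" for i
    using i by (simp add: diag_gens[OF assms(1) i] diag_gens[OF assms(2) i] diag_gens[OF assms(3) i] assms(4)
        clinear_smult[OF L(2)] S.smult_smult)
  show "diag l' (diag l (zsS i)) = diag m (zsS i)" if i: "i \<in> {1..n}" for i
    using i by (simp add: diag_gens[OF assms(1) i] diag_gens[OF assms(2) i] diag_gens[OF assms(3) i] assms(4)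
        clinear_smult[OF L(2)] S.smult_smult)
qed

lemma diag_id: assumes "a \<in> carrier S" shows "diag (\<lambda>_. 1) a = a"
proof (rule linear_eq_on_gens[OF _ clinear_id _ _ _ _ _ assms])
  have l: "nonzero_on (\<lambda>_. 1)" by (simp add: nonzero_on_def)
  show "clinear S S (diag (\<lambda>_. 1))" by (rule diag_linear[OF l])
qed (simp_all add: diag_mult diag_one diag_gens nonzero_on_def)

lemma diag_inverse: assumes "nonzero_on l" "a \<in> carrier S" shows "diag (\<lambda>i. inverse (l i)) (diag l a) = a"
  using diag_compose[of l "\<lambda>i. inverse (l i)" "\<lambda>_. 1" a] assms diag_id[OF assms(2)]
  by (simp add: nonzero_on_def)

lemma diag_graded_iso: assumes "nonzero_on l" shows "graded_iso (diag l) (diag (\<lambda>i. inverse (l i)))"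
proof -
  have l': "nonzero_on (\<lambda>i. inverse (l i))" using assms by (simp add: nonzero_on_def)
  show ?thesis
    using assms l' diag_inverse[OF assms] diag_inverse[OF l']
    by (simp add: graded_iso_def diag_linear diag_Hk diag_one diag_mult)
qed

lemma diag_cong: "(\<And>i. i \<in> {1..n} \<Longrightarrow> l i = l' i) \<Longrightarrow> nonzero_on l \<Longrightarrow> nonzero_on l' \<Longrightarrow> a \<in> carrier S \<Longrightarrow> diag l a = diag l' a"
  by (rule linear_eq_on_gens) (simp_all add: diag_linear diag_mult diag_one diag_gens)

section \<open>The group of twists\<close>

lemma group_complex_units: "group complex_units"
  by (rule groupI) (auto simp: complex_units_def mult.assoc intro!: exI[of _ "inverse _"] bexI[of _ "inverse _"])

abbreviation "P \<equiv> product_group {1..n} (\<lambda>_. complex_units)"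

lemma carrier_P: "carrier P = {l \<in> extensional {1..n}. nonzero_on l}"
  by (auto simp: carrier_product_group complex_units_def nonzero_on_def PiE_def Pi_def)

theorem twist_group_iso:
  shows "group (twist_group (ES_bialgebroid S laurent \<rho>))" (is "group ?T")
    and "twist_group (ES_bialgebroid S laurent \<rho>) \<cong> P"
proof -
  note [simp del] = carrier_product_group mult_product_group one_product_group
  obtain N x y where sg: "strongly_graded S \<rho> N x y" using strongly_graded_sphere by blast
  interpret SG: strongly_graded S \<rho> N x y by (rule sg)
  interpret P: group P by (rule product_group) (simp add: group_complex_units)
  have gl: "SG.graded_linear (diag l)" if "nonzero_on l" for l
    using diag_linear[OF that] diag_Hk[OF that] by (simp add: SG.graded_linear_def hom_eq)
  have ga: "SG.graded_auto (diag l)" if l: "nonzero_on l" for l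
    using gl[OF l] gl[of "\<lambda>i. inverse (l i)"] diag_one[OF l] diag_mult[OF l] diag_graded_iso[OF l] l
    unfolding SG.graded_auto_def graded_iso_def by (auto simp: nonzero_on_def)
  let ?h = "\<lambda>l. SG.phi_of (diag l)"
  have T_carrier: "carrier ?T = {\<phi>. is_twist SG.K \<phi>}" and T_mult: "mult ?T = mult (dual_algebra SG.K)"
    and T_one: "one ?T = one (dual_algebra SG.K)"
    by (simp_all add: twist_group_def)
  have dual: "?h l \<in> dual_carrier SG.K" if "nonzero_on l" for l by (rule SG.phi_of_dual[OF gl[OF that]])
  have F_of: "SG.F_of (?h l) a = diag l a" if "nonzero_on l" "a \<in> carrier S" for l a
    by (rule SG.F_of_phi_of[OF gl[OF that(1)] that(2)])
  \<comment> \<open>Convolution composes in reverse order, which does no harm because diagonal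
    automorphisms commute.\<close>
  have hom: "?h \<in> hom P ?T"
  proof (rule homI)
    fix l assume "l \<in> carrier P"
    then show "?h l \<in> carrier ?T" using SG.twist_phi_of[OF ga] by (simp add: carrier_P T_carrier)
  next
    fix l m assume lm: "l \<in> carrier P" "m \<in> carrier P"
    then have nz: "nonzero_on l" "nonzero_on m" by (simp_all add: carrier_P)
    have "l \<otimes>\<^bsub>P\<^esub> m \<in> carrier P" using P.m_closed lm by blast
    then have nz': "nonzero_on (l \<otimes>\<^bsub>P\<^esub> m)" by (simp add: carrier_P)
    have v: "(l \<otimes>\<^bsub>P\<^esub> m) i = l i * m i" if "i \<in> {1..n}" for i
      using that by (simp add: complex_units_def mult_product_group)
    have comp: "SG.graded_linear (\<lambda>a. SG.F_of (?h m) (SG.F_of (?h l) a))"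
      using SG.graded_linear_F_of[OF dual[OF nz(1)]] SG.graded_linear_F_of[OF dual[OF nz(2)]] clinear_compose
      unfolding SG.graded_linear_def by blast
    have "?h (l \<otimes>\<^bsub>P\<^esub> m) = SG.phi_of (\<lambda>a. SG.F_of (?h m) (SG.F_of (?h l) a))"
    proof (rule SG.dual_eqI[OF dual[OF nz'] SG.phi_of_dual[OF comp]])
      fix a assume a: "a \<in> carrier S"
      show "SG.F_of (?h (l \<otimes>\<^bsub>P\<^esub> m)) a = SG.F_of (SG.phi_of (\<lambda>a. SG.F_of (?h m) (SG.F_of (?h l) a))) a"
        using diag_compose[OF nz nz' v a] SG.F_of_phi_of[OF comp a] F_of[OF nz' a] F_of[OF nz(1) a]
          F_of[OF nz(2) clinear_closed[OF diag_linear[OF nz(1)] a]] by simp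
    qed
    then show "?h (l \<otimes>\<^bsub>P\<^esub> m) = ?h l \<otimes>\<^bsub>?T\<^esub> ?h m"
      by (simp add: T_mult SG.dual_mult[OF dual[OF nz(1)] dual[OF nz(2)]])
  qed
  have inj: "inj_on ?h (carrier P)"
  proof (rule inj_onI)
    fix l m assume lm: "l \<in> carrier P" "m \<in> carrier P" and eq: "?h l = ?h m"
    have nz: "nonzero_on l" "nonzero_on m" using lm by (simp_all add: carrier_P)
    show "l = m"
    proof (rule extensionalityI)
      fix i assume i: "i \<in> {1..n}"
      have "l i \<odot>\<^bsub>S\<^esub> zS i = m i \<odot>\<^bsub>S\<^esub> zS i"
        using F_of[OF nz(1), of "zS i"] F_of[OF nz(2), of "zS i"] eq i diag_gens[OF nz(1) i] diag_gens[OF nz(2) i] by simp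
      \<comment> \<open>The scalars are read off in the torus, where the image of z_i is a nonzero
        monomial.\<close>
      then have "fscale (l i) (evS (zS i)) = fscale (m i) (evS (zS i))"
        by (simp only: flip: evS_smult[OF gens_closed(1)[OF i]])
      then show "l i = m i" using i by (simp add: evS_gens gimg_def fscale_single single_eq_iff)
    qed (use lm in \<open>auto simp: carrier_P\<close>)
  qed
  have surj: "?h ` carrier P = carrier ?T"
  proof
    show "?h ` carrier P \<subseteq> carrier ?T" using hom by (auto simp: hom_def)
    show "carrier ?T \<subseteq> ?h ` carrier P"
    proof
      fix \<phi> assume "\<phi> \<in> carrier ?T"
      then have tw: "is_twist SG.K \<phi>" by (simp add: T_carrier)
      note d = SG.twist_auto[OF tw]
      obtain G where G: "SG.graded_linear G" "\<forall>a\<in>carrier S. SG.F_of \<phi> (G a) = a \<and> G (SG.F_of \<phi> a) = a"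
        using d(2) by (auto simp: SG.graded_auto_def)
      let ?F = "SG.F_of \<phi>"
      have F: "SG.graded_linear ?F" "?F \<one>\<^bsub>S\<^esub> = \<one>\<^bsub>S\<^esub>" "\<forall>a\<in>carrier S. \<forall>b\<in>carrier S. ?F (a \<otimes>\<^bsub>S\<^esub> b) = ?F a \<otimes>\<^bsub>S\<^esub> ?F b"
        using d(2) by (auto simp: SG.graded_auto_def)
      have cl: "clinear S S ?F" "clinear S S G" using F(1) G(1) by (auto simp: SG.graded_linear_def)
      \<comment> \<open>\<open>graded_auto\<close> provides an inverse that is graded and linear;
        its multiplicativity follows from that of \<open>?F\<close>.\<close>
      have Gm: "G (a \<otimes>\<^bsub>S\<^esub> b) = G a \<otimes>\<^bsub>S\<^esub> G b" if "a \<in> carrier S" "b \<in> carrier S" for a b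
      proof -
        have c: "G a \<in> carrier S" "G b \<in> carrier S" using clinear_closed[OF cl(2)] that by auto
        then have "?F (G a \<otimes>\<^bsub>S\<^esub> G b) = a \<otimes>\<^bsub>S\<^esub> b" using F(3) G(2) that by simp
        then show ?thesis using G(2) c by (metis S.m_closed)
      qed
      have G1: "G \<one>\<^bsub>S\<^esub> = \<one>\<^bsub>S\<^esub>" using F(2) G(2) S.one_closed by metis
      have iso: "graded_iso ?F G"
        using F G(2) cl Gm G1 G(1) by (auto simp: graded_iso_def SG.graded_linear_def hom_eq)
      have "\<forall>j\<in>{1..n}. \<exists>c. c \<noteq> 0 \<and> ?F (zS j) = c \<odot>\<^bsub>S\<^esub> zS j \<and> ?F (zsS j) = inverse c \<odot>\<^bsub>S\<^esub> zsS j"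
        using generator_images[OF iso] by blast
      from bchoice[OF this] obtain c where c: "\<And>j. j \<in> {1..n} \<Longrightarrow> c j \<noteq> 0 \<and> ?F (zS j) = c j \<odot>\<^bsub>S\<^esub> zS j \<and> ?F (zsS j) = inverse (c j) \<odot>\<^bsub>S\<^esub> zsS j"
        by blast
      \<comment> \<open>Restriction makes the family of scalars extensional, as elements of the
        product group are.\<close>
      let ?l = "restrict c {1..n}"
      have nz: "nonzero_on ?l" and lP: "?l \<in> carrier P" using c by (auto simp: nonzero_on_def carrier_P)
      have "?F a = diag ?l a" if "a \<in> carrier S" for a
        by (rule linear_eq_on_gens[OF cl(1) diag_linear[OF nz] _ _ _ _ _ that])
          (use F diag_mult[OF nz] diag_one[OF nz] diag_gens[OF nz] c in auto)
      then have "\<phi> = ?h ?l"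
        by (intro SG.dual_eqI[OF d(1) dual[OF nz]]) (simp add: F_of[OF nz])
      then show "\<phi> \<in> ?h ` carrier P" using lP by blast
    qed
  qed
  have iso: "?h \<in> iso P ?T" using hom inj surj by (simp add: iso_def bij_betw_def)
  have one: "?h \<one>\<^bsub>P\<^esub> = \<one>\<^bsub>?T\<^esub>"
  proof -
    have nz: "nonzero_on \<one>\<^bsub>P\<^esub>" using P.one_closed by (simp add: carrier_P)
    have v: "\<one>\<^bsub>P\<^esub> i = 1" if "i \<in> {1..n}" for i using that by (simp add: complex_units_def one_product_group)
    have "?h \<one>\<^bsub>P\<^esub> = SG.phi_of (\<lambda>a. a)"
    proof (rule SG.dual_eqI[OF dual[OF nz] SG.phi_of_dual[OF SG.graded_linear_id]])
      fix a assume a: "a \<in> carrier S"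
      have "diag \<one>\<^bsub>P\<^esub> a = a"
        using diag_cong[of "\<one>\<^bsub>P\<^esub>" "\<lambda>_. 1" a] v nz a diag_id[OF a] by (simp add: nonzero_on_def)
      then show "SG.F_of (?h \<one>\<^bsub>P\<^esub>) a = SG.F_of (SG.phi_of (\<lambda>a. a)) a"
        using F_of[OF nz a] SG.F_of_phi_of[OF SG.graded_linear_id a] by simp
    qed
    then show ?thesis by (simp add: T_one SG.dual_one)
  qed
  \<comment> \<open>The twists are exactly the image of a group under a homomorphism, which yields
    the group axioms for convolution without checking them on twists.\<close>
  have "group (?T\<lparr>carrier := ?h ` carrier P, one := ?h \<one>\<^bsub>P\<^esub>\<rparr>)" by (rule P.hom_imp_img_group[OF hom])
  then show "group ?T" by (simp add: surj one)
  show "?T \<cong> P" using P.iso_set_sym[OF iso] by (auto simp: is_iso_def)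
qed

end

theorem proposition4p2:
  fixes n :: nat and q :: real
  assumes "n \<ge> 1" and "0 < q" and "q < 1"
  shows "let T = twist_group (ES_bialgebroid (sphere n q) laurent (sphere_coaction n q))
         in group T \<and> T \<cong> product_group {1..n} (\<lambda>_. complex_units)"
proof -
  interpret qsphere n q by unfold_locales (use assms in auto)
  show ?thesis using twist_group_iso by (simp add: Let_def)
qed

end
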